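(* There exists a finitely presented hereditarily conjugacy separable group $G$ which has an overgroup $K$ such that $|K:G|=2$, $K$ is not conjugacy separable and $K$ has unsolvable conjugacy problem.
   Context: An overgroup of $G$ is a group containing $G$ as a subgroup. A group $A$ is conjugacy separable if for any two non-conjugate elements $x,y\in A$ there is a homomorphism $\varphi$ from $A$ to a finite group $M$ such that $\varphi(x)$ and $\varphi(y)$ are not conjugate in $M$; $A$ is hereditarily conjugacy separable if every finite index subgroup of $A$ (including $A$ itself) is conjugacy separable. For a group $A$ generated by a finite set $Z$, the conjugacy problem in $A$ is solvable if there is an algorithm which, given two words over $Z^{\pm1}$, decides whether or not the elements of $A$ they represent are conjugate in $A$; otherwise it is unsolvable. *)

theory Defs
  imports "HOL-Algebra.Algebra" "HOL-Library.Nat_Bijection"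
begin

section \<open>Words and free groups\<close>

text \<open>
  The letter \<open>(i, True)\<close> stands for the generator \<open>x\<^sub>i\<close> and \<open>(i, False)\<close> for its
  formal inverse.
\<close>

type_synonym word = "(nat \<times> bool) list"

definition words :: "nat \<Rightarrow> word set" where
  "words n = lists ({..<n} \<times> UNIV)"

definition inv_letter :: "nat \<times> bool \<Rightarrow> nat \<times> bool" where
  "inv_letter a = (fst a, \<not> snd a)"

definition reduced :: "word \<Rightarrow> bool" where
  "reduced w \<longleftrightarrow> successively (\<lambda>a b. b \<noteq> inv_letter a) w"

fun cons_reduce :: "nat \<times> bool \<Rightarrow> word \<Rightarrow> word" where
  "cons_reduce a [] = [a]"
| "cons_reduce a (b # w) = (if b = inv_letter a then w else a # b # w)"

definition reduce :: "word \<Rightarrow> word" where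
  "reduce w = foldr cons_reduce w []"

definition free_group :: "nat \<Rightarrow> word monoid" where
  "free_group n =
     \<lparr>carrier = {w \<in> words n. reduced w}, monoid.mult = (\<lambda>u v. reduce (u @ v)), one = []\<rparr>"

lemma inv_letter_inv_letter [simp]: "inv_letter (inv_letter a) = a"
  by (simp add: inv_letter_def)

lemma inv_letter_in_iff [simp]: "inv_letter a \<in> {..<n} \<times> UNIV \<longleftrightarrow> a \<in> {..<n} \<times> UNIV"
  by (cases a) (simp add: inv_letter_def)

lemma reduced_Nil [simp]: "reduced []"
  by (simp add: reduced_def)

lemma reduced_cons_reduce: "reduced w \<Longrightarrow> reduced (cons_reduce a w)"
  by (cases w) (auto simp: reduced_def successively_Cons)

lemma cons_reduce_inv: "reduced w \<Longrightarrow> cons_reduce a (cons_reduce (inv_letter a) w) = w"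
proof (cases w)
  case (Cons b v)
  then show "reduced w \<Longrightarrow> ?thesis"
    by (cases v) (auto simp: reduced_def)
qed simp

lemma reduced_foldr: "reduced v \<Longrightarrow> reduced (foldr cons_reduce u v)"
  by (induction u) (auto intro: reduced_cons_reduce)

lemma reduced_reduce: "reduced (reduce w)"
  by (simp add: reduce_def reduced_foldr)

lemma reduce_reduced: "reduced w \<Longrightarrow> reduce w = w"
proof (induction w)
  case (Cons a w)
  then have "reduced w" by (cases w) (auto simp: reduced_def)
  with Cons show ?case
    by (cases w) (auto simp: reduce_def reduced_def)
qed (simp add: reduce_def)

lemma foldr_cons_reduce:
  assumes "reduced v" "reduced w"
  shows "foldr cons_reduce (cons_reduce a v) w = cons_reduce a (foldr cons_reduce v w)"
proof (cases v)
  case (Cons b v')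
  then show ?thesis
    using assms cons_reduce_inv[of "foldr cons_reduce v' w" a] by (auto simp: reduced_foldr)
qed simp

lemma foldr_reduce:
  assumes "reduced w"
  shows "foldr cons_reduce (reduce u) w = foldr cons_reduce u w"
proof (induction u)
  case (Cons a u)
  then show ?case
    using foldr_cons_reduce[OF reduced_reduce[of u] assms, of a] by (simp add: reduce_def)
qed (simp add: reduce_def)

lemma reduce_append: "reduce (u @ v) = foldr cons_reduce u (reduce v)"
  by (simp add: reduce_def)

lemma reduce_append_reduce_left: "reduce (reduce u @ v) = reduce (u @ v)"
  by (simp add: reduce_append foldr_reduce reduced_reduce)

lemma reduce_append_reduce_right: "reduce (u @ reduce v) = reduce (u @ v)"
  by (simp add: reduce_append reduce_reduced reduced_reduce)

lemma reduce_in_words: "w \<in> words n \<Longrightarrow> reduce w \<in> words n"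
proof (induction w)
  case (Cons a w)
  then have "reduce w \<in> words n" "a \<in> {..<n} \<times> UNIV" by (auto simp: words_def)
  then show ?case
    by (cases "reduce w") (auto simp: reduce_def words_def)
qed (simp add: reduce_def words_def)

lemma reduce_inv_word: "reduce (rev (map inv_letter w) @ w) = []"
proof (induction w)
  case (Cons a w)
  have "cons_reduce (inv_letter a) (cons_reduce a (reduce w)) = reduce w"
    using cons_reduce_inv[OF reduced_reduce, of "inv_letter a" w] by simp
  with Cons show ?case by (simp add: reduce_def)
qed (simp add: reduce_def)

lemma group_free_group: "group (free_group n)"
proof (rule groupI)
  fix u v w
  assume u: "u \<in> carrier (free_group n)" and v: "v \<in> carrier (free_group n)"
    and w: "w \<in> carrier (free_group n)"
  show "u \<otimes>\<^bsub>free_group n\<^esub> v \<in> carrier (free_group n)"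
    using u v by (auto simp: free_group_def reduced_reduce intro!: reduce_in_words)
      (auto simp: words_def)
  show "u \<otimes>\<^bsub>free_group n\<^esub> v \<otimes>\<^bsub>free_group n\<^esub> w = u \<otimes>\<^bsub>free_group n\<^esub> (v \<otimes>\<^bsub>free_group n\<^esub> w)"
    by (simp add: free_group_def reduce_append_reduce_left reduce_append_reduce_right)
  show "\<one>\<^bsub>free_group n\<^esub> \<otimes>\<^bsub>free_group n\<^esub> u = u"
    using u by (simp add: free_group_def reduce_reduced)
  let ?u' = "reduce (rev (map inv_letter u))"
  have "rev (map inv_letter u) \<in> words n"
    using u by (force simp: free_group_def words_def inv_letter_def)
  then have "?u' \<in> carrier (free_group n)"
    by (simp add: free_group_def reduced_reduce reduce_in_words)
  moreover have "?u' \<otimes>\<^bsub>free_group n\<^esub> u = \<one>\<^bsub>free_group n\<^esub>"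
    by (simp add: free_group_def reduce_append_reduce_left reduce_inv_word)
  ultimately show "\<exists>y\<in>carrier (free_group n). y \<otimes>\<^bsub>free_group n\<^esub> u = \<one>\<^bsub>free_group n\<^esub>"
    by blast
qed (simp add: free_group_def words_def)


section \<open>Finitely presented groups and overgroups\<close>

definition normal_closure :: "('a, 'b) monoid_scheme \<Rightarrow> 'a set \<Rightarrow> 'a set" where
  "normal_closure G R = \<Inter>{N. N \<lhd> G \<and> R \<subseteq> N}"

definition finitely_presented :: "('a, 'b) monoid_scheme \<Rightarrow> bool" where
  "finitely_presented G \<longleftrightarrow> group G \<and>
     (\<exists>n R. finite R \<and> R \<subseteq> carrier (free_group n) \<and>
        G \<cong> free_group n Mod normal_closure (free_group n) R)"

definition overgroup :: "('a, 'b) monoid_scheme \<Rightarrow> ('a, 'b) monoid_scheme \<Rightarrow> bool" where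
  "overgroup K G \<longleftrightarrow> group K \<and> subgroup (carrier G) K \<and> G = K\<lparr>carrier := carrier G\<rparr>"


section \<open>Conjugacy separability\<close>

definition conjugate :: "('a, 'b) monoid_scheme \<Rightarrow> 'a \<Rightarrow> 'a \<Rightarrow> bool" where
  "conjugate A x y \<longleftrightarrow> (\<exists>g\<in>carrier A. y = g \<otimes>\<^bsub>A\<^esub> x \<otimes>\<^bsub>A\<^esub> inv\<^bsub>A\<^esub> g)"

text \<open>
  Every finite group is isomorphic to one whose carrier is a set of natural numbers, so
  letting \<open>M\<close> range over type \<^typ>\<open>nat monoid\<close> covers all finite quotients.
\<close>

definition conjugacy_separable :: "('a, 'b) monoid_scheme \<Rightarrow> bool" where
  "conjugacy_separable A \<longleftrightarrow>
     (\<forall>x\<in>carrier A. \<forall>y\<in>carrier A. \<not> conjugate A x y \<longrightarrow>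
        (\<exists>(M :: nat monoid) \<phi>. group M \<and> finite (carrier M) \<and> \<phi> \<in> hom A M \<and>
           \<not> conjugate M (\<phi> x) (\<phi> y)))"

definition hereditarily_conjugacy_separable :: "('a, 'b) monoid_scheme \<Rightarrow> bool" where
  "hereditarily_conjugacy_separable A \<longleftrightarrow>
     (\<forall>H. subgroup H A \<and> finite (rcosets\<^bsub>A\<^esub> H) \<longrightarrow> conjugacy_separable (A\<lparr>carrier := H\<rparr>))"


section \<open>Partial recursive functions\<close>

datatype recf =
    Zero
  | Succ
  | Proj nat
  | Comp recf "recf list"
  | Prec recf recf
  | Mu recf

text \<open>
  \<open>computes f xs y\<close> means that the computation of \<open>f\<close> on \<open>xs\<close> halts with value \<open>y\<close>;
  there is no such \<open>y\<close> if it diverges.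
\<close>

inductive computes :: "recf \<Rightarrow> nat list \<Rightarrow> nat \<Rightarrow> bool" where
  Zero: "computes Zero xs 0"
| Succ: "computes Succ [x] (Suc x)"
| Proj: "i < length xs \<Longrightarrow> computes (Proj i) xs (xs ! i)"
| Comp: "list_all2 (\<lambda>g y. computes g xs y) gs ys \<Longrightarrow> computes f ys z \<Longrightarrow>
    computes (Comp f gs) xs z"
| Prec_0: "computes f xs y \<Longrightarrow> computes (Prec f g) (0 # xs) y"
| Prec_Suc: "computes (Prec f g) (k # xs) r \<Longrightarrow> computes g (k # r # xs) y \<Longrightarrow>
    computes (Prec f g) (Suc k # xs) y"
| Mu: "computes f (k # xs) 0 \<Longrightarrow> (\<forall>j<k. \<exists>r. computes f (j # xs) (Suc r)) \<Longrightarrow>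
    computes (Mu f) xs k"

inductive_cases computes_ZeroE: "computes Zero xs y"
inductive_cases computes_SuccE: "computes Succ xs y"
inductive_cases computes_ProjE: "computes (Proj i) xs y"
inductive_cases computes_CompE: "computes (Comp f gs) xs y"
inductive_cases computes_Prec_0E: "computes (Prec f g) (0 # xs) y"
inductive_cases computes_Prec_SucE: "computes (Prec f g) (Suc k # xs) y"
inductive_cases computes_MuE: "computes (Mu f) xs y"

lemma computes_deterministic: "computes f xs y \<Longrightarrow> computes f xs z \<Longrightarrow> y = z"
proof (induction arbitrary: z rule: computes.induct)
  case (Zero xs)
  then show ?case by (rule computes_ZeroE) simp
next
  case (Succ x)
  then show ?case by (rule computes_SuccE) simp
next
  case (Proj i xs)
  from Proj.prems show ?case by (rule computes_ProjE) simp
next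
  case (Comp xs gs ys f y)
  from Comp.prems obtain ys' where ys': "list_all2 (\<lambda>g y. computes g xs y) gs ys'" "computes f ys' z"
    by (rule computes_CompE)
  have "ys = ys'"
    using Comp.IH(1) ys'(1) by (auto simp: list_all2_conv_all_nth intro!: nth_equalityI)
  with Comp.IH(2) ys'(2) show ?case by blast
next
  case (Prec_0 f xs y g)
  from Prec_0.prems have "computes f xs z" by (rule computes_Prec_0E)
  with Prec_0.IH show ?case by blast
next
  case (Prec_Suc f g k xs r y)
  from Prec_Suc.prems obtain r' where "computes (Prec f g) (k # xs) r'" "computes g (k # r' # xs) z"
    by (rule computes_Prec_SucE)
  with Prec_Suc.IH show ?case by blast
next
  case (Mu f k xs)
  from Mu.prems have z: "computes f (z # xs) 0" "\<forall>j<z. \<exists>r. computes f (j # xs) (Suc r)"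
    by (auto elim!: computes_MuE)
  show ?case
  proof (rule linorder_cases[of k z])
    assume "k < z"
    with z(2) Mu.IH(1) show ?thesis by fastforce
  next
    assume "z < k"
    with z(1) Mu.IH(2) show ?thesis by fastforce
  qed
qed


section \<open>The conjugacy problem\<close>

text \<open>Words are presented to an algorithm through the standard codings of pairs and lists.\<close>

definition encode_word :: "word \<Rightarrow> nat" where
  "encode_word w = list_encode (map (\<lambda>(i, e). prod_encode (i, of_bool e)) w)"

fun eval_word :: "('a, 'b) monoid_scheme \<Rightarrow> 'a list \<Rightarrow> word \<Rightarrow> 'a" where
  "eval_word A zs [] = \<one>\<^bsub>A\<^esub>"
| "eval_word A zs ((i, e) # w) =
     (if e then zs ! i else inv\<^bsub>A\<^esub> (zs ! i)) \<otimes>\<^bsub>A\<^esub> eval_word A zs w"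

text \<open>A finite generating set is given by a list enumerating its elements.\<close>

definition generating_list :: "('a, 'b) monoid_scheme \<Rightarrow> 'a list \<Rightarrow> bool" where
  "generating_list A zs \<longleftrightarrow> set zs \<subseteq> carrier A \<and> generate A (set zs) = carrier A"

definition solvable_conjugacy_problem :: "('a, 'b) monoid_scheme \<Rightarrow> 'a list \<Rightarrow> bool" where
  "solvable_conjugacy_problem A zs \<longleftrightarrow>
     (\<exists>f. \<forall>u\<in>words (length zs). \<forall>v\<in>words (length zs).
        computes f [encode_word u, encode_word v]
          (if conjugate A (eval_word A zs u) (eval_word A zs v) then 1 else 0))"

text \<open>
  Solvability does not depend on the choice of the finite generating set, so unsolvability
  is required here for all of them.
\<close>

definition unsolvable_conjugacy_problem :: "('a, 'b) monoid_scheme \<Rightarrow> bool" where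
  "unsolvable_conjugacy_problem A \<longleftrightarrow>
     (\<exists>zs. generating_list A zs) \<and>
     (\<forall>zs. generating_list A zs \<longrightarrow> \<not> solvable_conjugacy_problem A zs)"

end

theory Submission
  imports Defs "HOL-Library.Product_Plus" "HOL-Library.Numeral_Type" "HOL-Computational_Algebra.Primes" "HOL-Combinatorics.Transposition"
begin

text \<open>
  Let \<open>F\<close> be a free group acting linearly on \<open>\<int>\<^sup>4\<close>, the additive group of integral \<open>2 \<times> 2\<close> matrices, and let an
  involution \<open>\<tau>\<close> permute the free generators without changing their action. Put
  \<open>G = \<int>\<^sup>4 \<rtimes> F\<close> and \<open>K = G \<rtimes> \<langle>\<tau>\<rangle>\<close>. Two elements \<open>a \<tau>\<close> and \<open>b \<tau>\<close> with \<open>a, b \<in> \<int>\<^sup>4\<close> are conjugate in \<open>K\<close>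
  iff \<open>b\<close> is in the orbit of \<open>a\<close> under the centralizer of \<open>\<tau>\<close> in \<open>F\<close>.

  The generators fixed by \<open>\<tau>\<close> act by conjugation with matrices \<open>\<rho>\<^sub>0, \<rho>\<^sub>1, \<dots>\<close>, which freely generate a group
  by ping-pong, and by left multiplication with the values at the \<open>\<rho>\<^sub>i\<close> of finitely many relators. The orbit of the
  identity matrix is then the normal closure of the relators, so conjugacy in \<open>K\<close> encodes the word problem of a
  finitely presented group. The relators are chosen such that the word problem encodes an undecidable
  generalized Collatz problem and such that the Baumslag-Solitar relation \<open>b x\<^sup>2 b\<^sup>-\<^sup>1 = x\<^sup>3\<close> yields a
  nontrivial element that dies in all finite quotients; nontriviality is seen in a permutation representation.

  The generators swapped by \<open>\<tau>\<close> include two copies of the elementary matrices. Hence finite index subgroups of \<open>F\<close>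
  contain powers of all elementary matrices and have orbits on \<open>\<int>\<^sup>4\<close> that are closed in the congruence
  topology. Elements of \<open>G\<close> with trivial image in \<open>F\<close> are therefore separated by congruence quotients. For
  the others, conjugators of \<open>g \<noteq> 1\<close> in finite quotients of \<open>F\<close> are close to conjugators in \<open>F\<close>, which is seen by
  counting the edges of closed paths in a Cayley graph modulo 3, and subgroups of \<open>\<int>\<^sup>4\<close> are closed.
\<close>

section \<open>Computable functions\<close>

text \<open>The obstacle is that \<open>G\<close> must stay hereditarily conjugacy separable while
  the centralizer of the involution carries an undecidable group that is not residually finite. A
  homomorphism from \<open>K\<close> to a group of finite order \<open>q\<close> kills
  \<open>q\<close> times every vector, so it sees a matrix only modulo \<open>q\<close>. Since
  \<open>rho 0\<close> is unipotent, \<open>x\<close> has finite order modulo \<open>q\<close>; then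
  \<open>b x b\<^sup>-\<^sup>1\<close> is a power of \<open>x\<close> there, and the
  Baumslag-Solitar commutator falls into the orbit modulo every \<open>q\<close>. That it misses the
  orbit itself is seen where explicit permutations take the place of normal forms in HNN extensions.
  Collatz maps serve as machines because their state is a single number \<open>n\<close>, coded by
  \<open>x\<^sup>n t x\<^sup>-\<^sup>n\<close>, and a step is division with remainder, which
  conjugation of one power of \<open>x\<close> to another can imitate. A further swapped pair of
  generators for each \<open>rho i\<close>, acting by left multiplication, makes the reduction
  computable: the matrix of \<open>kt_word n\<close> is reached by a word over the generators of
  \<open>K\<close>, without computing its entries.\<close>

definition total_computable :: "nat \<Rightarrow> (nat list \<Rightarrow> nat) \<Rightarrow> bool" where
  "total_computable k F \<longleftrightarrow> (\<exists>f. \<forall>xs. length xs = k \<longrightarrow> computes f xs (F xs))"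

lemma total_computable_comp:
  assumes "total_computable (length Gs) F" "\<And>G. G \<in> set Gs \<Longrightarrow> total_computable k G"
  shows "total_computable k (\<lambda>xs. F (map (\<lambda>G. G xs) Gs))"
proof -
  obtain f where f: "\<forall>xs. length xs = length Gs \<longrightarrow> computes f xs (F xs)"
    using assms(1) by (auto simp: total_computable_def)
  obtain g where g: "\<And>G xs. G \<in> set Gs \<Longrightarrow> length xs = k \<Longrightarrow> computes (g G) xs (G xs)"
    using assms(2) unfolding total_computable_def by metis
  have "computes (Comp f (map g Gs)) xs (F (map (\<lambda>G. G xs) Gs))" if "length xs = k" for xs
    by (rule computes.Comp[where ys = "map (\<lambda>G. G xs) Gs"])
      (use f g that in \<open>auto simp: list_all2_conv_all_nth\<close>)
  then show ?thesis unfolding total_computable_def by blast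
qed

lemma total_computable_proj: "i < k \<Longrightarrow> total_computable k (\<lambda>xs. xs ! i)"
  unfolding total_computable_def by (auto intro!: exI[of _ "Proj i"] computes.Proj)

lemma total_computable_Suc: "total_computable k F \<Longrightarrow> total_computable k (\<lambda>xs. Suc (F xs))"
proof -
  have "total_computable (length [F]) (\<lambda>xs. Suc (hd xs))"
    unfolding total_computable_def
    by (auto intro!: exI[of _ Succ] computes.Succ simp: length_Suc_conv)
  then show "total_computable k F \<Longrightarrow> ?thesis"
    using total_computable_comp[of "[F]" "\<lambda>xs. Suc (hd xs)" k] by simp
qed

lemma total_computable_const: "total_computable k (\<lambda>xs. c)"
proof (induction c)
  case 0
  show ?case unfolding total_computable_def by (auto intro!: exI[of _ Zero] computes.Zero)
next
  case (Suc c)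
  then show ?case by (rule total_computable_Suc)
qed

lemma total_computable_comp2:
  assumes "total_computable 2 (\<lambda>ys. H (ys ! 0) (ys ! 1))"
    and "total_computable k F" "total_computable k G"
  shows "total_computable k (\<lambda>xs. H (F xs) (G xs))"
proof -
  have "total_computable k (\<lambda>xs. (\<lambda>ys. H (ys ! 0) (ys ! 1)) (map (\<lambda>G. G xs) [F, G]))"
    by (rule total_computable_comp) (use assms in \<open>auto simp: numeral_2_eq_2\<close>)
  then show ?thesis by simp
qed

lemma total_computable_rec:
  assumes "total_computable k N" "total_computable k F"
    and "total_computable (Suc (Suc k)) (\<lambda>ys. G (ys ! 0) (ys ! 1) (drop 2 ys))"
  shows "total_computable k (\<lambda>xs. rec_nat (F xs) (\<lambda>n r. G n r xs) (N xs))"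
proof -
  obtain f where f: "\<forall>xs. length xs = k \<longrightarrow> computes f xs (F xs)"
    using assms(2) by (auto simp: total_computable_def)
  obtain g where g: "\<forall>ys. length ys = Suc (Suc k) \<longrightarrow> computes g ys (G (ys ! 0) (ys ! 1) (drop 2 ys))"
    using assms(3) by (auto simp: total_computable_def)
  have *: "computes (Prec f g) (n # xs) (rec_nat (F xs) (\<lambda>n r. G n r xs) n)"
    if xs: "length xs = k" for n xs
  proof (induction n)
    case 0
    then show ?case using f xs by (auto intro: computes.Prec_0)
  next
    case (Suc n)
    have "computes g (n # rec_nat (F xs) (\<lambda>n r. G n r xs) n # xs)
        (G n (rec_nat (F xs) (\<lambda>n r. G n r xs) n) xs)"
      using g[rule_format, of "n # rec_nat (F xs) (\<lambda>n r. G n r xs) n # xs"] xs by simp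
    with Suc show ?case by (auto intro: computes.Prec_Suc)
  qed
  have "total_computable (Suc k) (\<lambda>ys. rec_nat (F (tl ys)) (\<lambda>n r. G n r (tl ys)) (hd ys))"
    unfolding total_computable_def
    by (rule exI[of _ "Prec f g"]) (auto simp: length_Suc_conv *)
  \<comment> \<open>\<open>Prec\<close> recurses on the head of its argument list; composing with
    \<open>N\<close> and all \<open>k\<close> projections feeds it \<open>N xs # xs\<close>.\<close>
  moreover let ?Gs = "N # map (\<lambda>i xs. xs ! i) [0..<k]"
  have "total_computable k G" if "G \<in> set ?Gs" for G
    using that assms(1) by (auto intro: total_computable_proj)
  ultimately have "total_computable k (\<lambda>xs. (\<lambda>ys. rec_nat (F (tl ys)) (\<lambda>n r. G n r (tl ys)) (hd ys))
      (map (\<lambda>G. G xs) ?Gs))"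
    by (intro total_computable_comp) simp_all
  then obtain h where h: "\<forall>xs. length xs = k \<longrightarrow>
    computes h xs (rec_nat (F (map (\<lambda>i. xs ! i) [0..<k])) (\<lambda>n r. G n r (map (\<lambda>i. xs ! i) [0..<k])) (N xs))"
    by (auto simp: total_computable_def o_def)
  have "map (\<lambda>i. xs ! i) [0..<k] = xs" if "length xs = k" for xs :: "nat list"
    using that by (auto intro: nth_equalityI)
  with h show ?thesis unfolding total_computable_def by auto
qed

lemma total_computable_drop:
  assumes "total_computable k F"
  shows "total_computable (n + k) (\<lambda>xs. F (drop n xs))"
proof -
  have "total_computable (n + k) (\<lambda>xs. F (map (\<lambda>G. G xs) (map (\<lambda>i xs. xs ! (n + i)) [0..<k])))"
    by (rule total_computable_comp) (auto simp: assms intro: total_computable_proj)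
  then obtain h where h: "\<forall>xs. length xs = n + k \<longrightarrow> computes h xs (F (map (\<lambda>i. xs ! (n + i)) [0..<k]))"
    by (auto simp: total_computable_def o_def)
  have "map (\<lambda>i. xs ! (n + i)) [0..<k] = drop n xs" if "length xs = n + k" for xs :: "nat list"
    using that by (auto intro: nth_equalityI)
  with h show ?thesis unfolding total_computable_def by auto
qed

lemma total_computable_cong:
  "(\<And>xs. length xs = k \<Longrightarrow> F xs = G xs) \<Longrightarrow> total_computable k F \<Longrightarrow> total_computable k G"
  unfolding total_computable_def by auto

lemma total_computable_proj_drop: "n + i < k \<Longrightarrow> total_computable k (\<lambda>xs. drop n xs ! i)"
  by (rule total_computable_cong[of _ "\<lambda>xs. xs ! (n + i)"]) (auto intro: total_computable_proj)

lemma total_computable_add: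
  assumes "total_computable k F" "total_computable k G"
  shows "total_computable k (\<lambda>xs. F xs + G xs)"
proof (rule total_computable_comp2[where H = "(+)", OF _ assms])
  have *: "rec_nat b (\<lambda>_. Suc) a = a + b" for a b :: nat by (induction a) auto
  have "total_computable 2 (\<lambda>xs. rec_nat (xs ! 1) (\<lambda>n r. Suc r) (xs ! 0))"
    by (intro total_computable_rec total_computable_Suc total_computable_proj) simp_all
  then show "total_computable 2 (\<lambda>ys. ys ! 0 + ys ! 1)" by (simp only: *)
qed

lemma total_computable_mult:
  assumes "total_computable k F" "total_computable k G"
  shows "total_computable k (\<lambda>xs. F xs * G xs)"
proof (rule total_computable_comp2[where H = "(*)", OF _ assms])
  have *: "rec_nat 0 (\<lambda>_ r. r + b) a = a * b" for a b :: nat by (induction a) auto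
  have "total_computable 2 (\<lambda>xs. rec_nat 0 (\<lambda>n r. r + xs ! 1) (xs ! 0))"
    by (intro total_computable_rec total_computable_add total_computable_proj
        total_computable_proj_drop total_computable_const) simp_all
  then show "total_computable 2 (\<lambda>ys. ys ! 0 * ys ! 1)" by (simp only: *)
qed

lemma total_computable_power:
  assumes "total_computable k F" "total_computable k G"
  shows "total_computable k (\<lambda>xs. F xs ^ G xs)"
proof (rule total_computable_comp2[where H = "(^)", OF _ assms])
  have *: "rec_nat 1 (\<lambda>_ r. r * b) a = b ^ a" for a b :: nat by (induction a) auto
  have "total_computable 2 (\<lambda>xs. rec_nat 1 (\<lambda>n r. r * xs ! 0) (xs ! 1))"
    by (intro total_computable_rec total_computable_mult total_computable_proj
        total_computable_proj_drop total_computable_const) simp_all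
  then show "total_computable 2 (\<lambda>ys. ys ! 0 ^ ys ! 1)" by (simp only: *)
qed

lemma total_computable_pred:
  assumes "total_computable k F"
  shows "total_computable k (\<lambda>xs. F xs - 1)"
proof -
  have *: "rec_nat 0 (\<lambda>n _. n) a = a - 1" for a :: nat by (cases a) auto
  have "total_computable k (\<lambda>xs. rec_nat 0 (\<lambda>n r. n) (F xs))"
    by (intro total_computable_rec assms total_computable_proj total_computable_const) simp_all
  then show ?thesis by (simp only: *)
qed

lemma total_computable_diff:
  assumes "total_computable k F" "total_computable k G"
  shows "total_computable k (\<lambda>xs. F xs - G xs)"
proof (rule total_computable_comp2[where H = "(-)", OF _ assms])
  have *: "rec_nat b (\<lambda>_ r. r - 1) a = b - a" for a b :: nat by (induction a) auto
  have "total_computable 2 (\<lambda>xs. rec_nat (xs ! 0) (\<lambda>n r. r - 1) (xs ! 1))"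
    by (intro total_computable_rec total_computable_pred total_computable_proj) simp_all
  then show "total_computable 2 (\<lambda>ys. ys ! 0 - ys ! 1)" by (simp only: *)
qed

lemma total_computable_if:
  assumes "total_computable k F" "total_computable k G" "total_computable k H"
  shows "total_computable k (\<lambda>xs. if F xs = 0 then G xs else H xs)"
proof (rule total_computable_cong)
  \<comment> \<open>In truncated subtraction \<open>1 - F xs\<close> is the indicator of
    \<open>F xs = 0\<close>.\<close>
  show "total_computable k (\<lambda>xs. (1 - F xs) * G xs + (1 - (1 - F xs)) * H xs)"
    using assms by (intro total_computable_add total_computable_mult total_computable_diff total_computable_const)
qed auto

lemma total_computable_div:
  assumes "total_computable k F" "total_computable k G"
  shows "total_computable k (\<lambda>xs. F xs div G xs)"
proof (rule total_computable_comp2[where H = "(div)", OF _ assms])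
  \<comment> \<open>The counter \<open>n\<close> climbs to the dividend, and the quotient
    \<open>r\<close> grows as soon as \<open>Suc r * m\<close> fits into
    \<open>Suc n\<close>.\<close>
  let ?D = "\<lambda>m::nat. rec_nat 0 (\<lambda>n r. if Suc r * m - Suc n = 0 then Suc r else r)"
  have D: "?D m n = n div m" if m: "m > 0" for m n
  proof (induction n)
    case (Suc n)
    have "Suc n div m = (if Suc (n div m) * m \<le> Suc n then Suc (n div m) else n div m)"
    proof -
      have "n = m * (n div m) + n mod m" "n mod m < m" using m by auto
      moreover have "Suc (n div m) * m \<le> Suc n \<longleftrightarrow> Suc (n mod m) = m"
      proof -
        have "Suc (n div m) * m = m * (n div m) + m" by simp
        then show ?thesis using \<open>n = _\<close> \<open>n mod m < m\<close> by linarith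
      qed
      ultimately show ?thesis by (simp add: div_Suc mod_Suc)
    qed
    with Suc show ?case by simp
  qed simp
  \<comment> \<open>For divisor 0 the recursion would count up to the dividend, whereas the value of
    \<open>div\<close> is 0.\<close>
  have "total_computable 2 (\<lambda>xs. if xs ! 1 = 0 then 0 else ?D (xs ! 1) (xs ! 0))"
    by (intro total_computable_if total_computable_rec total_computable_Suc total_computable_diff
        total_computable_mult total_computable_proj total_computable_proj_drop total_computable_const)
      simp_all
  then show "total_computable 2 (\<lambda>ys. ys ! 0 div ys ! 1)"
  proof (rule total_computable_cong[rotated])
    fix xs :: "nat list"
    show "(if xs ! 1 = 0 then 0 else ?D (xs ! 1) (xs ! 0)) = xs ! 0 div xs ! 1"
      using D[of "xs ! 1" "xs ! 0"] by (cases "xs ! 1 = 0") auto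
  qed
qed

lemma total_computable_mod:
  assumes "total_computable k F" "total_computable k G"
  shows "total_computable k (\<lambda>xs. F xs mod G xs)"
proof (rule total_computable_cong)
  show "total_computable k (\<lambda>xs. F xs - G xs * (F xs div G xs))"
    by (intro assms total_computable_diff total_computable_mult total_computable_div)
qed (simp add: minus_mult_div_eq_mod)

lemmas total_computable_intros = total_computable_const total_computable_Suc total_computable_add
  total_computable_mult total_computable_power total_computable_diff total_computable_if
  total_computable_div total_computable_mod

section \<open>While programs and Collatz systems\<close>

datatype com = Skip | Inc nat | Dec nat | Seq com com | While nat com

inductive exec :: "com \<Rightarrow> (nat \<Rightarrow> nat) \<Rightarrow> (nat \<Rightarrow> nat) \<Rightarrow> bool" where
  "exec Skip \<sigma> \<sigma>"
| "exec (Inc r) \<sigma> (\<sigma>(r := Suc (\<sigma> r)))"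
| "exec (Dec r) \<sigma> (\<sigma>(r := \<sigma> r - 1))"
| "exec a \<sigma> \<tau> \<Longrightarrow> exec b \<tau> \<upsilon> \<Longrightarrow> exec (Seq a b) \<sigma> \<upsilon>"
| "\<sigma> r = 0 \<Longrightarrow> exec (While r c) \<sigma> \<sigma>"
| "\<sigma> r \<noteq> 0 \<Longrightarrow> exec c \<sigma> \<tau> \<Longrightarrow> exec (While r c) \<tau> \<upsilon> \<Longrightarrow> exec (While r c) \<sigma> \<upsilon>"

lemma exec_Skip [simp]: "exec Skip \<sigma> \<tau> \<longleftrightarrow> \<tau> = \<sigma>"
  by (subst exec.simps) auto

lemma exec_Inc [simp]: "exec (Inc r) \<sigma> \<tau> \<longleftrightarrow> \<tau> = \<sigma>(r := Suc (\<sigma> r))"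
  by (subst exec.simps) auto

lemma exec_Dec [simp]: "exec (Dec r) \<sigma> \<tau> \<longleftrightarrow> \<tau> = \<sigma>(r := \<sigma> r - 1)"
  by (subst exec.simps) auto

lemma exec_Seq [simp]: "exec (Seq a b) \<sigma> \<upsilon> \<longleftrightarrow> (\<exists>\<tau>. exec a \<sigma> \<tau> \<and> exec b \<tau> \<upsilon>)"
  by (subst exec.simps) auto

lemma exec_While: "exec (While r c) \<sigma> \<upsilon> \<longleftrightarrow>
    (if \<sigma> r = 0 then \<upsilon> = \<sigma> else \<exists>\<tau>. exec c \<sigma> \<tau> \<and> exec (While r c) \<tau> \<upsilon>)"
  by (subst exec.simps) auto

section \<open>Register macros and the compilation of partial recursive functions\<close>

definition clear :: "nat \<Rightarrow> com" where
  "clear r = While r (Dec r)"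

definition move :: "nat \<Rightarrow> nat \<Rightarrow> com" where
  "move r s = While r (Seq (Dec r) (Inc s))"

definition copy :: "nat \<Rightarrow> nat \<Rightarrow> nat \<Rightarrow> com" where
  "copy r s b = Seq (While r (Seq (Dec r) (Seq (Inc s) (Inc b)))) (move b r)"

definition diverge :: "nat \<Rightarrow> com" where
  "diverge b = Seq (Inc b) (While b Skip)"

fun clears :: "nat list \<Rightarrow> com" where
  "clears [] = Skip"
| "clears (r # rs) = Seq (clear r) (clears rs)"

lemma exec_clear [simp]: "exec (clear r) \<sigma> \<tau> \<longleftrightarrow> \<tau> = \<sigma>(r := 0)"
proof (induction "\<sigma> r" arbitrary: \<sigma>)
  case 0
  then show ?case by (auto simp: clear_def exec_While)
next
  case (Suc n)
  then show ?case using Suc.hyps(1)[of "\<sigma>(r := n)"]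
    by (auto simp: clear_def exec_While[of _ _ \<sigma>] simp flip: Suc.hyps(2))
qed

lemma exec_move [simp]: "r \<noteq> s \<Longrightarrow> exec (move r s) \<sigma> \<tau> \<longleftrightarrow> \<tau> = \<sigma>(r := 0, s := \<sigma> s + \<sigma> r)"
proof (induction "\<sigma> r" arbitrary: \<sigma>)
  case 0
  then show ?case by (auto simp: move_def exec_While)
next
  case (Suc n)
  then show ?case using Suc.hyps(1)[of "\<sigma>(r := n, s := Suc (\<sigma> s))"]
    by (auto simp: move_def exec_While[of _ _ \<sigma>] fun_upd_twist simp flip: Suc.hyps(2))
qed

lemma exec_copy [simp]:
  assumes "r \<noteq> s" "r \<noteq> b" "s \<noteq> b" "\<sigma> b = 0"
  shows "exec (copy r s b) \<sigma> \<tau> \<longleftrightarrow> \<tau> = \<sigma>(s := \<sigma> s + \<sigma> r)"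
proof -
  let ?w = "While r (Seq (Dec r) (Seq (Inc s) (Inc b)))"
  have "exec ?w \<sigma> \<tau> \<longleftrightarrow> \<tau> = \<sigma>(r := 0, s := \<sigma> s + \<sigma> r, b := \<sigma> b + \<sigma> r)" for \<sigma> \<tau>
    using assms(1-3)
  proof (induction "\<sigma> r" arbitrary: \<sigma>)
    case 0
    then show ?case by (auto simp: exec_While)
  next
    case (Suc n)
    then show ?case using Suc.hyps(1)[of "\<sigma>(r := n, s := Suc (\<sigma> s), b := Suc (\<sigma> b))"]
      by (auto simp: exec_While[of _ _ \<sigma>] fun_upd_twist simp flip: Suc.hyps(2))
  qed
  moreover have "\<sigma>(s := \<sigma> s + \<sigma> r, b := 0, r := \<sigma> r) = \<sigma>(s := \<sigma> s + \<sigma> r)"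
    using assms by auto
  ultimately show ?thesis using assms by (auto simp: copy_def fun_upd_twist)
qed

lemma exec_diverge [simp]: "\<not> exec (diverge b) \<sigma> \<tau>"
proof
  assume "exec (diverge b) \<sigma> \<tau>"
  then obtain \<upsilon> where "exec (While b Skip) \<upsilon> \<tau>" "\<upsilon> b \<noteq> 0" by (auto simp: diverge_def)
  then show False by (induction "While b Skip" \<upsilon> \<tau> rule: exec.induct) auto
qed

lemma exec_clears [simp]: "exec (clears rs) \<sigma> \<tau> \<longleftrightarrow> \<tau> = (\<lambda>r. if r \<in> set rs then 0 else \<sigma> r)"
proof (induction rs arbitrary: \<sigma>)
  case (Cons a rs)
  have "(\<lambda>r. if r \<in> set rs then 0 else (\<sigma>(a := 0)) r) = (\<lambda>r. if r \<in> set (a # rs) then 0 else \<sigma> r)"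
    by auto
  then show ?case by (simp only: clears.simps exec_Seq exec_clear Cons.IH simp_thms ex_simps)
qed (auto simp: fun_eq_iff)

text \<open>The registers \<open>as\<close> hold the arguments, \<open>d\<close> starts at 0 and
  receives the value, and the registers from \<open>b\<close> on are scratch space, zero at the
  start and again at the end. In \<open>Prec\<close> the scratch registers are the counter
  (\<open>b\<close>), the remaining rounds (\<open>b + 1\<close>), the current and the next value
  (\<open>b + 2\<close>, \<open>b + 3\<close>); in \<open>Mu\<close> they are the candidate and its
  value. A wrong number of arguments, for which \<open>computes\<close> has no value, compiles to
  \<open>diverge\<close>.\<close>

fun compile :: "recf \<Rightarrow> nat \<Rightarrow> nat list \<Rightarrow> nat \<Rightarrow> com"
and compiles :: "recf list \<Rightarrow> nat \<Rightarrow> nat list \<Rightarrow> nat \<Rightarrow> com" where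
  "compile Zero b as d = Skip"
| "compile Succ b as d = (case as of [a] \<Rightarrow> Seq (copy a d b) (Inc d) | _ \<Rightarrow> diverge b)"
| "compile (Proj i) b as d = (if i < length as then copy (as ! i) d b else diverge b)"
| "compile (Comp f gs) b as d =
    Seq (compiles gs (b + length gs) as b)
     (Seq (compile f (b + length gs) [b..<b + length gs] d) (clears [b..<b + length gs]))"
| "compile (Prec f g) b as d = (case as of [] \<Rightarrow> diverge b | a # as' \<Rightarrow>
     Seq (copy a (b + 1) (b + 4))
      (Seq (compile f (b + 4) as' (b + 2))
        (Seq (While (b + 1) (Seq (compile g (b + 4) (b # (b + 2) # as') (b + 3))
               (Seq (clear (b + 2)) (Seq (move (b + 3) (b + 2)) (Seq (Inc b) (Dec (b + 1)))))))
          (Seq (move (b + 2) d) (clear b)))))"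
| "compile (Mu f) b as d =
     Seq (compile f (b + 2) (b # as) (b + 1))
      (Seq (While (b + 1) (Seq (clear (b + 1)) (Seq (Inc b) (compile f (b + 2) (b # as) (b + 1)))))
        (move b d))"
| "compiles [] b as d = Skip"
| "compiles (g # gs) b as d = Seq (compile g b as d) (compiles gs b as (Suc d))"

lemma computes_Zero_iff: "computes Zero xs y \<longleftrightarrow> y = 0"
  by (subst computes.simps) auto

lemma computes_Succ_iff: "computes Succ xs y \<longleftrightarrow> (\<exists>x. xs = [x] \<and> y = Suc x)"
  by (subst computes.simps) auto

lemma computes_Proj_iff: "computes (Proj i) xs y \<longleftrightarrow> i < length xs \<and> y = xs ! i"
  by (subst computes.simps) auto

lemma computes_Comp_iff:
  "computes (Comp f gs) xs z \<longleftrightarrow> (\<exists>ys. list_all2 (\<lambda>g y. computes g xs y) gs ys \<and> computes f ys z)"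
  by (subst computes.simps) auto

lemma computes_Prec_Nil: "\<not> computes (Prec f g) [] y"
  by (subst computes.simps) auto

lemma computes_Prec_0_iff: "computes (Prec f g) (0 # xs) y \<longleftrightarrow> computes f xs y"
  by (subst computes.simps) auto

lemma computes_Prec_Suc_iff: "computes (Prec f g) (Suc k # xs) y \<longleftrightarrow>
    (\<exists>r. computes (Prec f g) (k # xs) r \<and> computes g (k # r # xs) y)"
  by (subst computes.simps) auto

lemma computes_Mu_iff: "computes (Mu f) xs k \<longleftrightarrow>
    computes f (k # xs) 0 \<and> (\<forall>j<k. \<exists>r. computes f (j # xs) (Suc r))"
  by (subst computes.simps) auto

text \<open>A value at the last round of a loop guarantees the values of all earlier rounds, so a
  defined result lets every round of the compiled loop finish.\<close>

lemma computes_Prec_downward: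
  "computes (Prec f g) ((i + n) # xs) y \<Longrightarrow> \<exists>z. computes (Prec f g) (i # xs) z"
  by (induction n arbitrary: y) (auto simp: computes_Prec_Suc_iff)

definition ready :: "nat \<Rightarrow> nat list \<Rightarrow> nat \<Rightarrow> (nat \<Rightarrow> nat) \<Rightarrow> bool" where
  "ready b as d \<sigma> \<longleftrightarrow> (\<forall>a\<in>set as. a < b) \<and> d < b \<and> d \<notin> set as \<and> (\<forall>r\<ge>b. \<sigma> r = 0) \<and> \<sigma> d = 0"

text \<open>The equivalence also covers divergence: without a value of \<open>f\<close> there is no
  final state. As only \<open>d\<close> may differ in the end, scratch registers are zero again and
  the code can be run repeatedly inside loops.\<close>

definition implements :: "com \<Rightarrow> recf \<Rightarrow> nat \<Rightarrow> nat list \<Rightarrow> nat \<Rightarrow> bool" where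
  "implements c f b as d \<longleftrightarrow> (\<forall>\<sigma> \<tau>. ready b as d \<sigma> \<longrightarrow>
     (exec c \<sigma> \<tau> \<longleftrightarrow> (\<exists>y. computes f (map \<sigma> as) y \<and> \<tau> = \<sigma>(d := y))))"

lemma map_fun_upd_notin: "d \<notin> set as \<Longrightarrow> map (\<sigma>(d := y)) as = map \<sigma> as"
  by auto

lemma implements_Prec:
  assumes f: "implements cf f (b + 4) as (b + 2)"
    and g: "implements cg g (b + 4) (b # (b + 2) # as) (b + 3)"
  shows "implements (Seq (copy a (b + 1) (b + 4)) (Seq cf
        (Seq (While (b + 1) (Seq cg
               (Seq (clear (b + 2)) (Seq (move (b + 3) (b + 2)) (Seq (Inc b) (Dec (b + 1)))))))
          (Seq (move (b + 2) d) (clear b))))) (Prec f g) b (a # as) d"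
  unfolding implements_def
proof (intro allI impI)
  fix \<sigma> \<tau>
  assume "ready b (a # as) d \<sigma>"
  then have a: "a < b" and as: "\<And>a. a \<in> set as \<Longrightarrow> a < b" and d: "d < b" "d \<noteq> a" "d \<notin> set as"
    and z: "\<And>r. b \<le> r \<Longrightarrow> \<sigma> r = 0" "\<sigma> d = 0"
    by (auto simp: ready_def)
  \<comment> \<open>\<open>S i r m\<close>: round \<open>i\<close> is reached with current value
    \<open>r\<close>, and \<open>m\<close> rounds remain.\<close>
  define S where "S i r m = \<sigma>(b := i, b + 2 := r, b + 1 := m)" for i r m
  have S_as: "map (S i r m) as = map \<sigma> as" for i r m
    using as by (fastforce simp: S_def)
  let ?w = "While (b + 1) (Seq cg (Seq (clear (b + 2)) (Seq (move (b + 3) (b + 2)) (Seq (Inc b) (Dec (b + 1))))))"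
  have loop: "exec ?w (S i r m) \<tau> \<longleftrightarrow>
      (\<exists>y. computes (Prec f g) ((i + m) # map \<sigma> as) y \<and> \<tau> = S (i + m) y 0)"
    if "computes (Prec f g) (i # map \<sigma> as) r" for i r m \<tau>
    using that
  proof (induction m arbitrary: i r)
    case 0
    then have "exec ?w (S i r 0) \<tau> \<longleftrightarrow> \<tau> = S i r 0" by (subst exec_While) (simp add: S_def)
    with 0 computes_deterministic show ?case by auto
  next
    case (Suc m)
    have "ready (b + 4) (b # (b + 2) # as) (b + 3) (S i r (Suc m))"
      using as z by (fastforce simp: ready_def S_def)
    then have body: "exec cg (S i r (Suc m)) \<tau> \<longleftrightarrow>
        (\<exists>y. computes g (i # r # map \<sigma> as) y \<and> \<tau> = (S i r (Suc m))(b + 3 := y))" for \<tau>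
      using g unfolding implements_def by (simp add: S_as del: fun_upd_apply) (simp add: S_def)
    have tail: "exec (Seq (clear (b + 2)) (Seq (move (b + 3) (b + 2)) (Seq (Inc b) (Dec (b + 1)))))
        ((S i r (Suc m))(b + 3 := y)) \<tau> \<longleftrightarrow> \<tau> = S (Suc i) y m" for y \<tau>
    proof -
      have "((S i r (Suc m))(b + 3 := y, b + 2 := 0, b + 3 := 0, b + 2 := y, b := Suc i, b + 1 := m)) = S (Suc i) y m"
        using z(1)[of "b + 3"] by (auto simp: S_def)
      moreover have "S i r (Suc m) (b + 1) = Suc m" "S i r (Suc m) b = i" by (auto simp: S_def)
      ultimately show ?thesis by (simp add: fun_upd_twist)
    qed
    have "S i r (Suc m) (b + 1) \<noteq> 0" by (simp add: S_def)
    then have "exec ?w (S i r (Suc m)) \<tau> \<longleftrightarrow>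
        (\<exists>y. computes g (i # r # map \<sigma> as) y \<and> exec ?w (S (Suc i) y m) \<tau>)"
      by (subst exec_While, subst exec_Seq) (simp only: if_False, metis body tail)
    also have "\<dots> \<longleftrightarrow> (\<exists>y. computes g (i # r # map \<sigma> as) y \<and>
        (\<exists>z. computes (Prec f g) ((Suc i + m) # map \<sigma> as) z \<and> \<tau> = S (Suc i + m) z 0))"
      using Suc.IH Suc.prems by (metis computes.Prec_Suc)
    also have "\<dots> \<longleftrightarrow> (\<exists>z. computes (Prec f g) ((i + Suc m) # map \<sigma> as) z \<and> \<tau> = S (i + Suc m) z 0)"
    proof -
      have "\<exists>y. computes g (i # r # map \<sigma> as) y"
        if "computes (Prec f g) ((Suc i + m) # map \<sigma> as) z" for z
        using computes_Prec_downward[OF that] Suc.prems computes_deterministic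
        by (fastforce simp: computes_Prec_Suc_iff)
      then show ?thesis by auto
    qed
    finally show ?case .
  qed
  have copy: "exec (copy a (b + 1) (b + 4)) \<sigma> \<upsilon> \<longleftrightarrow> \<upsilon> = S 0 0 (\<sigma> a)" for \<upsilon>
  proof -
    have "\<sigma>(b + 1 := \<sigma> (b + 1) + \<sigma> a) = S 0 0 (\<sigma> a)" using z by (auto simp: S_def)
    then show ?thesis using a z by simp
  qed
  have "ready (b + 4) as (b + 2) (S 0 0 (\<sigma> a))"
    using as z by (fastforce simp: ready_def S_def)
  then have base: "exec cf (S 0 0 (\<sigma> a)) \<upsilon> \<longleftrightarrow> (\<exists>y. computes f (map \<sigma> as) y \<and> \<upsilon> = S 0 y (\<sigma> a))" for \<upsilon>
    using f unfolding implements_def by (simp add: S_as) (simp add: S_def fun_upd_twist)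
  have fin: "exec (Seq (move (b + 2) d) (clear b)) (S i y 0) \<upsilon> \<longleftrightarrow> \<upsilon> = \<sigma>(d := y)" for i y \<upsilon>
  proof -
    have "(S i y 0)(b + 2 := 0, d := S i y 0 d + S i y 0 (b + 2), b := 0) = \<sigma>(d := y)"
      using d z by (auto simp: S_def)
    then show ?thesis using d by simp
  qed
  have "exec (Seq (copy a (b + 1) (b + 4)) (Seq cf (Seq ?w (Seq (move (b + 2) d) (clear b))))) \<sigma> \<tau> \<longleftrightarrow>
    (\<exists>r. computes f (map \<sigma> as) r \<and> (\<exists>\<upsilon>. exec ?w (S 0 r (\<sigma> a)) \<upsilon> \<and>
      exec (Seq (move (b + 2) d) (clear b)) \<upsilon> \<tau>))"
    unfolding exec_Seq[of "copy a (b + 1) (b + 4)"] exec_Seq[of cf] exec_Seq[of ?w]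
    by (metis copy base)
  also have "\<dots> \<longleftrightarrow> (\<exists>r. computes f (map \<sigma> as) r \<and>
      (\<exists>y. computes (Prec f g) (\<sigma> a # map \<sigma> as) y \<and> \<tau> = \<sigma>(d := y)))"
    using loop[of 0] unfolding computes_Prec_0_iff add_0 by (metis fin)
  also have "\<dots> \<longleftrightarrow> (\<exists>y. computes (Prec f g) (\<sigma> a # map \<sigma> as) y \<and> \<tau> = \<sigma>(d := y))"
    using computes_Prec_downward[of f g 0 "\<sigma> a"] by (auto simp: computes_Prec_0_iff)
  finally show "exec (Seq (copy a (b + 1) (b + 4)) (Seq cf (Seq ?w (Seq (move (b + 2) d) (clear b))))) \<sigma> \<tau> \<longleftrightarrow>
    (\<exists>y. computes (Prec f g) (map \<sigma> (a # as)) y \<and> \<tau> = \<sigma>(d := y))"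
    by simp
qed

lemma implements_Mu:
  assumes f: "implements cf f (b + 2) (b # as) (b + 1)"
  shows "implements (Seq cf (Seq (While (b + 1) (Seq (clear (b + 1)) (Seq (Inc b) cf))) (move b d))) (Mu f) b as d"
  unfolding implements_def
proof (intro allI impI)
  fix \<sigma> \<tau>
  assume "ready b as d \<sigma>"
  then have as: "\<And>a. a \<in> set as \<Longrightarrow> a < b" and d: "d < b" "d \<notin> set as"
    and z: "\<And>r. b \<le> r \<Longrightarrow> \<sigma> r = 0" "\<sigma> d = 0"
    by (auto simp: ready_def)
  define S where "S i v = \<sigma>(b := i, b + 1 := v)" for i v
  let ?body = "Seq (clear (b + 1)) (Seq (Inc b) cf)"
  let ?w = "While (b + 1) ?body"
  let ?xs = "map \<sigma> as"
  have run: "exec cf (S i 0) \<upsilon> \<longleftrightarrow> (\<exists>y. computes f (i # ?xs) y \<and> \<upsilon> = S i y)" for i \<upsilon>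
  proof -
    have "ready (b + 2) (b # as) (b + 1) (S i 0)"
      using as z by (fastforce simp: ready_def S_def)
    moreover have "map (S i 0) (b # as) = i # ?xs"
      using as by (fastforce simp: S_def)
    moreover have "(S i 0)(b + 1 := y) = S i y" for y by (simp add: S_def)
    ultimately show ?thesis using f unfolding implements_def by metis
  qed
  have start: "\<sigma> = S 0 0" using z by (auto simp: S_def)
  have body: "exec ?body (S i v) \<upsilon> \<longleftrightarrow> (\<exists>y. computes f (Suc i # ?xs) y \<and> \<upsilon> = S (Suc i) y)" for i v \<upsilon>
  proof -
    have "(S i v)(b + 1 := 0, b := Suc i) = S (Suc i) 0" "S i v b = i" by (auto simp: S_def)
    then have "exec ?body (S i v) \<upsilon> \<longleftrightarrow> exec cf (S (Suc i) 0) \<upsilon>" by simp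
    then show ?thesis by (simp add: run)
  qed
  \<comment> \<open>The search has no bound known in advance, so this direction is an induction on
    the run; the converse below descends from the result \<open>n\<close>.\<close>
  have loop_imp: "\<exists>n. \<upsilon> = S n 0 \<and> i \<le> n \<and> computes f (n # ?xs) 0 \<and>
      (\<forall>j. i \<le> j \<and> j < n \<longrightarrow> (\<exists>r. computes f (j # ?xs) (Suc r)))"
    if "exec ?w (S i v) \<upsilon>" "computes f (i # ?xs) v" for i v \<upsilon>
    using that
  proof (induction ?w "S i v" \<upsilon> arbitrary: i v rule: exec.induct)
    case 5
    then show ?case by (auto simp: S_def)
  next
    case (6 \<tau>' \<upsilon>)
    then obtain y where y: "computes f (Suc i # ?xs) y" "\<tau>' = S (Suc i) y" using body by auto
    then obtain n where n: "\<upsilon> = S n 0" "Suc i \<le> n" "computes f (n # ?xs) 0"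
      "\<forall>j. Suc i \<le> j \<and> j < n \<longrightarrow> (\<exists>r. computes f (j # ?xs) (Suc r))"
      using 6 by blast
    have "v \<noteq> 0" using 6 by (auto simp: S_def)
    then obtain r where "v = Suc r" by (cases v) auto
    then have "\<forall>j. i \<le> j \<and> j < n \<longrightarrow> (\<exists>r. computes f (j # ?xs) (Suc r))"
      using n(4) \<open>computes f (i # ?xs) v\<close> by (metis Suc_leI le_neq_implies_less)
    with n show ?case by (metis Suc_leD)
  qed
  have loop_if: "exec ?w (S i v) (S n 0)"
    if "computes f (i # ?xs) v" "i \<le> n" "computes f (n # ?xs) 0"
      "\<forall>j. i \<le> j \<and> j < n \<longrightarrow> (\<exists>r. computes f (j # ?xs) (Suc r))" for i v n
    using that(2,1,3,4)
  proof (induction i arbitrary: v rule: inc_induct)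
    case base
    then have "v = 0" using computes_deterministic by blast
    then show ?case by (subst exec_While) (simp add: S_def)
  next
    case (step i)
    then obtain r where "computes f (i # ?xs) (Suc r)" by blast
    with step have "v = Suc r" using computes_deterministic by blast
    obtain y where y: "computes f (Suc i # ?xs) y"
    proof (cases "Suc i = n")
      case True
      with step.prems that show ?thesis by blast
    next
      case False
      then show ?thesis using step that by (metis Suc_leI le_neq_implies_less order_refl Suc_leD)
    qed
    with step have "exec ?w (S (Suc i) y) (S n 0)" by auto
    moreover have "exec ?body (S i v) (S (Suc i) y)" using y by (simp only: body) blast
    moreover have "S i v (b + 1) \<noteq> 0" using \<open>v = Suc r\<close> by (simp add: S_def)
    ultimately show ?case by (auto intro: exec.intros(6))
  qed
  have fin: "exec (move b d) (S n 0) \<upsilon> \<longleftrightarrow> \<upsilon> = \<sigma>(d := n)" for n \<upsilon>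
  proof -
    have "(S n 0)(b := 0, d := S n 0 d + S n 0 b) = \<sigma>(d := n)"
      using d z by (auto simp: S_def)
    then show ?thesis using d by simp
  qed
  show "exec (Seq cf (Seq ?w (move b d))) \<sigma> \<tau> \<longleftrightarrow> (\<exists>y. computes (Mu f) ?xs y \<and> \<tau> = \<sigma>(d := y))"
  proof
    assume "exec (Seq cf (Seq ?w (move b d))) \<sigma> \<tau>"
    then obtain y \<upsilon> where "computes f (0 # ?xs) y" "exec ?w (S 0 y) \<upsilon>" "exec (move b d) \<upsilon> \<tau>"
      unfolding exec_Seq by (metis start run)
    with loop_imp[of 0 y \<upsilon>] fin show "\<exists>y. computes (Mu f) ?xs y \<and> \<tau> = \<sigma>(d := y)"
      by (auto simp: computes_Mu_iff)
  next
    assume "\<exists>y. computes (Mu f) ?xs y \<and> \<tau> = \<sigma>(d := y)"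
    then obtain n where n: "computes f (n # ?xs) 0" "\<forall>j<n. \<exists>r. computes f (j # ?xs) (Suc r)" "\<tau> = \<sigma>(d := n)"
      by (auto simp: computes_Mu_iff)
    obtain y where y: "computes f (0 # ?xs) y" using n by (cases "n = 0") auto
    have "exec cf \<sigma> (S 0 y)" using y start run by metis
    moreover have "exec ?w (S 0 y) (S n 0)" using loop_if y n by simp
    moreover have "exec (move b d) (S n 0) \<tau>" using fin n by blast
    ultimately show "exec (Seq cf (Seq ?w (move b d))) \<sigma> \<tau>" by (auto simp only: exec_Seq)
  qed
qed

definition implements_all :: "com \<Rightarrow> recf list \<Rightarrow> nat \<Rightarrow> nat list \<Rightarrow> nat \<Rightarrow> bool" where
  "implements_all c gs b as d \<longleftrightarrow> (\<forall>\<sigma> \<tau>. (\<forall>a\<in>set as. a < d) \<and> d + length gs \<le> b \<and>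
      (\<forall>r\<ge>d. \<sigma> r = 0) \<longrightarrow>
     (exec c \<sigma> \<tau> \<longleftrightarrow> (\<exists>ys. list_all2 (\<lambda>g y. computes g (map \<sigma> as) y) gs ys \<and>
        \<tau> = (\<lambda>r. if d \<le> r \<and> r < d + length gs then ys ! (r - d) else \<sigma> r))))"

lemma compile_correct:
  "implements (compile f b as d) f b as d"
  "implements_all (compiles gs b as d) gs b as d"
proof (induction f b as d and gs b as d rule: compile_compiles.induct)
  case (1 b as d)
  then show ?case by (auto simp: implements_def ready_def computes_Zero_iff)
next
  case (2 b as d)
  show ?case
  proof (cases "\<exists>a. as = [a]")
    case True
    then show ?thesis by (auto simp: implements_def ready_def computes_Succ_iff)
  next
    case False
    then have "compile Succ b as d = diverge b" by (auto split: list.splits)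
    moreover have "\<nexists>x. map \<sigma> as = [x]" for \<sigma> :: "nat \<Rightarrow> nat" using False by auto
    ultimately show ?thesis by (simp add: implements_def computes_Succ_iff)
  qed
next
  case (3 i b as d)
  show ?case
  proof (cases "i < length as")
    case True
    then have "as ! i \<in> set as" by simp
    then have "d \<notin> set as \<Longrightarrow> as ! i \<noteq> d" by metis
    then have "exec (copy (as ! i) d b) \<sigma> \<tau> \<longleftrightarrow> \<tau> = \<sigma>(d := \<sigma> d + \<sigma> (as ! i))"
      if "ready b as d \<sigma>" for \<sigma> \<tau>
      using that \<open>as ! i \<in> set as\<close> by (intro exec_copy) (auto simp: ready_def)
    with True show ?thesis by (simp add: implements_def computes_Proj_iff) (simp add: ready_def)
  qed (auto simp: implements_def computes_Proj_iff)
next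
  case (4 f gs b as d)
  let ?n = "length gs"
  show ?case unfolding implements_def
  proof (intro allI impI)
    fix \<sigma> \<tau>
    assume rd: "ready b as d \<sigma>"
    define S where "S ys = (\<lambda>r. if b \<le> r \<and> r < b + ?n then ys ! (r - b) else \<sigma> r)" for ys
    have gs: "exec (compiles gs (b + ?n) as b) \<sigma> \<upsilon> \<longleftrightarrow>
        (\<exists>ys. list_all2 (\<lambda>g y. computes g (map \<sigma> as) y) gs ys \<and> \<upsilon> = S ys)" for \<upsilon>
      using 4(1) rd unfolding implements_all_def S_def ready_def by simp
    have f: "exec (compile f (b + ?n) [b..<b + ?n] d) (S ys) \<upsilon> \<longleftrightarrow> (\<exists>y. computes f ys y \<and> \<upsilon> = (S ys)(d := y))"
      if "length ys = ?n" for ys \<upsilon>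
    proof -
      have "ready (b + ?n) [b..<b + ?n] d (S ys)" using rd by (auto simp: ready_def S_def)
      moreover have "map (S ys) [b..<b + ?n] = ys" using that by (intro nth_equalityI) (auto simp: S_def)
      ultimately show ?thesis using 4(2) by (auto simp: implements_def)
    qed
    have cl: "exec (clears [b..<b + ?n]) ((S ys)(d := y)) \<upsilon> \<longleftrightarrow> \<upsilon> = \<sigma>(d := y)" for ys y \<upsilon>
    proof -
      have "(\<lambda>r. if r \<in> set [b..<b + ?n] then 0 else ((S ys)(d := y)) r) = \<sigma>(d := y)"
        using rd by (auto simp: S_def ready_def fun_eq_iff)
      then show ?thesis by (simp only: exec_clears)
    qed
    show "exec (compile (Comp f gs) b as d) \<sigma> \<tau> \<longleftrightarrow> (\<exists>y. computes (Comp f gs) (map \<sigma> as) y \<and> \<tau> = \<sigma>(d := y))"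
    proof
      assume "exec (compile (Comp f gs) b as d) \<sigma> \<tau>"
      then obtain ys \<upsilon> where "list_all2 (\<lambda>g y. computes g (map \<sigma> as) y) gs ys"
        "exec (compile f (b + ?n) [b..<b + ?n] d) (S ys) \<upsilon>" "exec (clears [b..<b + ?n]) \<upsilon> \<tau>"
        unfolding compile.simps exec_Seq by (metis gs)
      moreover from this obtain y where "computes f ys y" "\<upsilon> = (S ys)(d := y)"
        using f list_all2_lengthD by metis
      ultimately show "\<exists>y. computes (Comp f gs) (map \<sigma> as) y \<and> \<tau> = \<sigma>(d := y)"
        using cl by (auto simp: computes_Comp_iff)
    next
      assume "\<exists>y. computes (Comp f gs) (map \<sigma> as) y \<and> \<tau> = \<sigma>(d := y)"
      then obtain y ys where "list_all2 (\<lambda>g y. computes g (map \<sigma> as) y) gs ys" "computes f ys y" "\<tau> = \<sigma>(d := y)"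
        by (auto simp: computes_Comp_iff)
      then show "exec (compile (Comp f gs) b as d) \<sigma> \<tau>"
        unfolding compile.simps exec_Seq by (metis gs f cl list_all2_lengthD)
    qed
  qed
next
  case (5 f g b as d)
  show ?case
  proof (cases as)
    case Nil
    then show ?thesis by (simp add: implements_def computes_Prec_Nil)
  next
    case (Cons a as')
    then show ?thesis using implements_Prec[of "compile f (b + 4) as' (b + 2)" f b as'] 5 by simp
  qed
next
  case (6 f b as d)
  then show ?case using implements_Mu by simp
next
  case (7 b as d)
  have "(\<lambda>r. if d \<le> r \<and> r < d then [] ! (r - d) else \<sigma> r) = \<sigma>" for \<sigma> :: "nat \<Rightarrow> nat" by auto
  then show ?case by (simp add: implements_all_def)
next
  case (8 g gs b as d)
  show ?case unfolding implements_all_def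
  proof (intro allI impI)
    fix \<sigma> \<tau> :: "nat \<Rightarrow> nat"
    assume *: "(\<forall>a\<in>set as. a < d) \<and> d + length (g # gs) \<le> b \<and> (\<forall>r\<ge>d. \<sigma> r = 0)"
    then have "ready b as d \<sigma>" by (auto simp: ready_def)
    then have g: "exec (compile g b as d) \<sigma> \<upsilon> \<longleftrightarrow> (\<exists>y. computes g (map \<sigma> as) y \<and> \<upsilon> = \<sigma>(d := y))" for \<upsilon>
      using 8(1) by (simp add: implements_def)
    have xs: "map (\<sigma>(d := y)) as = map \<sigma> as" for y using * by (intro map_fun_upd_notin) auto
    have gs: "exec (compiles gs b as (Suc d)) (\<sigma>(d := y)) \<upsilon> \<longleftrightarrow>
        (\<exists>ys. list_all2 (\<lambda>g y. computes g (map \<sigma> as) y) gs ys \<and>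
          \<upsilon> = (\<lambda>r. if d \<le> r \<and> r < d + length (g # gs) then (y # ys) ! (r - d) else \<sigma> r))" for y \<upsilon>
    proof -
      have "(\<lambda>r. if Suc d \<le> r \<and> r < Suc d + length gs then ys ! (r - Suc d) else (\<sigma>(d := y)) r) =
          (\<lambda>r. if d \<le> r \<and> r < d + length (g # gs) then (y # ys) ! (r - d) else \<sigma> r)" for ys
        by (auto simp: fun_eq_iff nth_Cons' Suc_diff_le)
      moreover have cond: "(\<forall>a\<in>set as. a < Suc d) \<and> Suc d + length gs \<le> b \<and> (\<forall>r\<ge>Suc d. (\<sigma>(d := y)) r = 0)"
        using * by auto
      ultimately show ?thesis
        using 8(2)[unfolded implements_all_def, rule_format, OF cond, of \<upsilon>] by (simp only: xs)
    qed
    show "exec (compiles (g # gs) b as d) \<sigma> \<tau> \<longleftrightarrow>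
        (\<exists>ys. list_all2 (\<lambda>g y. computes g (map \<sigma> as) y) (g # gs) ys \<and>
          \<tau> = (\<lambda>r. if d \<le> r \<and> r < d + length (g # gs) then ys ! (r - d) else \<sigma> r))"
    proof -
      have "exec (compiles (g # gs) b as d) \<sigma> \<tau> \<longleftrightarrow> (\<exists>y. computes g (map \<sigma> as) y \<and>
          exec (compiles gs b as (Suc d)) (\<sigma>(d := y)) \<tau>)"
        unfolding compiles.simps exec_Seq g by blast
      then show ?thesis unfolding gs list_all2_Cons1 by blast
    qed
  qed
qed

text \<open>A total step function for which the empty stack is a fixed point, so that runs become
  iterations and can be matched with iterations of a Collatz map.\<close>

fun sstep :: "com list \<times> (nat \<Rightarrow> nat) \<Rightarrow> com list \<times> (nat \<Rightarrow> nat)" where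
  "sstep ([], \<sigma>) = ([], \<sigma>)"
| "sstep (Skip # cs, \<sigma>) = (cs, \<sigma>)"
| "sstep (Inc r # cs, \<sigma>) = (cs, \<sigma>(r := Suc (\<sigma> r)))"
| "sstep (Dec r # cs, \<sigma>) = (cs, \<sigma>(r := \<sigma> r - 1))"
| "sstep (Seq a b # cs, \<sigma>) = (a # b # cs, \<sigma>)"
| "sstep (While r c # cs, \<sigma>) = (if \<sigma> r = 0 then cs else c # While r c # cs, \<sigma>)"

lemma exec_imp_sstep: "exec c \<sigma> \<tau> \<Longrightarrow> \<exists>n. (sstep ^^ n) (c # cs, \<sigma>) = (cs, \<tau>)"
proof (induction arbitrary: cs rule: exec.induct)
  case (4 a \<sigma> \<tau> b \<upsilon>)
  then obtain n m where "(sstep ^^ n) (a # b # cs, \<sigma>) = (b # cs, \<tau>)" "(sstep ^^ m) (b # cs, \<tau>) = (cs, \<upsilon>)"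
    by blast
  then have "(sstep ^^ (m + Suc n)) (Seq a b # cs, \<sigma>) = (cs, \<upsilon>)"
    by (simp add: funpow_add funpow_Suc_right del: funpow.simps)
  then show ?case by blast
next
  case (6 \<sigma> r c \<tau> \<upsilon>)
  then obtain n m where "(sstep ^^ n) (c # While r c # cs, \<sigma>) = (While r c # cs, \<tau>)"
    "(sstep ^^ m) (While r c # cs, \<tau>) = (cs, \<upsilon>)"
    by blast
  then have "(sstep ^^ (m + Suc n)) (While r c # cs, \<sigma>) = (cs, \<upsilon>)"
    using 6(1) by (simp add: funpow_add funpow_Suc_right del: funpow.simps)
  then show ?case by blast
qed (rule exI[of _ 1], simp)+

fun execs :: "com list \<Rightarrow> (nat \<Rightarrow> nat) \<Rightarrow> (nat \<Rightarrow> nat) \<Rightarrow> bool" where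
  "execs [] \<sigma> \<tau> \<longleftrightarrow> \<tau> = \<sigma>"
| "execs (c # cs) \<sigma> \<tau> \<longleftrightarrow> (\<exists>\<upsilon>. exec c \<sigma> \<upsilon> \<and> execs cs \<upsilon> \<tau>)"

lemma execs_sstep:
  fixes cs \<sigma>
  shows "case sstep (cs, \<sigma>) of (cs', \<sigma>') \<Rightarrow> execs cs' \<sigma>' \<tau> \<Longrightarrow> execs cs \<sigma> \<tau>"
proof (cases cs)
  case (Cons c cs')
  assume *: "case sstep (cs, \<sigma>) of (cs', \<sigma>') \<Rightarrow> execs cs' \<sigma>' \<tau>"
  show ?thesis
  proof (cases c)
    case (Seq a b)
    with Cons * show ?thesis by auto
  next
    case (While r d)
    with Cons * show ?thesis by (cases "\<sigma> r = 0") (auto intro: exec.intros)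
  qed (use Cons * in auto)
qed simp

lemma sstep_imp_execs: "(sstep ^^ n) (cs, \<sigma>) = ([], \<tau>) \<Longrightarrow> execs cs \<sigma> \<tau>"
proof (induction n arbitrary: cs \<sigma>)
  case (Suc n)
  obtain cs' \<sigma>' where *: "sstep (cs, \<sigma>) = (cs', \<sigma>')" by (cases "sstep (cs, \<sigma>)")
  with Suc.prems have "(sstep ^^ n) (cs', \<sigma>') = ([], \<tau>)"
    by (simp add: funpow_Suc_right del: funpow.simps)
  then have "execs cs' \<sigma>' \<tau>" by (rule Suc.IH)
  with * show ?case by (intro execs_sstep) simp
qed simp

lemma exec_iff_sstep: "exec c \<sigma> \<tau> \<longleftrightarrow> (\<exists>n. (sstep ^^ n) ([c], \<sigma>) = ([], \<tau>))"
  using exec_imp_sstep[of c \<sigma> \<tau> "[]"] sstep_imp_execs[of _ "[c]" \<sigma> \<tau>] by auto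

fun regs :: "com \<Rightarrow> nat set" where
  "regs Skip = {}"
| "regs (Inc r) = {r}"
| "regs (Dec r) = {r}"
| "regs (Seq a b) = regs a \<union> regs b"
| "regs (While r c) = insert r (regs c)"

lemma finite_regs: "finite (regs c)"
  by (induction c) auto

text \<open>Only finitely many stacks of pending commands occur in a run of a program, so they can serve as
  the labels of a Collatz system.\<close>

fun conts :: "com \<Rightarrow> com list \<Rightarrow> com list set" where
  "conts Skip cs = {Skip # cs}"
| "conts (Inc r) cs = {Inc r # cs}"
| "conts (Dec r) cs = {Dec r # cs}"
| "conts (Seq a b) cs = insert (Seq a b # cs) (conts a (b # cs) \<union> conts b cs)"
| "conts (While r c) cs = insert (While r c # cs) (conts c (While r c # cs))"

lemma finite_conts: "finite (conts c cs)"
  by (induction c arbitrary: cs) auto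

lemma conts_start: "c # cs \<in> conts c cs"
  by (cases c) auto

lemma conts_step: "ds \<in> conts c cs \<Longrightarrow> fst (sstep (ds, \<sigma>)) \<in> insert cs (conts c cs)"
proof (induction c arbitrary: cs)
  case (Seq a b)
  from Seq.prems consider "ds = Seq a b # cs" | "ds \<in> conts a (b # cs)" | "ds \<in> conts b cs" by auto
  then show ?case
  proof cases
    case 2
    then show ?thesis using Seq.IH(1)[of "b # cs"] conts_start[of b cs] by auto
  next
    case 3
    then show ?thesis using Seq.IH(2)[of cs] by auto
  qed (simp add: conts_start)
next
  case (While r c)
  from While.prems consider "ds = While r c # cs" | "ds \<in> conts c (While r c # cs)" by auto
  then show ?case
  proof cases
    case 2
    then show ?thesis using While.IH[of "While r c # cs"] by auto
  qed (simp add: conts_start)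
qed auto

lemma conts_regs: "ds \<in> conts c cs \<Longrightarrow> d \<in> set ds \<Longrightarrow> regs d \<subseteq> regs c \<union> \<Union> (regs ` set cs)"
proof (induction c arbitrary: cs)
  case (Seq a b)
  from Seq.prems consider "ds = Seq a b # cs" | "ds \<in> conts a (b # cs)" | "ds \<in> conts b cs" by auto
  then show ?case
  proof cases
    case 2
    then show ?thesis using Seq.IH(1)[of "b # cs"] Seq.prems by auto
  next
    case 3
    then show ?thesis using Seq.IH(2)[of cs] Seq.prems by auto
  qed (use Seq.prems in auto)
next
  case (While r c)
  from While.prems consider "ds = While r c # cs" | "ds \<in> conts c (While r c # cs)" by auto
  then show ?case
  proof cases
    case 2
    then show ?thesis using While.IH[of "While r c # cs"] While.prems by auto
  qed (use While.prems in auto)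
qed auto

text \<open>A generalized Collatz function: for \<open>i < m\<close> it sends
  \<open>i + m * j\<close> to \<open>C i + A i * j\<close>.\<close>

definition collatz_step :: "nat \<Rightarrow> (nat \<Rightarrow> nat) \<Rightarrow> (nat \<Rightarrow> nat) \<Rightarrow> nat \<Rightarrow> nat" where
  "collatz_step m A C n = (n div m) * A (n mod m) + C (n mod m)"

definition collatz_reaches :: "nat \<Rightarrow> (nat \<Rightarrow> nat) \<Rightarrow> (nat \<Rightarrow> nat) \<Rightarrow> nat \<Rightarrow> nat \<Rightarrow> bool" where
  "collatz_reaches m A C z n \<longleftrightarrow> (\<exists>j. (collatz_step m A C ^^ j) n = z)"

text \<open>\<open>C i < A i\<close> makes \<open>C i\<close> a residue modulo \<open>A i\<close>,
  which the row permutations below rely on. As \<open>z\<close> is fixed, a number reaches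
  \<open>z\<close> iff its successor does, so the set of these numbers is invariant in both
  directions.\<close>

definition collatz_system :: "nat \<Rightarrow> (nat \<Rightarrow> nat) \<Rightarrow> (nat \<Rightarrow> nat) \<Rightarrow> nat \<Rightarrow> bool" where
  "collatz_system m A C z \<longleftrightarrow> m > 0 \<and> (\<forall>i<m. C i < A i) \<and> collatz_step m A C z = z"

section \<open>Collatz systems simulating while programs\<close>

definition nprime :: "nat \<Rightarrow> nat" where
  "nprime = enumerate {p. Factorial_Ring.prime p}"

lemma prime_nprime: "Factorial_Ring.prime (nprime r)"
  using enumerate_in_set[OF primes_infinite] by (auto simp: nprime_def)

lemma nprime_eq_iff [simp]: "nprime r = nprime s \<longleftrightarrow> r = s"
  using strict_mono_enumerate[OF primes_infinite] unfolding nprime_def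
  by (auto dest: strict_mono_eq)

lemma nprime_pos [simp]: "nprime r > 0"
  using prime_nprime prime_gt_0_nat by blast

lemma nprime_dvd_iff: "nprime r dvd nprime s \<longleftrightarrow> r = s"
  using primes_dvd_imp_eq[OF prime_nprime prime_nprime] by auto

definition store_code :: "nat \<Rightarrow> (nat \<Rightarrow> nat) \<Rightarrow> nat" where
  "store_code R \<sigma> = (\<Prod>r<R. nprime r ^ \<sigma> r)"

lemma nprime_dvd_store_code: "r < R \<Longrightarrow> nprime r dvd store_code R \<sigma> \<longleftrightarrow> \<sigma> r > 0"
proof
  assume "r < R" "nprime r dvd store_code R \<sigma>"
  then obtain s where "s < R" "nprime r dvd nprime s ^ \<sigma> s"
    unfolding store_code_def by (auto simp: prime_dvd_prod_iff prime_nprime)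
  then have "nprime r dvd nprime s" "\<sigma> s > 0"
    using prime_dvd_power prime_nprime not_prime_unit by (blast, metis gr0I power_0)
  then show "\<sigma> r > 0" by (simp add: nprime_dvd_iff)
next
  assume "r < R" "\<sigma> r > 0"
  then have "nprime r dvd nprime r ^ \<sigma> r" "nprime r ^ \<sigma> r dvd store_code R \<sigma>"
    unfolding store_code_def by (auto intro: dvd_prodI)
  then show "nprime r dvd store_code R \<sigma>" by (rule dvd_trans)
qed

lemma store_code_inc: "r < R \<Longrightarrow> store_code R (\<sigma>(r := Suc (\<sigma> r))) = nprime r * store_code R \<sigma>"
proof -
  assume r: "r < R"
  have "(\<Prod>s\<in>{..<R} - {r}. nprime s ^ (\<sigma>(r := Suc (\<sigma> r))) s) = (\<Prod>s\<in>{..<R} - {r}. nprime s ^ \<sigma> s)"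
    by (intro prod.cong) auto
  with r show ?thesis
    unfolding store_code_def by (simp add: prod.remove[of "{..<R}" r])
qed

lemma store_code_dec:
  assumes "r < R" "\<sigma> r > 0"
  shows "store_code R (\<sigma>(r := \<sigma> r - 1)) = store_code R \<sigma> div nprime r"
proof -
  have "store_code R \<sigma> = nprime r * store_code R (\<sigma>(r := \<sigma> r - 1))"
    using store_code_inc[OF assms(1), of "\<sigma>(r := \<sigma> r - 1)"] assms(2) by simp
  then show ?thesis by simp
qed

text \<open>The result \<open>(a, b, cs')\<close> says that the code \<open>q\<close> of the store
  becomes \<open>a * (q div b)\<close> and the stack becomes \<open>cs'\<close>. It depends on
  \<open>q\<close> only through divisibility by primes, hence only on \<open>q\<close> modulo their
  product.\<close>

fun transition :: "com list \<Rightarrow> nat \<Rightarrow> nat \<times> nat \<times> com list" where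
  "transition [] q = (1, 1, [])"
| "transition (Skip # cs) q = (1, 1, cs)"
| "transition (Inc r # cs) q = (nprime r, 1, cs)"
| "transition (Dec r # cs) q = (1, if nprime r dvd q then nprime r else 1, cs)"
| "transition (Seq a b # cs) q = (1, 1, a # b # cs)"
| "transition (While r c # cs) q = (1, 1, if nprime r dvd q then c # While r c # cs else cs)"

lemma transition_pos: "transition cs q = (a, b, cs') \<Longrightarrow> a > 0 \<and> b > 0 \<and> b dvd q"
  by (induction cs q rule: transition.induct) auto

lemma transition_sstep:
  assumes "\<And>c r. c \<in> set cs \<Longrightarrow> r \<in> regs c \<Longrightarrow> r < R"
  shows "sstep (cs, \<sigma>) = (cs', \<sigma>') \<Longrightarrow> \<exists>a b. transition cs (store_code R \<sigma>) = (a, b, cs') \<and>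
    store_code R \<sigma>' = a * (store_code R \<sigma> div b)"
  using assms
proof (cases cs)
  case (Cons c ds)
  assume step: "sstep (cs, \<sigma>) = (cs', \<sigma>')"
  have R: "r < R" if "r \<in> regs c" for r using assms Cons that by auto
  show ?thesis
  proof (cases c)
    case (Inc r)
    then show ?thesis using R Cons step store_code_inc[of r R \<sigma>] by auto
  next
    case (Dec r)
    then show ?thesis using R Cons step store_code_dec[of r R \<sigma>]
      by (cases "\<sigma> r = 0") (auto simp: nprime_dvd_store_code fun_upd_idem)
  next
    case (While r d)
    then show ?thesis using R Cons step by (auto simp: nprime_dvd_store_code)
  qed (use Cons step in auto)
qed auto

text \<open>A state is coded as \<open>M * store_code R \<sigma> + idx cs\<close>, where
  \<open>idx\<close> numbers the \<open>M\<close> possible stacks. The residue modulo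
  \<open>M * P\<close> reveals the stack and the registers that are zero, so a program step is a
  Collatz step. The hypothesis \<open>final\<close> leaves a single number as the code of all
  halting states.\<close>

theorem collatz_of_com:
  assumes regs: "\<And>r. r \<in> regs c \<Longrightarrow> r < R"
    and final: "\<And>\<sigma> \<tau>. exec c \<sigma> \<tau> \<Longrightarrow> \<forall>r\<ge>R. \<sigma> r = 0 \<Longrightarrow> \<tau> = (\<lambda>_. 0)"
  shows "\<exists>m A C M l z. collatz_system m A C z \<and>
    (\<forall>\<sigma>. (\<forall>r\<ge>R. \<sigma> r = 0) \<longrightarrow>
      ((\<exists>\<tau>. exec c \<sigma> \<tau>) \<longleftrightarrow> collatz_reaches m A C z (M * store_code R \<sigma> + l)))"
proof -
  define L where "L = insert [] (conts c [])"
  have "finite L" by (simp add: L_def finite_conts)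
  then obtain idx where idx: "bij_betw idx L {0..<card L}"
    using ex_bij_betw_finite_nat by blast
  define M where "M = card L"
  define P where "P = (\<Prod>r<R. nprime r)"
  define lab where "lab = inv_into L idx"
  have idx_less: "idx cs < M" if "cs \<in> L" for cs
    using idx that by (auto simp: bij_betw_def M_def)
  have lab_idx: "lab (idx cs) = cs" if "cs \<in> L" for cs
    using idx that by (simp add: lab_def bij_betw_inv_into_left)
  have lab_in: "lab l \<in> L" if "l < M" for l
    using idx that unfolding lab_def M_def bij_betw_def by (metis atLeast0LessThan inv_into_into lessThan_iff)
  have M: "M > 0" using idx_less[of "[]"] by (auto simp: L_def)
  have P: "P > 0" by (auto simp: P_def intro!: prod_pos)
  have regs': "r < R" if "cs \<in> L" "d \<in> set cs" "r \<in> regs d" for cs d r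
    using that conts_regs[of cs c "[]" d] regs by (auto simp: L_def)
  have dvd_P: "nprime r dvd P" if "r < R" for r
    unfolding P_def using that by (intro dvd_prodI) auto
  \<comment> \<open>A residue \<open>i\<close> stands for the stack \<open>lab (i mod M)\<close> and
    the store code \<open>i div M\<close> modulo \<open>P\<close>. If \<open>b\<close> divides
    \<open>P\<close> and \<open>w\<close>, then
    \<open>(P * v + w) div b = v * (P div b) + w div b\<close>, which gives slope and
    offset.\<close>
  define A where "A i = (case transition (lab (i mod M)) (i div M) of (a, b, cs) \<Rightarrow> M * a * (P div b))" for i
  define C where "C i = (case transition (lab (i mod M)) (i div M) of (a, b, cs) \<Rightarrow> M * a * (i div M div b) + idx cs)" for i
  \<comment> \<open>The empty stack with all registers zero, for which \<open>store_code\<close> is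
    1.\<close>
  define z where "z = M + idx []"
  have trans_L: "cs' \<in> L" if "cs \<in> L" "transition cs q = (a, b, cs')" for cs q a b cs'
  proof -
    have "cs' \<in> range (\<lambda>\<sigma>. fst (sstep (cs, \<sigma>)))"
      using that(2)
    proof (induction cs q rule: transition.induct)
      case (6 r c cs q)
      \<comment> \<open>A store that takes the same branch as \<open>transition\<close>, so that
        \<open>conts_step\<close> applies to the next stack.\<close>
      let ?\<sigma> = "\<lambda>_. if nprime r dvd q then 1 else 0"
      have "cs' = fst (sstep (While r c # cs, ?\<sigma>))" using 6 by auto
      then show ?case by blast
    qed auto
    then obtain \<sigma> where "cs' = fst (sstep (cs, \<sigma>))" by blast
    then show ?thesis using conts_step[of cs c "[]" \<sigma>] that(1) by (auto simp: L_def)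
  qed
  have trans_b: "b dvd P" if "cs \<in> L" "transition cs q = (a, b, cs')" for cs q a b cs'
  proof -
    have *: "nprime r dvd P" if "d \<in> set cs" "r \<in> regs d" for d r
      using regs'[OF \<open>cs \<in> L\<close> that] dvd_P by blast
    from that(2) * show ?thesis
      by (induction cs q rule: transition.induct) (fastforce split: if_splits)+
  qed
  have trans_mod: "transition cs (q mod P) = transition cs q" if "cs \<in> L" for cs q
  proof -
    have *: "nprime r dvd q mod P \<longleftrightarrow> nprime r dvd q" if "d \<in> set cs" "r \<in> regs d" for d r q
      using regs'[OF \<open>cs \<in> L\<close> that] dvd_P by (simp add: dvd_mod_iff)
    show ?thesis
    proof (cases cs)
      case (Cons d ds)
      with *[of d] show ?thesis by (cases d) auto
    qed simp
  qed
  have step: "collatz_step (M * P) A C (M * u + idx cs) = M * (a * (u div b)) + idx cs'"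
    if cs: "cs \<in> L" and t: "transition cs u = (a, b, cs')" for u cs a b cs'
  proof -
    let ?n = "M * u + idx cs"
    have i: "?n mod (M * P) = M * (u mod P) + idx cs" "?n div (M * P) = u div P"
      using idx_less[OF cs] by (simp_all add: mod_mult2_eq div_mult2_eq)
    have "lab (?n mod (M * P) mod M) = cs" "?n mod (M * P) div M = u mod P"
      using idx_less[OF cs] lab_idx[OF cs] by (simp_all add: i)
    then have AC: "A (?n mod (M * P)) = M * a * (P div b)" "C (?n mod (M * P)) = M * a * (u mod P div b) + idx cs'"
      using t trans_mod[OF cs, of u] by (simp_all add: A_def C_def)
    have b: "b dvd P" "b dvd u mod P" "b > 0"
      using trans_b[OF cs t] transition_pos[of cs "u mod P" a b cs'] t trans_mod[OF cs, of u] by auto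
    have "u div b = (P * (u div P) + u mod P) div b" by simp
    also have "\<dots> = (u div P) * (P div b) + u mod P div b"
      using b by (subst div_plus_div_distrib_dvd_left) (auto simp: div_mult_swap dvd_div_mult mult.commute)
    finally show ?thesis
      unfolding collatz_step_def AC i(2) by (simp add: algebra_simps)
  qed
  have C_less: "C i < A i" if "i < M * P" for i
  proof -
    obtain a b cs where t: "transition (lab (i mod M)) (i div M) = (a, b, cs)" by (cases "transition (lab (i mod M)) (i div M)")
    have L: "lab (i mod M) \<in> L" using lab_in M by simp
    have ab: "a > 0" "b > 0" "b dvd i div M" using transition_pos[OF t] by auto
    have "i div M < P" using that by (simp add: less_mult_imp_div_less mult.commute)
    then have "i div M div b < P div b"
      using ab trans_b[OF L t] by (simp add: div_less_mono)
    then have "M * a * (i div M div b) + M * a \<le> M * a * (P div b)"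
      by (metis Suc_leI mult_Suc_right mult_le_mono2 add.commute)
    moreover have "idx cs < M * a"
      using idx_less[OF trans_L[OF L t]] ab by (metis One_nat_def Suc_leI less_le_trans mult.right_neutral mult_le_mono2)
    ultimately show ?thesis using t by (simp add: A_def C_def)
  qed
  have "collatz_system (M * P) A C z"
    using M P C_less step[of "[]" 1 1 1 "[]"] by (auto simp: collatz_system_def z_def L_def)
  moreover
  have "(\<exists>\<tau>. exec c \<sigma> \<tau>) \<longleftrightarrow> collatz_reaches (M * P) A C z (M * store_code R \<sigma> + idx [c])"
    if \<sigma>: "\<forall>r\<ge>R. \<sigma> r = 0" for \<sigma>
  proof -
    define code where "code x = M * store_code R (snd x) + idx (fst x)" for x
    have iter: "(collatz_step (M * P) A C ^^ j) (code ([c], \<sigma>)) = code ((sstep ^^ j) ([c], \<sigma>)) \<and>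
        fst ((sstep ^^ j) ([c], \<sigma>)) \<in> L" for j
    proof (induction j)
      case 0
      then show ?case using conts_start[of c "[]"] by (simp add: L_def)
    next
      case (Suc j)
      obtain cs \<upsilon> where cs: "(sstep ^^ j) ([c], \<sigma>) = (cs, \<upsilon>)" by (cases "(sstep ^^ j) ([c], \<sigma>)")
      obtain cs' \<upsilon>' where cs': "sstep (cs, \<upsilon>) = (cs', \<upsilon>')" by (cases "sstep (cs, \<upsilon>)")
      have L: "cs \<in> L" using Suc cs by simp
      obtain a b where ab: "transition cs (store_code R \<upsilon>) = (a, b, cs')"
        "store_code R \<upsilon>' = a * (store_code R \<upsilon> div b)"
        using transition_sstep[OF _ cs', of R] regs'[OF L] by blast
      show ?case using Suc cs cs' step[OF L ab(1)] ab(2) trans_L[OF L ab(1)] by (simp add: code_def)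
    qed
    show ?thesis
    proof
      assume "\<exists>\<tau>. exec c \<sigma> \<tau>"
      then obtain \<tau> n where \<tau>: "exec c \<sigma> \<tau>" "(sstep ^^ n) ([c], \<sigma>) = ([], \<tau>)" by (auto simp: exec_iff_sstep)
      then have "(collatz_step (M * P) A C ^^ n) (code ([c], \<sigma>)) = z"
        using iter[of n] final[OF \<tau>(1) \<sigma>] by (simp add: code_def z_def store_code_def)
      then show "collatz_reaches (M * P) A C z (M * store_code R \<sigma> + idx [c])"
        by (auto simp: collatz_reaches_def code_def)
    next
      assume "collatz_reaches (M * P) A C z (M * store_code R \<sigma> + idx [c])"
      then obtain n where "(collatz_step (M * P) A C ^^ n) (code ([c], \<sigma>)) = z"
        by (auto simp: collatz_reaches_def code_def)
      with iter[of n] have *: "code ((sstep ^^ n) ([c], \<sigma>)) mod M = z mod M" "fst ((sstep ^^ n) ([c], \<sigma>)) \<in> L" by auto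
      then have "idx (fst ((sstep ^^ n) ([c], \<sigma>))) = idx []"
        using idx_less[of "[]"] idx_less[OF *(2)] by (simp add: code_def z_def L_def)
      then have "fst ((sstep ^^ n) ([c], \<sigma>)) = []"
        using *(2) lab_idx[of "[]"] lab_idx[OF *(2)] by (simp add: L_def)
      then show "\<exists>\<tau>. exec c \<sigma> \<tau>" unfolding exec_iff_sstep by (metis prod.collapse)
    qed
  qed
  ultimately show ?thesis by blast
qed

lemma regs_clears: "regs (clears rs) = set rs"
  by (induction rs) (auto simp: clear_def)

lemma collatz_of_recf:
  "\<exists>m A C M l z. collatz_system m A C z \<and>
    (\<forall>a b. (\<exists>y. computes f [a, b] y) \<longleftrightarrow>
      collatz_reaches m A C z (M * (nprime 0 ^ a * nprime 1 ^ b) + l))"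
proof -
  define c0 where "c0 = compile f 3 [0, 1] 2"
  obtain R where R: "\<forall>r\<in>regs c0 \<union> {0, 1, 2}. r < R"
    using finite_nat_set_iff_bounded[of "regs c0 \<union> {0, 1, 2}"] finite_regs by auto
  \<comment> \<open>Clearing every register after the run produces the unique final store that
    \<open>collatz_of_com\<close> asks for.\<close>
  define c where "c = Seq c0 (clears [0..<R])"
  have c0: "exec c0 \<sigma> \<tau> \<longleftrightarrow> (\<exists>y. computes f [\<sigma> 0, \<sigma> 1] y \<and> \<tau> = \<sigma>(2 := y))"
    if "\<forall>r\<ge>2. \<sigma> r = 0" for \<sigma> \<tau>
    using compile_correct(1)[of f 3 "[0, 1]" 2] that
    by (simp add: implements_def ready_def c0_def)
  have run: "exec c \<sigma> \<tau> \<longleftrightarrow> (\<exists>\<upsilon>. exec c0 \<sigma> \<upsilon> \<and> \<tau> = (\<lambda>r. if r < R then 0 else \<upsilon> r))" for \<sigma> \<tau>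
    by (simp add: c_def)
  have exec_ge: "exec d \<sigma> \<tau> \<Longrightarrow> regs d \<subseteq> {..<R} \<Longrightarrow> R \<le> r \<Longrightarrow> \<tau> r = \<sigma> r" for d \<sigma> \<tau> r
    by (induction rule: exec.induct) auto
  have "\<exists>m A C M l z. collatz_system m A C z \<and>
    (\<forall>\<sigma>. (\<forall>r\<ge>R. \<sigma> r = 0) \<longrightarrow>
      ((\<exists>\<tau>. exec c \<sigma> \<tau>) \<longleftrightarrow> collatz_reaches m A C z (M * store_code R \<sigma> + l)))"
  proof (rule collatz_of_com)
    show "r < R" if "r \<in> regs c" for r using that R by (auto simp: c_def regs_clears)
    show "\<tau> = (\<lambda>_. 0)" if run_c: "exec c \<sigma> \<tau>" and zero: "\<forall>r\<ge>R. \<sigma> r = 0" for \<sigma> \<tau>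
    proof -
      obtain \<upsilon> where \<upsilon>: "exec c0 \<sigma> \<upsilon>" "\<tau> = (\<lambda>r. if r < R then 0 else \<upsilon> r)"
        using run_c[unfolded run] by blast
      have "\<upsilon> r = 0" if "R \<le> r" for r
        using exec_ge[OF \<upsilon>(1) _ that] R that zero by auto
      then show ?thesis by (auto simp: \<upsilon>(2))
    qed
  qed
  then obtain m A C M l z where sys: "collatz_system m A C z"
    and reach: "\<And>\<sigma>. (\<forall>r\<ge>R. \<sigma> r = 0) \<Longrightarrow>
      ((\<exists>\<tau>. exec c \<sigma> \<tau>) \<longleftrightarrow> collatz_reaches m A C z (M * store_code R \<sigma> + l))"
    by blast
  have "(\<exists>y. computes f [a, b] y) \<longleftrightarrow> collatz_reaches m A C z (M * (nprime 0 ^ a * nprime 1 ^ b) + l)" for a b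
  proof -
    define \<sigma> :: "nat \<Rightarrow> nat" where "\<sigma> = (\<lambda>_. 0)(0 := a, 1 := b)"
    have "store_code R \<sigma> = (\<Prod>r\<in>{0, 1}. nprime r ^ \<sigma> r)"
      unfolding store_code_def using R by (intro prod.mono_neutral_right) (auto simp: \<sigma>_def)
    then have "store_code R \<sigma> = nprime 0 ^ a * nprime 1 ^ b" by (simp add: \<sigma>_def)
    moreover have "(\<exists>\<tau>. exec c \<sigma> \<tau>) \<longleftrightarrow> (\<exists>y. computes f [a, b] y)"
      using c0[of \<sigma>] by (auto simp: run \<sigma>_def)
    moreover have "\<forall>r\<ge>R. \<sigma> r = 0" using R by (auto simp: \<sigma>_def)
    ultimately show ?thesis using reach[of \<sigma>] by simp
  qed
  with sys show ?thesis by blast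
qed

section \<open>A universal function and the diagonal argument\<close>

definition digit :: "nat \<Rightarrow> nat \<Rightarrow> nat \<Rightarrow> nat" where
  "digit p b i = p div b ^ i mod b"

lemma digits_exist: "\<forall>d\<in>set ds. d < b \<Longrightarrow> \<exists>p. \<forall>i<length ds. digit p b i = ds ! i"
proof (induction ds)
  case (Cons d ds)
  then obtain p where p: "\<forall>i<length ds. digit p b i = ds ! i" by auto
  have "digit (d + b * p) b i = (d # ds) ! i" if "i < length (d # ds)" for i
    using that p Cons.prems by (cases i) (auto simp: digit_def div_mult2_eq)
  then show ?case by blast
qed simp

lemma total_computable_digit:
  "total_computable k F \<Longrightarrow> total_computable k G \<Longrightarrow> total_computable k H \<Longrightarrow>
    total_computable k (\<lambda>xs. digit (F xs) (G xs) (H xs))"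
  unfolding digit_def by (intro total_computable_mod total_computable_div total_computable_power)

text \<open>The universal partial function: the digits of \<open>p\<close> in base \<open>b\<close> list the data
  \<open>m, M, l, z, A 0, C 0, A 1, C 1, \<dots>\<close> of a Collatz system and of an initial value.\<close>

definition digit_step :: "nat \<Rightarrow> nat \<Rightarrow> nat \<Rightarrow> nat" where
  "digit_step p b = collatz_step (digit p b 0) (\<lambda>i. digit p b (4 + 2 * i)) (\<lambda>i. digit p b (5 + 2 * i))"

definition digit_start :: "nat \<Rightarrow> nat \<Rightarrow> nat" where
  "digit_start p b = digit p b 1 * (nprime 0 ^ p * nprime 1 ^ b) + digit p b 2"

definition digit_halts :: "nat \<Rightarrow> nat \<Rightarrow> bool" where
  "digit_halts p b \<longleftrightarrow> (\<exists>j. (digit_step p b ^^ j) (digit_start p b) = digit p b 3)"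

lemma universal: "\<exists>f. \<forall>p b. (\<exists>y. computes f [p, b] y) \<longleftrightarrow> digit_halts p b"
proof -
  define F where "F p b j = rec_nat (digit_start p b) (\<lambda>_. digit_step p b) j" for p b j
  have F: "F p b j = (digit_step p b ^^ j) (digit_start p b)" for p b j
    by (induction j) (auto simp: F_def)
  \<comment> \<open>The sum of both truncated differences vanishes iff the two numbers agree, so
    \<open>Mu\<close> searches for the moment at which the target digit is hit.\<close>
  have "total_computable 3 (\<lambda>xs. (F (xs ! 1) (xs ! 2) (xs ! 0) - digit (xs ! 1) (xs ! 2) 3) +
      (digit (xs ! 1) (xs ! 2) 3 - F (xs ! 1) (xs ! 2) (xs ! 0)))"
    unfolding F_def digit_start_def digit_step_def collatz_step_def
    by (intro total_computable_add total_computable_diff total_computable_digit total_computable_rec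
        total_computable_mult total_computable_power total_computable_div total_computable_mod
        total_computable_const total_computable_proj total_computable_proj_drop) simp_all
  then obtain g where g: "\<And>xs. length xs = 3 \<Longrightarrow> computes g xs ((F (xs ! 1) (xs ! 2) (xs ! 0) - digit (xs ! 1) (xs ! 2) 3) +
      (digit (xs ! 1) (xs ! 2) 3 - F (xs ! 1) (xs ! 2) (xs ! 0)))"
    by (auto simp: total_computable_def)
  have g': "computes g [j, p, b] ((F p b j - digit p b 3) + (digit p b 3 - F p b j))" for j p b
    using g[of "[j, p, b]"] by (simp add: numeral_2_eq_2)
  have "(\<exists>y. computes (Mu g) [p, b] y) \<longleftrightarrow> digit_halts p b" for p b
  proof
    assume "\<exists>y. computes (Mu g) [p, b] y"
    then obtain k where "computes g [k, p, b] 0" by (auto simp: computes_Mu_iff)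
    with g'[of k p b] have "F p b k = digit p b 3" using computes_deterministic by fastforce
    then show "digit_halts p b" unfolding digit_halts_def F by blast
  next
    assume "digit_halts p b"
    then have ex: "\<exists>k. F p b k = digit p b 3" by (auto simp: digit_halts_def F)
    define k where "k = (LEAST k. F p b k = digit p b 3)"
    have k: "F p b k = digit p b 3" unfolding k_def using ex by (rule LeastI_ex)
    have less: "F p b j \<noteq> digit p b 3" if "j < k" for j using not_less_Least that k_def by blast
    have "computes (Mu g) [p, b] k"
      unfolding computes_Mu_iff
    proof (intro conjI allI impI)
      show "computes g [k, p, b] 0" using g'[of k p b] k by simp
      fix j assume "j < k"
      then have "\<exists>r. (F p b j - digit p b 3) + (digit p b 3 - F p b j) = Suc r"
        using less[of j] by presburger
      then show "\<exists>r. computes g [j, p, b] (Suc r)" using g'[of j p b] by auto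
    qed
    then show "\<exists>y. computes (Mu g) [p, b] y" by blast
  qed
  then show ?thesis by blast
qed

text \<open>Diagonalization for the Collatz system of the universal function. A decision procedure
  would give a partial recursive function halting exactly where \<open>digit_halts\<close> fails; it
  has a Collatz system in turn, and the digits \<open>p\<close> of that system in a base
  \<open>b\<close> above all its data contradict themselves.\<close>

theorem undecidable_collatz:
  "\<exists>m A C z. collatz_system m A C z \<and>
    \<not> total_computable 1 (\<lambda>xs. if collatz_reaches m A C z (xs ! 0) then 1 else 0)"
proof -
  obtain u where u: "\<And>p b. (\<exists>y. computes u [p, b] y) \<longleftrightarrow> digit_halts p b" using universal by blast
  obtain m A C M l z where sys: "collatz_system m A C z"
    and reach: "\<And>a b. (\<exists>y. computes u [a, b] y) \<longleftrightarrow>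
      collatz_reaches m A C z (M * (nprime 0 ^ a * nprime 1 ^ b) + l)"
    using collatz_of_recf by metis
  have "\<not> total_computable 1 (\<lambda>xs. if collatz_reaches m A C z (xs ! 0) then 1 else 0)"
  proof
    assume tc: "total_computable 1 (\<lambda>xs. if collatz_reaches m A C z (xs ! 0) then 1 else 0)"
    have "total_computable 2 (\<lambda>xs. (\<lambda>ys. if collatz_reaches m A C z (ys ! 0) then 1 else 0)
        (map (\<lambda>G. G xs) [\<lambda>xs. M * (nprime 0 ^ (xs ! 0) * nprime 1 ^ (xs ! 1)) + l]))"
      by (rule total_computable_comp)
        (use tc in \<open>auto intro!: total_computable_add total_computable_mult total_computable_power
          total_computable_const total_computable_proj\<close>)
    then have "total_computable 2 (\<lambda>xs. if digit_halts (xs ! 0) (xs ! 1) then 1 else 0)"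
      by (simp only: list.map nth_Cons_0 reach[symmetric] u)
    then have "total_computable (1 + 2) (\<lambda>xs. (\<lambda>xs. if digit_halts (xs ! 0) (xs ! 1) then 1 else 0) (drop 1 xs))"
      by (rule total_computable_drop)
    then obtain d where d: "\<And>xs. length xs = 1 + 2 \<Longrightarrow>
        computes d xs (if digit_halts (drop 1 xs ! 0) (drop 1 xs ! 1) then 1 else 0)"
      by (auto simp: total_computable_def)
    have d': "computes d [k, p, b] (if digit_halts p b then 1 else 0)" for k p b
      using d[of "[k, p, b]"] by simp
    \<comment> \<open>The value of \<open>d\<close> is independent of the search variable
      \<open>k\<close>: \<open>Mu d\<close> stops at 0 if \<open>digit_halts p b\<close> fails and
      runs forever otherwise.\<close>
    have f: "(\<exists>y. computes (Mu d) [p, b] y) \<longleftrightarrow> \<not> digit_halts p b" for p b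
      using d'[of _ p b] computes_deterministic[OF d'[of _ p b]]
      by (cases "digit_halts p b") (fastforce simp: computes_Mu_iff)+
    obtain m' A' C' M' l' z' where sys': "collatz_system m' A' C' z'"
      and reach': "\<And>a b. (\<exists>y. computes (Mu d) [a, b] y) \<longleftrightarrow>
        collatz_reaches m' A' C' z' (M' * (nprime 0 ^ a * nprime 1 ^ b) + l')"
      using collatz_of_recf by metis
    define ds where "ds = [m', M', l', z'] @ concat (map (\<lambda>i. [A' i, C' i]) [0..<m'])"
    define b where "b = Suc (Max (set ds))"
    have "\<forall>d\<in>set ds. d < b" by (auto simp: b_def less_Suc_eq_le)
    then obtain p where p: "\<forall>i<length ds. digit p b i = ds ! i" using digits_exist by blast
    have len: "length ds = 4 + 2 * m'"
      by (simp add: ds_def length_concat o_def sum_list_triv)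
    have nth: "concat (map (\<lambda>i. [A' i, C' i]) [0..<m']) ! (2 * i) = A' i \<and>
        concat (map (\<lambda>i. [A' i, C' i]) [0..<m']) ! (2 * i + 1) = C' i" if "i < m'" for i m'
      using that
    proof (induction m')
      case (Suc m)
      have "length (concat (map (\<lambda>i. [A' i, C' i]) [0..<m])) = 2 * m"
        by (simp add: length_concat o_def sum_list_triv)
      with Suc show ?case by (cases "i < m") (auto simp: nth_append less_Suc_eq)
    qed simp
    have AC: "digit p b (4 + 2 * i) = A' i" "digit p b (5 + 2 * i) = C' i" if "i < m'" for i
    proof -
      have "ds ! (4 + 2 * i) = A' i" "ds ! (4 + (2 * i + 1)) = C' i"
        using nth[OF that] by (simp_all add: ds_def nth_append)
      with that p len show "digit p b (4 + 2 * i) = A' i" "digit p b (5 + 2 * i) = C' i"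
        by (auto simp: add.assoc[symmetric] eval_nat_numeral)
    qed
    have small: "digit p b 0 = m'" "digit p b 1 = M'" "digit p b 2 = l'" "digit p b 3 = z'"
      using p len by (auto simp: ds_def eval_nat_numeral)
    have "m' > 0" using sys' by (simp add: collatz_system_def)
    then have "digit_step p b = collatz_step m' A' C'"
      by (auto simp: digit_step_def collatz_step_def small AC fun_eq_iff simp del: One_nat_def)
    then have "digit_halts p b \<longleftrightarrow> collatz_reaches m' A' C' z' (M' * (nprime 0 ^ p * nprime 1 ^ b) + l')"
      by (simp add: digit_halts_def collatz_reaches_def digit_start_def small del: One_nat_def)
    with f[of p b] reach'[of p b] show False by blast
  qed
  with sys show ?thesis by blast
qed

section \<open>Words and actions of free groups\<close>

definition inv_word :: "word \<Rightarrow> word" where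
  "inv_word w = rev (map inv_letter w)"

lemma inv_word_simps [simp]: "inv_word [] = []" "inv_word (a # w) = inv_word w @ [inv_letter a]"
  "inv_word (u @ v) = inv_word v @ inv_word u" "inv_word (inv_word w) = w" "length (inv_word w) = length w"
  by (simp_all add: inv_word_def rev_map o_def)

lemma words_append [simp]: "u @ v \<in> words n \<longleftrightarrow> u \<in> words n \<and> v \<in> words n"
  by (auto simp: words_def)

lemma words_Cons [simp]: "a # v \<in> words n \<longleftrightarrow> fst a < n \<and> v \<in> words n"
  by (cases a) (auto simp: words_def)

lemma words_Nil [simp]: "[] \<in> words n"
  by (simp add: words_def)

lemma fst_inv_letter [simp]: "fst (inv_letter a) = fst a"
  by (simp add: inv_letter_def)

lemma inv_letter_neq [simp]: "inv_letter a \<noteq> a" "a \<noteq> inv_letter a"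
  by (cases a; simp add: inv_letter_def)+

lemma inv_word_words [simp]: "inv_word w \<in> words n \<longleftrightarrow> w \<in> words n"
  by (induction w) auto

lemma words_concat: "concat ws \<in> words n \<longleftrightarrow> (\<forall>w\<in>set ws. w \<in> words n)"
  by (induction ws) auto

lemma carrier_free_group: "w \<in> carrier (free_group n) \<longleftrightarrow> w \<in> words n \<and> reduced w"
  by (simp add: free_group_def)

lemma mult_free_group [simp]: "u \<otimes>\<^bsub>free_group n\<^esub> v = reduce (u @ v)"
  by (simp add: free_group_def)

lemma one_free_group [simp]: "\<one>\<^bsub>free_group n\<^esub> = []"
  by (simp add: free_group_def)

lemma reduce_in_carrier [simp]: "w \<in> words n \<Longrightarrow> reduce w \<in> carrier (free_group n)"
  by (simp add: carrier_free_group reduced_reduce reduce_in_words)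

lemma reduce_reduce [simp]: "reduce (reduce w) = reduce w"
  by (simp add: reduce_reduced reduced_reduce)

lemma reduce_Nil [simp]: "reduce [] = []"
  by (simp add: reduce_def)

lemma reduced_inv_word: "reduced w \<Longrightarrow> reduced (inv_word w)"
proof -
  have "a = inv_letter b \<longleftrightarrow> b = inv_letter a" for a b :: "nat \<times> bool"
    by (metis inv_letter_inv_letter)
  then show "reduced w \<Longrightarrow> ?thesis"
    unfolding reduced_def inv_word_def by (auto simp: successively_rev successively_map elim!: successively_mono)
qed

lemma inv_free_group:
  assumes "w \<in> carrier (free_group n)"
  shows "inv\<^bsub>free_group n\<^esub> w = inv_word w"
proof -
  interpret group "free_group n" by (rule group_free_group)
  have "inv_word w \<in> carrier (free_group n)"
    using assms by (simp add: carrier_free_group reduced_inv_word)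
  moreover have "inv_word w \<otimes>\<^bsub>free_group n\<^esub> w = \<one>\<^bsub>free_group n\<^esub>"
    by (simp add: inv_word_def reduce_inv_word)
  ultimately show ?thesis using assms by (simp add: inv_equality)
qed

definition act_letter :: "(nat \<Rightarrow> 'y \<Rightarrow> 'y) \<Rightarrow> nat \<times> bool \<Rightarrow> 'y \<Rightarrow> 'y" where
  "act_letter g a = (if snd a then g (fst a) else inv_into UNIV (g (fst a)))"

fun act :: "(nat \<Rightarrow> 'y \<Rightarrow> 'y) \<Rightarrow> word \<Rightarrow> 'y \<Rightarrow> 'y" where
  "act g [] = id"
| "act g (a # w) = act_letter g a \<circ> act g w"

lemma act_append [simp]: "act g (u @ v) = act g u \<circ> act g v"
  by (induction u) (auto simp: o_assoc)

context
  fixes g :: "nat \<Rightarrow> 'y \<Rightarrow> 'y"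
  assumes bij: "\<And>i. bij (g i)"
begin

lemma act_letter_inverse [simp]: "act_letter g (inv_letter a) (act_letter g a y) = y"
    "act_letter g a (act_letter g (inv_letter a) y) = y"
  using bij[of "fst a"] by (auto simp: act_letter_def inv_letter_def bij_is_inj bij_is_surj surj_f_inv_f)

lemma act_cons_reduce: "act g (cons_reduce a w) y = act_letter g a (act g w y)"
  by (cases w) auto

lemma act_reduce [simp]: "act g (reduce w) y = act g w y"
  unfolding reduce_def by (induction w arbitrary: y) (auto simp: act_cons_reduce)

lemma act_inv_word [simp]: "act g (inv_word w) (act g w y) = y" "act g w (act g (inv_word w) y) = y"
  by (induction w arbitrary: y) auto

lemma act_inv_word_eq: "act g (inv_word w) = inv_into UNIV (act g w)"
  by (rule sym, rule inv_unique_comp) (auto simp: fun_eq_iff)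

lemma act_quotient_eq_id: "act g u = act g v \<Longrightarrow> act g (u @ inv_word v) = id"
  by (auto simp: fun_eq_iff)

lemma act_eq_if_quotient: "act g (u @ inv_word v) = id \<Longrightarrow> act g u = act g v"
  by (auto simp: fun_eq_iff) (metis act_inv_word(1))

end

section \<open>A permutation representation\<close>

definition xpow :: "nat \<Rightarrow> word" where
  "xpow n = replicate n (0, True)"

definition tword :: "nat \<Rightarrow> word" where
  "tword n = xpow n @ [(1, True)] @ inv_word (xpow n)"

definition comm_word :: "word \<Rightarrow> word \<Rightarrow> word" where
  "comm_word u v = (u @ v) @ inv_word (v @ u)"

definition kt_word :: "nat \<Rightarrow> word" where
  "kt_word n = comm_word [(2, True)] (tword n)"

definition bs_word :: word where
  "bs_word = comm_word [(3, True), (0, True), (3, False)] [(0, True)]"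

text \<open>The letters are \<open>x, t, k, b, r\<^sub>0, \<dots>, r\<^bsub>m-1\<^esub>\<close>. The last three families of relators make \<open>r\<^sub>i\<close>
  commute with \<open>k\<close> and conjugate \<open>x\<^sup>n t x\<^sup>-\<^sup>n\<close> for \<open>n = i + m j\<close> to the same word for the Collatz
  successor \<open>n = C i + A i j\<close>, so that \<open>k\<close> commutes with it if \<open>n\<close> reaches \<open>z\<close>. The relator
  \<open>b x\<^sup>2 b\<^sup>-\<^sup>1 x\<^sup>-\<^sup>3\<close> makes \<open>[b x b\<^sup>-\<^sup>1, x]\<close> trivial in every finite quotient.\<close>

definition relators :: "nat \<Rightarrow> (nat \<Rightarrow> nat) \<Rightarrow> (nat \<Rightarrow> nat) \<Rightarrow> nat \<Rightarrow> word list" where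
  "relators m A C z =
     [kt_word z, ((3, True) # xpow 2) @ inv_word (xpow 3 @ [(3, True)])] @
     concat (map (\<lambda>i. [comm_word [(2, True)] [(4 + i, True)],
        ((4 + i, True) # xpow m) @ inv_word (xpow (A i) @ [(4 + i, True)]),
        ((4 + i, True) # tword i) @ inv_word (tword (C i) @ [(4 + i, True)])]) [0..<m])"

text \<open>The permutation representation acts on rows of integer points \<open>\<alpha>\<close>; the row \<open>((a, s), n)\<close> attaches the
  number \<open>a + s \<alpha>\<close> to \<open>\<alpha>\<close>. Grouping a row into blocks of length \<open>M\<close> preserves this number and
  turns \<open>shift ^^ M\<close> into \<open>shift\<close>.\<close>

type_synonym point = "int \<times> (rat \<times> rat) \<times> nat"

definition shift :: "point \<Rightarrow> point" where
  "shift = (\<lambda>(\<alpha>, l). (\<alpha> + 1, l))"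

text \<open>The position inside a block is recorded as a new last digit, in base \<open>M\<close>,
  of the row index \<open>n\<close>; this makes the regrouping invertible.\<close>

definition fold_row :: "nat \<Rightarrow> point \<Rightarrow> point" where
  "fold_row M = (\<lambda>(\<alpha>, (a, s), n). (\<alpha> div int M, (a + s * of_int (\<alpha> mod int M), s * of_nat M),
     n * M + nat (\<alpha> mod int M)))"

definition unfold_row :: "nat \<Rightarrow> point \<Rightarrow> point" where
  "unfold_row M = (\<lambda>(j, (b, q), n). (int M * j + int (n mod M),
     (b - q / of_nat M * of_nat (n mod M), q / of_nat M), n div M))"

definition val :: "point \<Rightarrow> rat" where
  "val = (\<lambda>(\<alpha>, (a, s), n). a + s * of_int \<alpha>)"

definition swap_rows :: "(rat \<times> rat) \<times> nat \<Rightarrow> (rat \<times> rat) \<times> nat \<Rightarrow> point \<Rightarrow> point" where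
  "swap_rows l l' = map_prod id (transpose l l')"

lemma unfold_fold_row:
  assumes "M > 0"
  shows "unfold_row M (fold_row M p) = p"
proof -
  obtain \<alpha> a s n where p: "p = (\<alpha>, (a, s), n)" by (metis prod.collapse)
  define r where "r = nat (\<alpha> mod int M)"
  have r: "\<alpha> mod int M = int r" "r < M" using assms by (auto simp: r_def nat_less_iff)
  have "int M * (\<alpha> div int M) + int r = \<alpha>" by (metis r(1) mult_div_mod_eq)
  then show ?thesis using r assms by (simp add: p unfold_row_def fold_row_def)
qed

lemma fold_unfold_row: "M > 0 \<Longrightarrow> fold_row M (unfold_row M p) = p"
  by (cases p) (auto simp: unfold_row_def fold_row_def nat_mod_distrib simp flip: of_nat_mod zmod_int)

lemma bij_fold_row: "M > 0 \<Longrightarrow> bij (fold_row M)"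
  by (rule o_bij[of "unfold_row M"]) (auto simp: unfold_fold_row fold_unfold_row)

lemma bij_unfold_row: "M > 0 \<Longrightarrow> bij (unfold_row M)"
  by (rule o_bij[of "fold_row M"]) (auto simp: unfold_fold_row fold_unfold_row)

lemma bij_shift: "bij shift"
  by (rule o_bij[of "\<lambda>(\<alpha>, l). (\<alpha> - 1, l)"]) (auto simp: shift_def)

lemma bij_swap_rows: "bij (swap_rows l l')"
  by (rule o_bij[of "swap_rows l l'"]) (auto simp: swap_rows_def)

lemma shift_funpow: "(shift ^^ n) (\<alpha>, l) = (\<alpha> + int n, l)"
  by (induction n) (auto simp: shift_def)

lemma fold_row_shift: "M > 0 \<Longrightarrow> fold_row M ((shift ^^ M) p) = shift (fold_row M p)"
  by (cases p) (auto simp: shift_funpow fold_row_def, simp add: shift_def)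

lemma shift_unfold_row: "M > 0 \<Longrightarrow> (shift ^^ M) (unfold_row M p) = unfold_row M (shift p)"
  by (metis fold_row_shift fold_unfold_row unfold_fold_row)

lemma swap_rows_shift: "swap_rows l l' (shift p) = shift (swap_rows l l' p)"
  by (cases p) (auto simp: swap_rows_def shift_def)

lemma val_fold_row: "M > 0 \<Longrightarrow> val (fold_row M p) = val p"
proof -
  assume "M > 0"
  obtain \<alpha> a s n where p: "p = (\<alpha>, (a, s), n)" by (metis prod.collapse)
  have "(of_int \<alpha> :: rat) = of_nat M * of_int (\<alpha> div int M) + of_int (\<alpha> mod int M)"
    by (metis mult_div_mod_eq of_int_add of_int_mult of_int_of_nat_eq)
  then show ?thesis by (simp add: p val_def fold_row_def algebra_simps)
qed

lemma val_unfold_row: "M > 0 \<Longrightarrow> val (unfold_row M p) = val p"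
  by (metis val_fold_row fold_unfold_row)

text \<open>A lamp over each point, switched only over \<open>D\<close>. With the noncommuting
  transpositions of \<open>0, 1\<close> and of \<open>1, 2\<close>, two such maps commute iff their
  sets \<open>D\<close> are disjoint; this is how \<open>t\<close> and \<open>k\<close> detect
  membership of \<open>n\<close> in \<open>H\<close>.\<close>

definition lamp :: "point set \<Rightarrow> (nat \<Rightarrow> nat) \<Rightarrow> point \<times> nat \<Rightarrow> point \<times> nat" where
  "lamp D \<pi> = (\<lambda>(p, s). (p, if p \<in> D then \<pi> s else s))"

definition base_point :: "nat \<Rightarrow> point" where
  "base_point n = (int n, (0, 1), 0)"

locale collatz_permutations =
  fixes m :: nat and A C :: "nat \<Rightarrow> nat" and H :: "nat set" and z :: nat
  assumes m: "m > 0" and CA: "\<And>i. i < m \<Longrightarrow> C i < A i" and z: "z \<in> H"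
    and H: "\<And>i j. i < m \<Longrightarrow> i + m * j \<in> H \<longleftrightarrow> C i + A i * j \<in> H"
begin

definition Hpts :: "point set" where
  "Hpts = {p. \<exists>n\<in>H. val p = of_nat n}"

text \<open>Grouped by \<open>m\<close>, the points \<open>base_point (i + m * j)\<close> form one
  row; exchanging it with the row of the numbers \<open>C i + A i * j\<close> and ungrouping by
  \<open>A i\<close> turns them into \<open>base_point (C i + A i * j)\<close>. Exchanging two rows
  keeps the map bijective and compatible with \<open>shift\<close>.\<close>

definition row_perm :: "nat \<Rightarrow> point \<Rightarrow> point" where
  "row_perm i = unfold_row (A i) \<circ> swap_rows ((of_nat i, of_nat m), i) ((of_nat (C i), of_nat (A i)), C i) \<circ> fold_row m"

text \<open>For \<open>b\<close>, grouping by 2 turns \<open>shift ^^ 2\<close> into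
  \<open>shift\<close>, and ungrouping by 3 turns that into \<open>shift ^^ 3\<close>: the
  Baumslag-Solitar relation. The set \<open>Hpts\<close> of \<open>k\<close> is defined through
  \<open>val\<close>, which grouping preserves; \<open>t\<close> switches the lamp of a single
  point, and its conjugates by powers of \<open>x\<close> those of the other base points.\<close>

definition gen :: "nat \<Rightarrow> point \<times> nat \<Rightarrow> point \<times> nat" where
  "gen i = (if i = 0 then map_prod shift id
    else if i = 1 then lamp {base_point 0} (transpose 0 1)
    else if i = 2 then lamp (- Hpts) (transpose 1 2)
    else if i = 3 then map_prod (unfold_row 3 \<circ> fold_row 2) id
    else if i < 4 + m then map_prod (row_perm (i - 4)) id else id)"

lemma Hpts_fold_row: "M > 0 \<Longrightarrow> fold_row M p \<in> Hpts \<longleftrightarrow> p \<in> Hpts"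
  by (simp add: Hpts_def val_fold_row)

lemma Hpts_unfold_row: "M > 0 \<Longrightarrow> unfold_row M p \<in> Hpts \<longleftrightarrow> p \<in> Hpts"
  by (simp add: Hpts_def val_unfold_row)

lemma base_point_Hpts: "base_point n \<in> Hpts \<longleftrightarrow> n \<in> H"
  by (auto simp: base_point_def Hpts_def val_def)

lemma Hpts_row:
  assumes "i < M"
  shows "(j, (of_nat i, of_nat M), n) \<in> Hpts \<longleftrightarrow> j \<ge> 0 \<and> i + M * nat j \<in> H"
proof -
  have *: "val (j, (of_nat i, of_nat M), n) = of_int (int i + int M * j)"
    by (simp add: val_def)
  have "int i + int M * j \<ge> 0 \<longleftrightarrow> j \<ge> 0"
  proof
    assume "int i + int M * j \<ge> 0"
    show "j \<ge> 0"
    proof (rule ccontr)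
      assume "\<not> j \<ge> 0"
      then have "int M * j \<le> int M * (- 1)" by (intro mult_left_mono) auto
      then show False using assms \<open>int i + int M * j \<ge> 0\<close> by simp
    qed
  qed simp
  moreover have "int i + int M * j = int (i + M * nat j)" if "j \<ge> 0" using that by simp
  ultimately show ?thesis
    unfolding Hpts_def mem_Collect_eq *
    by (metis of_int_eq_iff of_int_of_nat_eq of_nat_0_le_iff of_nat_eq_iff)
qed

text \<open>This is what makes \<open>r\<^sub>i\<close> commute with \<open>k\<close>: grouping
  preserves \<open>val\<close>, and the exchanged rows carry \<open>i + m * j\<close> and
  \<open>C i + A i * j\<close>, which lie in \<open>H\<close> simultaneously.\<close>

lemma Hpts_row_perm:
  assumes "i < m"
  shows "row_perm i p \<in> Hpts \<longleftrightarrow> p \<in> Hpts"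
proof -
  have A: "A i > 0" using CA[OF assms] by simp
  have "swap_rows ((of_nat i, of_nat m), i) ((of_nat (C i), of_nat (A i)), C i) q \<in> Hpts \<longleftrightarrow> q \<in> Hpts" for q
  proof -
    obtain j l where q: "q = (j, l)" by (cases q)
    have "(j, (of_nat i, of_nat m), i) \<in> Hpts \<longleftrightarrow> (j, (of_nat (C i), of_nat (A i)), C i) \<in> Hpts"
      by (simp add: Hpts_row assms CA H)
    then show ?thesis unfolding q swap_rows_def by (auto simp: transpose_def)
  qed
  with A m show ?thesis by (simp add: row_perm_def Hpts_fold_row Hpts_unfold_row)
qed

lemma bij_row_perm: "i < m \<Longrightarrow> bij (row_perm i)"
  unfolding row_perm_def using m CA[of i]
  by (intro bij_comp bij_fold_row bij_unfold_row bij_swap_rows) auto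

lemma row_perm_shift:
  assumes "i < m"
  shows "row_perm i ((shift ^^ m) p) = (shift ^^ A i) (row_perm i p)"
proof -
  have A: "A i > 0" using CA[OF assms] by simp
  with m show ?thesis by (simp add: row_perm_def fold_row_shift swap_rows_shift shift_unfold_row)
qed

lemma row_perm_base_point:
  assumes "i < m"
  shows "row_perm i (base_point i) = base_point (C i)"
  using assms CA[OF assms]
  by (simp add: row_perm_def base_point_def fold_row_def unfold_row_def swap_rows_def)

lemma bij_lamp: "bij \<pi> \<Longrightarrow> bij (lamp D \<pi>)"
  by (rule o_bij[of "lamp D (inv_into UNIV \<pi>)"])
    (auto simp: lamp_def fun_eq_iff bij_is_inj bij_is_surj surj_f_inv_f)

lemma bij_map_prod_id: "bij f \<Longrightarrow> bij (map_prod f id)"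
  by (rule o_bij[of "map_prod (inv_into UNIV f) id"])
    (auto simp: fun_eq_iff bij_is_inj bij_is_surj surj_f_inv_f)

lemma bij_gen: "bij (gen i)"
  by (auto simp: gen_def intro!: bij_lamp bij_map_prod_id bij_shift bij_comp bij_fold_row
      bij_unfold_row bij_row_perm)

lemma act_inv_word_conj:
  assumes "\<And>p s. act gen w (p, s) = (f p, s)" "bij f"
  shows "act gen (inv_word w) (p, s) = (inv_into UNIV f p, s)"
proof -
  have "act gen w (inv_into UNIV f p, s) = (p, s)" using assms by (simp add: bij_is_surj surj_f_inv_f)
  then show ?thesis by (metis act_inv_word(1) bij_gen)
qed

lemma act_xpow: "act gen (xpow n) (p, s) = ((shift ^^ n) p, s)"
  unfolding xpow_def by (induction n arbitrary: p) (auto simp: act_letter_def gen_def)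

lemma bij_shift_funpow: "bij (shift ^^ n)"
  by (simp add: bij_shift)

lemma act_tword: "act gen (tword n) = lamp {base_point n} (transpose 0 1)"
proof
  fix x :: "point \<times> nat"
  obtain p s where x: "x = (p, s)" by (cases x)
  have "inv_into UNIV (shift ^^ n) p = base_point 0 \<longleftrightarrow> p = base_point n"
  proof -
    have "(shift ^^ n) (base_point 0) = base_point n" by (simp add: base_point_def shift_funpow)
    then show ?thesis using bij_shift_funpow[of n] by (metis bij_inv_eq_iff)
  qed
  moreover have "(shift ^^ n) (inv_into UNIV (shift ^^ n) p) = p"
    using bij_shift_funpow[of n] by (simp add: bij_is_surj surj_f_inv_f)
  ultimately show "act gen (tword n) x = lamp {base_point n} (transpose 0 1) x"
    unfolding x tword_def
    by (simp add: act_inv_word_conj[OF act_xpow bij_shift_funpow])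
      (simp add: act_letter_def gen_def lamp_def act_xpow)
qed

lemma act_comm_eq_id: "act gen (comm_word u v) = id \<longleftrightarrow> (\<forall>x. act gen u (act gen v x) = act gen v (act gen u x))"
proof -
  have "act gen (comm_word u v) = id \<longleftrightarrow> act gen (u @ v) = act gen (v @ u)"
    unfolding comm_word_def by (metis act_quotient_eq_id act_eq_if_quotient bij_gen)
  then show ?thesis by (simp add: fun_eq_iff)
qed

lemma act_kt_word: "act gen (kt_word n) = id \<longleftrightarrow> n \<in> H"
proof -
  have k: "act gen [(2, True)] = lamp (- Hpts) (transpose 1 2)" by (simp add: act_letter_def gen_def)
  show ?thesis
  proof
    assume "act gen (kt_word n) = id"
    then have "lamp (- Hpts) (transpose 1 2) (lamp {base_point n} (transpose 0 1) (base_point n, 0)) =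
        lamp {base_point n} (transpose 0 1) (lamp (- Hpts) (transpose 1 2) (base_point n, 0))"
      unfolding kt_word_def act_comm_eq_id k act_tword by blast
    then show "n \<in> H" by (auto simp: lamp_def base_point_Hpts transpose_def split: if_splits)
  next
    assume "n \<in> H"
    then show "act gen (kt_word n) = id"
      unfolding kt_word_def act_comm_eq_id k act_tword by (auto simp: lamp_def base_point_Hpts)
  qed
qed

lemma act_bs_word: "act gen bs_word \<noteq> id"
proof
  let ?b = "unfold_row 3 \<circ> fold_row 2"
  assume "act gen bs_word = id"
  then have *: "act gen [(3, True), (0, True), (3, False)] (act gen [(0, True)] x) =
      act gen [(0, True)] (act gen [(3, True), (0, True), (3, False)] x)" for x
    unfolding bs_word_def act_comm_eq_id by blast
  have b: "act_letter gen (3, True) (p, s) = (?b p, s)" for p s by (simp add: act_letter_def gen_def)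
  have b': "act_letter gen (3, False) (?b p, s) = (p, s)" for p s
    using act_letter_inverse(1)[of gen, OF bij_gen, where a = "(3, True)" and y = "(p, s)"]
    unfolding b by (simp add: inv_letter_def)
  have a: "act_letter gen (0, True) (p, s) = (shift p, s)" for p s by (simp add: act_letter_def gen_def)
  have conj: "act gen [(3, True), (0, True), (3, False)] (?b p, s) = (?b (shift p), s)" for p s
    unfolding act.simps comp_apply id_apply using b'[of p s, unfolded comp_apply] a b by simp
  \<comment> \<open>The points satisfy \<open>x b q = b q'\<close>. Yet \<open>b x q'\<close> and
    \<open>x b x q\<close> end in different rows, with labels \<open>(- 1, 2)\<close> and
    \<open>(1, 2)\<close>, so \<open>b x b\<^sup>-\<^sup>1\<close> and \<open>x\<close> do not
    commute at \<open>b q\<close>.\<close>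
  let ?q = "(0, (0, 3), 0) :: point" and ?q' = "(1, (- 1, 3), 0) :: point"
  have q': "shift (?b ?q) = ?b ?q'" by (simp add: shift_def fold_row_def unfold_row_def)
  have a': "act gen [(0, True)] (p, s) = (shift p, s)" for p s using a by simp
  have "(?b (shift ?q'), 0 :: nat) = (shift (?b (shift ?q)), 0)"
    using *[of "(?b ?q, 0)"] unfolding a' q' conj .
  then show False by (simp add: shift_def fold_row_def unfold_row_def)
qed

lemma act_relators:
  assumes "w \<in> set (relators m A C z)"
  shows "act gen w = id"
proof -
  have quot: "act gen (u @ inv_word v) = id" if "\<And>p s. act gen u (p, s) = act gen v (p, s)" for u v
    using that by (intro act_quotient_eq_id bij_gen) auto
  have b: "act_letter gen (3, True) (p, s) = (unfold_row 3 (fold_row 2 p), s)" for p s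
    by (simp add: act_letter_def gen_def)
  have r: "act_letter gen (4 + i, True) (p, s) = (row_perm i p, s)" if "i < m" for i p s
    using that by (simp add: act_letter_def gen_def)
  consider "w = kt_word z" | "w = ((3, True) # xpow 2) @ inv_word (xpow 3 @ [(3, True)])"
    | i where "i < m" "w = comm_word [(2, True)] [(4 + i, True)]"
    | i where "i < m" "w = ((4 + i, True) # xpow m) @ inv_word (xpow (A i) @ [(4 + i, True)])"
    | i where "i < m" "w = ((4 + i, True) # tword i) @ inv_word (tword (C i) @ [(4 + i, True)])"
    using assms unfolding relators_def by auto
  then show ?thesis
  proof cases
    case 1
    then show ?thesis using z act_kt_word by simp
  next
    case 2
    show ?thesis unfolding 2
      by (rule quot) (simp add: act_xpow b fold_row_shift shift_unfold_row)
  next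
    case 3
    have k: "act gen [(2, True)] = lamp (- Hpts) (transpose 1 2)" by (simp add: act_letter_def gen_def)
    show ?thesis unfolding 3 act_comm_eq_id k
      using 3 by (auto simp: r lamp_def Hpts_row_perm)
  next
    case 4
    show ?thesis unfolding 4(2) by (rule quot) (simp add: act_xpow r 4(1) row_perm_shift)
  next
    case 5
    have "row_perm i p = base_point (C i) \<longleftrightarrow> p = base_point i" for p
      using bij_row_perm[OF 5(1)] row_perm_base_point[OF 5(1)] by (metis bij_pointE)
    then show ?thesis unfolding 5(2) by (intro quot) (simp add: act_tword r 5(1) lamp_def)
  qed
qed

end

lemma collatz_representation:
  assumes "collatz_system m A C z"
  shows "\<exists>g :: nat \<Rightarrow> point \<times> nat \<Rightarrow> point \<times> nat. (\<forall>i. bij (g i)) \<and>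
    (\<forall>w\<in>set (relators m A C z). act g w = id) \<and> act g bs_word \<noteq> id \<and>
    (\<forall>n. act g (kt_word n) = id \<longrightarrow> collatz_reaches m A C z n)"
proof -
  have sys: "m > 0" "\<And>i. i < m \<Longrightarrow> C i < A i" "collatz_step m A C z = z"
    using assms by (auto simp: collatz_system_def)
  interpret collatz_permutations m A C "{n. collatz_reaches m A C z n}" z
  proof
    show "z \<in> {n. collatz_reaches m A C z n}" by (auto simp: collatz_reaches_def intro: exI[of _ 0])
    fix i j assume i: "i < m"
    have "collatz_step m A C (i + m * j) = C i + A i * j"
      using i by (simp add: collatz_step_def)
    moreover have "collatz_reaches m A C z (collatz_step m A C n) \<longleftrightarrow> collatz_reaches m A C z n" for n
    proof
      assume "collatz_reaches m A C z (collatz_step m A C n)"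
      then obtain j where "(collatz_step m A C ^^ Suc j) n = z"
        by (auto simp: collatz_reaches_def funpow_Suc_right simp del: funpow.simps)
      then show "collatz_reaches m A C z n" unfolding collatz_reaches_def by blast
    next
      assume "collatz_reaches m A C z n"
      then obtain j where j: "(collatz_step m A C ^^ j) n = z" by (auto simp: collatz_reaches_def)
      then have "(collatz_step m A C ^^ j) (collatz_step m A C n) = z"
        using sys(3) by (metis funpow_swap1)
      then show "collatz_reaches m A C z (collatz_step m A C n)" by (auto simp: collatz_reaches_def)
    qed
    ultimately show "i + m * j \<in> {n. collatz_reaches m A C z n} \<longleftrightarrow> C i + A i * j \<in> {n. collatz_reaches m A C z n}"
      by (metis mem_Collect_eq)
  qed (use sys in auto)
  show ?thesis
    by (rule exI[of _ gen]) (use bij_gen act_relators act_bs_word act_kt_word in auto)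
qed

section \<open>Evaluation of words in groups\<close>

context group
begin

definition eval_letter :: "'a list \<Rightarrow> nat \<times> bool \<Rightarrow> 'a" where
  "eval_letter zs a = (if snd a then zs ! fst a else inv (zs ! fst a))"

lemma eval_word_Cons: "eval_word G zs (a # w) = eval_letter zs a \<otimes> eval_word G zs w"
  by (cases a) (simp add: eval_letter_def)

lemma eval_letter_closed [simp]: "set zs \<subseteq> carrier G \<Longrightarrow> fst a < length zs \<Longrightarrow> eval_letter zs a \<in> carrier G"
  by (auto simp: eval_letter_def dest: nth_mem)

lemma eval_letter_inv: "set zs \<subseteq> carrier G \<Longrightarrow> fst a < length zs \<Longrightarrow> eval_letter zs (inv_letter a) = inv (eval_letter zs a)"
  by (auto simp: eval_letter_def inv_letter_def dest: nth_mem)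

context
  fixes zs :: "'a list"
  assumes zs: "set zs \<subseteq> carrier G"
begin

lemma eval_word_closed [simp]: "w \<in> words (length zs) \<Longrightarrow> eval_word G zs w \<in> carrier G"
  by (induction w) (auto simp: eval_word_Cons zs simp del: eval_word.simps(2))

lemma eval_word_append [simp]:
  "u \<in> words (length zs) \<Longrightarrow> v \<in> words (length zs) \<Longrightarrow> eval_word G zs (u @ v) = eval_word G zs u \<otimes> eval_word G zs v"
  by (induction u) (auto simp: eval_word_Cons zs m_assoc simp del: eval_word.simps(2))

lemma eval_word_inv [simp]: "w \<in> words (length zs) \<Longrightarrow> eval_word G zs (inv_word w) = inv (eval_word G zs w)"
proof (induction w)
  case (Cons a w)
  then show ?case
    by (auto simp: eval_word_Cons zs eval_letter_inv inv_mult_group simp del: eval_word.simps(2))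
qed simp

lemma eval_word_cons_reduce:
  "fst a < length zs \<Longrightarrow> w \<in> words (length zs) \<Longrightarrow>
    eval_word G zs (cons_reduce a w) = eval_letter zs a \<otimes> eval_word G zs w"
  by (cases w) (auto simp: eval_word_Cons zs eval_letter_inv inv_solve_left' m_assoc[symmetric]
      simp del: eval_word.simps(2))

lemma eval_word_reduce [simp]: "w \<in> words (length zs) \<Longrightarrow> eval_word G zs (reduce w) = eval_word G zs w"
proof (induction w)
  case (Cons a w)
  then have "eval_word G zs (cons_reduce a (reduce w)) = eval_letter zs a \<otimes> eval_word G zs (reduce w)"
    by (intro eval_word_cons_reduce) (auto intro: reduce_in_words)
  with Cons show ?case by (simp add: reduce_def eval_word_Cons del: eval_word.simps(2))
qed simp

lemma eval_word_replicate: "i < length zs \<Longrightarrow> eval_word G zs (replicate n (i, True)) = zs ! i [^] n"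
proof (induction n)
  case (Suc n)
  moreover have "zs ! i \<in> carrier G" using Suc.prems zs by (auto dest: nth_mem)
  ultimately show ?case using nat_pow_Suc2[of "zs ! i" n] by simp
qed simp

lemma eval_word_concat_replicate:
  "w \<in> words (length zs) \<Longrightarrow> eval_word G zs (concat (replicate n w)) = eval_word G zs w [^] n"
proof (induction n)
  case (Suc n)
  moreover have "eval_word G zs w \<in> carrier G" using Suc.prems by simp
  ultimately show ?case using nat_pow_Suc2[of "eval_word G zs w" n] by (simp add: words_concat)
qed simp

lemma eval_word_hom: "(\<lambda>w. eval_word G zs w) \<in> hom (free_group (length zs)) G"
  by (rule homI) (auto simp: carrier_free_group)

lemma generate_eq_eval_word: "generate G (set zs) = eval_word G zs ` words (length zs)"
proof
  show "generate G (set zs) \<subseteq> eval_word G zs ` words (length zs)"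
  proof
    fix x assume "x \<in> generate G (set zs)"
    then show "x \<in> eval_word G zs ` words (length zs)"
    proof induction
      case one
      show ?case by (rule image_eqI[of _ _ "[]"]) auto
    next
      case (incl h)
      then obtain i where "i < length zs" "zs ! i = h" by (auto simp: in_set_conv_nth)
      with zs nth_mem[of i zs] show ?case by (intro image_eqI[of _ _ "[(i, True)]"]) auto
    next
      case (inv h)
      then obtain i where "i < length zs" "zs ! i = h" by (auto simp: in_set_conv_nth)
      with zs nth_mem[of i zs] show ?case by (intro image_eqI[of _ _ "[(i, False)]"]) auto
    next
      case (eng h1 h2)
      then obtain u v where "u \<in> words (length zs)" "v \<in> words (length zs)"
        "h1 = eval_word G zs u" "h2 = eval_word G zs v" by blast
      then show ?case by (intro image_eqI[of _ _ "u @ v"]) auto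
    qed
  qed
  show "eval_word G zs ` words (length zs) \<subseteq> generate G (set zs)"
  proof
    fix x assume "x \<in> eval_word G zs ` words (length zs)"
    then obtain w where "w \<in> words (length zs)" "x = eval_word G zs w" by blast
    then show "x \<in> generate G (set zs)"
      by (induction w arbitrary: x)
        (auto simp: eval_word_Cons eval_letter_def simp del: eval_word.simps(2)
          intro!: generate.eng intro: generate.incl generate.inv generate.one nth_mem)
  qed
qed

end

definition conj_pow :: "'a \<Rightarrow> 'a \<Rightarrow> nat \<Rightarrow> 'a" where
  "conj_pow x t n = x [^] n \<otimes> t \<otimes> inv (x [^] n)"

lemma conj_pow_closed [simp]: "x \<in> carrier G \<Longrightarrow> t \<in> carrier G \<Longrightarrow> conj_pow x t n \<in> carrier G"
  by (simp add: conj_pow_def)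

lemma pow_intertwine:
  assumes "r \<in> carrier G" "x \<in> carrier G" "y \<in> carrier G" "r \<otimes> x = y \<otimes> r"
  shows "r \<otimes> x [^] (n::nat) = y [^] n \<otimes> r"
proof (induction n)
  case (Suc n)
  have "r \<otimes> x [^] Suc n = (r \<otimes> x [^] n) \<otimes> x" using assms by (simp add: m_assoc)
  also have "\<dots> = y [^] n \<otimes> (r \<otimes> x)" using Suc assms by (simp add: m_assoc)
  also have "\<dots> = y [^] Suc n \<otimes> r" using assms by (simp add: m_assoc)
  finally show ?case .
qed (use assms in simp)

text \<open>The element splits as
  \<open>X\<^sup>j (x\<^sup>i t x\<^sup>-\<^sup>i) X\<^sup>-\<^sup>j\<close> with
  \<open>X = x\<^sup>m\<close>, and conjugation by \<open>r\<close> is known on \<open>X\<close> and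
  on the middle factor. This performs one Collatz step on the exponent.\<close>

lemma conj_pow_intertwine:
  assumes "x \<in> carrier G" "t \<in> carrier G" "r \<in> carrier G"
    and x: "r \<otimes> x [^] m = x [^] a \<otimes> r" and t: "r \<otimes> conj_pow x t i = conj_pow x t c \<otimes> r"
  shows "r \<otimes> conj_pow x t (i + m * j) = conj_pow x t (c + a * j) \<otimes> r"
proof -
  have xx: "r \<otimes> (x [^] m) [^] j = (x [^] a) [^] j \<otimes> r"
    by (rule pow_intertwine) (use assms in auto)
  have split: "conj_pow x t (i + m * j) = (x [^] m) [^] j \<otimes> conj_pow x t i \<otimes> inv ((x [^] m) [^] j)" for i m
  proof -
    have "x [^] (i + m * j) = (x [^] m) [^] j \<otimes> x [^] i"
      using assms by (simp add: nat_pow_pow nat_pow_mult add.commute)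
    then show ?thesis using assms by (simp add: conj_pow_def inv_mult_group m_assoc)
  qed
  let ?X = "(x [^] m) [^] j" and ?Y = "(x [^] a) [^] j"
  have inv: "r \<otimes> inv ?X = inv ?Y \<otimes> r"
  proof -
    have "?Y \<otimes> (r \<otimes> inv ?X) = r" 
    proof -
      have "?Y \<otimes> (r \<otimes> inv ?X) = (?Y \<otimes> r) \<otimes> inv ?X" using assms(1-3) by (simp add: m_assoc)
      also have "\<dots> = r \<otimes> ?X \<otimes> inv ?X" by (simp only: xx)
      also have "\<dots> = r" using assms(1-3) by (simp add: m_assoc)
      finally show ?thesis .
    qed
    then show ?thesis using assms by (metis inv_solve_left m_closed nat_pow_closed inv_closed)
  qed
  have "r \<otimes> conj_pow x t (i + m * j) = (r \<otimes> ?X) \<otimes> conj_pow x t i \<otimes> inv ?X"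
    using assms by (simp add: split m_assoc)
  also have "\<dots> = ?Y \<otimes> (r \<otimes> conj_pow x t i) \<otimes> inv ?X" using assms by (simp add: xx m_assoc)
  also have "\<dots> = ?Y \<otimes> conj_pow x t c \<otimes> (r \<otimes> inv ?X)" using assms(1-3) by (simp add: t m_assoc)
  also have "\<dots> = conj_pow x t (c + a * j) \<otimes> r" using assms(1-3) by (simp add: inv split m_assoc)
  finally show ?thesis .
qed

lemma conj_commute_iff:
  assumes "k \<in> carrier G" "r \<in> carrier G" "u \<in> carrier G" "v \<in> carrier G"
    and "r \<otimes> u = v \<otimes> r" "k \<otimes> r = r \<otimes> k"
  shows "k \<otimes> u = u \<otimes> k \<longleftrightarrow> k \<otimes> v = v \<otimes> k"
proof -
  have "k \<otimes> u = u \<otimes> k \<longleftrightarrow> r \<otimes> (k \<otimes> u) = r \<otimes> (u \<otimes> k)" using assms by simp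
  also have "r \<otimes> (k \<otimes> u) = (k \<otimes> v) \<otimes> r"
    using assms by (metis m_assoc)
  also have "r \<otimes> (u \<otimes> k) = (v \<otimes> k) \<otimes> r"
    using assms by (metis m_assoc)
  also have "(k \<otimes> v) \<otimes> r = (v \<otimes> k) \<otimes> r \<longleftrightarrow> k \<otimes> v = v \<otimes> k" using assms by simp
  finally show ?thesis .
qed

text \<open>The finite order of \<open>x\<close> is odd: if it were \<open>2 * h\<close>, the
  relation raised to the power \<open>h\<close> would give \<open>x\<^sup>3\<^sup>h = 1\<close>, but
  \<open>2 * h\<close> does not divide \<open>3 * h\<close>. Hence \<open>x\<close> is a power of
  \<open>x\<^sup>2\<close>, and its conjugate by \<open>b\<close> is a power of
  \<open>x\<^sup>3\<close>.\<close>

lemma baumslag_solitar_commute: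
  assumes x: "x \<in> carrier G" and b: "b \<in> carrier G"
    and rel: "b \<otimes> x [^] (2::nat) = x [^] (3::nat) \<otimes> b" and e: "x [^] (e::nat) = \<one>" "e > 0"
  shows "(b \<otimes> x \<otimes> inv b) \<otimes> x = x \<otimes> (b \<otimes> x \<otimes> inv b)"
proof -
  have ord: "ord x > 0" using e x ord_eq_0 by auto
  have "odd (ord x)"
  proof
    assume "even (ord x)"
    then obtain h where h: "ord x = 2 * h" by blast
    have "b \<otimes> (x [^] (2::nat)) [^] h = (x [^] (3::nat)) [^] h \<otimes> b"
      by (rule pow_intertwine) (use x b rel in auto)
    then have "b \<otimes> x [^] ord x = x [^] (3 * h) \<otimes> b" using x by (simp add: nat_pow_pow h)
    then have "x [^] (3 * h) = \<one>" using x b by simp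
    then have "ord x dvd 3 * h" using x by (simp add: pow_eq_id)
    then obtain q where "3 * h = 2 * h * q" by (auto simp: h dvd_def)
    then have "3 = 2 * q" using ord h by simp
    then show False by presburger
  qed
  then obtain h where h: "ord x = 2 * h + 1" by (elim oddE)
  have x': "x = (x [^] (2::nat)) [^] (h + 1)"
  proof -
    have "2 * (h + 1) = ord x + 1" using h by simp
    then have "(x [^] (2::nat)) [^] (h + 1) = x [^] (ord x + 1)" using x by (simp only: nat_pow_pow)
    also have "\<dots> = x" using x by (simp add: nat_pow_mult[symmetric])
    finally show ?thesis by simp
  qed
  have "b \<otimes> (x [^] (2::nat)) [^] (h + 1) = (x [^] (3::nat)) [^] (h + 1) \<otimes> b"
    by (rule pow_intertwine) (use x b rel in auto)
  then have "b \<otimes> x \<otimes> inv b = x [^] (3 * (h + 1))"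
    using x b unfolding x'[symmetric] by (simp only: nat_pow_pow) (simp add: m_assoc del: nat_pow_Suc)
  then show ?thesis using x by (metis nat_pow_Suc nat_pow_Suc2)
qed

end

section \<open>A free group of matrices\<close>

text \<open>Integer 2x2 matrices, row by row, also serve as the module \<open>\<int>\<^sup>4\<close>.\<close>

type_synonym mat = "int \<times> int \<times> int \<times> int"

fun mm :: "mat \<Rightarrow> mat \<Rightarrow> mat" where
  "mm (a, b, c, d) (e, f, g, h) = (a * e + b * g, a * f + b * h, c * e + d * g, c * f + d * h)"

fun adj :: "mat \<Rightarrow> mat" where
  "adj (a, b, c, d) = (d, - b, - c, a)"

fun det :: "mat \<Rightarrow> int" where
  "det (a, b, c, d) = a * d - b * c"

definition I2 :: mat where
  "I2 = (1, 0, 0, 1)"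

lemma mm_assoc: "mm (mm P Q) W = mm P (mm Q W)"
  by (cases P; cases Q; cases W) (simp add: algebra_simps)

lemma mm_I2 [simp]: "mm I2 P = P" "mm P I2 = P"
  by (cases P; simp add: I2_def)+

lemma mm_adj: "det P = 1 \<Longrightarrow> mm P (adj P) = I2" "det P = 1 \<Longrightarrow> mm (adj P) P = I2"
  by (cases P; simp add: I2_def algebra_simps)+

lemma adj_mm: "adj (mm P Q) = mm (adj Q) (adj P)"
  by (cases P; cases Q) (simp add: algebra_simps)

lemma adj_adj [simp]: "adj (adj P) = P"
  by (cases P) simp

lemma adj_I2 [simp]: "adj I2 = I2"
  by (simp add: I2_def)

lemma det_mm [simp]: "det (mm P Q) = det P * det Q"
  by (cases P; cases Q) (simp add: algebra_simps)

lemma det_I2 [simp]: "det I2 = 1"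
  by (simp add: I2_def)

lemma mm_add: "mm P (Q + W) = mm P Q + mm P W" "mm (Q + W) P = mm Q P + mm W P"
  by (cases P; cases Q; cases W; simp add: algebra_simps)+

lemma mm_diff: "mm P (Q - W) = mm P Q - mm P W" "mm (Q - W) P = mm Q P - mm W P"
  by (cases P; cases Q; cases W; simp add: algebra_simps)+

text \<open>In the coordinates \<open>s = p - i * q\<close> and \<open>q\<close> this is the shear
  subtracting \<open>5 * s\<close> from \<open>q\<close>. The factor 5 is the least integer for
  which \<open>q * s \<le> 2 * s\<^sup>2\<close> always leads to
  \<open>q * s < - 2 * s\<^sup>2\<close>, the strict inequality of the ping-pong table.\<close>

definition rho :: "nat \<Rightarrow> mat" where
  "rho i = (1 - 5 * int i, 5 * int i ^ 2, - 5, 1 + 5 * int i)"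

definition mat_letter :: "nat \<times> bool \<Rightarrow> mat" where
  "mat_letter a = (if snd a then rho (fst a) else adj (rho (fst a)))"

fun mat_word :: "word \<Rightarrow> mat" where
  "mat_word [] = I2"
| "mat_word (a # w) = mm (mat_letter a) (mat_word w)"

lemma det_mat_letter [simp]: "det (mat_letter a) = 1"
  by (simp add: mat_letter_def rho_def power2_eq_square algebra_simps)

lemma mat_letter_inv: "mat_letter (inv_letter a) = adj (mat_letter a)"
  using adj_adj by (simp add: mat_letter_def inv_letter_def)

lemma det_mat_word [simp]: "det (mat_word w) = 1"
  by (induction w) auto

lemma mat_word_append: "mat_word (u @ v) = mm (mat_word u) (mat_word v)"
  by (induction u) (auto simp: mm_assoc)

lemma mat_word_inv: "mat_word (inv_word w) = adj (mat_word w)"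
  by (induction w) (auto simp: mat_word_append adj_mm mat_letter_inv)

lemma mm_cancel: "det P = 1 \<Longrightarrow> mm (adj P) (mm P Q) = Q" "det P = 1 \<Longrightarrow> mm P (mm (adj P) Q) = Q"
  by (simp_all add: mm_adj flip: mm_assoc)

lemma mat_word_cons_reduce: "mat_word (cons_reduce a w) = mm (mat_letter a) (mat_word w)"
  by (cases w) (auto simp: mat_letter_inv mm_cancel)

lemma mat_word_reduce [simp]: "mat_word (reduce w) = mat_word w"
  unfolding reduce_def by (induction w) (auto simp: mat_word_cons_reduce)

fun mat_app :: "mat \<Rightarrow> int \<times> int \<Rightarrow> int \<times> int" where
  "mat_app (a, b, c, d) (p, q) = (a * p + b * q, c * p + d * q)"

lemma mat_app_mm: "mat_app (mm P Q) v = mat_app P (mat_app Q v)"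
  by (cases P; cases Q; cases v) (simp add: algebra_simps)

text \<open>Ping-pong: \<open>rho i\<close> is the parabolic map fixing the point \<open>i\<close> of the projective line; the table
  consists of the two halves of the disc of radius \<open>1/2\<close> around \<open>i\<close>.\<close>

fun pong :: "nat \<times> bool \<Rightarrow> int \<times> int \<Rightarrow> bool" where
  "pong (i, e) (p, q) \<longleftrightarrow> (let s = p - int i * q in s \<noteq> 0 \<and>
     (if e then q * s < - 2 * (s * s) else q * s > 2 * (s * s)))"

lemma pong_step:
  assumes "p - int i * q \<noteq> 0" "\<not> pong (inv_letter (i, e)) (p, q)"
  shows "pong (i, e) (mat_app (mat_letter (i, e)) (p, q))"
proof -
  define s where "s = p - int i * q"
  have s: "s \<noteq> 0" using assms(1) by (simp add: s_def)
  then have "s * s > 0" by (auto simp: zero_less_mult_iff)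
  show ?thesis
  proof (cases e)
    case True
    have "mat_app (mat_letter (i, e)) (p, q) = (s + int i * (q - 5 * s), q - 5 * s)"
      using True by (simp add: mat_letter_def rho_def s_def algebra_simps power2_eq_square)
    moreover have "q * s \<le> 2 * (s * s)"
      using assms True by (simp add: inv_letter_def Let_def flip: s_def)
    ultimately show ?thesis
      using True s \<open>s * s > 0\<close> by (simp add: s_def[symmetric] Let_def algebra_simps)
  next
    case False
    have "mat_app (mat_letter (i, e)) (p, q) = (s + int i * (q + 5 * s), q + 5 * s)"
      using False by (simp add: mat_letter_def rho_def s_def algebra_simps power2_eq_square)
    moreover have "q * s \<ge> - 2 * (s * s)"
      using assms False by (simp add: inv_letter_def Let_def flip: s_def)
    ultimately show ?thesis
      using False s \<open>s * s > 0\<close> by (simp add: s_def[symmetric] Let_def algebra_simps)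
  qed
qed

lemma pong_abs:
  assumes "pong (i, e) (p, q)"
  shows "2 * \<bar>p - int i * q\<bar> < \<bar>q\<bar>"
proof -
  define s where "s = p - int i * q"
  have s: "s \<noteq> 0" "2 * (s * s) < \<bar>q * s\<bar>"
    using assms by (auto simp: Let_def s_def split: if_splits)
  moreover have "(2 * \<bar>s\<bar>) * \<bar>s\<bar> = 2 * (s * s)" by simp
  ultimately have "(2 * \<bar>s\<bar>) * \<bar>s\<bar> < \<bar>q\<bar> * \<bar>s\<bar>" by (simp only: abs_mult)
  then have "2 * \<bar>s\<bar> < \<bar>q\<bar>" by (meson abs_ge_zero mult_right_less_imp_less)
  then show ?thesis by (simp add: s_def)
qed

text \<open>Open discs of radius \<open>1/2\<close> around distinct integers are disjoint, and none
  contains the centre of another.\<close>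

lemma pong_disjoint:
  assumes "pong (j, e) (p, q)" "i \<noteq> j"
  shows "p - int i * q \<noteq> 0" "\<not> pong (i, e') (p, q)"
proof -
  have "2 * \<bar>p - int j * q\<bar> < \<bar>q\<bar>" using pong_abs[OF assms(1)] .
  moreover have "1 * \<bar>q\<bar> \<le> \<bar>int j - int i\<bar> * \<bar>q\<bar>"
    using assms(2) by (intro mult_right_mono) auto
  moreover define t where "t = (int j - int i) * q"
  moreover have "p - int i * q = (p - int j * q) + t" by (simp add: algebra_simps t_def)
  ultimately have "2 * \<bar>p - int j * q\<bar> < \<bar>q\<bar>" "\<bar>q\<bar> \<le> \<bar>t\<bar>" "p - int i * q = (p - int j * q) + t"
    by (simp_all add: abs_mult)
  moreover have "2 * \<bar>a\<bar> < \<bar>q\<bar> \<Longrightarrow> \<bar>q\<bar> \<le> \<bar>t\<bar> \<Longrightarrow> b = a + t \<Longrightarrow> \<bar>q\<bar> < 2 * \<bar>b\<bar>" for a b t :: int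
    by linarith
  ultimately have *: "\<bar>q\<bar> < 2 * \<bar>p - int i * q\<bar>" by blast
  then show "p - int i * q \<noteq> 0" by auto
  show "\<not> pong (i, e') (p, q)" using pong_abs[of i e' p q] * by linarith
qed

lemma pong_same: "pong a v \<Longrightarrow> \<not> pong (inv_letter a) v"
proof (cases a; cases v)
  fix i e p q assume "pong a v" and a: "a = (i, e)" "v = (p, q)"
  moreover have "0 \<le> (p - int i * q) * (p - int i * q)" by simp
  ultimately show "\<not> pong (inv_letter a) v"
    by (cases e) (auto simp: inv_letter_def Let_def simp del: zero_le_square)
qed

text \<open>The game starts at \<open>(1, 0)\<close>, the point at infinity, which lies outside all
  tables; each letter of a reduced word then moves the point into its own table.\<close>

lemma reduced_pong: "reduced w \<Longrightarrow> w \<noteq> [] \<Longrightarrow> pong (hd w) (mat_app (mat_word w) (1, 0))"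
proof (induction w)
  case (Cons a w)
  obtain i e where a: "a = (i, e)" by (cases a)
  show ?case
  proof (cases w)
    case Nil
    then show ?thesis using pong_step[of 1 i 0 e] by (simp add: a mat_app_mm Let_def inv_letter_def I2_def)
  next
    case (Cons b w')
    obtain j d where b: "b = (j, d)" by (cases b)
    obtain p q where pq: "mat_app (mat_word w) (1, 0) = (p, q)" by force
    have "pong b (p, q)" using Cons.IH Cons.prems Cons pq by (auto simp: reduced_def)
    moreover have "b \<noteq> inv_letter a" using Cons.prems Cons by (simp add: reduced_def)
    ultimately have "p - int i * q \<noteq> 0 \<and> \<not> pong (inv_letter a) (p, q)"
    proof (cases "i = j")
      case True
      then have "b = a" using \<open>b \<noteq> inv_letter a\<close> by (auto simp: a b inv_letter_def)
      then show ?thesis using \<open>pong b (p, q)\<close> pong_same by (auto simp: a Let_def)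
    next
      case False
      then show ?thesis using pong_disjoint \<open>pong b (p, q)\<close> by (auto simp: a b inv_letter_def simp del: pong.simps)
    qed
    then show ?thesis using pong_step[of p i q e] by (simp add: a mat_app_mm pq del: pong.simps)
  qed
qed simp

lemma mat_word_faithful: "mat_word w = I2 \<Longrightarrow> reduce w = []"
proof (rule ccontr)
  assume "mat_word w = I2" "reduce w \<noteq> []"
  then have "pong (hd (reduce w)) (mat_app I2 (1, 0))"
    using reduced_pong[OF reduced_reduce] by (metis mat_word_reduce)
  then show False by (cases "hd (reduce w)") (auto simp: I2_def Let_def split: if_splits)
qed

text \<open>Faithfulness lets matrices stand for elements of the free group, so that a permutation
  representation may be evaluated on a matrix.\<close>

lemma act_eq_if_mat_word_eq:
  assumes "mat_word u = mat_word v" "\<And>i. bij (g i)"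
  shows "act g u = act g v"
proof (rule act_eq_if_quotient[OF assms(2)])
  have "mat_word (u @ inv_word v) = I2" by (simp add: mat_word_append mat_word_inv assms(1) mm_adj)
  then have "reduce (u @ inv_word v) = []" by (rule mat_word_faithful)
  then have "act g (reduce (u @ inv_word v)) = id" by simp
  then show "act g (u @ inv_word v) = id" using act_reduce[OF assms(2)] by (auto simp: fun_eq_iff)
qed

section \<open>Congruences and the orbit of the identity matrix\<close>

fun dvd_vec :: "int \<Rightarrow> mat \<Rightarrow> bool" where
  "dvd_vec q (a, b, c, d) \<longleftrightarrow> q dvd a \<and> q dvd b \<and> q dvd c \<and> q dvd d"

lemma dvd_vec_0 [simp]: "dvd_vec q 0"
  by (simp add: zero_prod_def)

lemma dvd_vec_zero_iff [simp]: "dvd_vec 0 P \<longleftrightarrow> P = 0"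
  by (cases P) (simp add: zero_prod_def)

lemma dvd_vec_add: "dvd_vec q P \<Longrightarrow> dvd_vec q Q \<Longrightarrow> dvd_vec q (P + Q)"
  by (cases P; cases Q) auto

lemma dvd_vec_diff: "dvd_vec q P \<Longrightarrow> dvd_vec q Q \<Longrightarrow> dvd_vec q (P - Q)"
  by (cases P; cases Q) auto

lemma dvd_vec_minus [simp]: "dvd_vec q (- P) \<longleftrightarrow> dvd_vec q P"
  by (cases P) auto

lemma dvd_vec_mm: "dvd_vec q P \<Longrightarrow> dvd_vec q (mm P Q)" "dvd_vec q Q \<Longrightarrow> dvd_vec q (mm P Q)"
  by (cases P; cases Q; auto)+

text \<open>Each rule applies one letter of the centralizer of the involution, which makes this an
  orbit by construction. That it is also a normal subgroup, closed under products and inverses, is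
  derived from the rules below.\<close>

inductive_set orb :: "nat \<Rightarrow> word list \<Rightarrow> mat set" for k :: nat and R :: "word list" where
  one: "I2 \<in> orb k R"
| conj: "P \<in> orb k R \<Longrightarrow> fst a < k \<Longrightarrow> mm (mat_letter a) (mm P (mat_letter (inv_letter a))) \<in> orb k R"
| rel: "P \<in> orb k R \<Longrightarrow> r \<in> set R \<Longrightarrow> mm (mat_word r) P \<in> orb k R"
| rel_inv: "P \<in> orb k R \<Longrightarrow> r \<in> set R \<Longrightarrow> mm (adj (mat_word r)) P \<in> orb k R"

text \<open>Carries nontriviality over from permutations: a word that acts nontrivially, while all
  relators act trivially, has its matrix outside the orbit.\<close>

lemma orb_mat_word:
  assumes "P \<in> orb k R"
  shows "\<exists>u. P = mat_word u \<and> (\<forall>g :: nat \<Rightarrow> 'y \<Rightarrow> 'y. (\<forall>i. bij (g i)) \<longrightarrow> (\<forall>r\<in>set R. act g r = id) \<longrightarrow> act g u = id)"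
  using assms
proof (induction rule: orb.induct)
  case one
  show ?case by (rule exI[of _ "[]"]) simp
next
  case (conj P a)
  then obtain u where u: "P = mat_word u" "\<And>g :: nat \<Rightarrow> 'y \<Rightarrow> 'y. \<forall>i. bij (g i) \<Longrightarrow> \<forall>r\<in>set R. act g r = id \<Longrightarrow> act g u = id"
    by blast
  show ?case
    by (rule exI[of _ "a # u @ [inv_letter a]"])
      (auto simp: u mat_word_append fun_eq_iff)
next
  case (rel P r)
  then obtain u where u: "P = mat_word u" "\<And>g :: nat \<Rightarrow> 'y \<Rightarrow> 'y. \<forall>i. bij (g i) \<Longrightarrow> \<forall>r\<in>set R. act g r = id \<Longrightarrow> act g u = id"
    by blast
  show ?case
    by (rule exI[of _ "r @ u"]) (use rel in \<open>auto simp: u mat_word_append fun_eq_iff\<close>)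
next
  case (rel_inv P r)
  then obtain u where u: "P = mat_word u" "\<And>g :: nat \<Rightarrow> 'y \<Rightarrow> 'y. \<forall>i. bij (g i) \<Longrightarrow> \<forall>r\<in>set R. act g r = id \<Longrightarrow> act g u = id"
    by blast
  have "act g (inv_word r) = id" if "\<forall>i. bij (g i)" "\<forall>r\<in>set R. act g r = id" for g :: "nat \<Rightarrow> 'y \<Rightarrow> 'y"
    using that rel_inv act_inv_word_eq[of g r] by simp
  then show ?case
    by (intro exI[of _ "inv_word r @ u"]) (auto simp: u mat_word_append mat_word_inv fun_eq_iff)
qed

lemma orb_conj_word: "P \<in> orb k R \<Longrightarrow> w \<in> words k \<Longrightarrow> mm (mat_word w) (mm P (adj (mat_word w))) \<in> orb k R"
proof (induction w)
  case (Cons a w)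
  then have "mm (mat_letter a) (mm (mm (mat_word w) (mm P (adj (mat_word w)))) (mat_letter (inv_letter a))) \<in> orb k R"
    by (intro orb.conj) auto
  then show ?case by (simp add: mm_assoc adj_mm mat_letter_inv)
qed simp

lemma orb_mult: "P \<in> orb k R \<Longrightarrow> Q \<in> orb k R \<Longrightarrow> mm P Q \<in> orb k R"
proof (induction arbitrary: Q rule: orb.induct)
  case (conj P a)
  \<comment> \<open>With \<open>a\<close> for the letter, \<open>a P a\<^sup>-\<^sup>1 Q = a (P
    (a\<^sup>-\<^sup>1 Q a)) a\<^sup>-\<^sup>1\<close>; the induction hypothesis is used for the
    conjugate of \<open>Q\<close>.\<close>
  have "mm (mat_letter (inv_letter a)) (mm Q (mat_letter (inv_letter (inv_letter a)))) \<in> orb k R"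
    by (rule orb.conj) (use conj in auto)
  then have "mm P (mm (mat_letter (inv_letter a)) (mm Q (mat_letter a))) \<in> orb k R"
    using conj by simp
  from orb.conj[OF this conj(2)] show ?case
    by (simp add: mm_assoc mat_letter_inv mm_adj)
qed (auto intro: orb.intros simp: mm_assoc)

lemma orb_adj: "P \<in> orb k R \<Longrightarrow> adj P \<in> orb k R"
proof (induction rule: orb.induct)
  case (conj P a)
  from orb.conj[OF conj(3,2)] show ?case by (simp add: adj_mm mm_assoc mat_letter_inv)
next
  case (rel P r)
  have "adj (mat_word r) \<in> orb k R" using orb.rel_inv[OF orb.one rel(2)] by simp
  then show ?case using rel by (simp add: adj_mm orb_mult)
next
  case (rel_inv P r)
  have "mat_word r \<in> orb k R" using orb.rel[OF orb.one rel_inv(2)] by simp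
  then show ?case using rel_inv by (simp add: adj_mm orb_mult)
qed (auto intro: orb.one)

text \<open>For \<open>q = 0\<close> congruence is equality.\<close>

definition orb_subgroup :: "nat \<Rightarrow> word list \<Rightarrow> int \<Rightarrow> word set" where
  "orb_subgroup k R q = {u \<in> carrier (free_group k). \<exists>P\<in>orb k R. dvd_vec q (mat_word u - P)}"

lemma dvd_vec_mm_diff:
  "dvd_vec q (P - P') \<Longrightarrow> dvd_vec q (Q - Q') \<Longrightarrow> dvd_vec q (mm P Q - mm P' Q')"
proof -
  have "mm P Q - mm P' Q' = mm (P - P') Q + mm P' (Q - Q')" by (simp add: mm_diff)
  then show "dvd_vec q (P - P') \<Longrightarrow> dvd_vec q (Q - Q') \<Longrightarrow> ?thesis"
    by (simp add: dvd_vec_add dvd_vec_mm)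
qed

lemma dvd_vec_adj_diff: "dvd_vec q (P - P') \<Longrightarrow> dvd_vec q (adj P - adj P')"
  by (cases P; cases P') (simp add: dvd_diff_commute)

text \<open>In the quotient by this subgroup all relators hold, so their group theoretic
  consequences become statements about the orbit. For \<open>q > 0\<close> the class of
  \<open>x\<close> moreover has finite order there.\<close>

lemma normal_orb_subgroup: "orb_subgroup k R q \<lhd> free_group k"
proof -
  interpret F: group "free_group k" by (rule group_free_group)
  have sub: "subgroup (orb_subgroup k R q) (free_group k)"
  proof (rule F.subgroupI)
    show "orb_subgroup k R q \<noteq> {}"
      using orb.one[of k R] F.one_closed by (force simp: orb_subgroup_def)
    fix u assume u: "u \<in> orb_subgroup k R q"
    then obtain P where "P \<in> orb k R" "dvd_vec q (mat_word u - P)" "u \<in> carrier (free_group k)"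
      by (auto simp: orb_subgroup_def)
    then show "inv\<^bsub>free_group k\<^esub> u \<in> orb_subgroup k R q"
      using F.inv_closed[of u] orb_adj[of P] dvd_vec_adj_diff[of q "mat_word u" P]
      by (auto simp: orb_subgroup_def inv_free_group mat_word_inv)
    fix v assume "v \<in> orb_subgroup k R q"
    then obtain Q where "Q \<in> orb k R" "dvd_vec q (mat_word v - Q)" "v \<in> carrier (free_group k)"
      by (auto simp: orb_subgroup_def)
    then show "u \<otimes>\<^bsub>free_group k\<^esub> v \<in> orb_subgroup k R q"
      using \<open>P \<in> orb k R\<close> \<open>dvd_vec q (mat_word u - P)\<close> \<open>u \<in> carrier _\<close> F.m_closed[of u v]
        orb_mult[of P k R Q] dvd_vec_mm_diff[of q "mat_word u" P "mat_word v" Q]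
      by (auto simp: orb_subgroup_def mat_word_append)
  qed (auto simp: orb_subgroup_def)
  show ?thesis
    unfolding F.normal_inv_iff
  proof (intro conjI ballI sub)
    fix w u assume w: "w \<in> carrier (free_group k)" and u: "u \<in> orb_subgroup k R q"
    then obtain P where P: "P \<in> orb k R" "dvd_vec q (mat_word u - P)" and uc: "u \<in> carrier (free_group k)"
      by (auto simp: orb_subgroup_def)
    have "w \<otimes>\<^bsub>free_group k\<^esub> u \<otimes>\<^bsub>free_group k\<^esub> inv\<^bsub>free_group k\<^esub> w \<in> carrier (free_group k)"
      using w uc by (meson F.inv_closed F.m_closed)
    moreover have "mm (mat_word w) (mm P (adj (mat_word w))) \<in> orb k R"
      using P w by (intro orb_conj_word) (auto simp: carrier_free_group)
    moreover have "dvd_vec q (mat_word (w \<otimes>\<^bsub>free_group k\<^esub> u \<otimes>\<^bsub>free_group k\<^esub> inv\<^bsub>free_group k\<^esub> w) -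
        mm (mat_word w) (mm P (adj (mat_word w))))"
    proof -
      have "mat_word (w \<otimes>\<^bsub>free_group k\<^esub> u \<otimes>\<^bsub>free_group k\<^esub> inv\<^bsub>free_group k\<^esub> w) =
          mm (mat_word w) (mm (mat_word u) (adj (mat_word w)))"
        using w by (simp add: inv_free_group mat_word_append mat_word_inv mm_assoc)
      then show ?thesis using P(2) by (simp add: dvd_vec_mm_diff)
    qed
    ultimately show "w \<otimes>\<^bsub>free_group k\<^esub> u \<otimes>\<^bsub>free_group k\<^esub> inv\<^bsub>free_group k\<^esub> w \<in> orb_subgroup k R q"
      by (auto simp: orb_subgroup_def)
  qed
qed

lemma words_replicate [simp]: "replicate n a \<in> words k \<longleftrightarrow> n = 0 \<or> fst a < k"
  by (induction n) auto

lemma words_special [simp]: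
  "xpow n \<in> words (4 + m)" "tword n \<in> words (4 + m)" "kt_word n \<in> words (4 + m)" "bs_word \<in> words (4 + m)"
  by (simp_all add: xpow_def tword_def kt_word_def bs_word_def comm_word_def)

lemma words_relators: "w \<in> set (relators m A C z) \<Longrightarrow> w \<in> words (4 + m)"
  by (auto simp: relators_def comm_word_def)

context group
begin

lemma eval_word_quotient_iff:
  assumes "set zs \<subseteq> carrier G" "u \<in> words (length zs)" "v \<in> words (length zs)"
  shows "eval_word G zs (u @ inv_word v) = \<one> \<longleftrightarrow> eval_word G zs u = eval_word G zs v"
  using assms inv_solve_right'[of \<one> "eval_word G zs u" "eval_word G zs v"]
  by simp

lemma eval_tword:
  assumes "set zs \<subseteq> carrier G" "length zs = 4 + m"
  shows "eval_word G zs (tword n) = conj_pow (zs ! 0) (zs ! 1) n"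
proof -
  have c: "zs ! 0 \<in> carrier G" "zs ! 1 \<in> carrier G" using assms nth_mem[of _ zs] by auto
  have "eval_word G zs (xpow n) = zs ! 0 [^] n"
    unfolding xpow_def using assms by (intro eval_word_replicate) auto
  moreover have "eval_word G zs (tword n) =
      eval_word G zs (xpow n) \<otimes> eval_word G zs [(1, True)] \<otimes> inv (eval_word G zs (xpow n))"
    unfolding tword_def using assms words_special(1)[of n m] c
    by (subst eval_word_append, simp_all)+ (simp add: m_assoc)
  ultimately show ?thesis using c by (simp add: conj_pow_def)
qed

text \<open>Conjugation by \<open>r\<^sub>i\<close> fixes \<open>k\<close> and replaces
  \<open>n\<close> by its Collatz successor, so commuting with \<open>k\<close> propagates back from
  \<open>z\<close> along an orbit. The second claim is the Baumslag-Solitar argument for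
  \<open>x\<close> of finite order.\<close>

lemma relators_imply:
  assumes zs: "set zs \<subseteq> carrier G" "length zs = 4 + m"
    and R': "\<forall>w\<in>set (relators m A C z). eval_word G zs w = \<one>"
    and m: "m > 0"
  shows "collatz_reaches m A C z n \<Longrightarrow> eval_word G zs (kt_word n) = \<one>"
    and "zs ! 0 [^] (e::nat) = \<one> \<Longrightarrow> e > 0 \<Longrightarrow> eval_word G zs bs_word = \<one>"
proof -
  note R = bspec[OF R']
  have c: "zs ! i \<in> carrier G" if "i < 4 + m" for i using that zs nth_mem[of i zs] by auto
  let ?x = "zs ! 0" and ?t = "zs ! 1" and ?k = "zs ! 2" and ?b = "zs ! 3"
  have cc: "?x \<in> carrier G" "?t \<in> carrier G" "?k \<in> carrier G" "?b \<in> carrier G" using c by auto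
  have xpow: "eval_word G zs (xpow n) = ?x [^] n" for n
    unfolding xpow_def using zs by (intro eval_word_replicate) auto
  note quot = eval_word_quotient_iff[OF zs(1), unfolded zs(2)]
  note tw = eval_tword[OF zs]
  have gen: "eval_word G zs ((i, True) # w) = zs ! i \<otimes> eval_word G zs w" for i w by simp
  have app: "eval_word G zs (u @ v) = eval_word G zs u \<otimes> eval_word G zs v"
    if "u \<in> words (4 + m)" "v \<in> words (4 + m)" for u v using that zs by simp
  have kt: "eval_word G zs (kt_word n) = \<one> \<longleftrightarrow> ?k \<otimes> conj_pow ?x ?t n = conj_pow ?x ?t n \<otimes> ?k" for n
    unfolding kt_word_def comm_word_def using cc by (subst quot) (simp_all add: app tw)
  have step: "?k \<otimes> conj_pow ?x ?t n = conj_pow ?x ?t n \<otimes> ?k \<longleftrightarrow>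
      ?k \<otimes> conj_pow ?x ?t (collatz_step m A C n) = conj_pow ?x ?t (collatz_step m A C n) \<otimes> ?k" for n
  proof -
    define i where "i = n mod m"
    define j where "j = n div m"
    have i: "i < m" using m by (simp add: i_def)
    have n: "n = i + m * j" "collatz_step m A C n = C i + A i * j"
      by (simp_all add: i_def j_def collatz_step_def)
    let ?r = "zs ! (4 + i)"
    have r: "?r \<in> carrier G" using c i by simp
    have mem: "comm_word [(2, True)] [(4 + i, True)] \<in> set (relators m A C z)"
      "((4 + i, True) # xpow m) @ inv_word (xpow (A i) @ [(4 + i, True)]) \<in> set (relators m A C z)"
      "((4 + i, True) # tword i) @ inv_word (tword (C i) @ [(4 + i, True)]) \<in> set (relators m A C z)"
      using i unfolding relators_def by auto
    have kr: "?k \<otimes> ?r = ?r \<otimes> ?k"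
      using R[OF mem(1)] i r cc unfolding comm_word_def by (subst (asm) quot) simp_all
    have xr: "?r \<otimes> ?x [^] m = ?x [^] A i \<otimes> ?r"
      using R[OF mem(2)] i r cc by (subst (asm) quot) (auto simp: app xpow)
    have tr: "?r \<otimes> conj_pow ?x ?t i = conj_pow ?x ?t (C i) \<otimes> ?r"
      using R[OF mem(3)] i r cc by (subst (asm) quot) (auto simp: app tw)
    show ?thesis unfolding n(2) unfolding n(1)
      by (rule conj_commute_iff[OF _ r _ _ conj_pow_intertwine[OF cc(1,2) r xr tr] kr]) (use cc in auto)
  qed
  show "eval_word G zs (kt_word n) = \<one>" if reaches: "collatz_reaches m A C z n"
  proof -
    obtain j where "(collatz_step m A C ^^ j) n = z" using reaches by (auto simp: collatz_reaches_def)
    then show ?thesis unfolding kt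
    proof (induction j arbitrary: n)
      case 0
      have "eval_word G zs (kt_word z) = \<one>" by (rule R) (simp add: relators_def)
      with 0 kt[of z] show ?case by simp
    next
      case (Suc j)
      then show ?case by (subst step) (simp add: funpow_Suc_right del: funpow.simps)
    qed
  qed
  show "eval_word G zs bs_word = \<one>" if e: "?x [^] e = \<one>" "e > 0"
  proof -
    have "((3, True) # xpow 2) @ inv_word (xpow 3 @ [(3, True)]) \<in> set (relators m A C z)"
      by (simp add: relators_def)
    from R[OF this] have "?b \<otimes> ?x [^] (2::nat) = ?x [^] (3::nat) \<otimes> ?b"
      using cc by (subst (asm) quot) (auto simp: app xpow)
    from baumslag_solitar_commute[OF cc(1,4) this e]
    show ?thesis unfolding bs_word_def comm_word_def using cc by (subst quot) (auto simp: m_assoc)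
  qed
qed

end

lemma eval_word_Mod:
  assumes N: "N \<lhd> free_group k"
  defines "zs \<equiv> map (\<lambda>i. N #>\<^bsub>free_group k\<^esub> [(i, True)]) [0..<k]"
  shows "set zs \<subseteq> carrier (free_group k Mod N)"
    and "w \<in> words k \<Longrightarrow> eval_word (free_group k Mod N) zs w = N #>\<^bsub>free_group k\<^esub> reduce w"
proof -
  interpret F: group "free_group k" by (rule group_free_group)
  interpret N: normal N "free_group k" by (rule N)
  interpret Q: group "free_group k Mod N" by (rule N.factorgroup_is_group)
  have gen: "[(i, e)] \<in> carrier (free_group k)" if "i < k" for i e
    using that by (simp add: carrier_free_group reduced_def)
  have hom: "(#>\<^bsub>free_group k\<^esub>) N \<in> hom (free_group k) (free_group k Mod N)" by (rule N.r_coset_hom_Mod)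
  show zs: "set zs \<subseteq> carrier (free_group k Mod N)"
    using gen by (auto simp: zs_def carrier_FactGroup)
  have len: "length zs = k" by (simp add: zs_def)
  show "eval_word (free_group k Mod N) zs w = N #>\<^bsub>free_group k\<^esub> reduce w" if "w \<in> words k"
    using that
  proof (induction w)
    case Nil
    then show ?case using hom_one[OF hom F.is_group Q.is_group] by simp
  next
    case (Cons a w)
    obtain i e where a: "a = (i, e)" by (cases a)
    with Cons have i: "i < k" and w: "w \<in> words k" by auto
    have "Q.eval_letter zs a = N #>\<^bsub>free_group k\<^esub> [a]"
    proof (cases e)
      case True
      then show ?thesis using i by (simp add: a Q.eval_letter_def zs_def)
    next
      case False
      have "inv\<^bsub>free_group k Mod N\<^esub> (N #>\<^bsub>free_group k\<^esub> [(i, True)]) = N #>\<^bsub>free_group k\<^esub> [(i, False)]"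
        using group_hom.hom_inv[of "free_group k" "free_group k Mod N" "(#>\<^bsub>free_group k\<^esub>) N" "[(i, True)]"]
          gen[OF i, of True] hom F.is_group Q.is_group
        by (simp add: group_hom_def group_hom_axioms_def inv_free_group inv_letter_def)
      with False show ?thesis using i by (simp add: a Q.eval_letter_def zs_def)
    qed
    then have "eval_word (free_group k Mod N) zs (a # w) =
        (N #>\<^bsub>free_group k\<^esub> [a]) \<otimes>\<^bsub>free_group k Mod N\<^esub> (N #>\<^bsub>free_group k\<^esub> reduce w)"
      using Cons.IH[OF w] by (simp add: Q.eval_word_Cons del: eval_word.simps(2))
    also have "\<dots> = N #>\<^bsub>free_group k\<^esub> reduce ([a] @ reduce w)"
      using hom_mult[OF hom, of "[a]" "reduce w"] gen[OF i, of e] w by (simp add: a)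
    finally show ?case using reduce_append_reduce_right[of "[a]" w] by simp
  qed
qed

text \<open>Nonmembership comes from the permutation representation, membership from computing in
  the quotient of the free group by \<open>orb_subgroup\<close>: with modulus 0 for
  \<open>kt_word\<close>, with a positive modulus for \<open>bs_word\<close>.\<close>

lemma orb_kt_word:
  assumes sys: "collatz_system m A C z"
  shows "collatz_reaches m A C z n \<longleftrightarrow> mat_word (kt_word n) \<in> orb (4 + m) (relators m A C z)"
    and "mat_word bs_word \<notin> orb (4 + m) (relators m A C z)"
    and "q > 0 \<Longrightarrow> \<exists>P\<in>orb (4 + m) (relators m A C z). dvd_vec q (mat_word bs_word - P)"
proof -
  let ?k = "4 + m" and ?R = "relators m A C z"
  obtain g :: "nat \<Rightarrow> point \<times> nat \<Rightarrow> point \<times> nat" where g: "\<And>i. bij (g i)" "\<And>w. w \<in> set ?R \<Longrightarrow> act g w = id"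
    "act g bs_word \<noteq> id" "\<And>n. act g (kt_word n) = id \<Longrightarrow> collatz_reaches m A C z n"
    using collatz_representation[OF sys] by blast
  have orb: "act g w = id" if orb: "mat_word w \<in> orb ?k ?R" for w
  proof -
    obtain u where "mat_word w = mat_word u" "act g u = id"
      using orb_mat_word[OF orb] g by metis
    then show ?thesis using act_eq_if_mat_word_eq g(1) by metis
  qed
  show "mat_word bs_word \<notin> orb ?k ?R" using orb g(3) by blast
  \<comment> \<open>Both uses of the quotient at once; for \<open>kt_word\<close> the modulus is
    arbitrary and is later set to 0.\<close>
  have *: "\<exists>P\<in>orb ?k ?R. dvd_vec q (mat_word w - P)"
    if "w = kt_word n \<and> collatz_reaches m A C z n \<or> w = bs_word \<and> q > 0" for w n q
  proof -
    define N where "N = orb_subgroup ?k ?R q"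
    have N: "N \<lhd> free_group ?k" unfolding N_def by (rule normal_orb_subgroup)
    interpret F: group "free_group ?k" by (rule group_free_group)
    interpret N: normal N "free_group ?k" by (rule N)
    interpret Q: group "free_group ?k Mod N" by (rule N.factorgroup_is_group)
    define zs where "zs = map (\<lambda>i. N #>\<^bsub>free_group ?k\<^esub> [(i, True)]) [0..<?k]"
    note zs = eval_word_Mod[OF N, folded zs_def]
    have len: "length zs = ?k" by (simp add: zs_def)
    have eval_one: "eval_word (free_group ?k Mod N) zs w = \<one>\<^bsub>free_group ?k Mod N\<^esub> \<longleftrightarrow> reduce w \<in> N" if "w \<in> words ?k" for w
    proof -
      have "reduce w \<in> carrier (free_group ?k)" using that by simp
      then have "N #>\<^bsub>free_group ?k\<^esub> reduce w = N \<longleftrightarrow> reduce w \<in> N"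
        using F.coset_join1[OF _ _ N.subgroup_axioms] F.coset_join2[OF _ N.subgroup_axioms] by blast
      then show ?thesis unfolding zs(2)[OF that] by (simp add: FactGroup_def)
    qed
    have mem: "reduce w \<in> N" if "w \<in> words ?k" "P \<in> orb ?k ?R" "dvd_vec q (mat_word w - P)" for w P
      unfolding N_def orb_subgroup_def using that by (intro CollectI conjI bexI[of _ P]) simp_all
    have relN: "eval_word (free_group ?k Mod N) zs r = \<one>\<^bsub>free_group ?k Mod N\<^esub>" if r: "r \<in> set ?R" for r
    proof -
      have "mat_word r \<in> orb ?k ?R" using orb.rel[OF orb.one r] by simp
      then have "reduce r \<in> N" using words_relators[OF r] mem by simp
      then show ?thesis using eval_one words_relators[OF r] by blast
    qed
    have m: "m > 0" using sys by (simp add: collatz_system_def)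
    have "\<forall>w\<in>set ?R. eval_word (free_group ?k Mod N) zs w = \<one>\<^bsub>free_group ?k Mod N\<^esub>"
      using relN by blast
    note imp = Q.relators_imply[OF zs(1) len this m]
    have "eval_word (free_group ?k Mod N) zs w = \<one>\<^bsub>free_group ?k Mod N\<^esub>" "w \<in> words ?k"
    proof -
      show "w \<in> words ?k" using that by auto
      show "eval_word (free_group ?k Mod N) zs w = \<one>\<^bsub>free_group ?k Mod N\<^esub>"
        using that
      proof (elim disjE conjE)
        assume "w = bs_word" "q > 0"
        \<comment> \<open>The letter \<open>x\<close> acts by the unipotent matrix
          \<open>rho 0\<close>, so its power with exponent \<open>q\<close> is the identity modulo
          \<open>q\<close>.\<close>
        have "mat_word (xpow n) = (1, 0, - 5 * int n, 1)" for n
          unfolding xpow_def by (induction n) (auto simp: I2_def mat_letter_def rho_def)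
        then have "dvd_vec q (mat_word (xpow (nat q)) - I2)" using \<open>q > 0\<close> by (simp add: I2_def)
        then have "reduce (xpow (nat q)) \<in> N"
          using orb.one by (intro mem[rotated 2]) simp_all
        then have "eval_word (free_group ?k Mod N) zs (xpow (nat q)) = \<one>\<^bsub>free_group ?k Mod N\<^esub>"
          using eval_one words_special(1)[of "nat q" m] by blast
        moreover have "eval_word (free_group ?k Mod N) zs (xpow (nat q)) = zs ! 0 [^]\<^bsub>free_group ?k Mod N\<^esub> nat q"
          unfolding xpow_def using len by (intro Q.eval_word_replicate zs(1)) auto
        ultimately show ?thesis using imp(2)[where e = "nat q"] \<open>q > 0\<close> \<open>w = bs_word\<close> by simp
      next
        assume "w = kt_word n" "collatz_reaches m A C z n"
        show ?thesis unfolding \<open>w = kt_word n\<close> by (rule imp(1)[OF \<open>collatz_reaches m A C z n\<close>])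
      qed
    qed
    then have "reduce w \<in> N" using eval_one by blast
    then obtain P where "P \<in> orb ?k ?R" "dvd_vec q (mat_word (reduce w) - P)"
      unfolding N_def orb_subgroup_def by blast
    then show ?thesis unfolding mat_word_reduce by blast
  qed
  show "\<exists>P\<in>orb ?k ?R. dvd_vec q (mat_word bs_word - P)" if "q > 0" using * that by blast
  show "collatz_reaches m A C z n \<longleftrightarrow> mat_word (kt_word n) \<in> orb ?k ?R"
  proof
    assume "collatz_reaches m A C z n"
    then obtain P where "P \<in> orb ?k ?R" "mat_word (kt_word n) - P = 0"
      using *[of "kt_word n" n 0] by auto
    then show "mat_word (kt_word n) \<in> orb ?k ?R" by simp
  next
    assume "mat_word (kt_word n) \<in> orb ?k ?R"
    then show "collatz_reaches m A C z n" by (intro g(4) orb)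
  qed
qed

section \<open>The lattice of integer vectors\<close>

fun smul :: "int \<Rightarrow> mat \<Rightarrow> mat" where
  "smul k (a, b, c, d) = (k * a, k * b, k * c, k * d)"

lemma smul_simps [simp]: "smul 0 a = 0" "smul 1 a = a" "smul k 0 = 0" "smul (- 1) a = - a"
  by (cases a; simp add: zero_prod_def)+

lemma smul_add: "smul k (a + b) = smul k a + smul k b" "smul (k + l) a = smul k a + smul l a"
    "smul k (a - b) = smul k a - smul k b" "smul (k - l) a = smul k a - smul l a" "smul k (smul l a) = smul (k * l) a"
    "smul k (- a) = - smul k a" "smul (- k) a = - smul k a"
  by (cases a; cases b; simp add: algebra_simps)+

lemma dvd_vec_iff: "dvd_vec q a \<longleftrightarrow> (\<exists>b. a = smul q b)"
  by (cases a) (fastforce elim!: dvdE)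

lemma dvd_vec_dvd_trans: "p dvd q \<Longrightarrow> dvd_vec q a \<Longrightarrow> dvd_vec p a"
  by (cases a) (auto intro: dvd_trans)

text \<open>These are the additive subgroups of \<open>\<int>\<^sup>4\<close>; closure under
  integral multiples follows.\<close>

definition subspace :: "mat set \<Rightarrow> bool" where
  "subspace B \<longleftrightarrow> 0 \<in> B \<and> (\<forall>a\<in>B. \<forall>b\<in>B. a - b \<in> B)"

lemma subspace_smul: "subspace B \<Longrightarrow> a \<in> B \<Longrightarrow> smul k a \<in> B"
proof (induction k rule: int_induct[where k = 0])
  case (step1 k)
  have "smul (k + 1) a = smul k a - (0 - a)" by (simp add: smul_add)
  then show ?case using step1 by (metis subspace_def)
next
  case (step2 k)
  have "smul (k - 1) a = smul k a - a" by (simp add: smul_add)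
  then show ?case using step2 by (metis subspace_def)
qed (simp add: subspace_def)

lemma subspace_add: "subspace B \<Longrightarrow> a \<in> B \<Longrightarrow> b \<in> B \<Longrightarrow> a + b \<in> B"
proof -
  assume B: "subspace B" "a \<in> B" "b \<in> B"
  then have "a - (0 - b) \<in> B" unfolding subspace_def by blast
  then show ?thesis by simp
qed

text \<open>A subgroup maximal among those avoiding \<open>v\<close> has finite index, since every nontrivial subgroup
  of the quotient contains the image of \<open>v\<close>.\<close>

lemma subspace_closed:
  assumes B: "subspace B" and v: "v \<notin> B"
  shows "\<exists>q>0. \<forall>b\<in>B. \<not> dvd_vec q (v - b)"
proof -
  define \<C> where "\<C> = {C. subspace C \<and> B \<subseteq> C \<and> v \<notin> C}"
  have "\<exists>M\<in>\<C>. \<forall>C\<in>\<C>. M \<subseteq> C \<longrightarrow> C = M"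
  proof (rule subset_Zorn_nonempty)
    show "\<C> \<noteq> {}" using B v by (auto simp: \<C>_def)
    fix D assume D: "D \<noteq> {}" "subset.chain \<C> D"
    have "subspace (\<Union> D)"
      unfolding subspace_def
    proof (intro conjI ballI)
      show "0 \<in> \<Union> D" using D by (auto simp: subset.chain_def \<C>_def subspace_def)
      fix a b assume "a \<in> \<Union> D" "b \<in> \<Union> D"
      then obtain P Q where PQ: "P \<in> D" "Q \<in> D" "a \<in> P" "b \<in> Q" by blast
      have "P \<subseteq> Q \<or> Q \<subseteq> P" using D(2) PQ by (auto simp: subset.chain_def)
      then obtain R where "R \<in> D" "a \<in> R" "b \<in> R" using PQ by blast
      moreover have "subspace R" using D(2) \<open>R \<in> D\<close> by (auto simp: subset.chain_def \<C>_def)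
      ultimately show "a - b \<in> \<Union> D" unfolding subspace_def by blast
    qed
    moreover have "B \<subseteq> P \<and> v \<notin> P" if "P \<in> D" for P
      using D(2) that by (auto simp: subset.chain_def \<C>_def)
    ultimately show "\<Union> D \<in> \<C>" using D(1) unfolding \<C>_def by blast
  qed
  then obtain M where MC: "M \<in> \<C>" and Mmax: "\<forall>C\<in>\<C>. M \<subseteq> C \<longrightarrow> C = M" by (elim bexE)
  then have M: "subspace M" "B \<subseteq> M" "v \<notin> M" by (simp_all add: \<C>_def)
  have max: "C = M" if "subspace C" "M \<subseteq> C" "v \<notin> C" for C
  proof -
    have "C \<in> \<C>" using that M(2) by (simp add: \<C>_def)
    with Mmax that(2) show ?thesis by simp
  qed
  have torsion: "\<exists>n>0. smul n w \<in> M" for w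
  proof (rule ccontr)
    assume no: "\<not> (\<exists>n>0. smul n w \<in> M)"
    have no': "smul t w \<notin> M" if "t \<noteq> 0" for t
    proof
      assume "smul t w \<in> M"
      then have "smul (sgn t) (smul t w) \<in> M" by (rule subspace_smul[OF M(1)])
      then have "smul \<bar>t\<bar> w \<in> M" by (simp add: smul_add abs_sgn mult.commute)
      then show False using no that by auto
    qed
    \<comment> \<open>If no nonzero multiple of \<open>w\<close> is in \<open>M\<close>, maximality
      forces \<open>v\<close> into \<open>M\<close> plus the multiples of \<open>k w\<close>, for
      every \<open>k > 0\<close>. Comparing \<open>v = c + t w\<close> for \<open>k = 1\<close> with
      \<open>k = 2 * \<bar>t\<bar>\<close> yields a multiple of \<open>w\<close> in \<open>M\<close>
      that is nonzero by parity.\<close>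
    have ex: "\<exists>c\<in>M. \<exists>s. v = c + smul (s * k) w" if k: "k > 0" for k
    proof (rule ccontr)
      assume none: "\<not> (\<exists>c\<in>M. \<exists>s. v = c + smul (s * k) w)"
      define C where "C = {c + smul (s * k) w |c s. c \<in> M}"
      have "subspace C"
        unfolding subspace_def
      proof (intro conjI ballI)
        have "0 \<in> M" using M(1) by (simp add: subspace_def)
        then have "0 + smul (0 * k) w \<in> C" unfolding C_def by blast
        then show "0 \<in> C" by simp
        fix a b assume "a \<in> C" "b \<in> C"
        then obtain c s c' s' where "a = c + smul (s * k) w" "b = c' + smul (s' * k) w" "c \<in> M" "c' \<in> M"
          unfolding C_def by blast
        then have "a - b = (c - c') + smul ((s - s') * k) w" "c - c' \<in> M"
          using M(1) by (auto simp: smul_add algebra_simps subspace_def)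
        then show "a - b \<in> C" unfolding C_def by blast
      qed
      moreover have "M \<subseteq> C"
      proof
        fix c assume "c \<in> M"
        then have "c + smul (0 * k) w \<in> C" unfolding C_def by blast
        then show "c \<in> C" by simp
      qed
      moreover have "v \<notin> C" using none by (auto simp: C_def)
      ultimately have "C = M" by (rule max)
      moreover have "0 + smul (1 * k) w \<in> C"
        using M(1) unfolding C_def subspace_def by blast
      ultimately show False using no' k by simp
    qed
    obtain c t where c: "c \<in> M" "v = c + smul t w" using ex[of 1] by auto
    then have t: "t \<noteq> 0" using M(3) by auto
    obtain c' s where c': "c' \<in> M" "v = c' + smul (s * (2 * \<bar>t\<bar>)) w" using ex[of "2 * \<bar>t\<bar>"] t by auto
    have "smul (t - s * (2 * \<bar>t\<bar>)) w = c' - c" using c(2) c'(2) by (simp add: smul_add algebra_simps)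
    then have "smul (t - s * (2 * \<bar>t\<bar>)) w \<in> M" using c c' M(1) by (simp add: subspace_def)
    moreover have "t - s * (2 * \<bar>t\<bar>) \<noteq> 0"
    proof
      assume "t - s * (2 * \<bar>t\<bar>) = 0"
      then have "1 * t = (2 * (s * sgn t)) * t" by (simp add: abs_sgn algebra_simps)
      then have "1 = 2 * (s * sgn t)" using t by (metis mult_right_cancel)
      then show False by presburger
    qed
    ultimately show False using no' by blast
  qed
  obtain n1 n2 n3 n4 where n: "n1 > 0" "smul n1 (1, 0, 0, 0) \<in> M" "n2 > 0" "smul n2 (0, 1, 0, 0) \<in> M"
    "n3 > 0" "smul n3 (0, 0, 1, 0) \<in> M" "n4 > 0" "smul n4 (0, 0, 0, 1) \<in> M"
    using torsion[of "(1, 0, 0, 0)"] torsion[of "(0, 1, 0, 0)"] torsion[of "(0, 0, 1, 0)"] torsion[of "(0, 0, 0, 1)"]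
    by (elim exE conjE)
  \<comment> \<open>Every vector divisible by \<open>q\<close> is a combination of the four
    multiples of unit vectors found in \<open>M\<close>.\<close>
  define q where "q = n1 * n2 * n3 * n4"
  have "q > 0" using n by (simp add: q_def)
  moreover have "\<not> dvd_vec q (v - b)" if "b \<in> B" for b
  proof
    assume "dvd_vec q (v - b)"
    then obtain x y z t where vb: "v - b = smul q (x, y, z, t)" unfolding dvd_vec_iff by (metis prod_cases4)
    also have "\<dots> = smul (n2 * n3 * n4 * x) (smul n1 (1, 0, 0, 0)) + smul (n1 * n3 * n4 * y) (smul n2 (0, 1, 0, 0))
        + smul (n1 * n2 * n4 * z) (smul n3 (0, 0, 1, 0)) + smul (n1 * n2 * n3 * t) (smul n4 (0, 0, 0, 1))"
      by (simp add: q_def)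
    also have "\<dots> \<in> M" 
      by (intro subspace_add[OF M(1)] subspace_smul[OF M(1) n(2)] subspace_smul[OF M(1) n(4)]
          subspace_smul[OF M(1) n(6)] subspace_smul[OF M(1) n(8)])
    finally have "v - b + b \<in> M" using that M by (intro subspace_add) auto
    then show False using M(3) by simp
  qed
  ultimately show ?thesis by blast
qed

fun coord :: "mat \<Rightarrow> nat \<Rightarrow> int" where
  "coord (x, y, z, t) i = (if i = 0 then x else if i = 1 then y else if i = 2 then z else t)"

definition unit_vec :: "nat \<Rightarrow> mat" where
  "unit_vec i = (of_bool (i = 0), of_bool (i = 1), of_bool (i = 2), of_bool (i = 3))"

definition elem :: "nat \<Rightarrow> nat \<Rightarrow> int \<Rightarrow> mat \<Rightarrow> mat" where
  "elem i j k a = a + smul (k * coord a j) (unit_vec i)"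

fun content :: "mat \<Rightarrow> int" where
  "content (x, y, z, t) = gcd (gcd (gcd x y) z) t"

lemma dvd_content_iff: "q dvd content a \<longleftrightarrow> dvd_vec q a"
  by (cases a) auto

lemma content_nonneg [simp]: "content a \<ge> 0"
  by (cases a) simp

lemma content_zero_iff: "content a = 0 \<longleftrightarrow> a = 0"
  by (cases a) (auto simp: zero_prod_def)

lemma content_smul: "content (smul k a) = \<bar>k\<bar> * content a"
proof -
  have *: "gcd (\<bar>k\<bar> * m) (k * n) = \<bar>k\<bar> * gcd m n" for m n
    by (cases "k \<ge> 0") (auto simp: gcd_mult_left abs_mult)
  show ?thesis by (cases a) (simp add: gcd_mult_left abs_mult *)
qed

text \<open>Euclid's algorithm by shears alone, for any transitive relation containing them; even
  the final change of sign of \<open>x\<close> is a product of shears.\<close>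

lemma euclid_pair:
  fixes R :: "int \<times> int \<Rightarrow> int \<times> int \<Rightarrow> bool"
  assumes trans: "\<And>p q r. R p q \<Longrightarrow> R q r \<Longrightarrow> R p r"
    and s1: "\<And>x y k. R (x, y) (x + k * y, y)" and s2: "\<And>x y k. R (x, y) (x, y + k * x)"
  shows "R (x, y) (gcd x y, 0)"
proof (induction "nat \<bar>y\<bar>" arbitrary: x y rule: less_induct)
  case less
  show ?case
  proof (cases "y = 0")
    case True
    show ?thesis
    proof (cases "x \<ge> 0")
      case True
      then show ?thesis using s1[of x 0 0] \<open>y = 0\<close> by simp
    next
      case False
      have "R (x, 0) (x, - x)" using s2[of x 0 "- 1"] by simp
      moreover have "R (x, - x) (- x, - x)" using s1[of x "- x" 2] by simp
      moreover have "R (- x, - x) (- x, 0)" using s2[of "- x" "- x" "- 1"] by simp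
      ultimately have "R (x, 0) (- x, 0)" using trans by blast
      then show ?thesis using False \<open>y = 0\<close> by simp
    qed
  next
    case False
    let ?r = "x mod y"
    have "R (x, y) (?r, y)" using s1[of x y "- (x div y)"] by (simp add: minus_div_mult_eq_mod)
    moreover have "R (?r, y) (?r + y, y)" using s1[of ?r y 1] by simp
    moreover have "R (?r + y, y) (?r + y, - ?r)" using s2[of "?r + y" y "- 1"] by simp
    moreover have "R (?r + y, - ?r) (y, - ?r)" using s1[of "?r + y" "- ?r" 1] by simp
    moreover have "R (y, - ?r) (gcd y (- ?r), 0)"
      by (rule less) (use False abs_mod_less[of y x] in auto)
    moreover have "gcd y (- ?r) = gcd x y" by (simp add: gcd_red_int[symmetric] gcd.commute)
    ultimately show ?thesis using trans by metis
  qed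
qed

text \<open>Let \<open>a\<close> be the product of the primes dividing \<open>n\<close> but not
  \<open>x\<close>. Then each prime factor of \<open>n\<close> divides exactly one of
  \<open>x\<close> and \<open>a * y\<close>.\<close>

lemma coprime_shift:
  fixes n x y :: int
  assumes "n \<noteq> 0" "gcd (gcd n x) y = 1"
  shows "\<exists>a. coprime n (x + a * y)"
proof -
  define a where "a = \<Prod>{p \<in> prime_factors n. \<not> p dvd x}"
  have fin: "finite {p \<in> prime_factors n. \<not> p dvd x}" by simp
  have "coprime n (x + a * y)"
  proof (rule ccontr)
    assume "\<not> coprime n (x + a * y)"
    then have "\<not> is_unit (gcd n (x + a * y))" by (simp only: is_unit_gcd not_False_eq_True)
    moreover have "gcd n (x + a * y) \<noteq> 0" using assms(1) by simp
    ultimately obtain p where "p dvd gcd n (x + a * y)" "Factorial_Ring.prime p"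
      using prime_divisor_exists by blast
    then have p: "Factorial_Ring.prime p" "p dvd n" "p dvd x + a * y" by simp_all
    have pn: "p \<in> prime_factors n" using p assms(1) by (simp add: in_prime_factors_iff)
    show False
    proof (cases "p dvd x")
      case True
      then have "p dvd a * y" using p(3) by (simp add: dvd_add_right_iff)
      moreover have "\<not> p dvd y"
      proof
        assume "p dvd y"
        then have "p dvd gcd (gcd n x) y" using True p(2) by simp
        then have "is_unit p" by (simp only: assms(2))
        then show False using p(1) not_prime_unit by blast
      qed
      ultimately have "p dvd a" using p(1) by (simp add: prime_dvd_mult_iff)
      then obtain p' where "p' \<in> prime_factors n" "\<not> p' dvd x" "p dvd p'"
        using prime_dvd_prod_iff[OF fin p(1), of "\<lambda>p. p"] by (auto simp: a_def)
      moreover from this have "p = p'" by (intro primes_dvd_imp_eq[OF p(1)]) auto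
      ultimately show False using True by blast
    next
      case False
      then have "p dvd a" unfolding a_def using pn fin dvd_prodI[of "{p \<in> prime_factors n. \<not> p dvd x}" p "\<lambda>p. p"] by simp
      then have "p dvd x" using p(3) by (simp add: dvd_add_left_iff)
      with False show False by blast
    qed
  qed
  then show ?thesis by blast
qed

text \<open>Only shears by multiples of \<open>m\<close> are available, so Euclid's algorithm cannot
  be used. Instead the third coordinate is changed until the first three are coprime; a combination
  of them overwrites the fourth by \<open>m\<close>, which repairs the first coordinate to 1, and
  the 1 clears everything else.\<close>

lemma reach_unit_vec:
  fixes m s :: int and R :: "mat \<Rightarrow> mat \<Rightarrow> bool"
  assumes trans: "\<And>p q r. R p q \<Longrightarrow> R q r \<Longrightarrow> R p r"
    and step: "\<And>i j k a. i < 4 \<Longrightarrow> j < 4 \<Longrightarrow> i \<noteq> j \<Longrightarrow> R a (elem i j (m * k) a)"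
    and m: "m \<ge> 2" and b: "content b = 1" "dvd_vec (m * m) (b - unit_vec 0)"
  shows "R b (unit_vec 0)"
proof -
  obtain x y z t where xyzt: "b = (x, y, z, t)" by (cases b)
  have dvd: "m * m dvd x - 1" "m * m dvd y" "m * m dvd z" "m * m dvd t"
    using b(2) by (simp_all add: xyzt unit_vec_def)
  obtain s where s: "x = 1 + m * m * s" using dvd(1) by (metis add_diff_cancel_left' dvdE diff_add_cancel add.commute)
  have "m dvd y" "m dvd z" "m dvd t" using dvd by (auto intro: dvd_mult_left)
  then obtain y' z' t' where yzt: "y = m * y'" "z = m * z'" "t = m * t'" by (elim dvdE)
  have cop_m: "coprime x m"
  proof -
    have "gcd m ((m * s) * m + 1) = 1" by (simp only: gcd_add_mult) simp
    then have "coprime m ((m * s) * m + 1)" by (rule gcd_eq_1_imp_coprime)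
    then have "coprime (1 + m * (m * s)) m"
      by (simp add: coprime_commute algebra_simps)
    then show ?thesis by (simp add: s mult.assoc)
  qed
  have "x \<noteq> 0"
  proof
    assume "x = 0"
    then show False using cop_m m by simp
  qed
  then have f: "gcd x y \<noteq> 0" by simp
  have "gcd (gcd (gcd x y) z) (m * t) = 1"
  proof -
    have "gcd (gcd (gcd x y) z) t = 1" using b(1) by (simp add: xyzt)
    then have "coprime (gcd (gcd x y) z) t" by (rule gcd_eq_1_imp_coprime)
    moreover have "coprime (gcd (gcd x y) z) m"
      by (rule coprime_divisors[OF dvd_trans[OF gcd_dvd1 gcd_dvd1] dvd_refl cop_m])
    ultimately have "coprime (gcd (gcd x y) z) (m * t)" by simp
    then show ?thesis by (rule coprime_imp_gcd_eq_1)
  qed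
  \<comment> \<open>After replacing \<open>z\<close> by \<open>w\<close> the first three coordinates
    have gcd 1, so \<open>t\<close> may be overwritten.\<close>
  from coprime_shift[OF f this] obtain c where c: "coprime (gcd x y) (z + c * (m * t))" by blast
  define w where "w = z + c * (m * t)"
  have "gcd (gcd x y) w = 1" unfolding w_def using c by (rule coprime_imp_gcd_eq_1)
  then obtain f1 f2 where f12: "f1 * gcd x y + f2 * w = 1"
    using bezout_int[of "gcd x y" w] by (elim exE) simp
  obtain g1 g2 where g12: "g1 * x + g2 * y = gcd x y" using bezout_int[of x y] by blast
  have bez: "f1 * g1 * x + f1 * g2 * y + f2 * w = 1"
    using f12 g12[symmetric] by (simp add: algebra_simps)
  have w: "w = m * (z' + c * t)" by (simp add: w_def yzt algebra_simps)
  have el: "R (x1, x2, x3, x4) (x1 + m * k * coord (x1, x2, x3, x4) j, x2, x3, x4)" if "j < 4" "j \<noteq> 0" for x1 x2 x3 x4 k j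
    using step[of 0 j "(x1, x2, x3, x4)" k] that by (simp add: elem_def unit_vec_def)
  have e2: "R (x1, x2, x3, x4) (x1, x2 + m * k * x1, x3, x4)" for x1 x2 x3 x4 k
    using step[of 1 0 "(x1, x2, x3, x4)" k] by (simp add: elem_def unit_vec_def)
  have e3: "R (x1, x2, x3, x4) (x1, x2, x3 + m * k * coord (x1, x2, x3, x4) j, x4)" if "j < 4" "j \<noteq> 2" for x1 x2 x3 x4 k j
    using step[of 2 j "(x1, x2, x3, x4)" k] that by (simp add: elem_def unit_vec_def)
  have e4: "R (x1, x2, x3, x4) (x1, x2, x3, x4 + m * k * coord (x1, x2, x3, x4) j)" if "j < 4" "j \<noteq> 3" for x1 x2 x3 x4 k j
    using step[of 3 j "(x1, x2, x3, x4)" k] that by (simp add: elem_def unit_vec_def)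
  have 1: "R (x, y, z, t) (x, y, w, t)"
    using e3[of 3 x y z t c] by (simp add: w_def algebra_simps)
  \<comment> \<open>Chosen so that \<open>t + m * k = m\<close>; the Bezout combination equal to 1
    is added \<open>m * k\<close> times.\<close>
  define k where "k = 1 - t'"
  define t2 where "t2 = t + m * (k * (f1 * g1)) * x"
  define t3 where "t3 = t2 + m * (k * (f1 * g2)) * y"
  have 2: "R (x, y, w, t) (x, y, w, t2)" using e4[of 0 x y w t "k * (f1 * g1)"] by (simp add: t2_def)
  have 3: "R (x, y, w, t2) (x, y, w, t3)" using e4[of 1 x y w t2 "k * (f1 * g2)"] by (simp add: t3_def)
  have 4: "R (x, y, w, t3) (x, y, w, m)"
  proof -
    have "t3 + m * (k * f2) * w = t + m * k * (f1 * g1 * x + f1 * g2 * y + f2 * w)"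
      by (simp add: t3_def t2_def algebra_simps)
    also have "\<dots> = m" by (simp only: bez) (simp add: k_def yzt algebra_simps)
    finally show ?thesis using e4[of 2 x y w t3 "k * f2"] by simp
  qed
  \<comment> \<open>Here the congruence modulo \<open>m * m\<close> is used: \<open>x - 1\<close> is
    a multiple of \<open>m\<close> times the fourth coordinate \<open>m\<close>.\<close>
  have 5: "R (x, y, w, m) (1, y, w, m)"
  proof -
    have "x + m * (- s) * m = 1" by (simp add: s)
    then show ?thesis using el[of 3 x y w m "- s"] by simp
  qed
  have 6: "R (1, y, w, m) (1, 0, w, m)" using e2[of 1 y w m "- y'"] by (simp add: yzt)
  have 7: "R (1, 0, w, m) (1, 0, 0, m)" using e3[of 0 1 0 w m "- (z' + c * t)"] by (simp add: w algebra_simps)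
  have 8: "R (1, 0, 0, m) (1, 0, 0, 0)" using e4[of 0 1 0 0 m "- 1"] by simp
  have "(1, 0, 0, 0) = unit_vec 0" by (simp add: unit_vec_def)
  with trans[OF 1 trans[OF 2 trans[OF 3 trans[OF 4 trans[OF 5 trans[OF 6 trans[OF 7 8]]]]]]]
  show ?thesis by (simp add: xyzt)
qed

lemma reach_content:
  fixes R :: "mat \<Rightarrow> mat \<Rightarrow> bool"
  assumes trans: "\<And>p q r. R p q \<Longrightarrow> R q r \<Longrightarrow> R p r"
    and step: "\<And>i j k a. i < 4 \<Longrightarrow> j < 4 \<Longrightarrow> i \<noteq> j \<Longrightarrow> R a (elem i j k a)"
  shows "R a (smul (content a) (unit_vec 0))"
proof -
  obtain x y z t where a: "a = (x, y, z, t)" by (cases a)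
  have 1: "R (x, y, z, t) (gcd x y, 0, z, t)"
  proof -
    let ?R = "\<lambda>(x, y) (x', y'). R (x, y, z, t) (x', y', z, t)"
    have "?R (x, y) (gcd x y, 0)"
    proof (rule euclid_pair[where R = ?R])
      fix p q r :: "int \<times> int"
      assume "?R p q" "?R q r"
      then show "?R p r" unfolding split_beta by (rule trans)
    next
      fix x y k :: int
      show "?R (x, y) (x + k * y, y)" using step[of 0 1 "(x, y, z, t)" k] by (simp add: elem_def unit_vec_def)
      show "?R (x, y) (x, y + k * x)" using step[of 1 0 "(x, y, z, t)" k] by (simp add: elem_def unit_vec_def)
    qed
    then show ?thesis by simp
  qed
  have 2: "R (gcd x y, 0, z, t) (gcd (gcd x y) z, 0, 0, t)"
  proof -
    let ?R = "\<lambda>(x, y) (x', y'). R (x, 0, y, t) (x', 0, y', t)"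
    have "?R (gcd x y, z) (gcd (gcd x y) z, 0)"
    proof (rule euclid_pair[where R = ?R])
      fix p q r :: "int \<times> int"
      assume "?R p q" "?R q r"
      then show "?R p r" unfolding split_beta by (rule trans)
    next
      fix x y k :: int
      show "?R (x, y) (x + k * y, y)" using step[of 0 2 "(x, 0, y, t)" k] by (simp add: elem_def unit_vec_def)
      show "?R (x, y) (x, y + k * x)" using step[of 2 0 "(x, 0, y, t)" k] by (simp add: elem_def unit_vec_def)
    qed
    then show ?thesis by simp
  qed
  have 3: "R (gcd (gcd x y) z, 0, 0, t) (gcd (gcd (gcd x y) z) t, 0, 0, 0)"
  proof -
    let ?R = "\<lambda>(x, y) (x', y'). R (x, 0, 0, y) (x', 0, 0, y')"
    have "?R (gcd (gcd x y) z, t) (gcd (gcd (gcd x y) z) t, 0)"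
    proof (rule euclid_pair[where R = ?R])
      fix p q r :: "int \<times> int"
      assume "?R p q" "?R q r"
      then show "?R p r" unfolding split_beta by (rule trans)
    next
      fix x y k :: int
      show "?R (x, y) (x + k * y, y)" using step[of 0 3 "(x, 0, 0, y)" k] by (simp add: elem_def unit_vec_def)
      show "?R (x, y) (x, y + k * x)" using step[of 3 0 "(x, 0, 0, y)" k] by (simp add: elem_def unit_vec_def)
    qed
    then show ?thesis by simp
  qed
  have "R a (gcd (gcd (gcd x y) z) t, 0, 0, 0)" unfolding a by (rule trans[OF 1 trans[OF 2 3]])
  then show ?thesis by (simp add: a unit_vec_def)
qed

section \<open>Subgroups of finite index\<close>

definition fin_normal :: "('a, 'b) monoid_scheme \<Rightarrow> 'a set \<Rightarrow> bool" where
  "fin_normal G U \<longleftrightarrow> U \<lhd> G \<and> finite (rcosets\<^bsub>G\<^esub> U)"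

lemma (in group) finite_rcosets_if:
  assumes "subgroup H G" "finite (\<phi> ` carrier G)"
    and "\<And>u v. u \<in> carrier G \<Longrightarrow> v \<in> carrier G \<Longrightarrow> \<phi> u = \<phi> v \<Longrightarrow> u \<otimes> inv v \<in> H"
  shows "finite (rcosets H)"
proof -
  define f where "f c = H #> (SOME x. x \<in> carrier G \<and> \<phi> x = c)" for c
  have "rcosets H \<subseteq> f ` \<phi> ` carrier G"
  proof
    fix c assume "c \<in> rcosets H"
    then obtain x where x: "x \<in> carrier G" "c = H #> x" by (auto simp: RCOSETS_def)
    define y where "y = (SOME y. y \<in> carrier G \<and> \<phi> y = \<phi> x)"
    have y: "y \<in> carrier G" "\<phi> y = \<phi> x"
      using someI[of "\<lambda>y. y \<in> carrier G \<and> \<phi> y = \<phi> x" x] x by (auto simp: y_def)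
    have "H #> x = H #> y"
    proof -
      have "x \<otimes> inv y \<in> H" using assms(3) x y by simp
      then have "x \<in> H #> y"
        using x y by (auto simp: r_coset_def intro!: bexI[of _ "x \<otimes> inv y"] simp: m_assoc)
      then show ?thesis using repr_independence[OF _ y(1) assms(1)] by simp
    qed
    then have "c = f (\<phi> x)" by (simp add: f_def y_def x(2))
    then show "c \<in> f ` \<phi> ` carrier G" using x by blast
  qed
  then show ?thesis using assms(2) finite_subset by blast
qed

lemma (in group) rcoset_eq_imp:
  assumes "subgroup H G" "u \<in> carrier G" "v \<in> carrier G" "H #> u = H #> v"
  shows "u \<otimes> inv v \<in> H"
proof -
  have "u \<in> H #> v" using rcos_self[OF assms(2,1)] assms(4) by simp
  then show ?thesis using assms subgroup.subset by (fastforce simp: r_coset_def m_assoc)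
qed

lemma (in group) fin_normal_Int:
  assumes "fin_normal G U" "fin_normal G V"
  shows "fin_normal G (U \<inter> V)"
proof -
  have UV: "U \<lhd> G" "V \<lhd> G" using assms by (auto simp: fin_normal_def)
  then have sub: "subgroup U G" "subgroup V G" by (auto intro: normal_imp_subgroup)
  have N: "U \<inter> V \<lhd> G" using normal_inv_iff UV sub by (auto intro: subgroups_Inter_pair)
  have "(\<lambda>w. (U #> w, V #> w)) ` carrier G \<subseteq> (rcosets U) \<times> (rcosets V)"
    by (auto simp: RCOSETS_def)
  then have "finite ((\<lambda>w. (U #> w, V #> w)) ` carrier G)"
    by (rule finite_subset) (use assms in \<open>simp add: fin_normal_def\<close>)
  then have "finite (rcosets (U \<inter> V))"
    by (rule finite_rcosets_if[rotated]) (use N sub rcoset_eq_imp in \<open>auto intro: normal_imp_subgroup\<close>)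
  with N show ?thesis by (simp add: fin_normal_def)
qed

lemma act_image:
  assumes bij: "\<And>i. bij (g i)" and S: "\<And>i. i < n \<Longrightarrow> g i ` S = S" and w: "w \<in> words n" and y: "y \<in> S"
  shows "act g w y \<in> S"
  using w
proof (induction w)
  case (Cons a w)
  then have "act g w y \<in> S" "g (fst a) ` S = S" using S by auto
  then have "inv_into UNIV (g (fst a)) (act g w y) \<in> S" "g (fst a) (act g w y) \<in> S"
    using bij[of "fst a"] by (metis bij_is_inj imageE inv_f_f, blast)
  then show ?case by (simp add: act_letter_def)
qed (use y in simp)

lemma fin_normal_act:
  assumes bij: "\<And>i. bij (g i)" and S: "\<And>i. i < n \<Longrightarrow> g i ` S = S" and fin: "finite S"
  shows "fin_normal (free_group n) {w \<in> carrier (free_group n). \<forall>y\<in>S. act g w y = y}"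
proof -
  interpret F: group "free_group n" by (rule group_free_group)
  let ?U = "{w \<in> carrier (free_group n). \<forall>y\<in>S. act g w y = y}"
  note ar = act_reduce[of g, OF bij] and ai = act_inv_word[of g, OF bij]
  have cl: "act g w y \<in> S" if "w \<in> carrier (free_group n)" "y \<in> S" for w y
    by (rule act_image[where n = n]) (use bij S that in \<open>auto simp: carrier_free_group\<close>)
  have inv_cl: "inv_word w \<in> carrier (free_group n)" if "w \<in> carrier (free_group n)" for w
    using F.inv_closed[OF that] by (simp add: inv_free_group that)
  have sub: "subgroup ?U (free_group n)"
  proof (rule F.subgroupI)
    show "?U \<noteq> {}" using F.one_closed by force
    fix u assume u: "u \<in> ?U"
    then have "act g (inv_word u) y = y" if "y \<in> S" for y using ai(1)[of u y] that by simp
    then show "inv\<^bsub>free_group n\<^esub> u \<in> ?U" using u inv_cl by (simp add: inv_free_group)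
    fix v assume "v \<in> ?U"
    with u show "u \<otimes>\<^bsub>free_group n\<^esub> v \<in> ?U" using F.m_closed[of u v] by (simp add: ar)
  qed auto
  have N: "?U \<lhd> free_group n"
    unfolding F.normal_inv_iff
  proof (intro conjI ballI sub)
    fix w u assume w: "w \<in> carrier (free_group n)" and u: "u \<in> ?U"
    have "w \<otimes>\<^bsub>free_group n\<^esub> u \<otimes>\<^bsub>free_group n\<^esub> inv\<^bsub>free_group n\<^esub> w \<in> carrier (free_group n)"
      using w u by (intro F.m_closed F.inv_closed) auto
    moreover have "act g (w \<otimes>\<^bsub>free_group n\<^esub> u \<otimes>\<^bsub>free_group n\<^esub> inv\<^bsub>free_group n\<^esub> w) y = y" if "y \<in> S" for y
    proof -
      have "act g u (act g (inv_word w) y) = act g (inv_word w) y"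
        using cl[OF inv_cl[OF w] that] u by blast
      then show ?thesis using w by (simp add: inv_free_group ar ai)
    qed
    ultimately show "w \<otimes>\<^bsub>free_group n\<^esub> u \<otimes>\<^bsub>free_group n\<^esub> inv\<^bsub>free_group n\<^esub> w \<in> ?U" by simp
  qed
  have "(\<lambda>w. restrict (act g w) S) ` carrier (free_group n) \<subseteq> S \<rightarrow>\<^sub>E S" using cl by auto
  then have "finite ((\<lambda>w. restrict (act g w) S) ` carrier (free_group n))"
    by (rule finite_subset) (simp add: finite_PiE fin)
  then have "finite (rcosets\<^bsub>free_group n\<^esub> ?U)"
  proof (rule F.finite_rcosets_if[OF sub])
    fix u v assume uv: "u \<in> carrier (free_group n)" "v \<in> carrier (free_group n)"
      and eq: "restrict (act g u) S = restrict (act g v) S"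
    have "act g u (act g (inv_word v) y) = y" if "y \<in> S" for y
    proof -
      have "act g (inv_word v) y \<in> S" using cl inv_cl uv that by blast
      then have "act g u (act g (inv_word v) y) = act g v (act g (inv_word v) y)"
        using fun_cong[OF eq, of "act g (inv_word v) y"] by simp
      then show ?thesis by (simp add: ai)
    qed
    moreover have "u \<otimes>\<^bsub>free_group n\<^esub> inv\<^bsub>free_group n\<^esub> v \<in> carrier (free_group n)" using uv F.inv_closed F.m_closed by blast
    ultimately show "u \<otimes>\<^bsub>free_group n\<^esub> inv\<^bsub>free_group n\<^esub> v \<in> ?U" using uv by (simp add: inv_free_group ar)
  qed
  with N show ?thesis by (simp add: fin_normal_def)
qed

text \<open>The count is taken modulo 3, the least modulus in which the values \<open>1\<close>, \<open>- 1\<close> and \<open>0\<close> on the edges of a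
  simple cycle stay distinct.\<close>

definition edge_count :: "(nat \<Rightarrow> nat \<times> bool) \<Rightarrow> (nat \<Rightarrow> 'v) \<Rightarrow> nat \<Rightarrow> 'v \<Rightarrow> nat \<times> bool \<Rightarrow> 3" where
  "edge_count G V M v s = (\<Sum>i<M. of_bool (V i = v \<and> G i = s) - of_bool (V (Suc i) = v \<and> inv_letter (G i) = s))"

definition simple_cycle :: "(nat \<Rightarrow> 'v \<Rightarrow> 'v) \<Rightarrow> (nat \<Rightarrow> nat \<times> bool) \<Rightarrow> (nat \<Rightarrow> 'v) \<Rightarrow> nat \<Rightarrow> bool" where
  "simple_cycle g G V M \<longleftrightarrow> M > 0 \<and> (\<forall>i. V (Suc i) = act_letter g (G i) (V i)) \<and>
    (\<forall>i j. V i = V j \<longleftrightarrow> i mod M = j mod M) \<and> (\<forall>i. G (i mod M) = G i) \<and> (\<forall>i. G (Suc i) \<noteq> inv_letter (G i))"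

lemma sum_of_bool_le_1:
  fixes p :: "nat \<Rightarrow> bool"
  assumes "\<And>i j. i < M \<Longrightarrow> j < M \<Longrightarrow> p i \<Longrightarrow> p j \<Longrightarrow> i = j"
  shows "(\<Sum>i<M. of_bool (p i) :: 3) = of_bool (\<exists>i<M. p i)"
proof (cases "\<exists>i<M. p i")
  case True
  then obtain i where i: "i < M" "p i" by blast
  have "(\<Sum>j<M. of_bool (p j) :: 3) = (\<Sum>j<M. if j = i then 1 else 0)"
    using assms i by (intro sum.cong) auto
  also have "\<dots> = 1" using i by (subst sum.delta) auto
  finally show ?thesis using True by simp
qed auto

text \<open>Distinct vertices allow each edge to be used at most once in a direction, and use in
  both directions would put a letter next to its inverse. So the two sums are 0 or 1 and not both
  1.\<close>

lemma edge_count_eq_1_iff: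
  assumes "simple_cycle g G V M"
  shows "edge_count G V M v s = 1 \<longleftrightarrow> (\<exists>i. V i = v \<and> G i = s)"
proof -
  have M: "M > 0" and V: "\<And>i j. V i = V j \<longleftrightarrow> i mod M = j mod M" and G: "\<And>i. G (i mod M) = G i"
    and red: "\<And>i. G (Suc i) \<noteq> inv_letter (G i)"
    using assms by (auto simp: simple_cycle_def)
  let ?p = "\<lambda>i. V i = v \<and> G i = s" and ?q = "\<lambda>i. V (Suc i) = v \<and> inv_letter (G i) = s"
  have "(\<Sum>i<M. of_bool (?p i) :: 3) = of_bool (\<exists>i<M. ?p i)"
  proof (rule sum_of_bool_le_1)
    fix i j assume "i < M" "j < M" "?p i" "?p j"
    then show "i = j" using V[of i j] by simp
  qed
  moreover have "(\<Sum>i<M. of_bool (?q i) :: 3) = of_bool (\<exists>i<M. ?q i)"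
  proof (rule sum_of_bool_le_1)
    fix i j assume "i < M" "j < M" "?q i" "?q j"
    then have "Suc i mod M = Suc j mod M" using V[of "Suc i" "Suc j"] by simp
    with \<open>i < M\<close> \<open>j < M\<close> show "i = j" by (auto simp: mod_Suc split: if_splits)
  qed
  moreover have "\<not> ((\<exists>i<M. ?p i) \<and> (\<exists>i<M. ?q i))"
  proof
    assume "(\<exists>i<M. ?p i) \<and> (\<exists>i<M. ?q i)"
    then obtain i j where "G i = inv_letter (G j)" "V i = V (Suc j)" by metis
    then have "i mod M = Suc j mod M" using V by blast
    then have "G i = G (Suc j)" using G[of i] G[of "Suc j"] by simp
    with \<open>G i = inv_letter (G j)\<close> red[of j] show False by simp
  qed
  moreover have "(\<exists>i<M. ?p i) \<longleftrightarrow> (\<exists>i. ?p i)"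
  proof
    assume "\<exists>i. ?p i"
    then obtain i where "?p i" ..
    then have "?p (i mod M)" using V[of "i mod M" i] G[of i] by simp
    then show "\<exists>i<M. ?p i" using M by (intro exI[of _ "i mod M"]) simp
  qed auto
  ultimately show ?thesis
    unfolding edge_count_def sum_subtractf by (cases "\<exists>i<M. ?p i"; cases "\<exists>i<M. ?q i") auto
qed

text \<open>The counts determine the directed edges, and each vertex of a simple cycle has one
  outgoing edge. Starting from a common edge the cycles therefore agree forever, that is, up to the
  rotation \<open>i0\<close>.\<close>

lemma simple_cycles_match:
  assumes c: "simple_cycle g G V M" and c': "simple_cycle g G' V' M'"
    and eq: "\<And>v s. edge_count G V M v s = edge_count G' V' M' v s"
  obtains i0 where "M = M'" "\<And>j. V (i0 + j) = V' j" "\<And>j. G (i0 + j) = G' j"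
proof -
  have V: "\<And>i j. V i = V j \<longleftrightarrow> i mod M = j mod M" "\<And>i. V (Suc i) = act_letter g (G i) (V i)" and G: "\<And>i. G (i mod M) = G i"
    and V': "\<And>i j. V' i = V' j \<longleftrightarrow> i mod M' = j mod M'" "\<And>i. V' (Suc i) = act_letter g (G' i) (V' i)"
    using c c' by (auto simp: simple_cycle_def)
  have ex: "\<exists>i. V i = V' j \<and> G i = G' j" for j
    using edge_count_eq_1_iff[OF c, of "V' j" "G' j"] edge_count_eq_1_iff[OF c', of "V' j" "G' j"] eq by auto
  obtain i0 where i0: "V i0 = V' 0" "G i0 = G' 0" using ex by blast
  have match: "V (i0 + j) = V' j \<and> G (i0 + j) = G' j" for j
  proof (induction j)
    case (Suc j)
    then have 1: "V (i0 + Suc j) = V' (Suc j)" using V V' by simp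
    obtain i where "V i = V' (Suc j)" "G i = G' (Suc j)" using ex by blast
    with 1 have "i mod M = (i0 + Suc j) mod M" using V(1)[of i "i0 + Suc j"] by simp
    then have "G i = G (i0 + Suc j)" using G[of i] G[of "i0 + Suc j"] by simp
    with 1 \<open>G i = G' (Suc j)\<close> show ?case by simp
  qed (use i0 in simp)
  have "M dvd j \<longleftrightarrow> M' dvd j" for j
  proof -
    have "M dvd j \<longleftrightarrow> V (i0 + j) = V (i0 + 0)"
      by (simp add: V(1) mod_eq_dvd_iff_nat)
    also have "\<dots> \<longleftrightarrow> V' j = V' 0" using match[of j] match[of 0] by simp
    also have "\<dots> \<longleftrightarrow> M' dvd j" using V' by (simp add: dvd_eq_mod_eq_0)
    finally show ?thesis .
  qed
  from this[of M] this[of M'] have "M = M'" by (simp add: dvd_antisym)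
  then show ?thesis using that match by blast
qed

text \<open>Realizes a group on the image of an injection. It brings finite quotients, and in the
  end \<open>K\<close> itself, to carriers of natural numbers.\<close>

definition transport :: "('a \<Rightarrow> 'b) \<Rightarrow> ('a, 'c) monoid_scheme \<Rightarrow> 'b monoid" where
  "transport f G = \<lparr>carrier = f ` carrier G,
     monoid.mult = (\<lambda>x y. f (inv_into (carrier G) f x \<otimes>\<^bsub>G\<^esub> inv_into (carrier G) f y)), one = f \<one>\<^bsub>G\<^esub>\<rparr>"

lemma transport_iso:
  assumes "group G" "inj_on f (carrier G)"
  shows "group (transport f G)" "f \<in> iso G (transport f G)"
proof -
  interpret G: group G by fact
  have inv: "inv_into (carrier G) f (f x) = x" if "x \<in> carrier G" for x
    using assms(2) that by simp
  have mult: "f x \<otimes>\<^bsub>transport f G\<^esub> f y = f (x \<otimes>\<^bsub>G\<^esub> y)" if "x \<in> carrier G" "y \<in> carrier G" for x y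
    using that by (simp add: transport_def inv)
  show "group (transport f G)"
  proof (rule groupI)
    show "\<one>\<^bsub>transport f G\<^esub> \<in> carrier (transport f G)" by (simp add: transport_def)
  next
    fix x y assume "x \<in> carrier (transport f G)" "y \<in> carrier (transport f G)"
    then obtain a b where "x = f a" "y = f b" "a \<in> carrier G" "b \<in> carrier G" by (auto simp: transport_def)
    then show "x \<otimes>\<^bsub>transport f G\<^esub> y \<in> carrier (transport f G)"
      using mult by (simp add: transport_def)
  next
    fix x y z assume "x \<in> carrier (transport f G)" "y \<in> carrier (transport f G)" "z \<in> carrier (transport f G)"
    then obtain a b c where "x = f a" "y = f b" "z = f c" "a \<in> carrier G" "b \<in> carrier G" "c \<in> carrier G"
      by (auto simp: transport_def)
    then show "x \<otimes>\<^bsub>transport f G\<^esub> y \<otimes>\<^bsub>transport f G\<^esub> z = x \<otimes>\<^bsub>transport f G\<^esub> (y \<otimes>\<^bsub>transport f G\<^esub> z)"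
      by (simp add: mult G.m_assoc)
  next
    fix x assume "x \<in> carrier (transport f G)"
    then obtain a where a: "x = f a" "a \<in> carrier G" by (auto simp: transport_def)
    have one: "\<one>\<^bsub>transport f G\<^esub> = f \<one>\<^bsub>G\<^esub>" by (simp add: transport_def)
    show "\<one>\<^bsub>transport f G\<^esub> \<otimes>\<^bsub>transport f G\<^esub> x = x" using a by (simp add: one mult)
    have "f (inv\<^bsub>G\<^esub> a) \<otimes>\<^bsub>transport f G\<^esub> x = \<one>\<^bsub>transport f G\<^esub>" using a by (simp add: one mult)
    moreover have "f (inv\<^bsub>G\<^esub> a) \<in> carrier (transport f G)" using a by (simp add: transport_def)
    ultimately show "\<exists>y\<in>carrier (transport f G). y \<otimes>\<^bsub>transport f G\<^esub> x = \<one>\<^bsub>transport f G\<^esub>" by blast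
  qed
  show "f \<in> iso G (transport f G)"
    unfolding iso_def
  proof (intro CollectI conjI homI)
    show "bij_betw f (carrier G) (carrier (transport f G))"
      using assms(2) by (simp add: bij_betw_def transport_def)
  qed (auto simp: mult, simp add: transport_def)
qed

lemma conjugate_iso:
  assumes "f \<in> iso G H" "group G" "group H" "x \<in> carrier G" "y \<in> carrier G"
  shows "conjugate H (f x) (f y) \<longleftrightarrow> conjugate G x y"
proof -
  interpret group_hom G H f using assms by (simp add: group_hom_def group_hom_axioms_def iso_def)
  have bij: "bij_betw f (carrier G) (carrier H)" using assms by (simp add: iso_def)
  have *: "f y = f g \<otimes>\<^bsub>H\<^esub> f x \<otimes>\<^bsub>H\<^esub> inv\<^bsub>H\<^esub> (f g) \<longleftrightarrow> y = g \<otimes>\<^bsub>G\<^esub> x \<otimes>\<^bsub>G\<^esub> inv\<^bsub>G\<^esub> g" if g: "g \<in> carrier G" for g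
  proof -
    have "f g \<otimes>\<^bsub>H\<^esub> f x \<otimes>\<^bsub>H\<^esub> inv\<^bsub>H\<^esub> (f g) = f (g \<otimes>\<^bsub>G\<^esub> x \<otimes>\<^bsub>G\<^esub> inv\<^bsub>G\<^esub> g)" using g assms(4) by simp
    then show ?thesis
      using inj_on_eq_iff[of f "carrier G" y "g \<otimes>\<^bsub>G\<^esub> x \<otimes>\<^bsub>G\<^esub> inv\<^bsub>G\<^esub> g"] bij g assms(4,5)
      by (simp only: bij_betw_def G.m_closed G.inv_closed)
  qed
  show ?thesis
  proof
    assume "conjugate H (f x) (f y)"
    then obtain h where "h \<in> carrier H" "f y = h \<otimes>\<^bsub>H\<^esub> f x \<otimes>\<^bsub>H\<^esub> inv\<^bsub>H\<^esub> h" by (auto simp: conjugate_def)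
    moreover from this obtain g where "g \<in> carrier G" "h = f g" using bij by (auto simp: bij_betw_def)
    ultimately show "conjugate G x y" using * by (auto simp: conjugate_def)
  next
    assume "conjugate G x y"
    then obtain g where g: "g \<in> carrier G" "y = g \<otimes>\<^bsub>G\<^esub> x \<otimes>\<^bsub>G\<^esub> inv\<^bsub>G\<^esub> g" by (auto simp: conjugate_def)
    then have "f y = f g \<otimes>\<^bsub>H\<^esub> f x \<otimes>\<^bsub>H\<^esub> inv\<^bsub>H\<^esub> (f g)" using * by blast
    then show "conjugate H (f x) (f y)" using g(1) by (auto simp: conjugate_def)
  qed
qed

lemma conjugacy_separable_iso:
  assumes "f \<in> iso G H" "group G" "group H" "conjugacy_separable G"
  shows "conjugacy_separable H"
  unfolding conjugacy_separable_def
proof (intro ballI impI)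
  fix x y assume xy: "x \<in> carrier H" "y \<in> carrier H" and nc: "\<not> conjugate H x y"
  obtain a b where ab: "a \<in> carrier G" "b \<in> carrier G" "x = f a" "y = f b"
    using assms(1) xy unfolding iso_def bij_betw_def by blast
  then have "\<not> conjugate G a b" using nc conjugate_iso[OF assms(1-3)] by simp
  then obtain M \<phi> where M: "group (M :: nat monoid)" "finite (carrier M)" "\<phi> \<in> hom G M" "\<not> conjugate M (\<phi> a) (\<phi> b)"
    using assms(4) ab(1,2) unfolding conjugacy_separable_def by blast
  let ?g = "inv_into (carrier G) f"
  have g: "?g \<in> iso H G" using group.iso_set_sym[OF assms(2,1)] .
  then have "\<phi> \<circ> ?g \<in> hom H M" using M(3) by (auto simp: iso_def intro: hom_compose)
  moreover have "?g x = a" "?g y = b" using ab assms(1) by (simp_all add: iso_def bij_betw_def)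
  ultimately show "\<exists>(M :: nat monoid) \<phi>. group M \<and> finite (carrier M) \<and> \<phi> \<in> hom H M \<and> \<not> conjugate M (\<phi> x) (\<phi> y)"
    using M by (intro exI[of _ M] exI[of _ "\<phi> \<circ> ?g"]) simp
qed

context group
begin

text \<open>This set is the preimage of the normal core of \<open>H\<close>; it has finite index as
  the kernel of right multiplication on the finitely many cosets of \<open>H\<close>.\<close>

lemma fin_normal_comap:
  assumes F: "group F" and \<iota>: "\<iota> \<in> hom F G" and H: "subgroup H G" "finite (rcosets H)"
  shows "fin_normal F {w \<in> carrier F. \<forall>x\<in>carrier G. x \<otimes> \<iota> w \<otimes> inv x \<in> H}"
proof -
  interpret F: group F by fact
  interpret \<iota>: group_hom F G \<iota> using F \<iota> by (simp add: group_hom_def group_hom_axioms_def)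
  interpret H: subgroup H G by fact
  let ?U = "{w \<in> carrier F. \<forall>x\<in>carrier G. x \<otimes> \<iota> w \<otimes> inv x \<in> H}"
  have prod: "x \<otimes> (u \<otimes> v) \<otimes> inv x = (x \<otimes> u \<otimes> inv x) \<otimes> (x \<otimes> v \<otimes> inv x)"
    if "x \<in> carrier G" "u \<in> carrier G" "v \<in> carrier G" for x u v
    using that by (simp add: m_assoc inv_solve_left)
  have sub: "subgroup ?U F"
  proof (rule F.subgroupI)
    have "\<one>\<^bsub>F\<^esub> \<in> ?U" by simp
    then show "?U \<noteq> {}" by blast
    fix u assume u: "u \<in> ?U"
    show "inv\<^bsub>F\<^esub> u \<in> ?U"
    proof (intro CollectI conjI ballI)
      fix x assume x: "x \<in> carrier G"
      then have "inv (x \<otimes> \<iota> u \<otimes> inv x) \<in> H" using u by auto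
      then show "x \<otimes> \<iota> (inv\<^bsub>F\<^esub> u) \<otimes> inv x \<in> H" using x u by (simp add: inv_mult_group m_assoc)
    qed (use u in simp)
    fix v assume v: "v \<in> ?U"
    show "u \<otimes>\<^bsub>F\<^esub> v \<in> ?U"
    proof (intro CollectI conjI ballI)
      fix x assume x: "x \<in> carrier G"
      then have "(x \<otimes> \<iota> u \<otimes> inv x) \<otimes> (x \<otimes> \<iota> v \<otimes> inv x) \<in> H" using u v by auto
      then show "x \<otimes> \<iota> (u \<otimes>\<^bsub>F\<^esub> v) \<otimes> inv x \<in> H" using prod x u v by simp
    qed (use u v in simp)
  qed auto
  have N: "?U \<lhd> F"
    unfolding F.normal_inv_iff
  proof (intro conjI ballI sub)
    fix w u assume w: "w \<in> carrier F" and u: "u \<in> ?U"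
    show "w \<otimes>\<^bsub>F\<^esub> u \<otimes>\<^bsub>F\<^esub> inv\<^bsub>F\<^esub> w \<in> ?U"
    proof (intro CollectI conjI ballI)
      fix x assume x: "x \<in> carrier G"
      then have "(x \<otimes> \<iota> w) \<otimes> \<iota> u \<otimes> inv (x \<otimes> \<iota> w) \<in> H" using w u by auto
      then show "x \<otimes> \<iota> (w \<otimes>\<^bsub>F\<^esub> u \<otimes>\<^bsub>F\<^esub> inv\<^bsub>F\<^esub> w) \<otimes> inv x \<in> H"
        using x w u by (simp add: inv_mult_group m_assoc)
    qed (use w u in simp)
  qed
  let ?\<phi> = "\<lambda>w. restrict (\<lambda>c. c #> \<iota> w) (rcosets H)"
  have "?\<phi> ` carrier F \<subseteq> rcosets H \<rightarrow>\<^sub>E rcosets H"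
  proof -
    have "c #> \<iota> w \<in> rcosets H" if w: "w \<in> carrier F" and c: "c \<in> rcosets H" for w c
    proof -
      obtain x where "x \<in> carrier G" "c = H #> x" using c by (auto simp: RCOSETS_def)
      then have "c #> \<iota> w = H #> (x \<otimes> \<iota> w)" "x \<otimes> \<iota> w \<in> carrier G"
        using w coset_mult_assoc[OF H.subset] by auto
      then show ?thesis by (auto simp: RCOSETS_def)
    qed
    then show ?thesis by auto
  qed
  then have "finite (?\<phi> ` carrier F)" by (rule finite_subset) (simp add: finite_PiE H)
  then have "finite (rcosets\<^bsub>F\<^esub> ?U)"
  proof (rule F.finite_rcosets_if[OF sub])
    fix u v assume u: "u \<in> carrier F" and v: "v \<in> carrier F" and eq: "?\<phi> u = ?\<phi> v"
    show "u \<otimes>\<^bsub>F\<^esub> inv\<^bsub>F\<^esub> v \<in> ?U"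
    proof (intro CollectI conjI ballI)
      fix x assume x: "x \<in> carrier G"
      then have "H #> x \<in> rcosets H" by (auto simp: RCOSETS_def)
      then have "(H #> x) #> \<iota> u = (H #> x) #> \<iota> v" using fun_cong[OF eq, of "H #> x"] by simp
      then have "H #> (x \<otimes> \<iota> u) = H #> (x \<otimes> \<iota> v)"
        using x u v coset_mult_assoc[OF H.subset] by simp
      then have "(x \<otimes> \<iota> u) \<otimes> inv (x \<otimes> \<iota> v) \<in> H"
        using x u v by (intro rcoset_eq_imp[OF H(1)]) auto
      then show "x \<otimes> \<iota> (u \<otimes>\<^bsub>F\<^esub> inv\<^bsub>F\<^esub> v) \<otimes> inv x \<in> H"
        using x u v by (simp add: inv_mult_group m_assoc)
    qed (use u v in simp)
  qed
  with N show ?thesis by (simp add: fin_normal_def)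
qed

text \<open>By the pigeonhole principle some power of \<open>x\<close> with positive exponent at
  most the index lies in \<open>H\<close>, and that exponent divides the factorial. Without
  normality the index itself might fail as exponent.\<close>

lemma pow_fact_in_subgroup:
  assumes H: "subgroup H G" "finite (rcosets H)" and x: "x \<in> carrier G"
  shows "x [^] (fact (card (rcosets H)) :: nat) \<in> H"
proof -
  interpret H: subgroup H G by fact
  let ?c = "card (rcosets H)"
  have "(\<lambda>i::nat. H #> x [^] i) ` {..?c} \<subseteq> rcosets H" using x by (auto simp: RCOSETS_def)
  then have "\<not> inj_on (\<lambda>i::nat. H #> x [^] i) {..?c}"
    using card_inj_on_le[OF _ _ H(2), of "\<lambda>i::nat. H #> x [^] i" "{..?c}"] by auto
  then obtain i j :: nat where ij: "i < j" "j \<le> ?c" "H #> x [^] i = H #> x [^] j"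
    unfolding inj_on_def by (metis atMost_iff linorder_neqE_nat)
  then have "x [^] j \<otimes> inv (x [^] i) \<in> H" using x by (intro rcoset_eq_imp[OF H(1)]) auto
  moreover have "x [^] j = x [^] (j - i) \<otimes> x [^] i" using x ij by (simp add: nat_pow_mult)
  ultimately have 1: "x [^] (j - i) \<in> H" using x by (simp add: m_assoc)
  have "j - i dvd fact ?c" using ij by (intro dvd_fact) auto
  then obtain k where "fact ?c = (j - i) * k" by blast
  then have "x [^] (fact ?c :: nat) = (x [^] (j - i)) [^] k" using x by (simp add: nat_pow_pow)
  also have "\<dots> \<in> H"
  proof (induction k)
    case (Suc k)
    then show ?case using 1 by simp
  qed simp
  finally show ?thesis .
qed

lemma conjugacy_separable_if:
  assumes "\<And>x y. x \<in> carrier G \<Longrightarrow> y \<in> carrier G \<Longrightarrow> \<not> conjugate G x y \<Longrightarrow>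
    \<exists>V. fin_normal G V \<and> (\<forall>k\<in>carrier G. k \<otimes> x \<otimes> inv k \<otimes> inv y \<notin> V)"
  shows "conjugacy_separable G"
  unfolding conjugacy_separable_def
proof (intro ballI impI)
  fix x y assume xy: "x \<in> carrier G" "y \<in> carrier G" and nc: "\<not> conjugate G x y"
  then obtain V where V: "fin_normal G V" and sep: "\<And>k. k \<in> carrier G \<Longrightarrow> k \<otimes> x \<otimes> inv k \<otimes> inv y \<notin> V"
    using assms by metis
  interpret V: normal V G using V by (simp add: fin_normal_def)
  interpret Q: group "G Mod V" by (rule V.factorgroup_is_group)
  have fin: "finite (carrier (G Mod V))" using V by (simp add: fin_normal_def FactGroup_def)
  obtain f :: "'a set \<Rightarrow> nat" where f: "inj_on f (carrier (G Mod V))"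
    using finite_imp_inj_to_nat_seg[OF fin] by blast
  define M where "M = transport f (G Mod V)"
  have M: "group M" "f \<in> iso (G Mod V) M" unfolding M_def using transport_iso[OF Q.is_group f] by auto
  let ?\<pi> = "(#>) V"
  interpret \<pi>: group_hom G "G Mod V" ?\<pi>
    using V.r_coset_hom_Mod by (simp add: group_hom_def group_hom_axioms_def is_group Q.is_group)
  have "finite (carrier M)" using fin by (simp add: M_def transport_def)
  moreover have "f \<circ> ?\<pi> \<in> hom G M" 
    using V.r_coset_hom_Mod M(2) unfolding iso_def hom_def
    by (auto simp: Pi_iff simp del: mult_FactGroup)
  moreover have "\<not> conjugate M ((f \<circ> ?\<pi>) x) ((f \<circ> ?\<pi>) y)"
  proof
    assume "conjugate M ((f \<circ> ?\<pi>) x) ((f \<circ> ?\<pi>) y)"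
    then have "conjugate (G Mod V) (?\<pi> x) (?\<pi> y)"
      using conjugate_iso[OF M(2) Q.is_group M(1)] xy by simp
    then obtain c where "c \<in> carrier (G Mod V)" "?\<pi> y = c \<otimes>\<^bsub>G Mod V\<^esub> ?\<pi> x \<otimes>\<^bsub>G Mod V\<^esub> inv\<^bsub>G Mod V\<^esub> c"
      by (auto simp: conjugate_def)
    then obtain k where k: "k \<in> carrier G" "?\<pi> y = ?\<pi> k \<otimes>\<^bsub>G Mod V\<^esub> ?\<pi> x \<otimes>\<^bsub>G Mod V\<^esub> inv\<^bsub>G Mod V\<^esub> (?\<pi> k)"
      by (auto simp: carrier_FactGroup)
    then have "V #> (k \<otimes> x \<otimes> inv k) = V #> y"
      using xy by (simp del: mult_FactGroup one_FactGroup)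
    then have "k \<otimes> x \<otimes> inv k \<otimes> inv y \<in> V"
      using k xy by (intro rcoset_eq_imp[OF V.subgroup_axioms]) auto
    with sep k show False by blast
  qed
  ultimately show "\<exists>(M :: nat monoid) \<phi>. group M \<and> finite (carrier M) \<and> \<phi> \<in> hom G M \<and> \<not> conjugate M (\<phi> x) (\<phi> y)"
    using M(1) by blast
qed

end

section \<open>Conjugacy in finite quotients of free groups\<close>

lemma cyclic_reduction:
  assumes "reduced w" "w \<noteq> []"
  shows "\<exists>a c. w = a @ c @ inv_word a \<and> c \<noteq> [] \<and> reduced (c @ c)"
  using assms
proof (induction w rule: length_induct)
  case (1 w)
  show ?case
  proof (cases "reduced (w @ w)")
    case True
    with 1 show ?thesis by (intro exI[of _ "[]"] exI[of _ w]) simp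
  next
    case False
    with 1 have last: "hd w = inv_letter (last w)"
      by (auto simp: reduced_def successively_append_iff)
    obtain s v where w: "w = s # v" using 1 by (cases w) auto
    have "v \<noteq> []" using last w by auto
    then obtain u t where v: "v = u @ [t]" by (metis append_butlast_last_id)
    have t: "t = inv_letter s" using last w v by simp
    have u: "reduced u" "u \<noteq> []" using 1 w v t by (auto simp: reduced_def successively_Cons successively_append_iff split: if_splits)
    then obtain a c where "u = a @ c @ inv_word a" "c \<noteq> []" "reduced (c @ c)" 
      using 1(1)[rule_format, of u] w v by auto
    then show ?thesis using w v t by (intro exI[of _ "s # a"] exI[of _ c]) auto
  qed
qed

text \<open>A skew product: the middle component counts, modulo 3, the signed traversals of the edge
  \<open>p\<close> (a vertex with a letter) while the first component moves. Turning the count into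
  a permutation action makes it visible in finite quotients of the free group.\<close>

definition skew :: "(nat \<Rightarrow> 'v \<Rightarrow> 'v) \<Rightarrow> nat \<Rightarrow> 'v \<times> 3 \<times> ('v \<times> (nat \<times> bool)) \<Rightarrow> 'v \<times> 3 \<times> ('v \<times> (nat \<times> bool))" where
  "skew g i = (\<lambda>(v, n, p). (g i v,
     n + of_bool (v = fst p \<and> (i, True) = snd p) - of_bool (g i v = fst p \<and> (i, False) = snd p), p))"

lemma bij_skew:
  assumes "\<And>i. bij (g i)"
  shows "bij (skew g i)"
proof (rule o_bij)
  let ?h = "inv_into UNIV (g i)"
  show "(\<lambda>(v, n, p). (?h v, n - of_bool (?h v = fst p \<and> (i, True) = snd p) + of_bool (v = fst p \<and> (i, False) = snd p), p)) \<circ> skew g i = id"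
    using assms[of i] by (auto simp: skew_def fun_eq_iff bij_is_inj)
  show "skew g i \<circ> (\<lambda>(v, n, p). (?h v, n - of_bool (?h v = fst p \<and> (i, True) = snd p) + of_bool (v = fst p \<and> (i, False) = snd p), p)) = id"
    using assms[of i] by (auto simp: skew_def fun_eq_iff bij_is_surj surj_f_inv_f)
qed

lemma act_letter_skew:
  assumes "\<And>i. bij (g i)"
  shows "act_letter (skew g) a (v, n, p) = (act_letter g a v,
    n + of_bool (v = fst p \<and> a = snd p) - of_bool (act_letter g a v = fst p \<and> inv_letter a = snd p), p)"
proof -
  obtain i e where a: "a = (i, e)" by (cases a)
  show ?thesis
  proof (cases e)
    case True
    then show ?thesis by (simp add: a act_letter_def skew_def inv_letter_def)
  next
    case False
    let ?h = "inv_into UNIV (g i)"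
    have "skew g i (?h v, n - of_bool (?h v = fst p \<and> (i, True) = snd p) + of_bool (v = fst p \<and> (i, False) = snd p), p) = (v, n, p)"
      using assms[of i] by (simp add: skew_def bij_is_surj surj_f_inv_f)
    then have "inv_into UNIV (skew g i) (v, n, p) = (?h v, n - of_bool (?h v = fst p \<and> (i, True) = snd p) + of_bool (v = fst p \<and> (i, False) = snd p), p)"
      by (metis assms bij_skew bij_is_inj inv_f_f)
    then show ?thesis using False by (simp add: a act_letter_def inv_letter_def algebra_simps)
  qed
qed

lemma act_skew_shift:
  assumes "\<And>i. bij (g i)" "act (skew g) w (v, n, p) = (v', n', p')"
  shows "act (skew g) w (v, n + t, p) = (v', n' + t, p')"
  using assms(2)
proof (induction w arbitrary: v' n' p')
  case (Cons a w)
  obtain v1 n1 p1 where 1: "act (skew g) w (v, n, p) = (v1, n1, p1)" by (cases "act (skew g) w (v, n, p)")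
  from Cons.IH[OF 1] Cons.prems 1 show ?case
    by (auto simp: act_letter_skew[OF assms(1)])
qed simp

lemma act_skew_fst:
  assumes "\<And>i. bij (g i)"
  shows "\<exists>m. act (skew g) w (v, n, p) = (act g w v, m, p)"
  by (induction w) (auto simp: act_letter_skew[OF assms])

definition path_word :: "(nat \<Rightarrow> nat \<times> bool) \<Rightarrow> nat \<Rightarrow> word" where
  "path_word G i = rev (map G [0..<i])"

lemma path_word_simps [simp]: "path_word G 0 = []" "path_word G (Suc i) = G i # path_word G i"
  "length (path_word G i) = i"
  by (simp_all add: path_word_def)

lemma path_word_add: "path_word G (i + j) = path_word (\<lambda>k. G (i + k)) j @ path_word G i"
  by (induction j) auto

lemma act_skew_path:
  assumes "\<And>i. bij (g i)" "\<And>i. V (Suc i) = act_letter g (G i) (V i)"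
  shows "act (skew g) (path_word G M) (V 0, n, p) = (V M, n + edge_count G V M (fst p) (snd p), p)"
  by (induction M) (auto simp: act_letter_skew[OF assms(1)] edge_count_def assms(2)[symmetric] algebra_simps)

lemma extend_injection:
  fixes f :: "nat \<Rightarrow> nat"
  assumes "finite S" "D \<subseteq> S" "inj_on f D" "f ` D \<subseteq> S"
  obtains h where "bij h" "h ` S = S" "\<And>x. x \<in> D \<Longrightarrow> h x = f x"
proof -
  have "card (S - D) = card (S - f ` D)"
    using assms by (simp add: card_Diff_subset finite_subset card_image)
  then obtain k where k: "bij_betw k (S - D) (S - f ` D)"
    using finite_same_card_bij[of "S - D" "S - f ` D"] assms by auto
  define h where "h x = (if x \<in> D then f x else if x \<in> S then k x else x)" for x
  have 1: "bij_betw h D (f ` D)"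
    using assms(3) by (simp add: h_def bij_betw_def inj_on_def)
  have 2: "bij_betw h (S - D) (S - f ` D)"
    by (rule bij_betw_cong[THEN iffD1, OF _ k]) (simp add: h_def)
  have 3: "bij_betw h S S"
    using bij_betw_combine[OF 1 2] assms by (simp add: Un_absorb1 Un_Diff_cancel)
  have 4: "bij_betw h (- S) (- S)"
    by (rule bij_betw_cong[THEN iffD1, OF _ bij_betw_id]) (use assms(2) in \<open>auto simp: h_def\<close>)
  have "bij h" using bij_betw_combine[OF 3 4] by simp
  moreover have "h ` S = S" using 3 by (simp add: bij_betw_def)
  moreover have "h x = f x" if "x \<in> D" for x using that by (simp add: h_def)
  ultimately show ?thesis using that by blast
qed

text \<open>Writing a cyclically reduced word around a cycle of length \<open>L\<close> prescribes a
  partial injection for each generator, since a conflict would be a letter next to its inverse;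
  partial injections of a finite set extend to permutations.\<close>

lemma cycle_permutation:
  assumes L: "L > 0" and per: "\<And>i. G (i mod L) = G i" and red: "\<And>i. G (Suc i) \<noteq> inv_letter (G i)"
  shows "\<exists>\<pi> :: nat \<Rightarrow> nat \<Rightarrow> nat. (\<forall>x. bij (\<pi> x) \<and> \<pi> x ` {..<L} = {..<L}) \<and>
    (\<forall>i. act_letter \<pi> (G i) (i mod L) = Suc i mod L)"
proof -
  define pr where "pr j = (j + L - 1) mod L" for j
  have pr_Suc: "pr (Suc j mod L) = j mod L" for j
  proof -
    have "pr (Suc j mod L) = (Suc j mod L + (L - 1)) mod L" using L by (simp add: pr_def)
    also have "\<dots> = (Suc j + (L - 1)) mod L" by (rule mod_add_left_eq)
    also have "\<dots> = j mod L" using L by simp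
    finally show ?thesis .
  qed
  have Suc_pr: "Suc (pr j) mod L = j mod L" for j
    using L by (simp add: pr_def mod_Suc_eq)
  have pr_less: "pr j < L" for j using L by (simp add: pr_def)
  have "\<exists>h. bij h \<and> h ` {..<L} = {..<L} \<and> (\<forall>j<L. G j = (x, True) \<longrightarrow> h j = Suc j mod L) \<and>
      (\<forall>j<L. G (pr j) = (x, False) \<longrightarrow> h j = pr j)" for x
  proof -
    define D where "D = {j. j < L \<and> (G j = (x, True) \<or> G (pr j) = (x, False))}"
    define f where "f j = (if G j = (x, True) then Suc j mod L else pr j)" for j
    have no: "G (pr j) \<noteq> (x, False)" if "G j = (x, True)" for j
    proof
      assume "G (pr j) = (x, False)"
      moreover have "G (Suc (pr j)) = G j" using per[of "Suc (pr j)"] per[of j] Suc_pr[of j] by simp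
      ultimately show False using red[of "pr j"] that by (simp add: inv_letter_def)
    qed
    have mixed: False if "G j = (x, True)" "G (pr j') = (x, False)" "Suc j mod L = pr j'" for j j'
    proof -
      have "G (Suc j) = (x, False)" using that per[of "Suc j"] by simp
      then show False using red[of j] that(1) by (simp add: inv_letter_def)
    qed
    have "inj_on f D"
    proof (rule inj_onI)
      fix j j' assume jj: "j \<in> D" "j' \<in> D" "f j = f j'"
      then have less: "j < L" "j' < L" by (auto simp: D_def)
      consider "G j = (x, True)" "G j' = (x, True)" | "G j \<noteq> (x, True)" "G j' \<noteq> (x, True)"
        | "G j = (x, True)" "G j' \<noteq> (x, True)" | "G j \<noteq> (x, True)" "G j' = (x, True)" by blast
      then show "j = j'"
      proof cases
        case 1
        then have "Suc j mod L = Suc j' mod L" using jj by (simp add: f_def)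
        then have "j mod L = j' mod L" using pr_Suc[of j] pr_Suc[of j'] by simp
        then show ?thesis using less by simp
      next
        case 2
        then have "pr j = pr j'" using jj by (simp add: f_def)
        then have "j mod L = j' mod L" using Suc_pr[of j] Suc_pr[of j'] by simp
        then show ?thesis using less by simp
      next
        case 3
        have eq: "Suc j mod L = pr j'" using jj(3) unfolding f_def if_P[OF 3(1)] if_not_P[OF 3(2)] .
        have "G (pr j') = (x, False)" using jj(2) 3(2) unfolding D_def by blast
        from mixed[OF 3(1) this eq] show ?thesis ..
      next
        case 4
        have eq: "pr j = Suc j' mod L" using jj(3) unfolding f_def if_P[OF 4(2)] if_not_P[OF 4(1)] .
        have "G (pr j) = (x, False)" using jj(1) 4(1) unfolding D_def by blast
        from mixed[OF 4(2) this eq[symmetric]] show ?thesis ..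
      qed
    qed
    moreover have "f ` D \<subseteq> {..<L}" 
    proof
      fix k assume "k \<in> f ` D"
      then obtain j where "k = f j" by blast
      then show "k \<in> {..<L}" using L pr_less[of j] by (cases "G j = (x, True)") (simp_all add: f_def)
    qed
    moreover have "D \<subseteq> {..<L}" by (auto simp: D_def)
    ultimately obtain h where h: "bij h" "h ` {..<L} = {..<L}" "\<And>j. j \<in> D \<Longrightarrow> h j = f j"
      using extend_injection[of "{..<L}" D f] by blast
    then show ?thesis using no by (intro exI[of _ h]) (auto simp: D_def f_def)
  qed
  then have "\<forall>x. \<exists>h. bij h \<and> h ` {..<L} = {..<L} \<and> (\<forall>j<L. G j = (x, True) \<longrightarrow> h j = Suc j mod L) \<and>
      (\<forall>j<L. G (pr j) = (x, False) \<longrightarrow> h j = pr j)" by (rule allI)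
  from choice[OF this] obtain \<pi> where \<pi>': "\<forall>x. bij (\<pi> x) \<and> \<pi> x ` {..<L} = {..<L} \<and> (\<forall>j<L. G j = (x, True) \<longrightarrow> \<pi> x j = Suc j mod L) \<and>
      (\<forall>j<L. G (pr j) = (x, False) \<longrightarrow> \<pi> x j = pr j)" ..
  have \<pi>: "bij (\<pi> x)" "\<pi> x ` {..<L} = {..<L}"
    "j < L \<Longrightarrow> G j = (x, True) \<Longrightarrow> \<pi> x j = Suc j mod L"
    "j < L \<Longrightarrow> G (pr j) = (x, False) \<Longrightarrow> \<pi> x j = pr j" for x j
    using \<pi>'[rule_format, of x] by blast+
  have "act_letter \<pi> (G i) (i mod L) = Suc i mod L" for i
  proof -
    obtain x e where G: "G i = (x, e)" by (cases "G i")
    show ?thesis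
    proof (cases e)
      case True
      then have "\<pi> x (i mod L) = Suc (i mod L) mod L" using L G per[of i] by (intro \<pi>(3)) auto
      with True G show ?thesis by (simp add: act_letter_def mod_Suc_eq)
    next
      case False
      then have "\<pi> x (Suc i mod L) = pr (Suc i mod L)" using L G per[of i] by (intro \<pi>(4)) (auto simp: pr_Suc)
      then have "\<pi> x (Suc i mod L) = i mod L" by (simp add: pr_Suc)
      then have "inv_into UNIV (\<pi> x) (i mod L) = Suc i mod L" using \<pi>(1)[of x] by (metis bij_is_inj inv_f_f)
      with False G show ?thesis by (simp add: act_letter_def)
    qed
  qed
  with \<pi>(1,2) show ?thesis by blast
qed

lemma (in group) pow_eq_iff_mod:
  assumes "x \<in> carrier G" "\<And>e::nat. x [^] e = \<one> \<longleftrightarrow> m dvd e"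
  shows "x [^] (a::nat) = x [^] (b::nat) \<longleftrightarrow> a mod m = b mod m"
proof -
  have *: "x [^] (a::nat) = x [^] (a + e) \<longleftrightarrow> a mod m = (a + e) mod m" for a e
  proof -
    have "x [^] a = x [^] (a + e) \<longleftrightarrow> x [^] e = \<one>"
      using assms(1) by (simp add: nat_pow_mult[symmetric])
    also have "\<dots> \<longleftrightarrow> m dvd e" by (rule assms(2))
    also have "\<dots> \<longleftrightarrow> (a + e) mod m = a mod m" by (simp add: mod_eq_dvd_iff_nat)
    finally show ?thesis by auto
  qed
  show ?thesis
  proof (cases "a \<le> b")
    case True
    then show ?thesis using *[of a "b - a"] by simp
  next
    case False
    then show ?thesis using *[of b "a - b"] by auto
  qed
qed

declare mult_FactGroup [simp del] one_FactGroup [simp del]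

section \<open>Cayley graphs of finite quotients\<close>

definition coset :: "nat \<Rightarrow> word set \<Rightarrow> word \<Rightarrow> word set" where
  "coset n U w = U #>\<^bsub>free_group n\<^esub> reduce w"

text \<open>Left multiplication in the quotient, extended by the identity to a bijection of the
  whole type, as the action of words requires.\<close>

definition coset_act :: "nat \<Rightarrow> word set \<Rightarrow> nat \<Rightarrow> word set \<Rightarrow> word set" where
  "coset_act n U i c = (if i < n \<and> c \<in> carrier (free_group n Mod U)
     then coset n U [(i, True)] \<otimes>\<^bsub>free_group n Mod U\<^esub> c else c)"

locale free_quotient =
  fixes n :: nat and U :: "word set"
  assumes N: "U \<lhd> free_group n"
begin

sublocale F: group "free_group n" by (rule group_free_group)

sublocale N: normal U "free_group n" by (rule N)

sublocale Q: group "free_group n Mod U" by (rule N.factorgroup_is_group)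

abbreviation "Q \<equiv> free_group n Mod U"

lemma coset_closed [simp]: "w \<in> words n \<Longrightarrow> coset n U w \<in> carrier Q"
  using reduce_in_carrier[of w n] by (auto simp: coset_def carrier_FactGroup)

lemma coset_append: "u \<in> words n \<Longrightarrow> v \<in> words n \<Longrightarrow> coset n U (u @ v) = coset n U u \<otimes>\<^bsub>Q\<^esub> coset n U v"
  using hom_mult[OF N.r_coset_hom_Mod, of "reduce u" "reduce v"]
  by (simp add: coset_def reduce_append_reduce_left reduce_append_reduce_right)

lemma coset_Nil: "coset n U [] = \<one>\<^bsub>Q\<^esub>"
  using hom_one[OF N.r_coset_hom_Mod F.is_group Q.is_group] by (simp add: coset_def)

lemma coset_inv_word: "w \<in> words n \<Longrightarrow> coset n U (inv_word w) = inv\<^bsub>Q\<^esub> (coset n U w)"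
proof -
  assume w: "w \<in> words n"
  have "reduce (inv_word w @ w) = []" by (simp add: inv_word_def reduce_inv_word)
  then have "coset n U (inv_word w @ w) = \<one>\<^bsub>Q\<^esub>" using coset_Nil by (simp add: coset_def)
  then show ?thesis using w by (simp add: coset_append Q.inv_equality)
qed

lemma coset_eq_one_iff: "w \<in> words n \<Longrightarrow> coset n U w = \<one>\<^bsub>Q\<^esub> \<longleftrightarrow> reduce w \<in> U"
proof -
  assume w: "w \<in> words n"
  then have "U #>\<^bsub>free_group n\<^esub> reduce w = U \<longleftrightarrow> reduce w \<in> U"
    using F.coset_join1[OF _ _ N.subgroup_axioms] F.coset_join2[OF _ N.subgroup_axioms] reduce_in_carrier by blast
  then show ?thesis unfolding coset_def by (simp add: FactGroup_def)
qed

lemma coset_replicate: "w \<in> words n \<Longrightarrow> coset n U (concat (replicate j w)) = coset n U w [^]\<^bsub>Q\<^esub> j"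
proof (induction j)
  case (Suc j)
  then show ?case
    using Q.nat_pow_Suc2[of "coset n U w" j] by (simp add: coset_append words_concat)
qed (simp add: coset_Nil)

lemma bij_coset_act: "bij (coset_act n U i)"
proof (cases "i < n")
  case True
  have x: "coset n U [(i, True)] \<in> carrier Q" using True by simp
  show ?thesis
  proof (rule o_bij)
    let ?h = "\<lambda>c. if c \<in> carrier Q then inv\<^bsub>Q\<^esub> (coset n U [(i, True)]) \<otimes>\<^bsub>Q\<^esub> c else c"
    show "?h \<circ> coset_act n U i = id"
      using x True by (auto simp: coset_act_def fun_eq_iff Q.m_assoc[symmetric])
    show "coset_act n U i \<circ> ?h = id"
      using x True by (auto simp: coset_act_def fun_eq_iff Q.m_assoc[symmetric])
  qed
next
  case False
  then have "coset_act n U i = id" by (auto simp: coset_act_def)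
  then show ?thesis by simp
qed

lemma act_letter_coset: "fst a < n \<Longrightarrow> c \<in> carrier Q \<Longrightarrow> act_letter (coset_act n U) a c = coset n U [a] \<otimes>\<^bsub>Q\<^esub> c"
proof -
  assume a: "fst a < n" and c: "c \<in> carrier Q"
  obtain i e where ie: "a = (i, e)" by (cases a)
  with a have x: "coset n U [(i, True)] \<in> carrier Q" by simp
  show ?thesis
  proof (cases e)
    case True
    then show ?thesis using a c by (simp add: ie act_letter_def coset_act_def)
  next
    case False
    have inv: "coset n U [a] = inv\<^bsub>Q\<^esub> (coset n U [(i, True)])"
      using coset_inv_word[of "[(i, True)]"] a False by (simp add: ie inv_letter_def)
    have "coset_act n U i (coset n U [a] \<otimes>\<^bsub>Q\<^esub> c) = c"
      unfolding inv using x c a by (simp add: coset_act_def ie Q.m_assoc[symmetric])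
    then have "inv_into UNIV (coset_act n U i) c = coset n U [a] \<otimes>\<^bsub>Q\<^esub> c"
      using bij_coset_act[of i] by (metis bij_is_inj inv_f_f)
    then show ?thesis using False by (simp add: ie act_letter_def)
  qed
qed

lemma act_coset: "w \<in> words n \<Longrightarrow> c \<in> carrier Q \<Longrightarrow> act (coset_act n U) w c = coset n U w \<otimes>\<^bsub>Q\<^esub> c"
proof (induction w)
  case (Cons a w)
  then have "coset n U (a # w) = coset n U [a] \<otimes>\<^bsub>Q\<^esub> coset n U w"
    using coset_append[of "[a]" w] by simp
  with Cons show ?case by (simp add: act_letter_coset Q.m_assoc)
qed (simp add: coset_Nil)

lemma coset_act_image: "i < n \<Longrightarrow> coset_act n U i ` carrier Q = carrier Q"
proof
  assume i: "i < n"
  then show "coset_act n U i ` carrier Q \<subseteq> carrier Q" by (auto simp: coset_act_def)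
  show "carrier Q \<subseteq> coset_act n U i ` carrier Q"
  proof
    fix c assume "c \<in> carrier Q"
    then show "c \<in> coset_act n U i ` carrier Q"
      using i by (intro image_eqI[of _ _ "inv\<^bsub>Q\<^esub> (coset n U [(i, True)]) \<otimes>\<^bsub>Q\<^esub> c"])
        (auto simp: coset_act_def Q.m_assoc[symmetric])
  qed
qed

end

text \<open>The letters of the powers of \<open>g\<close>, read from the right because the last
  letter of a word acts first.\<close>

definition periodic :: "word \<Rightarrow> nat \<Rightarrow> nat \<times> bool" where
  "periodic g i = rev g ! (i mod length g)"

lemma periodic_mod: "periodic g (i mod length g) = periodic g i"
  by (simp add: periodic_def)

lemma periodic_add: "periodic g (length g * j + i) = periodic g i"
  by (simp add: periodic_def)

lemma periodic_reduced:
  assumes "reduced (g @ g)" "g \<noteq> []"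
  shows "periodic g (Suc i) \<noteq> inv_letter (periodic g i)"
proof -
  let ?L = "length g"
  have L: "?L > 0" using assms by simp
  have adj: "(g @ g) ! Suc k \<noteq> inv_letter ((g @ g) ! k)" if "Suc k < 2 * ?L" for k
    using assms(1) that unfolding reduced_def successively_conv_nth by simp
  define r where "r = i mod ?L"
  have r: "r < ?L" using L by (simp add: r_def)
  define k where "k = 2 * ?L - 2 - r"
  have k: "Suc k < 2 * ?L" "Suc k = 2 * ?L - 1 - r" using r L by (auto simp: k_def)
  have 1: "(g @ g) ! Suc k = periodic g i"
    using r k by (simp add: periodic_def nth_append rev_nth flip: r_def)
  have 2: "(g @ g) ! k = periodic g (Suc i)"
  proof (cases "Suc r = ?L")
    case True
    then have "Suc i mod ?L = 0" by (simp add: r_def mod_Suc)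
    then show ?thesis using True L by (simp add: periodic_def nth_append rev_nth k_def)
  next
    case False
    then have "Suc i mod ?L = Suc r" by (simp add: r_def mod_Suc)
    then show ?thesis using False r
      by (simp add: periodic_def nth_append rev_nth k_def)
  qed
  show ?thesis using adj[OF k(1)] unfolding 1 2 by (metis inv_letter_inv_letter)
qed

lemma path_word_periodic_length: "r \<le> length g \<Longrightarrow> path_word (periodic g) r = drop (length g - r) g"
proof -
  assume r: "r \<le> length g"
  have "map (periodic g) [0..<r] = take r (rev g)"
    using r by (intro nth_equalityI) (auto simp: periodic_def)
  then show ?thesis by (simp add: path_word_def rev_take)
qed

lemma path_word_periodic: "path_word (periodic g) (length g * j + r) = path_word (periodic g) r @ concat (replicate j g)"
proof -
  have "path_word (periodic g) (length g * j) = concat (replicate j g)"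
  proof (induction j)
    case (Suc j)
    have "path_word (periodic g) (length g * j + length g) = g @ path_word (periodic g) (length g * j)"
      using path_word_periodic_length[of "length g" g] by (simp add: path_word_add periodic_add)
    with Suc show ?case by (simp add: add.commute)
  qed simp
  then show ?thesis by (simp add: path_word_add periodic_add)
qed

lemma periodic_words: "g \<in> words n \<Longrightarrow> g \<noteq> [] \<Longrightarrow> fst (periodic g i) < n"
proof -
  assume "g \<in> words n" "g \<noteq> []"
  then have "periodic g i \<in> set g" unfolding periodic_def by (metis length_greater_0_conv length_rev mod_less_divisor nth_mem set_rev)
  then show ?thesis using \<open>g \<in> words n\<close> by (auto simp: words_def)
qed

lemma path_word_words: "(\<And>i. fst (G i) < n) \<Longrightarrow> path_word G i \<in> words n"
  by (induction i) auto

lemma concat_replicate_snoc: "concat (replicate j g) @ g = g @ concat (replicate j g)"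
  by (induction j) auto

context free_quotient
begin

text \<open>The powers of \<open>g\<close> trace a closed path in the Cayley graph. Its vertices are
  distinct: the position modulo \<open>length g\<close> is seen by the action \<open>\<pi>\<close>,
  trivial on \<open>U\<close>, and the number of completed rounds by the order \<open>m\<close> of
  \<open>g\<close> in the quotient.\<close>

lemma simple_cycle_power:
  assumes g: "g \<in> words n" "g \<noteq> []" "reduced (g @ g)" and m: "m > 0"
    and ord: "\<And>e::nat. coset n U g [^]\<^bsub>Q\<^esub> e = \<one>\<^bsub>Q\<^esub> \<longleftrightarrow> m dvd e"
    and \<pi>: "\<And>x. bij (\<pi> x)" "\<And>i. act_letter \<pi> (periodic g i) (i mod length g) = Suc i mod length g"
      "\<And>u y. u \<in> U \<Longrightarrow> y < length g \<Longrightarrow> act \<pi> u y = y"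
    and x: "x \<in> carrier Q"
  shows "simple_cycle (coset_act n U) (periodic g) (\<lambda>i. coset n U (path_word (periodic g) i) \<otimes>\<^bsub>Q\<^esub> x) (length g * m)"
  unfolding simple_cycle_def
proof (intro conjI allI)
  let ?L = "length g" and ?P = "path_word (periodic g)"
  have L: "?L > 0" using g by simp
  then show "length g * m > 0" using m by simp
  have P: "?P i \<in> words n" for i using periodic_words[OF g(1,2)] by (rule path_word_words)
  show "coset n U (?P (Suc i)) \<otimes>\<^bsub>Q\<^esub> x = act_letter (coset_act n U) (periodic g i) (coset n U (?P i) \<otimes>\<^bsub>Q\<^esub> x)" for i
    using act_letter_coset[of "periodic g i" "coset n U (?P i) \<otimes>\<^bsub>Q\<^esub> x"] periodic_words[OF g(1,2), of i] P[of i] x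
      coset_append[of "[periodic g i]" "?P i"]
    by (simp add: Q.m_assoc)
  have actP: "act \<pi> (?P i) 0 = i mod ?L" for i
    by (induction i) (use \<pi>(2) in auto)
  have div_mod: "coset n U (?P i) = coset n U (?P (i mod ?L)) \<otimes>\<^bsub>Q\<^esub> (coset n U g [^]\<^bsub>Q\<^esub> (i div ?L))" for i
  proof -
    have "?P i = ?P (i mod ?L) @ concat (replicate (i div ?L) g)"
      using path_word_periodic[of g "i div ?L" "i mod ?L"] by simp
    then show ?thesis using P g(1) by (simp add: coset_append coset_replicate words_concat)
  qed
  show "coset n U (?P i) \<otimes>\<^bsub>Q\<^esub> x = coset n U (?P j) \<otimes>\<^bsub>Q\<^esub> x \<longleftrightarrow> i mod (?L * m) = j mod (?L * m)" for i j
  proof -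
    have "coset n U (?P i) \<otimes>\<^bsub>Q\<^esub> x = coset n U (?P j) \<otimes>\<^bsub>Q\<^esub> x \<longleftrightarrow> coset n U (?P i) = coset n U (?P j)"
      using P x by simp
    also have "\<dots> \<longleftrightarrow> i mod ?L = j mod ?L \<and> i div ?L mod m = j div ?L mod m"
    proof -
      have "i mod ?L = j mod ?L" if eq: "coset n U (?P i) = coset n U (?P j)"
      proof -
        have "coset n U (?P i @ inv_word (?P j)) = \<one>\<^bsub>Q\<^esub>"
          using P eq by (simp add: coset_append coset_inv_word)
        then have "reduce (?P i @ inv_word (?P j)) \<in> U" using P coset_eq_one_iff by simp
        then have "act \<pi> (reduce (?P i @ inv_word (?P j))) (j mod ?L) = j mod ?L" using \<pi>(3) L by simp
        then have "act \<pi> (?P i) (act \<pi> (inv_word (?P j)) (act \<pi> (?P j) 0)) = j mod ?L"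
          using act_reduce[of \<pi>, OF \<pi>(1)] by (simp add: actP)
        then show ?thesis using act_inv_word(1)[of \<pi>, OF \<pi>(1), where w = "?P j" and y = 0] by (simp add: actP)
      qed
      moreover have "coset n U (?P i) = coset n U (?P j) \<longleftrightarrow> i div ?L mod m = j div ?L mod m" if eq: "i mod ?L = j mod ?L"
        unfolding div_mod[of i] div_mod[of j] eq
        using P g(1) Q.pow_eq_iff_mod[OF coset_closed[OF g(1)] ord] by simp
      ultimately show ?thesis by blast
    qed
    also have "\<dots> \<longleftrightarrow> i mod (?L * m) = j mod (?L * m)"
    proof
      assume "i mod (?L * m) = j mod (?L * m)"
      then have "i mod (?L * m) mod ?L = j mod (?L * m) mod ?L" "i mod (?L * m) div ?L = j mod (?L * m) div ?L" by simp_all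
      then show "i mod ?L = j mod ?L \<and> i div ?L mod m = j div ?L mod m"
        using L by (simp add: mod_mult2_eq)
    qed (simp add: mod_mult2_eq)
    finally show ?thesis .
  qed
  show "periodic g (i mod (?L * m)) = periodic g i" for i
    by (simp add: periodic_def mod_mult2_eq)
  show "periodic g (Suc i) \<noteq> inv_letter (periodic g i)" for i using periodic_reduced g by blast
qed

end

lemma fin_normal_cycle:
  assumes "g \<noteq> []" "reduced (g @ g)"
  shows "\<exists>\<pi> K. fin_normal (free_group n) K \<and> (\<forall>x :: nat. bij (\<pi> x)) \<and>
    (\<forall>i. act_letter \<pi> (periodic g i) (i mod length g) = Suc i mod length g) \<and>
    (\<forall>u\<in>K. \<forall>y<length g. act \<pi> u y = y)"
proof -
  have "length g > 0" using assms by simp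
  from cycle_permutation[of "length g" "periodic g", OF this periodic_mod periodic_reduced[OF assms(2,1)]]
  obtain \<pi> :: "nat \<Rightarrow> nat \<Rightarrow> nat" where \<pi>: "\<forall>x. bij (\<pi> x) \<and> \<pi> x ` {..<length g} = {..<length g}"
    "\<forall>i. act_letter \<pi> (periodic g i) (i mod length g) = Suc i mod length g"
    by blast
  have "fin_normal (free_group n) {w \<in> carrier (free_group n). \<forall>y\<in>{..<length g}. act \<pi> w y = y}"
    by (rule fin_normal_act) (use \<pi>(1) in auto)
  then show ?thesis using \<pi> by (intro exI[of _ \<pi>] exI conjI) auto
qed

lemma edge_count_outside:
  "(\<And>i. V i \<noteq> v) \<Longrightarrow> edge_count G V M v s = 0"
  "(\<And>i. fst (G i) \<noteq> fst s) \<Longrightarrow> edge_count G V M v s = 0"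
  by (auto simp: edge_count_def intro!: sum.neutral) (metis fst_inv_letter)+

section \<open>Conjugacy from edge counts\<close>

context free_quotient
begin

definition edge_space :: "(word set \<times> 3 \<times> (word set \<times> (nat \<times> bool))) set" where
  "edge_space = carrier Q \<times> UNIV \<times> (carrier Q \<times> ({..<n} \<times> UNIV))"

text \<open>Modulo this subgroup a word still determines all edge counts modulo 3 of its paths in
  the Cayley graph.\<close>

definition edge_kernel :: "word set" where
  "edge_kernel = {w \<in> carrier (free_group n). \<forall>y\<in>edge_space. act (skew (coset_act n U)) w y = y}"

lemma skew_image:
  assumes "finite (carrier Q)" "i < n"
  shows "skew (coset_act n U) i ` edge_space = edge_space"
proof (rule endo_inj_surj)
  show "finite edge_space" using assms by (simp add: edge_space_def)
  show "skew (coset_act n U) i ` edge_space \<subseteq> edge_space"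
    using coset_act_image[OF assms(2)] by (auto simp: edge_space_def skew_def)
  show "inj_on (skew (coset_act n U) i) edge_space"
    using bij_skew[of "coset_act n U", OF bij_coset_act] by (meson bij_is_inj inj_on_subset subset_UNIV)
qed

lemma fin_normal_edge_kernel:
  assumes "finite (carrier Q)"
  shows "fin_normal (free_group n) edge_kernel"
  unfolding edge_kernel_def
  by (rule fin_normal_act)
    (use assms skew_image bij_skew[of "coset_act n U", OF bij_coset_act] in \<open>auto simp: edge_space_def\<close>)

lemma act_edge_space:
  assumes "finite (carrier Q)" "w \<in> words n" "y \<in> edge_space"
  shows "act (skew (coset_act n U)) w y \<in> edge_space"
  by (rule act_image[where n = n])
    (use assms skew_image bij_skew[of "coset_act n U", OF bij_coset_act] in auto)

lemma act_skew_power: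
  assumes "w \<in> words n" "w \<noteq> []" "x \<in> carrier Q"
  defines "V \<equiv> \<lambda>i. coset n U (path_word (periodic w) i) \<otimes>\<^bsub>Q\<^esub> x"
  shows "act (skew (coset_act n U)) (concat (replicate m w)) (x, c, p) =
    (V (length w * m), c + edge_count (periodic w) V (length w * m) (fst p) (snd p), p)"
proof -
  have V: "V (Suc i) = act_letter (coset_act n U) (periodic w i) (V i)" for i
  proof -
    have P: "path_word (periodic w) i \<in> words n" using periodic_words[OF assms(1,2)] by (rule path_word_words)
    show ?thesis
      using act_letter_coset[of "periodic w i" "V i"] periodic_words[OF assms(1,2), of i] P assms(3)
        coset_append[of "[periodic w i]" "path_word (periodic w) i"]
      by (simp add: V_def Q.m_assoc)
  qed
  have "concat (replicate m w) = path_word (periodic w) (length w * m)"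
    using path_word_periodic[of w m 0] by simp
  moreover have "V 0 = x" using assms(3) by (simp add: V_def coset_Nil)
  ultimately show ?thesis
    using act_skew_path[of "coset_act n U" V "periodic w", OF bij_coset_act V] by metis
qed

lemma act_concat_replicate_conj:
  assumes "\<And>i. bij (f i)"
  shows "act f (concat (replicate m (d @ g @ inv_word d))) y = act f (d @ concat (replicate m g) @ inv_word d) y"
  using act_inv_word[of f, OF assms] by (induction m) auto

text \<open>Modulo \<open>edge_kernel\<close> the path of \<open>h\<^sup>m\<close> from the identity
  has the counts of the path of \<open>d g\<^sup>m d\<^sup>-\<^sup>1\<close>. As the part of
  \<open>g\<^sup>m\<close> is closed, the way back along \<open>d\<close> cancels the way out along
  \<open>d\<^sup>-\<^sup>1\<close>, and only the cycle of \<open>g\<close> starting at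
  \<open>d\<^sup>-\<^sup>1\<close> is counted.\<close>

lemma conj_edge_count:
  assumes fin: "finite (carrier Q)" and g: "g \<in> words n" "g \<noteq> []" and h: "h \<in> words n" and d: "d \<in> words n"
    and D: "reduce (d @ g @ inv_word d @ inv_word h) \<in> edge_kernel"
    and gm: "coset n U g [^]\<^bsub>Q\<^esub> (m::nat) = \<one>\<^bsub>Q\<^esub>"
    and p: "fst p \<in> carrier Q" "fst (snd p) < n"
  defines "W \<equiv> \<lambda>i. coset n U (path_word (periodic g) i) \<otimes>\<^bsub>Q\<^esub> inv\<^bsub>Q\<^esub> (coset n U d)"
  shows "act (skew (coset_act n U)) (concat (replicate m h)) (\<one>\<^bsub>Q\<^esub>, 0, p) =
    (\<one>\<^bsub>Q\<^esub>, edge_count (periodic g) W (length g * m) (fst p) (snd p), p)"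
proof -
  let ?A = "coset_act n U" and ?f = "skew (coset_act n U)"
  note bA = bij_coset_act and bf = bij_skew[of "coset_act n U", OF bij_coset_act]
  let ?ec = "edge_count (periodic g) W (length g * m) (fst p) (snd p)"
  have same: "act ?f h y = act ?f (d @ g @ inv_word d) y" if "y \<in> edge_space" for y
  proof -
    have "act ?f h y \<in> edge_space" using act_edge_space[OF fin h that] .
    then have "act ?f (reduce (d @ g @ inv_word d @ inv_word h)) (act ?f h y) = act ?f h y"
      using D unfolding edge_kernel_def by blast
    then show ?thesis using act_reduce[of ?f, OF bf] act_inv_word[of ?f, OF bf] by simp
  qed
  have pow: "act ?f (concat (replicate k h)) y = act ?f (concat (replicate k (d @ g @ inv_word d))) y"
    if "y \<in> edge_space" for k y
  proof (induction k)
    case (Suc k)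
    have "act ?f (concat (replicate k h)) y \<in> edge_space"
      using act_edge_space[OF fin _ that] h by (simp add: words_concat)
    with Suc same show ?case by simp
  qed simp
  obtain c where c: "act ?f (inv_word d) (\<one>\<^bsub>Q\<^esub>, 0, p) = (inv\<^bsub>Q\<^esub> (coset n U d), c, p)"
  proof -
    obtain c where "act ?f (inv_word d) (\<one>\<^bsub>Q\<^esub>, 0, p) = (act ?A (inv_word d) \<one>\<^bsub>Q\<^esub>, c, p)"
      using act_skew_fst[of ?A, OF bA] by blast
    then show ?thesis using that act_coset[of "inv_word d" "\<one>\<^bsub>Q\<^esub>"] d by (simp add: coset_inv_word)
  qed
  have W_end: "W (length g * m) = inv\<^bsub>Q\<^esub> (coset n U d)"
    using path_word_periodic[of g m 0] g d gm by (simp add: W_def coset_replicate)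
  have return: "act ?f d (inv\<^bsub>Q\<^esub> (coset n U d), c, p) = (\<one>\<^bsub>Q\<^esub>, 0, p)"
    using act_inv_word(2)[of ?f, OF bf, where w = d and y = "(\<one>\<^bsub>Q\<^esub>, 0, p)"] by (simp add: c)
  have "(\<one>\<^bsub>Q\<^esub>, 0, p) \<in> edge_space" using p by (cases p) (auto simp: edge_space_def)
  then have "act ?f (concat (replicate m h)) (\<one>\<^bsub>Q\<^esub>, 0, p) = act ?f (d @ concat (replicate m g) @ inv_word d) (\<one>\<^bsub>Q\<^esub>, 0, p)"
    by (simp only: pow act_concat_replicate_conj[of ?f, OF bf])
  also have "\<dots> = act ?f d (act ?f (concat (replicate m g)) (inv\<^bsub>Q\<^esub> (coset n U d), c, p))" by (simp add: c)
  also have "\<dots> = act ?f d (inv\<^bsub>Q\<^esub> (coset n U d), c + ?ec, p)"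
  proof -
    have "inv\<^bsub>Q\<^esub> (coset n U d) \<in> carrier Q" using d by simp
    from act_skew_power[OF g this, of m c p, folded W_def] show ?thesis by (simp only: W_end[unfolded W_def])
  qed
  also have "\<dots> = (\<one>\<^bsub>Q\<^esub>, ?ec, p)"
    using act_skew_shift[of ?A, OF bA return, of ?ec] by simp
  finally show ?thesis .
qed

end

text \<open>If \<open>d\<close> conjugates \<open>g\<close> to \<open>h\<close> modulo
  \<open>\<Delta>\<close>, the cycle of \<open>g\<close> through \<open>d\<^sup>-\<^sup>1\<close>
  and that of \<open>h\<close> through the identity have equal counts, so they differ by a rotation.
  Hence \<open>h\<close> is a cyclic permutation of \<open>g\<close>, and \<open>d\<close> agrees
  modulo \<open>U\<close> with an initial part of the path of \<open>g\<close>.\<close>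

lemma conjugacy_cyclic:
  assumes U: "fin_normal (free_group n) U" and g: "g \<in> words n" "g \<noteq> []" "reduced (g @ g)"
    and h: "h \<in> words n" "h = [] \<or> reduced (h @ h)"
  shows "\<exists>\<Delta>. fin_normal (free_group n) \<Delta> \<and> \<Delta> \<subseteq> U \<and> (\<forall>d\<in>words n. reduce (d @ g @ inv_word d @ inv_word h) \<in> \<Delta> \<longrightarrow>
    (\<exists>r<length g. \<exists>j. h @ path_word (periodic g) r = path_word (periodic g) r @ g \<and>
      reduce (inv_word d @ path_word (periodic g) r @ concat (replicate j g)) \<in> U))"
proof -
  obtain \<pi> K where K: "fin_normal (free_group n) K" and \<pi>: "\<And>x :: nat. bij (\<pi> x)"
    "\<And>i. act_letter \<pi> (periodic g i) (i mod length g) = Suc i mod length g"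
    "\<And>u y. u \<in> K \<Longrightarrow> y < length g \<Longrightarrow> act \<pi> u y = y"
    using fin_normal_cycle[OF g(2,3), of n] by blast
  have "\<exists>\<pi>' K'. fin_normal (free_group n) K' \<and> (h \<noteq> [] \<longrightarrow> (\<forall>x :: nat. bij (\<pi>' x)) \<and>
    (\<forall>i. act_letter \<pi>' (periodic h i) (i mod length h) = Suc i mod length h) \<and>
    (\<forall>u\<in>K'. \<forall>y<length h. act \<pi>' u y = y))"
  proof (cases "h = []")
    case False
    then show ?thesis using fin_normal_cycle[of h n] h by blast
  qed (use K in blast)
  then obtain \<pi>' K' where K': "fin_normal (free_group n) K'" and \<pi>': "h \<noteq> [] \<longrightarrow> (\<forall>x :: nat. bij (\<pi>' x)) \<and>
    (\<forall>i. act_letter \<pi>' (periodic h i) (i mod length h) = Suc i mod length h) \<and>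
    (\<forall>u\<in>K'. \<forall>y<length h. act \<pi>' u y = y)"
    by blast
  \<comment> \<open>Passing to \<open>K\<close> and \<open>K'\<close> makes the cycles of
    \<open>g\<close> and \<open>h\<close> simple in the quotient.\<close>
  define U' where "U' = U \<inter> (K \<inter> K')"
  have U': "fin_normal (free_group n) U'" unfolding U'_def by (intro group.fin_normal_Int[OF group_free_group] U K K')
  interpret free_quotient n U' by (rule free_quotient.intro) (use U' in \<open>simp add: fin_normal_def\<close>)
  have UK: "u \<in> K" "u \<in> K'" if "u \<in> U'" for u using that by (auto simp: U'_def)
  have fin: "finite (carrier Q)" using U' by (simp add: fin_normal_def FactGroup_def)
  define \<Delta> where "\<Delta> = U' \<inter> edge_kernel"
  have "fin_normal (free_group n) \<Delta>" unfolding \<Delta>_def by (intro F.fin_normal_Int U' fin_normal_edge_kernel fin)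
  moreover have "\<Delta> \<subseteq> U" by (auto simp: \<Delta>_def U'_def)
  moreover have "\<exists>r<length g. \<exists>j. h @ path_word (periodic g) r = path_word (periodic g) r @ g \<and>
      reduce (inv_word d @ path_word (periodic g) r @ concat (replicate j g)) \<in> U"
    if d: "d \<in> words n" and D: "reduce (d @ g @ inv_word d @ inv_word h) \<in> \<Delta>" for d
  proof -
    let ?cg = "coset n U' g" and ?ch = "coset n U' h" and ?cd = "coset n U' d"
    define m where "m = Q.ord ?cg"
    have m: "m > 0" unfolding m_def using Q.ord_ge_1[OF fin, of ?cg] g(1) by simp
    have ordg: "?cg [^]\<^bsub>Q\<^esub> e = \<one>\<^bsub>Q\<^esub> \<longleftrightarrow> m dvd e" for e :: nat
      unfolding m_def using g(1) by (simp add: Q.pow_eq_id)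
    have "coset n U' (d @ g @ inv_word d @ inv_word h) = \<one>\<^bsub>Q\<^esub>"
      using D d g h by (subst coset_eq_one_iff) (auto simp: \<Delta>_def)
    then have "?cd \<otimes>\<^bsub>Q\<^esub> (?cg \<otimes>\<^bsub>Q\<^esub> (inv\<^bsub>Q\<^esub> ?cd \<otimes>\<^bsub>Q\<^esub> inv\<^bsub>Q\<^esub> ?ch)) = \<one>\<^bsub>Q\<^esub>"
      using d g h by (simp add: coset_append coset_inv_word)
    then have dg: "?cd \<otimes>\<^bsub>Q\<^esub> ?cg = ?ch \<otimes>\<^bsub>Q\<^esub> ?cd"
      using d g h by (simp add: Q.inv_mult_group[symmetric] Q.m_assoc[symmetric])
        (metis Q.inv_closed Q.inv_equality Q.inv_inv Q.m_closed coset_closed)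
    have ordh: "?ch [^]\<^bsub>Q\<^esub> e = \<one>\<^bsub>Q\<^esub> \<longleftrightarrow> m dvd e" for e :: nat
    proof -
      have "?cd \<otimes>\<^bsub>Q\<^esub> ?cg [^]\<^bsub>Q\<^esub> e = ?ch [^]\<^bsub>Q\<^esub> e \<otimes>\<^bsub>Q\<^esub> ?cd"
        by (rule Q.pow_intertwine) (use d g h dg in auto)
      then have "?ch [^]\<^bsub>Q\<^esub> e = \<one>\<^bsub>Q\<^esub> \<longleftrightarrow> ?cg [^]\<^bsub>Q\<^esub> e = \<one>\<^bsub>Q\<^esub>"
        using d g h by (metis Q.l_one Q.nat_pow_closed Q.one_closed Q.r_cancel Q.l_cancel Q.r_one coset_closed)
      then show ?thesis by (simp add: ordg)
    qed
    define W where "W i = coset n U' (path_word (periodic g) i) \<otimes>\<^bsub>Q\<^esub> inv\<^bsub>Q\<^esub> ?cd" for i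
    have W: "simple_cycle (coset_act n U') (periodic g) W (length g * m)"
      unfolding W_def[abs_def]
      by (rule simple_cycle_power[where \<pi> = \<pi>]) (use g m ordg \<pi> d UK in auto)
    have D': "reduce (d @ g @ inv_word d @ inv_word h) \<in> edge_kernel" using D by (simp add: \<Delta>_def)
    note count = conj_edge_count[OF fin g(1,2) h(1) d D' ordg[THEN iffD2, OF dvd_refl], folded W_def]
    have W_carrier: "W i \<in> carrier Q" for i
      using path_word_words[of "periodic g" n i] periodic_words[OF g(1,2)] d by (simp add: W_def)
    show ?thesis
    proof (cases "h = []")
      \<comment> \<open>For trivial \<open>h\<close> all counts vanish, whereas the cycle of
        \<open>g\<close> has an edge.\<close>
      case True
      have "edge_count (periodic g) W (length g * m) (W 0) (periodic g 0) = 1"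
        using edge_count_eq_1_iff[OF W] by blast
      moreover have "edge_count (periodic g) W (length g * m) (W 0) (periodic g 0) = 0"
        using count[of "(W 0, periodic g 0)"] True W_carrier periodic_words[OF g(1,2)] by simp
      ultimately show ?thesis by simp
    next
      case False
      define V where "V i = coset n U' (path_word (periodic h) i) \<otimes>\<^bsub>Q\<^esub> \<one>\<^bsub>Q\<^esub>" for i
      have V: "simple_cycle (coset_act n U') (periodic h) V (length h * m)"
        unfolding V_def[abs_def]
        by (rule simple_cycle_power[where \<pi> = \<pi>']) (use False h m ordh \<pi>' UK in auto)
      have V_carrier: "V i \<in> carrier Q" for i
        using path_word_words[of "periodic h" n i] periodic_words[OF h(1) False] by (simp add: V_def)
      have "edge_count (periodic g) W (length g * m) v s = edge_count (periodic h) V (length h * m) v s" for v s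
      proof (cases "v \<in> carrier Q \<and> fst s < n")
        case True
        then show ?thesis
          using count[of "(v, s)"] act_skew_power[OF h(1) False Q.one_closed, of m 0 "(v, s)", folded V_def] by simp
      next
        case no: False
        then consider "v \<notin> carrier Q" | "\<not> fst s < n" by blast
        then show ?thesis
        proof cases
          case 1
          then have "W i \<noteq> v" "V i \<noteq> v" for i using W_carrier V_carrier by auto
          then show ?thesis by (simp add: edge_count_outside(1))
        next
          case 2
          then have "fst (periodic g i) \<noteq> fst s" "fst (periodic h i) \<noteq> fst s" for i
            using periodic_words[OF g(1,2), of i] periodic_words[OF h(1) False, of i] by auto
          then show ?thesis by (simp add: edge_count_outside(2))
        qed
      qed
      from simple_cycles_match[OF W V this] obtain i0 where len: "length g * m = length h * m"
        and WV: "\<And>j. W (i0 + j) = V j" and gh: "\<And>j. periodic g (i0 + j) = periodic h j" by metis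
      let ?P = "path_word (periodic g)"
      have "length g = length h" using len m by simp
      then have h_path: "h = path_word (\<lambda>k. periodic g (i0 + k)) (length g)"
        using path_word_periodic_length[of "length h" h] by (simp add: gh)
      define r where "r = i0 mod length g"
      define j where "j = i0 div length g"
      have r: "r < length g" using g by (simp add: r_def)
      have i0: "i0 = length g * j + r" by (simp add: r_def j_def)
      have P: "?P i0 = ?P r @ concat (replicate j g)" unfolding i0 by (rule path_word_periodic)
      have "?P (i0 + length g) = h @ ?P i0" by (simp add: path_word_add flip: h_path)
      moreover have "?P (length g * 1 + i0) = ?P i0 @ g"
      proof -
        have "?P (length g * 1 + i0) = path_word (\<lambda>k. periodic g (length g * 1 + k)) i0 @ ?P (length g * 1)"
          by (rule path_word_add)
        then show ?thesis using path_word_periodic_length[of "length g" g] by (simp only: periodic_add) simp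
      qed
      ultimately have "h @ ?P i0 = ?P i0 @ g" by (simp add: add.commute)
      then have "(h @ ?P r) @ concat (replicate j g) = (?P r @ g) @ concat (replicate j g)"
        by (simp add: P concat_replicate_snoc)
      then have 1: "h @ ?P r = ?P r @ g" by simp
      have Pw: "?P i0 \<in> words n" using periodic_words[OF g(1,2)] by (rule path_word_words)
      have "coset n U' (?P i0) \<otimes>\<^bsub>Q\<^esub> inv\<^bsub>Q\<^esub> ?cd = \<one>\<^bsub>Q\<^esub>"
        using WV[of 0] by (simp add: W_def V_def coset_Nil)
      then have "coset n U' (?P i0) = ?cd" using Pw d by (metis Q.inv_equality Q.inv_inv coset_closed Q.inv_closed)
      then have "coset n U' (inv_word d @ ?P i0) = \<one>\<^bsub>Q\<^esub>" using Pw d by (simp add: coset_append coset_inv_word)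
      then have "reduce (inv_word d @ ?P i0) \<in> U'" using Pw d by (subst (asm) coset_eq_one_iff) auto
      then have 2: "reduce (inv_word d @ ?P r @ concat (replicate j g)) \<in> U" by (simp add: P U'_def)
      show ?thesis using r 1 2 by blast
    qed
  qed
  ultimately show ?thesis by blast
qed

lemma reduce_cancel:
  "reduce (u @ inv_word a @ a @ v) = reduce (u @ v)" "reduce (u @ a @ inv_word a @ v) = reduce (u @ v)"
proof -
  have *: "reduce (u @ inv_word a @ a @ v) = reduce (u @ v)" for a
  proof -
    have "reduce (inv_word a @ a @ v) = reduce (reduce (inv_word a @ a) @ v)"
      by (simp add: reduce_append_reduce_left)
    also have "\<dots> = reduce v" by (simp add: inv_word_def reduce_inv_word)
    finally show ?thesis by (metis reduce_append_reduce_right)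
  qed
  show "reduce (u @ inv_word a @ a @ v) = reduce (u @ v)" by (rule *)
  show "reduce (u @ a @ inv_word a @ v) = reduce (u @ v)" using *[of "inv_word a"] by simp
qed

lemma fin_normal_conj:
  assumes "fin_normal (free_group n) U" "reduce w \<in> U" "c \<in> words n" "w \<in> words n"
  shows "reduce (c @ w @ inv_word c) \<in> U"
proof -
  interpret free_quotient n U by (rule free_quotient.intro) (use assms in \<open>simp add: fin_normal_def\<close>)
  have "coset n U (c @ w @ inv_word c) = \<one>\<^bsub>Q\<^esub>"
    using assms coset_eq_one_iff[of w] by (simp add: coset_append coset_inv_word)
  then show ?thesis using assms by (subst (asm) coset_eq_one_iff) auto
qed

text \<open>The elements conjugating \<open>g\<close> to \<open>h\<close> form finitely many cosets of \<open>\<langle>g\<rangle>\<close>, represented by \<open>E\<close>.\<close>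

theorem conjugators_approximate:
  assumes g: "g \<in> words n" "reduce g \<noteq> []" and h: "h \<in> words n"
  shows "\<exists>E. finite E \<and> E \<subseteq> words n \<and> (\<forall>e\<in>E. reduce (e @ g) = reduce (h @ e)) \<and>
    (\<forall>U. fin_normal (free_group n) U \<longrightarrow> (\<exists>\<Delta>. fin_normal (free_group n) \<Delta> \<and> \<Delta> \<subseteq> U \<and>
      (\<forall>d\<in>words n. reduce (d @ g @ inv_word d @ inv_word h) \<in> \<Delta> \<longrightarrow>
        (\<exists>e\<in>E. \<exists>j. reduce (inv_word d @ e @ concat (replicate j g)) \<in> U))))"
proof -
  obtain a g' where a: "reduce g = a @ g' @ inv_word a" "g' \<noteq> []" "reduced (g' @ g')"
    using cyclic_reduction[OF reduced_reduce g(2)] by blast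
  obtain b h' where b: "reduce h = b @ h' @ inv_word b" "h' = [] \<or> reduced (h' @ h')"
  proof (cases "reduce h = []")
    case True
    then show ?thesis using that[of "[]" "[]"] by simp
  next
    case False
    then show ?thesis using cyclic_reduction[OF reduced_reduce False] that by blast
  qed
  have words: "a \<in> words n" "g' \<in> words n" "b \<in> words n" "h' \<in> words n"
    using reduce_in_words[OF g(1)] reduce_in_words[OF h] a(1) b(1) by auto
  have rg: "reduce (u @ g @ v) = reduce (u @ a @ g' @ inv_word a @ v)" for u v
  proof -
    have "reduce (u @ g @ v) = reduce (u @ reduce g @ v)" by (metis reduce_append_reduce_left reduce_append_reduce_right)
    then show ?thesis by (simp add: a(1))
  qed
  have rh: "reduce (u @ h @ v) = reduce (u @ b @ h' @ inv_word b @ v)" for u v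
  proof -
    have "reduce (u @ h @ v) = reduce (u @ reduce h @ v)" by (metis reduce_append_reduce_left reduce_append_reduce_right)
    then show ?thesis by (simp add: b(1))
  qed
  have rhi: "reduce (u @ inv_word h @ v) = reduce (u @ b @ inv_word h' @ inv_word b @ v)" for u v
  proof -
    have "reduce (u @ inv_word h @ v) = reduce (u @ (inv_word h @ h) @ b @ inv_word h' @ inv_word b @ v)"
    proof -
      have "reduce (u @ (inv_word h @ h) @ b @ inv_word h' @ inv_word b @ v) =
          reduce ((u @ inv_word h) @ b @ h' @ inv_word b @ b @ inv_word h' @ inv_word b @ v)"
        using rh[of "u @ inv_word h" "b @ inv_word h' @ inv_word b @ v"] by simp
      also have "\<dots> = reduce ((u @ inv_word h @ b @ h') @ inv_word h' @ inv_word b @ v)"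
        using reduce_cancel(1)[of "u @ inv_word h @ b @ h'" b] by simp
      also have "\<dots> = reduce ((u @ inv_word h @ b) @ inv_word b @ v)"
        using reduce_cancel(2)[of "u @ inv_word h @ b" h'] by simp
      also have "\<dots> = reduce (u @ inv_word h @ v)"
        using reduce_cancel(2)[of "u @ inv_word h" b] by simp
      finally show ?thesis by simp
    qed
    also have "\<dots> = reduce (u @ b @ inv_word h' @ inv_word b @ v)"
      using reduce_cancel(1)[of u h] by simp
    finally show ?thesis .
  qed
  have rgj: "reduce (u @ concat (replicate j g)) = reduce (u @ a @ concat (replicate j g') @ inv_word a)" for u j
  proof (induction j arbitrary: u)
    case 0
    show ?case using reduce_cancel(2)[of u a "[]"] by simp
  next
    case (Suc j)
    have "reduce (u @ concat (replicate (Suc j) g)) = reduce ((u @ g) @ concat (replicate j g))" by simp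
    also have "\<dots> = reduce (u @ g @ a @ concat (replicate j g') @ inv_word a)"
      using Suc[of "u @ g"] by simp
    also have "\<dots> = reduce ((u @ a @ g') @ inv_word a @ a @ concat (replicate j g') @ inv_word a)" by (simp add: rg)
    also have "\<dots> = reduce ((u @ a @ g') @ concat (replicate j g') @ inv_word a)" by (rule reduce_cancel)
    finally show ?case by simp
  qed
  let ?P = "path_word (periodic g')"
  \<comment> \<open>A suffix \<open>?P r\<close> of the cyclic core \<open>g'\<close> with
    \<open>h' @ ?P r = ?P r @ g'\<close> rotates \<open>g'\<close> into \<open>h'\<close>; composed
    with \<open>a\<close> and \<open>b\<close> it is an exact conjugator.\<close>
  define E where "E = (\<lambda>r. b @ ?P r @ inv_word a) ` {r. r < length g' \<and> h' @ ?P r = ?P r @ g'}"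
  have P: "?P r \<in> words n" for r using periodic_words[OF words(2) a(2)] by (rule path_word_words)
  have "finite E" by (simp add: E_def)
  moreover have "E \<subseteq> words n" using words P by (auto simp: E_def)
  moreover have "reduce (e @ g) = reduce (h @ e)" if e: "e \<in> E" for e
  proof -
    obtain r where r: "e = b @ ?P r @ inv_word a" "h' @ ?P r = ?P r @ g'" using e by (auto simp: E_def)
    have "reduce (e @ g) = reduce ((b @ ?P r) @ inv_word a @ a @ g' @ inv_word a)"
      using rg[of e "[]"] by (simp add: r)
    also have "\<dots> = reduce ((b @ ?P r) @ g' @ inv_word a)" by (rule reduce_cancel)
    also have "\<dots> = reduce ((b @ h') @ ?P r @ inv_word a)" using r(2) by (metis append_assoc)
    also have "\<dots> = reduce ((b @ h') @ inv_word b @ b @ ?P r @ inv_word a)" by (rule reduce_cancel[symmetric])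
    also have "\<dots> = reduce (h @ e)" using rh[of "[]" e] by (simp add: r)
    finally show ?thesis .
  qed
  moreover have "\<exists>\<Delta>. fin_normal (free_group n) \<Delta> \<and> \<Delta> \<subseteq> U \<and>
      (\<forall>d\<in>words n. reduce (d @ g @ inv_word d @ inv_word h) \<in> \<Delta> \<longrightarrow>
        (\<exists>e\<in>E. \<exists>j. reduce (inv_word d @ e @ concat (replicate j g)) \<in> U))" if U: "fin_normal (free_group n) U" for U
  proof -
    obtain \<Delta> where \<Delta>: "fin_normal (free_group n) \<Delta>" "\<Delta> \<subseteq> U"
      "\<And>d. d \<in> words n \<Longrightarrow> reduce (d @ g' @ inv_word d @ inv_word h') \<in> \<Delta> \<Longrightarrow>
        \<exists>r<length g'. \<exists>j. h' @ ?P r = ?P r @ g' \<and> reduce (inv_word d @ ?P r @ concat (replicate j g')) \<in> U"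
      using conjugacy_cyclic[OF U words(2) a(2,3) words(4) b(2)] by blast
    have "\<exists>e\<in>E. \<exists>j. reduce (inv_word d @ e @ concat (replicate j g)) \<in> U"
      if d: "d \<in> words n" and D: "reduce (d @ g @ inv_word d @ inv_word h) \<in> \<Delta>" for d
    proof -
      \<comment> \<open>The conjugator between the cyclic cores that corresponds to
        \<open>d\<close>.\<close>
      let ?d = "inv_word b @ d @ a"
      have "reduce (inv_word b @ (d @ g @ inv_word d @ inv_word h) @ inv_word (inv_word b)) \<in> \<Delta>"
        by (rule fin_normal_conj[OF \<Delta>(1) D]) (use words g h d in auto)
      moreover have "reduce (inv_word b @ (d @ g @ inv_word d @ inv_word h) @ inv_word (inv_word b)) =
          reduce (?d @ g' @ inv_word ?d @ inv_word h')"
      proof -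
        have "reduce (inv_word b @ (d @ g @ inv_word d @ inv_word h) @ inv_word (inv_word b)) =
            reduce ((inv_word b @ d) @ g @ inv_word d @ inv_word h @ b)" by simp
        also have "\<dots> = reduce ((inv_word b @ d @ a @ g' @ inv_word a @ inv_word d) @ inv_word h @ b)"
          using rg[of "inv_word b @ d"] by simp
        also have "\<dots> = reduce ((inv_word b @ d @ a @ g' @ inv_word a @ inv_word d @ b @ inv_word h') @ inv_word b @ b @ [])"
          using rhi[of "inv_word b @ d @ a @ g' @ inv_word a @ inv_word d" b] by simp
        also have "\<dots> = reduce (?d @ g' @ inv_word ?d @ inv_word h')"
          by (subst reduce_cancel) simp
        finally show ?thesis .
      qed
      ultimately obtain r j where r: "r < length g'" "h' @ ?P r = ?P r @ g'"
        "reduce (inv_word ?d @ ?P r @ concat (replicate j g')) \<in> U"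
        using \<Delta>(3)[of ?d] words d by auto
      let ?e = "b @ ?P r @ inv_word a"
      have "reduce (a @ (inv_word ?d @ ?P r @ concat (replicate j g')) @ inv_word a) \<in> U"
        by (rule fin_normal_conj[OF U r(3)]) (use words P d in \<open>auto simp: words_concat\<close>)
      moreover have "reduce (a @ (inv_word ?d @ ?P r @ concat (replicate j g')) @ inv_word a) =
          reduce (inv_word d @ ?e @ concat (replicate j g))"
      proof -
        have "reduce (a @ (inv_word ?d @ ?P r @ concat (replicate j g')) @ inv_word a) =
            reduce ([] @ a @ inv_word a @ (inv_word d @ b @ ?P r @ concat (replicate j g') @ inv_word a))"
          by simp
        also have "\<dots> = reduce ((inv_word d @ b @ ?P r) @ concat (replicate j g') @ inv_word a)"
          by (subst reduce_cancel) simp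
        also have "\<dots> = reduce ((inv_word d @ b @ ?P r) @ inv_word a @ a @ concat (replicate j g') @ inv_word a)"
          by (rule reduce_cancel[symmetric])
        also have "\<dots> = reduce (inv_word d @ ?e @ concat (replicate j g))"
          using rgj[of "inv_word d @ ?e" j] by simp
        finally show ?thesis .
      qed
      ultimately have "reduce (inv_word d @ ?e @ concat (replicate j g)) \<in> U" by (simp only:)
      moreover have "?e \<in> E" using r by (auto simp: E_def)
      ultimately show ?thesis by blast
    qed
    with \<Delta> show ?thesis by blast
  qed
  ultimately show ?thesis by blast
qed

section \<open>Split extensions with an involution\<close>

definition tau_word :: "(nat \<Rightarrow> nat) \<Rightarrow> word \<Rightarrow> word" where
  "tau_word t w = map (map_prod t id) w"

lemma tau_word_simps [simp]: "tau_word t [] = []" "tau_word t (a # w) = map_prod t id a # tau_word t w"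
  "tau_word t (u @ v) = tau_word t u @ tau_word t v"
  by (simp_all add: tau_word_def)

text \<open>\<open>(a, w, e)\<close> stands for \<open>a w \<tau>\<^sup>e\<close> in \<open>(\<int>\<^sup>4 \<rtimes> F) \<rtimes> \<langle>\<tau>\<rangle>\<close>, where the \<open>i\<close>-th free generator acts on \<open>\<int>\<^sup>4\<close> by
  \<open>g i\<close> and the involution \<open>\<tau>\<close> permutes the free generators by \<open>t\<close> and centralizes \<open>\<int>\<^sup>4\<close>.\<close>

definition split_ext :: "nat \<Rightarrow> (nat \<Rightarrow> nat) \<Rightarrow> (nat \<Rightarrow> mat \<Rightarrow> mat) \<Rightarrow> (mat \<times> word \<times> bool) monoid" where
  "split_ext n t g = \<lparr>carrier = {(a, w, e). w \<in> carrier (free_group n)},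
     monoid.mult = (\<lambda>(a, w, e) (b, v, d). (a + act g w b, reduce (w @ (if e then tau_word t v else v)), e \<noteq> d)),
     one = (0, [], False)\<rparr>"

definition split_sub :: "nat \<Rightarrow> (nat \<Rightarrow> nat) \<Rightarrow> (nat \<Rightarrow> mat \<Rightarrow> mat) \<Rightarrow> (mat \<times> word \<times> bool) monoid" where
  "split_sub n t g = (split_ext n t g)\<lparr>carrier := {(a, w, e). w \<in> carrier (free_group n) \<and> \<not> e}\<rparr>"

locale twisted_action =
  fixes n :: nat and t :: "nat \<Rightarrow> nat" and g :: "nat \<Rightarrow> mat \<Rightarrow> mat"
  assumes bij: "\<And>i. bij (g i)" and add: "\<And>i a b. g i (a + b) = g i a + g i b"
    and t_less: "\<And>i. i < n \<Longrightarrow> t i < n" and t_t: "\<And>i. t (t i) = i" and g_t: "\<And>i. g (t i) = g i"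
begin

abbreviation "K \<equiv> split_ext n t g"
abbreviation "G \<equiv> split_sub n t g"
abbreviation "F \<equiv> free_group n"
abbreviation "tw \<equiv> tau_word t"

sublocale F: group F by (rule group_free_group)

lemmas act_r [simp] = act_reduce[of g, OF bij]
lemmas act_i [simp] = act_inv_word[of g, OF bij]

lemma act_letter_add: "act_letter g a (x + y) = act_letter g a x + act_letter g a y"
proof (cases "snd a")
  case False
  let ?h = "inv_into UNIV (g (fst a))"
  have h: "g (fst a) (?h z) = z" "?h (g (fst a) z) = z" for z
    using bij[of "fst a"] by (simp_all add: bij_is_surj surj_f_inv_f bij_is_inj)
  have "g (fst a) (?h x + ?h y) = x + y" by (simp add: add h)
  then have "?h (x + y) = ?h x + ?h y" by (metis h(2))
  with False show ?thesis by (simp add: act_letter_def)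
qed (simp add: act_letter_def add)

lemma act_add [simp]: "act g w (x + y) = act g w x + act g w y"
  by (induction w) (simp_all add: act_letter_add)

lemma act_0 [simp]: "act g w 0 = 0"
  using act_add[of w 0 0] by simp

lemma act_minus [simp]: "act g w (- x) = - act g w x"
  using act_add[of w x "- x"] by (simp add: eq_neg_iff_add_eq_0 add.commute)

lemma act_diff [simp]: "act g w (x - y) = act g w x - act g w y"
  using act_add[of w x "- y"] by simp

lemma act_smul: "act g w (smul k x) = smul k (act g w x)"
proof (induction k rule: int_induct[where k = 0])
  case (step1 k)
  then show ?case by (simp add: smul_add)
next
  case (step2 k)
  then show ?case by (simp add: smul_add)
qed simp

lemma tw_tw [simp]: "tw (tw w) = w"
  by (induction w) (auto simp: t_t)

lemma tw_words [simp]: "tw w \<in> words n \<longleftrightarrow> w \<in> words n"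
proof -
  have *: "w \<in> words n \<Longrightarrow> tw w \<in> words n" for w by (induction w) (auto simp: t_less)
  show ?thesis using *[of w] *[of "tw w"] by auto
qed

lemma act_letter_t: "act_letter g (map_prod t id a) = act_letter g a"
  by (simp add: act_letter_def g_t fun_eq_iff)

lemma act_tw [simp]: "act g (tw w) x = act g w x"
  by (induction w) (auto simp: act_letter_t)

lemma t_eq_iff: "t i = t j \<longleftrightarrow> i = j"
  by (metis t_t)

lemma inv_letter_t: "inv_letter (map_prod t id a) = map_prod t id (inv_letter a)"
  by (simp add: inv_letter_def)

lemma map_prod_t_eq_iff: "map_prod t id a = map_prod t id b \<longleftrightarrow> a = b"
  by (cases a; cases b) (simp add: t_eq_iff)

lemma reduce_tw [simp]: "reduce (tw w) = tw (reduce w)"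
proof (induction w)
  case (Cons a w)
  have "cons_reduce (map_prod t id a) (tw v) = tw (cons_reduce a v)" for v
    by (cases v) (auto simp: inv_letter_t map_prod_t_eq_iff)
  with Cons show ?case by (simp add: reduce_def)
qed simp

lemma tw_carrier [simp]: "tw w \<in> carrier F \<longleftrightarrow> w \<in> carrier F"
proof -
  have *: "w \<in> carrier F \<Longrightarrow> tw w \<in> carrier F" for w
    using reduce_reduced[of w] reduced_reduce[of "tw w"] by (simp add: carrier_free_group)
  show ?thesis using *[of w] *[of "tw w"] by auto
qed

lemma tw_inv_word: "tw (inv_word w) = inv_word (tw w)"
  by (induction w) (auto simp: inv_letter_t)

lemma reduce_carrier: "w \<in> carrier F \<Longrightarrow> reduce w = w"
  by (simp add: carrier_free_group reduce_reduced)

lemma carrier_words: "w \<in> carrier F \<Longrightarrow> w \<in> words n"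
  by (simp add: carrier_free_group)

lemma inv_word_carrier [simp]: "inv_word w \<in> carrier F \<longleftrightarrow> w \<in> carrier F"
  by (metis carrier_free_group inv_word_words inv_word_simps(4) reduced_inv_word)

lemma reduce_twice [simp]: "reduce (u @ reduce v) = reduce (u @ v)" "reduce (reduce u @ v) = reduce (u @ v)"
  by (simp_all add: reduce_append_reduce_left reduce_append_reduce_right)

lemma reduce_inv_word_left [simp]: "reduce (inv_word w @ w) = []" "reduce (w @ inv_word w) = []"
  using reduce_cancel[of "[]" w "[]"] by simp_all

lemma K_carrier [simp]: "(a, w, e) \<in> carrier K \<longleftrightarrow> w \<in> carrier F"
  by (simp add: split_ext_def)

lemma K_mult [simp]: "(a, w, e) \<otimes>\<^bsub>K\<^esub> (b, v, d) = (a + act g w b, reduce (w @ (if e then tw v else v)), e \<noteq> d)"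
  by (simp add: split_ext_def)

lemma K_one: "\<one>\<^bsub>K\<^esub> = (0, [], False)"
  by (simp add: split_ext_def)

lemma Nil_carrier [simp]: "[] \<in> carrier F"
  by (simp add: carrier_free_group)

lemma append_carrier: "u \<in> carrier F \<Longrightarrow> v \<in> carrier F \<Longrightarrow> reduce (u @ v) \<in> carrier F"
  by (intro reduce_in_carrier) (simp add: carrier_words)

lemma group_K: "group K"
proof (rule groupI)
  fix x y assume "x \<in> carrier K" "y \<in> carrier K"
  then show "x \<otimes>\<^bsub>K\<^esub> y \<in> carrier K" by (cases x; cases y) (auto simp: append_carrier)
next
  fix x y z assume "x \<in> carrier K" "y \<in> carrier K" "z \<in> carrier K"
  then show "x \<otimes>\<^bsub>K\<^esub> y \<otimes>\<^bsub>K\<^esub> z = x \<otimes>\<^bsub>K\<^esub> (y \<otimes>\<^bsub>K\<^esub> z)"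
    by (cases x; cases y; cases z) (auto simp: add.assoc simp flip: reduce_tw)
next
  fix x assume "x \<in> carrier K"
  then obtain a w e where x: "x = (a, w, e)" "w \<in> carrier F" by (cases x) auto
  then show "\<one>\<^bsub>K\<^esub> \<otimes>\<^bsub>K\<^esub> x = x" by (simp add: K_one reduce_carrier)
  let ?v = "if e then tw (inv_word w) else inv_word w"
  have "(- act g (inv_word w) a, ?v, e) \<otimes>\<^bsub>K\<^esub> x = \<one>\<^bsub>K\<^esub>"
    by (simp add: x K_one flip: tau_word_simps(3))
  moreover have "(- act g (inv_word w) a, ?v, e) \<in> carrier K" using x by simp
  ultimately show "\<exists>y\<in>carrier K. y \<otimes>\<^bsub>K\<^esub> x = \<one>\<^bsub>K\<^esub>" by blast
qed (simp add: K_one)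

sublocale K: group K by (rule group_K)

lemma subgroup_G: "subgroup (carrier G) K"
proof (rule K.subgroupI)
  show "carrier G \<noteq> {}" by (force simp: split_sub_def)
  fix x assume x: "x \<in> carrier G"
  then obtain a w where xw: "x = (a, w, False)" "w \<in> carrier F" by (auto simp: split_sub_def)
  have "inv\<^bsub>K\<^esub> x = (- act g (inv_word w) a, inv_word w, False)"
    by (rule K.inv_equality) (use xw in \<open>auto simp: K_one\<close>)
  then show "inv\<^bsub>K\<^esub> x \<in> carrier G" using xw by (simp add: split_sub_def)
  fix y assume "y \<in> carrier G"
  with xw show "x \<otimes>\<^bsub>K\<^esub> y \<in> carrier G" by (auto simp: split_sub_def append_carrier)
qed (auto simp: split_sub_def split_ext_def)

lemma group_G: "group G"
  using K.subgroup_imp_group[OF subgroup_G] by (simp add: split_sub_def)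

sublocale G: group G by (rule group_G)

lemma G_carrier [simp]: "(a, w, e) \<in> carrier G \<longleftrightarrow> w \<in> carrier F \<and> \<not> e"
  by (simp add: split_sub_def)

lemma G_mult [simp]: "(a, w, False) \<otimes>\<^bsub>G\<^esub> (b, v, False) = (a + act g w b, reduce (w @ v), False)"
  by (simp add: split_sub_def split_ext_def)

lemma G_one: "\<one>\<^bsub>G\<^esub> = (0, [], False)"
  by (simp add: split_sub_def split_ext_def)

lemma G_inv [simp]: "w \<in> carrier F \<Longrightarrow> inv\<^bsub>G\<^esub> (a, w, False) = (- act g (inv_word w) a, inv_word w, False)"
  by (rule G.inv_equality) (auto simp: G_one)

lemma G_cases: "x \<in> carrier G \<Longrightarrow> (\<And>a w. x = (a, w, False) \<Longrightarrow> w \<in> carrier F \<Longrightarrow> P) \<Longrightarrow> P"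
  by (cases x) auto

lemma overgroup: "overgroup K G"
  using K.is_group subgroup_G by (simp add: overgroup_def split_sub_def)

lemma card_rcosets: "card (rcosets\<^bsub>K\<^esub> (carrier G)) = 2"
proof -
  have coset: "carrier G #>\<^bsub>K\<^esub> (a, w, e) = {(b, v, d). v \<in> carrier F \<and> d = e}" if w: "w \<in> carrier F" for a w e
  proof (rule Set.set_eqI)
    fix x :: "mat \<times> word \<times> bool"
    obtain b v d where x: "x = (b, v, d)" by (cases x)
    show "x \<in> carrier G #>\<^bsub>K\<^esub> (a, w, e) \<longleftrightarrow> x \<in> {(b, v, d). v \<in> carrier F \<and> d = e}"
    proof
      assume "x \<in> carrier G #>\<^bsub>K\<^esub> (a, w, e)"
      then show "x \<in> {(b, v, d). v \<in> carrier F \<and> d = e}"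
        using w by (auto simp: r_coset_def append_carrier split_sub_def)
    next
      assume "x \<in> {(b, v, d). v \<in> carrier F \<and> d = e}"
      then have v: "v \<in> carrier F" "d = e" by (auto simp: x)
      let ?u = "reduce (v @ inv_word w)"
      have "x = (b - act g ?u a, ?u, False) \<otimes>\<^bsub>K\<^esub> (a, w, e)"
        using v reduce_cancel(1)[of v w "[]"] by (simp add: x reduce_carrier)
      moreover have "(b - act g ?u a, ?u, False) \<in> carrier G" using v w by (simp add: append_carrier)
      ultimately show "x \<in> carrier G #>\<^bsub>K\<^esub> (a, w, e)" unfolding r_coset_def by blast
    qed
  qed
  have "rcosets\<^bsub>K\<^esub> (carrier G) = (\<lambda>e. {(b, v, d). v \<in> carrier F \<and> d = e}) ` UNIV"
  proof -
    have "rcosets\<^bsub>K\<^esub> (carrier G) \<subseteq> (\<lambda>e. {(b, v, d). v \<in> carrier F \<and> d = e}) ` UNIV"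
      using coset by (auto simp: RCOSETS_def)
    moreover have "{(b :: mat, v, d). v \<in> carrier F \<and> d = e} \<in> rcosets\<^bsub>K\<^esub> (carrier G)" for e
      using coset[of "[]" 0 e] by (auto simp: RCOSETS_def intro!: bexI[of _ "(0, [], e)"])
    ultimately show ?thesis by auto
  qed
  moreover have "inj (\<lambda>e :: bool. {(b :: mat, v, d). v \<in> carrier F \<and> d = e})"
  proof (rule injI)
    fix e e' assume "{(b :: mat, v, d). v \<in> carrier F \<and> d = e} = {(b, v, d). v \<in> carrier F \<and> d = e'}"
    then have "(0 :: mat, [], e) \<in> {(b, v, d). v \<in> carrier F \<and> d = e'}" by force
    then show "e = e'" by simp
  qed
  then have "card (range (\<lambda>e :: bool. {(b :: mat, v, d). v \<in> carrier F \<and> d = e})) = card (UNIV :: bool set)"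
    by (rule card_image)
  ultimately show ?thesis by (simp only: card_UNIV_bool)
qed

text \<open>As \<open>\<tau>\<close> centralizes the vectors, the vector \<open>c\<close> of a
  conjugator cancels in \<open>b + c = c + w a\<close>, and comparing the free parts gives
  \<open>tw w = w\<close>.\<close>

lemma conjugate_tau_iff:
  "conjugate K (a, [], True) (b, [], True) \<longleftrightarrow> (\<exists>w\<in>carrier F. tw w = w \<and> b = act g w a)"
proof -
  have "conjugate K (a, [], True) (b, [], True) \<longleftrightarrow>
      (\<exists>k\<in>carrier K. (b, [], True) \<otimes>\<^bsub>K\<^esub> k = k \<otimes>\<^bsub>K\<^esub> (a, [], True))"
    unfolding conjugate_def
    by (rule bex_cong[OF refl]) (auto simp: K.inv_solve_right eq_commute)
  also have "\<dots> \<longleftrightarrow> (\<exists>w\<in>carrier F. tw w = w \<and> b = act g w a)"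
  proof
    assume "\<exists>k\<in>carrier K. (b, [], True) \<otimes>\<^bsub>K\<^esub> k = k \<otimes>\<^bsub>K\<^esub> (a, [], True)"
    then obtain c w e where w: "w \<in> carrier F"
      and eq: "(b, [], True) \<otimes>\<^bsub>K\<^esub> (c, w, e) = (c, w, e) \<otimes>\<^bsub>K\<^esub> (a, [], True)"
      by (metis K_carrier prod_cases3)
    then have "b + c = c + act g w a" "tw w = w" by (auto simp: reduce_carrier)
    then show "\<exists>w\<in>carrier F. tw w = w \<and> b = act g w a"
      using w by (intro bexI[of _ w]) (auto simp: add.commute)
  next
    assume "\<exists>w\<in>carrier F. tw w = w \<and> b = act g w a"
    then obtain w where "w \<in> carrier F" "tw w = w" "b = act g w a" by blast
    then show "\<exists>k\<in>carrier K. (b, [], True) \<otimes>\<^bsub>K\<^esub> k = k \<otimes>\<^bsub>K\<^esub> (a, [], True)"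
      by (intro bexI[of _ "(0, w, False)"]) (auto simp: reduce_carrier)
  qed
  finally show ?thesis .
qed

end

section \<open>Hereditary conjugacy separability\<close>

fun vmod :: "int \<Rightarrow> mat \<Rightarrow> mat" where
  "vmod q (a, b, c, d) = (a mod q, b mod q, c mod q, d mod q)"

lemma vmod_eq_iff: "vmod q a = vmod q b \<longleftrightarrow> dvd_vec q (a - b)"
  by (cases a; cases b) (simp add: mod_eq_dvd_iff)

lemma finite_range_vmod: "q > 0 \<Longrightarrow> finite (vmod q ` S)"
proof (rule finite_subset)
  assume "q > 0"
  then show "vmod q ` S \<subseteq> {0..<q} \<times> {0..<q} \<times> {0..<q} \<times> {0..<q}" by auto
qed simp

lemma vec_decomp: "a = smul (coord a 0) (unit_vec 0) + smul (coord a 1) (unit_vec 1) +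
    smul (coord a 2) (unit_vec 2) + smul (coord a 3) (unit_vec 3)"
  by (cases a) (simp add: unit_vec_def)

lemma dvd_vec_smul_arg: "dvd_vec q a \<Longrightarrow> dvd_vec q (smul k a)"
  by (cases a) simp

lemma elem_elem: "i \<noteq> j \<Longrightarrow> i < 4 \<Longrightarrow> j < 4 \<Longrightarrow> elem i j k (elem i j l a) = elem i j (k + l) a"
proof -
  assume ij: "i \<noteq> j" "i < 4" "j < 4"
  have "coord (elem i j l a) j = coord a j"
    using ij by (cases a) (auto simp: elem_def unit_vec_def)
  then have "elem i j k (elem i j l a) = a + (smul (l * coord a j) (unit_vec i) + smul (k * coord a j) (unit_vec i))"
    by (simp add: elem_def[of i j k] add.assoc) (simp add: elem_def add.assoc)
  also have "\<dots> = elem i j (k + l) a"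
    by (simp only: smul_add(2)[symmetric] elem_def) (simp add: algebra_simps)
  finally show ?thesis .
qed

lemma elem_0 [simp]: "elem i j 0 a = a"
  by (simp add: elem_def)

context twisted_action
begin

definition ker_mod :: "int \<Rightarrow> word set" where
  "ker_mod q = {w \<in> carrier F. \<forall>a. dvd_vec q (act g w a - a)}"

lemma ker_modD: "w \<in> ker_mod q \<Longrightarrow> dvd_vec q (act g w a - a)"
  unfolding ker_mod_def by blast

lemma act_dvd_vec [simp]: "dvd_vec q (act g w a) \<longleftrightarrow> dvd_vec q a"
proof -
  have *: "dvd_vec q a \<Longrightarrow> dvd_vec q (act g w a)" for w a
    unfolding dvd_vec_iff by (metis act_smul)
  show ?thesis using *[of a w] *[of "act g w a" "inv_word w"] by auto
qed

lemma fin_normal_ker_mod: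
  assumes "q > 0"
  shows "fin_normal F (ker_mod q)"
proof -
  have sub: "subgroup (ker_mod q) F"
  proof (rule F.subgroupI)
    show "ker_mod q \<noteq> {}" by (force simp: ker_mod_def)
    fix u assume u: "u \<in> ker_mod q"
    have "dvd_vec q (act g (inv_word u) a - a)" for a
    proof -
      have "dvd_vec q (act g u (act g (inv_word u) a) - act g (inv_word u) a)" using u unfolding ker_mod_def by blast
      then show ?thesis using dvd_vec_minus[of q "a - act g (inv_word u) a"] by simp
    qed
    then show "inv\<^bsub>F\<^esub> u \<in> ker_mod q" using u by (simp add: ker_mod_def inv_free_group)
    fix v assume v: "v \<in> ker_mod q"
    have "dvd_vec q (act g u (act g v a) - a)" for a
    proof -
      have "dvd_vec q ((act g u (act g v a) - act g v a) + (act g v a - a))"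
        by (rule dvd_vec_add[OF ker_modD[OF u] ker_modD[OF v]])
      then show ?thesis by simp
    qed
    then show "u \<otimes>\<^bsub>F\<^esub> v \<in> ker_mod q" using u v by (simp add: ker_mod_def append_carrier)
  qed (auto simp: ker_mod_def)
  have N: "ker_mod q \<lhd> F"
    unfolding F.normal_inv_iff
  proof (intro conjI ballI sub)
    fix w u assume w: "w \<in> carrier F" and u: "u \<in> ker_mod q"
    have "dvd_vec q (act g w (act g u (act g (inv_word w) a)) - a)" for a
    proof -
      have "dvd_vec q (act g w (act g u (act g (inv_word w) a) - act g (inv_word w) a))"
        unfolding act_dvd_vec by (rule ker_modD[OF u])
      then show ?thesis by simp
    qed
    then show "w \<otimes>\<^bsub>F\<^esub> u \<otimes>\<^bsub>F\<^esub> inv\<^bsub>F\<^esub> w \<in> ker_mod q"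
      using w u by (simp add: ker_mod_def inv_free_group carrier_words)
  qed
  let ?\<phi> = "\<lambda>w. restrict (\<lambda>i. vmod q (act g w (unit_vec i))) {..<4}"
  have "?\<phi> ` carrier F \<subseteq> {..<4} \<rightarrow>\<^sub>E (range (vmod q))"
    by (intro image_subsetI) (simp add: restrict_PiE_iff)
  then have "finite (?\<phi> ` carrier F)"
    by (rule finite_subset) (use assms in \<open>simp add: finite_PiE finite_range_vmod\<close>)
  then have "finite (rcosets\<^bsub>F\<^esub> (ker_mod q))"
  proof (rule F.finite_rcosets_if[OF sub])
    fix u v assume u: "u \<in> carrier F" and v: "v \<in> carrier F" and eq: "?\<phi> u = ?\<phi> v"
    have unit: "dvd_vec q (act g u (unit_vec i) - act g v (unit_vec i))" if "i < 4" for i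
      using fun_cong[OF eq, of i] that by (simp add: vmod_eq_iff)
    have all: "dvd_vec q (act g u a - act g v a)" for a
    proof -
      let ?d = "\<lambda>i. smul (coord a i) (act g u (unit_vec i) - act g v (unit_vec i))"
      have "act g u a - act g v a = ?d 0 + ?d 1 + ?d 2 + ?d 3"
        by (subst (1 2) vec_decomp[of a]) (simp add: act_smul smul_add)
      moreover have "dvd_vec q (?d 0 + ?d 1 + ?d 2 + ?d 3)"
        by (intro dvd_vec_add dvd_vec_smul_arg unit) auto
      ultimately show ?thesis by simp
    qed
    have "dvd_vec q (act g (u @ inv_word v) a - a)" for a
      using all[of "act g (inv_word v) a"] by simp
    then show "u \<otimes>\<^bsub>F\<^esub> inv\<^bsub>F\<^esub> v \<in> ker_mod q"
      using u v by (simp add: ker_mod_def inv_free_group carrier_words)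
  qed
  with N show ?thesis by (simp add: fin_normal_def)
qed

definition congr_sub :: "int \<Rightarrow> word set \<Rightarrow> (mat \<times> word \<times> bool) set" where
  "congr_sub q D = {(c, u, e). dvd_vec q c \<and> u \<in> D \<and> \<not> e}"

lemma congr_sub_iff [simp]: "(c, u, e) \<in> congr_sub q D \<longleftrightarrow> dvd_vec q c \<and> u \<in> D \<and> \<not> e"
  by (simp add: congr_sub_def)

text \<open>Conjugating \<open>(c, u)\<close> by a vector \<open>a\<close> adds
  \<open>a - u a\<close>, so normality rests on \<open>u\<close> acting trivially modulo
  \<open>q\<close>.\<close>

lemma fin_normal_congr_sub:
  assumes q: "q > 0" and D: "fin_normal F D" "D \<subseteq> ker_mod q"
  shows "fin_normal G (congr_sub q D)"
proof -
  interpret D: normal D F using D by (simp add: fin_normal_def)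
  have sub: "subgroup (congr_sub q D) G"
  proof (rule G.subgroupI)
    show "congr_sub q D \<subseteq> carrier G" using D.subset by (auto simp: congr_sub_def split_sub_def)
    have "(0, [], False) \<in> congr_sub q D" using D.one_closed by simp
    then show "congr_sub q D \<noteq> {}" by blast
    fix x assume "x \<in> congr_sub q D"
    then obtain c u where x: "x = (c, u, False)" "dvd_vec q c" "u \<in> D" by (auto simp: congr_sub_def)
    then have uF: "u \<in> carrier F" using D.subset by blast
    show "inv\<^bsub>G\<^esub> x \<in> congr_sub q D"
      using x uF D.m_inv_closed[of u] by (simp add: inv_free_group)
    fix y assume "y \<in> congr_sub q D"
    then obtain d v where y: "y = (d, v, False)" "dvd_vec q d" "v \<in> D" by (auto simp: congr_sub_def)
    then show "x \<otimes>\<^bsub>G\<^esub> y \<in> congr_sub q D"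
      using x D.m_closed[of u v] by (simp add: dvd_vec_add)
  qed
  have N: "congr_sub q D \<lhd> G"
    unfolding G.normal_inv_iff
  proof (intro conjI ballI sub)
    fix x y assume "x \<in> carrier G" "y \<in> congr_sub q D"
    then obtain a w c u where x: "x = (a, w, False)" "w \<in> carrier F" and y: "y = (c, u, False)" "dvd_vec q c" "u \<in> D"
      by (auto simp: congr_sub_def elim!: G_cases)
    have uF: "u \<in> carrier F" using y D.subset by blast
    let ?v = "reduce (w @ u @ inv_word w)"
    have v: "?v \<in> D"
      using fin_normal_conj[OF D(1), of u w] y x uF by (simp add: carrier_words reduce_carrier)
    have "x \<otimes>\<^bsub>G\<^esub> y \<otimes>\<^bsub>G\<^esub> inv\<^bsub>G\<^esub> x = (a + act g w c - act g ?v a, ?v, False)"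
      using x y uF by simp
    moreover have "dvd_vec q (act g w c - (act g ?v a - a))"
      using y v D(2) by (intro dvd_vec_diff[OF _ ker_modD]) auto
    then have "dvd_vec q (a + act g w c - act g ?v a)" by (simp add: algebra_simps)
    ultimately show "x \<otimes>\<^bsub>G\<^esub> y \<otimes>\<^bsub>G\<^esub> inv\<^bsub>G\<^esub> x \<in> congr_sub q D" using v by simp
  qed
  let ?\<phi> = "\<lambda>(c, u, e :: bool). (vmod q c, D #>\<^bsub>F\<^esub> u)"
  have "?\<phi> ` carrier G \<subseteq> range (vmod q) \<times> (rcosets\<^bsub>F\<^esub> D)"
    by (auto simp: RCOSETS_def split_sub_def)
  then have "finite (?\<phi> ` carrier G)"
    by (rule finite_subset) (use q D in \<open>simp add: finite_range_vmod fin_normal_def\<close>)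
  then have "finite (rcosets\<^bsub>G\<^esub> (congr_sub q D))"
  proof (rule G.finite_rcosets_if[OF sub])
    fix x y assume "x \<in> carrier G" "y \<in> carrier G" and eq: "?\<phi> x = ?\<phi> y"
    then obtain a w b v where x: "x = (a, w, False)" "w \<in> carrier F" and y: "y = (b, v, False)" "v \<in> carrier F"
      by (auto elim!: G_cases)
    have ab: "dvd_vec q (a - b)" and wv: "D #>\<^bsub>F\<^esub> w = D #>\<^bsub>F\<^esub> v" using eq by (simp_all add: x y vmod_eq_iff)
    have D': "reduce (w @ inv_word v) \<in> D"
      using F.rcoset_eq_imp[OF D.subgroup_axioms x(2) y(2) wv] y by (simp add: inv_free_group)
    have "dvd_vec q ((a - b) - (act g (reduce (w @ inv_word v)) b - b))"
      using D' D(2) by (intro dvd_vec_diff[OF ab ker_modD]) auto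
    then show "x \<otimes>\<^bsub>G\<^esub> inv\<^bsub>G\<^esub> y \<in> congr_sub q D" using x y D' by simp
  qed
  with N show ?thesis by (simp add: fin_normal_def)
qed

text \<open>Vectors divisible by the factorial \<open>q\<close> of the index are \<open>q\<close>-th
  powers and lie in \<open>H\<close>; the free part is handled by the preimage of the normal core of
  \<open>H\<close>.\<close>

lemma finite_index_core:
  assumes H: "subgroup H G" "finite (rcosets\<^bsub>G\<^esub> H)"
  shows "\<exists>q>0. \<exists>U. fin_normal F U \<and> congr_sub q U \<subseteq> H"
proof -
  interpret H: subgroup H G by fact
  define q where "q = (fact (card (rcosets\<^bsub>G\<^esub> H)) :: nat)"
  define \<iota> where "\<iota> = (\<lambda>w. (0 :: mat, w :: word, False))"
  have \<iota>: "\<iota> \<in> hom F G" by (rule homI) (auto simp: \<iota>_def)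
  define U where "U = {w \<in> carrier F. \<forall>x\<in>carrier G. x \<otimes>\<^bsub>G\<^esub> \<iota> w \<otimes>\<^bsub>G\<^esub> inv\<^bsub>G\<^esub> x \<in> H}"
  have U: "fin_normal F U" unfolding U_def by (rule G.fin_normal_comap[OF F.is_group \<iota> H])
  have "(c, u, False) \<in> H" if "dvd_vec (int q) c" "u \<in> U" for c u
  proof -
    obtain b where b: "c = smul (int q) b" using \<open>dvd_vec (int q) c\<close> unfolding dvd_vec_iff by blast
    have "(b, [], False) [^]\<^bsub>G\<^esub> k = (smul (int k) b, [], False)" for k :: nat
      by (induction k) (auto simp: G_one smul_add algebra_simps)
    then have 1: "(c, [], False) \<in> H"
      using G.pow_fact_in_subgroup[OF H, of "(b, [], False)"] by (simp add: b q_def)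
    have "\<one>\<^bsub>G\<^esub> \<otimes>\<^bsub>G\<^esub> \<iota> u \<otimes>\<^bsub>G\<^esub> inv\<^bsub>G\<^esub> \<one>\<^bsub>G\<^esub> \<in> H" using \<open>u \<in> U\<close> unfolding U_def by blast
    moreover have u: "u \<in> carrier F" using \<open>u \<in> U\<close> by (simp add: U_def)
    ultimately have "(0, u, False) \<in> H" by (simp add: \<iota>_def)
    from H.m_closed[OF 1 this] show ?thesis using u by (simp add: reduce_carrier)
  qed
  then have "congr_sub (int q) U \<subseteq> H" by (auto simp: congr_sub_def)
  moreover have "int q > 0" by (simp add: q_def)
  ultimately show ?thesis using U by blast
qed

end

lemma (in group) fin_normal_restrict:
  assumes W: "fin_normal G W" and H: "subgroup H G"
  shows "fin_normal (G\<lparr>carrier := H\<rparr>) (W \<inter> H)"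
proof -
  interpret H: subgroup H G by fact
  interpret W: normal W G using W by (simp add: fin_normal_def)
  interpret GH: group "G\<lparr>carrier := H\<rparr>" by (rule subgroup_imp_group[OF H])
  have inv: "inv\<^bsub>G\<lparr>carrier := H\<rparr>\<^esub> x = inv x" if "x \<in> H" for x using m_inv_consistent[OF H that] .
  have sub: "subgroup (W \<inter> H) (G\<lparr>carrier := H\<rparr>)"
    by (rule GH.subgroupI) (use W.one_closed H.one_closed in \<open>auto simp: inv simp del: W.one_closed H.one_closed\<close>)
  have N: "W \<inter> H \<lhd> G\<lparr>carrier := H\<rparr>"
    unfolding GH.normal_inv_iff using sub W.inv_op_closed2 by (auto simp: inv)
  have "(#>) W ` H \<subseteq> rcosets W" using H.subset by (auto simp: RCOSETS_def)
  then have "finite ((#>) W ` carrier (G\<lparr>carrier := H\<rparr>))"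
    using W finite_subset by (auto simp: fin_normal_def)
  then have "finite (rcosets\<^bsub>G\<lparr>carrier := H\<rparr>\<^esub> (W \<inter> H))"
  proof (rule GH.finite_rcosets_if[OF sub])
    fix u v assume "u \<in> carrier (G\<lparr>carrier := H\<rparr>)" "v \<in> carrier (G\<lparr>carrier := H\<rparr>)" "W #> u = W #> v"
    then show "u \<otimes>\<^bsub>G\<lparr>carrier := H\<rparr>\<^esub> inv\<^bsub>G\<lparr>carrier := H\<rparr>\<^esub> v \<in> W \<inter> H"
      using rcoset_eq_imp[OF W.subgroup_axioms, of u v] by (simp add: inv)
  qed
  with N show ?thesis by (simp add: fin_normal_def)
qed

context twisted_action
begin

lemma content_act [simp]: "content (act g w a) = content a"
  by (metis act_dvd_vec content_nonneg dvd_content_iff dvd_refl zdvd_antisym_nonneg)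

text \<open>Elements of \<open>D\<close> act trivially modulo \<open>q\<close>, so in the vector
  component the conjugate of \<open>\<gamma>\<close> by \<open>u\<close> may be replaced by
  \<open>h\<close>.\<close>

lemma conj_in_congr_sub:
  assumes "u \<in> carrier F" "\<gamma> \<in> carrier F" "h \<in> carrier F" "D \<subseteq> ker_mod q"
    and "(c, u, False) \<otimes>\<^bsub>G\<^esub> (a, \<gamma>, False) \<otimes>\<^bsub>G\<^esub> inv\<^bsub>G\<^esub> (c, u, False) \<otimes>\<^bsub>G\<^esub> inv\<^bsub>G\<^esub> (b, h, False) \<in> congr_sub q D"
  shows "reduce (u @ \<gamma> @ inv_word u @ inv_word h) \<in> D" "dvd_vec q (c + act g u a - act g h c - b)"
proof -
  let ?s = "reduce (u @ \<gamma> @ inv_word u @ inv_word h)"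
  have eq: "(c, u, False) \<otimes>\<^bsub>G\<^esub> (a, \<gamma>, False) \<otimes>\<^bsub>G\<^esub> inv\<^bsub>G\<^esub> (c, u, False) \<otimes>\<^bsub>G\<^esub> inv\<^bsub>G\<^esub> (b, h, False) =
      (c + act g u a - act g u (act g \<gamma> (act g (inv_word u) c)) - act g u (act g \<gamma> (act g (inv_word u) (act g (inv_word h) b))), ?s, False)"
    using assms(1-3) by simp
  then show s: "?s \<in> D" using assms(5) by simp
  have act_s: "dvd_vec q (act g ?s x - x)" for x using ker_modD s assms(4) by blast
  have "act g ?s (act g h c) = act g u (act g \<gamma> (act g (inv_word u) c))" by simp
  moreover have "act g ?s b = act g u (act g \<gamma> (act g (inv_word u) (act g (inv_word h) b)))" by simp
  ultimately have "dvd_vec q (c + act g u a - act g ?s (act g h c) - act g ?s b)"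
    using assms(5) unfolding eq congr_sub_iff by simp
  then have "dvd_vec q ((c + act g u a - act g ?s (act g h c) - act g ?s b) + (act g ?s (act g h c) - act g h c)
      + (act g ?s b - b))"
    using act_s by (intro dvd_vec_add)
  then show "dvd_vec q (c + act g u a - act g h c - b)" by (simp add: algebra_simps)
qed

text \<open>The vectors \<open>b'\<close> for which \<open>(b', h)\<close> is conjugate to
  \<open>(a, \<gamma>)\<close> by an element of \<open>H\<close> form finitely many cosets of a
  subgroup of \<open>\<int>\<^sup>4\<close>. These are closed in the congruence topology, so
  \<open>b\<close> is excluded modulo some \<open>q\<close>; finite quotients of \<open>F\<close>
  then allow only conjugators close to exact ones.\<close>

lemma separate_hyperbolic:
  assumes H: "subgroup H G" and core: "q0 > 0" "fin_normal F U0" "congr_sub q0 U0 \<subseteq> H"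
    and \<gamma>: "\<gamma> \<in> carrier F" "\<gamma> \<noteq> []" and h: "h \<in> carrier F"
    and nc: "\<And>k. k \<in> H \<Longrightarrow> k \<otimes>\<^bsub>G\<^esub> (a, \<gamma>, False) \<otimes>\<^bsub>G\<^esub> inv\<^bsub>G\<^esub> k \<noteq> (b, h, False)"
  shows "\<exists>W. fin_normal G W \<and> (\<forall>k\<in>H. k \<otimes>\<^bsub>G\<^esub> (a, \<gamma>, False) \<otimes>\<^bsub>G\<^esub> inv\<^bsub>G\<^esub> k \<otimes>\<^bsub>G\<^esub> inv\<^bsub>G\<^esub> (b, h, False) \<notin> W)"
proof -
  interpret H: subgroup H G by fact
  have \<gamma>': "reduce \<gamma> \<noteq> []" using \<gamma> by (simp add: reduce_carrier)
  obtain E where E: "finite E" "E \<subseteq> words n" "\<And>e. e \<in> E \<Longrightarrow> reduce (e @ \<gamma>) = reduce (h @ e)"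
    and approx: "\<And>U. fin_normal F U \<Longrightarrow> \<exists>\<Delta>. fin_normal F \<Delta> \<and> \<Delta> \<subseteq> U \<and>
      (\<forall>d\<in>words n. reduce (d @ \<gamma> @ inv_word d @ inv_word h) \<in> \<Delta> \<longrightarrow>
        (\<exists>e\<in>E. \<exists>j. reduce (inv_word d @ e @ concat (replicate j \<gamma>)) \<in> U))"
    using conjugators_approximate[OF carrier_words[OF \<gamma>(1)] \<gamma>' carrier_words[OF h]] by metis
  define p where "p e j = e @ concat (replicate j \<gamma>)" for e j
  have p_words: "p e j \<in> words n" if "e \<in> E" for e j
    using that E(2) \<gamma>(1) by (auto simp: p_def words_concat carrier_words)
  have p_conj: "reduce (p e j @ \<gamma>) = reduce (h @ p e j)" if "e \<in> E" for e j
  proof -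
    have "reduce (p e j @ \<gamma>) = reduce (reduce (e @ \<gamma>) @ concat (replicate j \<gamma>))"
      by (simp add: p_def concat_replicate_snoc)
    then show ?thesis by (simp only: E(3)[OF that]) (simp add: p_def)
  qed
  \<comment> \<open>The vectors that occur with \<open>h\<close> among the conjugates of
    \<open>(a, \<gamma>)\<close> by elements of \<open>H\<close> above exact conjugators
    \<open>p e j\<close>.\<close>
  define S where "S = {act g (p e j) a + c - act g h c | e j c. e \<in> E \<and> (c, reduce (p e j), False) \<in> H}"
  \<comment> \<open>Multiplying a conjugator by a vector divisible by \<open>q0\<close> stays in
    \<open>H\<close> and translates \<open>S\<close> by an element of \<open>B\<close>.\<close>
  define B where "B = {c - act g h c | c. dvd_vec q0 c}"
  have B: "subspace B"
    unfolding subspace_def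
  proof (intro conjI ballI)
    have "0 - act g h 0 \<in> B" unfolding B_def using dvd_vec_0 by blast
    then show "0 \<in> B" by simp
    fix x y assume "x \<in> B" "y \<in> B"
    then obtain c d where "x = c - act g h c" "y = d - act g h d" "dvd_vec q0 c" "dvd_vec q0 d" by (auto simp: B_def)
    then have "x - y = (c - d) - act g h (c - d)" "dvd_vec q0 (c - d)" by (auto simp: dvd_vec_diff)
    then show "x - y \<in> B" unfolding B_def by blast
  qed
  have SB: "s + \<beta> \<in> S" if s: "s \<in> S" and \<beta>: "\<beta> \<in> B" for s \<beta>
  proof -
    obtain e j c where ejc: "s = act g (p e j) a + c - act g h c" "e \<in> E" "(c, reduce (p e j), False) \<in> H"
      using s by (auto simp: S_def)
    obtain d where d: "\<beta> = d - act g h d" "dvd_vec q0 d" using \<beta> by (auto simp: B_def)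
    interpret U0: normal U0 F using core by (simp add: fin_normal_def)
    have "(d, [], False) \<in> H" using d core(3) U0.one_closed by auto
    from H.m_closed[OF this ejc(3)] have "(d + c, reduce (p e j), False) \<in> H" by simp
    moreover have "s + \<beta> = act g (p e j) a + (d + c) - act g h (d + c)" by (simp add: ejc d algebra_simps)
    ultimately show ?thesis using ejc(2) unfolding S_def by blast
  qed
  have bS: "b \<notin> S"
  proof
    assume "b \<in> S"
    then obtain e j c where e: "e \<in> E" and b: "b = act g (p e j) a + c - act g h c" and k: "(c, reduce (p e j), False) \<in> H"
      by (auto simp: S_def)
    have conj: "reduce (p e j @ \<gamma> @ inv_word (p e j)) = h"
    proof -
      have "reduce (p e j @ \<gamma> @ inv_word (p e j)) = reduce (reduce (p e j @ \<gamma>) @ inv_word (p e j))" by simp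
      also have "\<dots> = reduce (h @ p e j @ inv_word (p e j) @ [])" by (simp only: p_conj[OF e]) simp
      also have "\<dots> = h" by (subst reduce_cancel) (simp add: reduce_carrier h)
      finally show ?thesis .
    qed
    have inv_red: "reduce (u @ inv_word (reduce v)) = reduce (u @ inv_word v)" if "v \<in> words n" for u v
    proof -
      have "reduce (inv_word (reduce v)) = reduce (inv_word v)"
      proof -
        have "reduce (inv_word v) = reduce (inv_word v @ reduce v @ inv_word (reduce v))"
          using reduce_cancel(2)[of "inv_word v" "reduce v" "[]"] by simp
        also have "\<dots> = reduce (reduce (inv_word v @ v) @ inv_word (reduce v))"
          by (metis append_assoc reduce_twice)
        finally show ?thesis by simp
      qed
      then show ?thesis by (metis reduce_twice(1))
    qed
    have pw: "p e j \<in> words n" using p_words e by blast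
    have act_h: "act g (p e j) (act g \<gamma> (act g (inv_word (reduce (p e j))) c)) = act g h c"
    proof -
      have "act g h c = act g (p e j @ \<gamma> @ inv_word (reduce (p e j))) c"
        using conj inv_red[OF pw, of "p e j @ \<gamma>"] act_r[of "p e j @ \<gamma> @ inv_word (reduce (p e j))" c] by simp
      then show ?thesis by simp
    qed
    have "(c, reduce (p e j), False) \<otimes>\<^bsub>G\<^esub> (a, \<gamma>, False) \<otimes>\<^bsub>G\<^esub> inv\<^bsub>G\<^esub> (c, reduce (p e j), False) = (b, h, False)"
      using pw \<gamma>(1) act_h conj inv_red[OF pw, of "p e j @ \<gamma>"] by (simp add: b)
    with nc[OF k] show False by blast
  qed
  \<comment> \<open>Finitely many representatives of \<open>S\<close> modulo \<open>B\<close>: the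
    power of \<open>\<gamma>\<close> is absorbed into the vector of the conjugator, which matters
    only modulo \<open>q0\<close>.\<close>
  define R where "R = (\<lambda>(e, z). act g e a + z - act g h z) ` (E \<times> range (vmod q0))"
  have "finite R" unfolding R_def using E(1) finite_range_vmod[OF core(1)] by simp
  have SR: "\<exists>r\<in>R. \<exists>\<beta>\<in>B. s = r + \<beta>" if s: "s \<in> S" for s
  proof -
    obtain e j c where ejc: "s = act g (p e j) a + c - act g h c" "e \<in> E" using s unfolding S_def by blast
    have he: "act g h (act g e x) = act g e (act g \<gamma> x)" for x
      using act_r[of "e @ \<gamma>" x] act_r[of "h @ e" x] E(3)[OF ejc(2)] by simp
    \<comment> \<open>The difference between \<open>a\<close> and its image under a power of
      \<open>\<gamma>\<close> telescopes to the form \<open>z - \<gamma> z\<close>.\<close>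
    have "\<exists>z. act g (concat (replicate j \<gamma>)) a = a + z - act g \<gamma> z" for j
    proof (induction j)
      case 0
      have "act g (concat (replicate 0 \<gamma>)) a = a + 0 - act g \<gamma> 0" by simp
      then show ?case by blast
    next
      case (Suc j)
      then obtain z where z: "act g (concat (replicate j \<gamma>)) a = a + z - act g \<gamma> z" by blast
      have "act g (concat (replicate (Suc j) \<gamma>)) a = a + (act g \<gamma> z - a) - act g \<gamma> (act g \<gamma> z - a)"
        by (simp add: z)
      then show ?case by blast
    qed
    then obtain z where z: "act g (concat (replicate j \<gamma>)) a = a + z - act g \<gamma> z" by blast
    define y where "y = act g e z + c"
    have s: "s = act g e a + y - act g h y" by (simp add: ejc y_def p_def z he)
    let ?r = "act g e a + vmod q0 y - act g h (vmod q0 y)"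
    let ?\<beta> = "(y - vmod q0 y) - act g h (y - vmod q0 y)"
    have "?r \<in> R" using ejc(2) unfolding R_def by force
    moreover have "dvd_vec q0 (y - vmod q0 y)" by (cases y) simp
    then have "?\<beta> \<in> B" unfolding B_def by blast
    moreover have "s = ?r + ?\<beta>" by (simp add: s)
    ultimately show ?thesis by blast
  qed
  have "\<exists>qr>0. \<forall>\<beta>\<in>B. \<not> dvd_vec qr (b - r - \<beta>)" if "r \<in> R \<inter> S" for r
  proof (rule subspace_closed[OF B])
    show "b - r \<notin> B"
    proof
      assume "b - r \<in> B"
      then have "r + (b - r) \<in> S" using that SB by blast
      then show False using bS by simp
    qed
  qed
  then obtain qf where qf: "\<And>r. r \<in> R \<inter> S \<Longrightarrow> qf r > 0" "\<And>r \<beta>. r \<in> R \<inter> S \<Longrightarrow> \<beta> \<in> B \<Longrightarrow> \<not> dvd_vec (qf r) (b - r - \<beta>)"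
    by metis
  define q where "q = (\<Prod>r\<in>R \<inter> S. qf r)"
  have q: "q > 0" unfolding q_def using qf(1) by (intro prod_pos) auto
  have qS: "\<not> dvd_vec q (b - s)" if "s \<in> S" for s
  proof
    assume dvd: "dvd_vec q (b - s)"
    obtain r \<beta> where r: "r \<in> R" "\<beta> \<in> B" "s = r + \<beta>" using SR \<open>s \<in> S\<close> by blast
    have "0 - \<beta> \<in> B" using B r(2) unfolding subspace_def by blast
    then have "s + (0 - \<beta>) \<in> S" using SB \<open>s \<in> S\<close> by blast
    then have rS: "r \<in> R \<inter> S" using r by simp
    have "qf r dvd q" unfolding q_def using rS \<open>finite R\<close> by (intro dvd_prodI) auto
    then have "dvd_vec (qf r) (b - r - \<beta>)" using dvd dvd_vec_dvd_trans by (simp add: r diff_diff_eq)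
    then show False using qf(2)[OF rS r(2)] by blast
  qed
  \<comment> \<open>An error in \<open>U0\<close> keeps the exact conjugator inside
    \<open>H\<close>, and an error in \<open>ker_mod q\<close> leaves vectors unchanged modulo
    \<open>q\<close>.\<close>
  have U: "fin_normal F (U0 \<inter> ker_mod q)" using core(2) fin_normal_ker_mod[OF q] by (rule F.fin_normal_Int)
  obtain D where D: "fin_normal F D" "D \<subseteq> U0 \<inter> ker_mod q"
    "\<And>d. d \<in> words n \<Longrightarrow> reduce (d @ \<gamma> @ inv_word d @ inv_word h) \<in> D \<Longrightarrow>
      \<exists>e\<in>E. \<exists>j. reduce (inv_word d @ e @ concat (replicate j \<gamma>)) \<in> U0 \<inter> ker_mod q"
    using approx[OF U] by blast
  have "fin_normal G (congr_sub q D)" using q D by (intro fin_normal_congr_sub) auto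
  moreover have "k \<otimes>\<^bsub>G\<^esub> (a, \<gamma>, False) \<otimes>\<^bsub>G\<^esub> inv\<^bsub>G\<^esub> k \<otimes>\<^bsub>G\<^esub> inv\<^bsub>G\<^esub> (b, h, False) \<notin> congr_sub q D" if k: "k \<in> H" for k
  proof
    assume in_sub: "k \<otimes>\<^bsub>G\<^esub> (a, \<gamma>, False) \<otimes>\<^bsub>G\<^esub> inv\<^bsub>G\<^esub> k \<otimes>\<^bsub>G\<^esub> inv\<^bsub>G\<^esub> (b, h, False) \<in> congr_sub q D"
    obtain c u where cu: "k = (c, u, False)" "u \<in> carrier F" using H.mem_carrier[OF k] by (elim G_cases)
    have Dq: "D \<subseteq> ker_mod q" using D by blast
    note conj = conj_in_congr_sub[OF cu(2) \<gamma>(1) h Dq in_sub[unfolded cu(1)]]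
    obtain e j where e: "e \<in> E" and w: "reduce (inv_word u @ p e j) \<in> U0" "reduce (inv_word u @ p e j) \<in> ker_mod q"
      using D(3)[OF carrier_words[OF cu(2)] conj(1)] by (auto simp: p_def)
    have "(0, reduce (inv_word u @ p e j), False) \<in> H" using w core(3) by auto
    from H.m_closed[OF k this] have "(c, reduce (p e j), False) \<in> H"
      using reduce_cancel(2)[of "[]" u "p e j"] by (simp add: cu)
    then have S: "act g (p e j) a + c - act g h c \<in> S" using e unfolding S_def by blast
    have "dvd_vec q (act g u (act g (reduce (inv_word u @ p e j)) a - a))"
      unfolding act_dvd_vec by (rule ker_modD[OF w(2)])
    then have "dvd_vec q (act g (p e j) a - act g u a)" by simp
    then have "dvd_vec q ((act g (p e j) a - act g u a) + (c + act g u a - act g h c - b))"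
      using conj(2) by (rule dvd_vec_add)
    moreover have "(act g (p e j) a - act g u a) + (c + act g u a - act g h c - b) = - (b - (act g (p e j) a + c - act g h c))"
      by (simp add: algebra_simps)
    ultimately have "dvd_vec q (b - (act g (p e j) a + c - act g h c))" by (simp only: dvd_vec_minus)
    with qS[OF S] show False by blast
  qed
  ultimately show ?thesis by blast
qed

end

lemma dvd_vec_content: "dvd_vec q (a - b) \<Longrightarrow> p dvd q \<Longrightarrow> p dvd content a \<longleftrightarrow> p dvd content b"
proof -
  assume "dvd_vec q (a - b)" "p dvd q"
  then have p: "dvd_vec p (a - b)" by (rule dvd_vec_dvd_trans[rotated])
  have "dvd_vec p (b + (a - b))" if "dvd_vec p b" using that p by (rule dvd_vec_add)
  moreover have "dvd_vec p (a - (a - b))" if "dvd_vec p a" using that p by (rule dvd_vec_diff)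
  ultimately show ?thesis unfolding dvd_content_iff by auto
qed

lemma dvd_vec_smul_smul: "d \<noteq> 0 \<Longrightarrow> dvd_vec (d * q) (smul d a) \<longleftrightarrow> dvd_vec q a"
  by (cases a) simp

locale elementary_action = twisted_action +
  assumes elems: "\<And>i j. i < 4 \<Longrightarrow> j < 4 \<Longrightarrow> i \<noteq> j \<Longrightarrow> \<exists>l<n. g l = elem i j 1"
begin

lemma act_pow: "x \<in> carrier F \<Longrightarrow> act g (x [^]\<^bsub>F\<^esub> (k :: nat)) a = (act g x ^^ k) a"
proof (induction k arbitrary: a)
  case (Suc k)
  then show ?case by (simp add: free_group_def funpow_swap1)
qed (simp add: free_group_def)

text \<open>Some letter acts as \<open>elem i j 1\<close>; its power with the factorial of the index
  as exponent lies in \<open>U\<close>, and composing such maps adds their third arguments.\<close>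

lemma elem_power_in_subgroup:
  assumes U: "subgroup U F" "finite (rcosets\<^bsub>F\<^esub> U)" and ij: "i < 4" "j < 4" "i \<noteq> j"
  shows "\<exists>v\<in>U. act g v = elem i j (fact (card (rcosets\<^bsub>F\<^esub> U)) * k)"
proof -
  interpret U: subgroup U F by fact
  obtain l where l: "l < n" "g l = elem i j 1" using elems ij by blast
  define m where "m = (fact (card (rcosets\<^bsub>F\<^esub> U)) :: nat)"
  define x where "x = [(l, True)]"
  have x: "x \<in> carrier F" using l by (simp add: x_def carrier_free_group words_def reduced_def)
  have x_pow: "(act g x ^^ k) a = elem i j (int k) a" for k a
    by (induction k) (use ij in \<open>simp_all add: x_def l act_letter_def elem_elem\<close>)
  define L where "L = x [^]\<^bsub>F\<^esub> m"
  have L: "L \<in> U" unfolding L_def m_def by (rule F.pow_fact_in_subgroup[OF U x])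
  have L_carrier: "L \<in> carrier F" using L U.subset by blast
  have act_L: "act g L a = elem i j (int m) a" for a
    using act_pow[OF x] x_pow by (simp add: L_def)
  have act_inv_L: "act g (inv_word L) a = elem i j (- int m) a" for a
  proof -
    have "elem i j (- int m) (act g L (act g (inv_word L) a)) = act g (inv_word L) a"
      unfolding act_L using ij by (simp add: elem_elem)
    then show ?thesis by simp
  qed
  have "\<exists>v\<in>U. act g v = elem i j (int m * k)"
  proof (induction k rule: int_induct[where k = 0])
    case base
    show ?case using U.one_closed by (intro bexI[of _ "[]"]) (auto simp: free_group_def fun_eq_iff)
  next
    case (step1 k)
    then obtain v where v: "v \<in> U" "act g v = elem i j (int m * k)" by blast
    have "reduce (L @ v) \<in> U" using U.m_closed[OF L v(1)] by (simp add: free_group_def)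
    moreover have "act g (reduce (L @ v)) = elem i j (int m * (k + 1))"
    proof
      show "act g (reduce (L @ v)) a = elem i j (int m * (k + 1)) a" for a
        using ij by (simp add: act_L v(2) elem_elem algebra_simps)
    qed
    ultimately show ?case by blast
  next
    case (step2 k)
    then obtain v where v: "v \<in> U" "act g v = elem i j (int m * k)" by blast
    have "inv_word L \<in> U" using U.m_inv_closed[OF L] L_carrier by (simp add: inv_free_group)
    then have "reduce (inv_word L @ v) \<in> U" using U.m_closed[OF _ v(1)] by (simp add: free_group_def)
    moreover have "act g (reduce (inv_word L @ v)) = elem i j (int m * (k - 1))"
    proof
      show "act g (reduce (inv_word L @ v)) a = elem i j (int m * (k - 1)) a" for a
        using ij by (simp add: act_inv_L v(2) elem_elem algebra_simps)
    qed
    ultimately show ?case by blast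
  qed
  then show ?thesis by (simp add: m_def)
qed

text \<open>Two vectors of content 1 that are congruent modulo \<open>m\<^sup>2\<close> are in the same orbit under the \<open>m\<close>-th powers
  of elementary matrices, hence in the same \<open>U\<close>-orbit for suitable \<open>m\<close>.\<close>

lemma separate_orbits:
  assumes U: "fin_normal F U" and ne: "\<And>u. u \<in> S \<Longrightarrow> act g u a \<noteq> b"
    and S: "\<And>u v. u \<in> S \<Longrightarrow> v \<in> U \<Longrightarrow> reduce (v @ u) \<in> S" "S \<subseteq> carrier F"
  shows "\<exists>q>0. \<forall>u\<in>S. \<not> dvd_vec q (act g u a - b)"
proof (cases "S = {}")
  case False
  interpret U: normal U F using U by (simp add: fin_normal_def)
  define d where "d = content a"
  define d' where "d' = content b"
  have d: "d \<ge> 0" "d' \<ge> 0" by (simp_all add: d_def d'_def)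
  have div: "p dvd d \<longleftrightarrow> p dvd d'" if "dvd_vec q (act g u a - b)" "p dvd q" for p q u
    using dvd_vec_content[OF that] by (simp add: d_def d'_def)
  consider "d \<noteq> d'" "d = 0" | "d \<noteq> d'" "d' = 0" | "d \<noteq> d'" "d > 0" "d' > 0" | "d = d'" "d = 0" | "d = d'" "d > 0"
    using d by linarith
  then show ?thesis
  proof cases
    \<comment> \<open>The modulus \<open>2 * d'\<close> divides \<open>d = 0\<close> but not
      \<open>d' > 0\<close>.\<close>
    case 1
    have "\<not> dvd_vec (2 * d') (act g u a - b)" for u
      using div[of "2 * d'" u "2 * d'"] 1 d by (auto dest: zdvd_imp_le)
    then show ?thesis using 1 d by (intro exI[of _ "2 * d'"]) auto
  next
    case 2
    have "\<not> dvd_vec (2 * d) (act g u a - b)" for u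
      using div[of "2 * d" u "2 * d"] 2 d by (auto dest: zdvd_imp_le)
    then show ?thesis using 2 d by (intro exI[of _ "2 * d"]) auto
  next
    case 3
    \<comment> \<open>Both contents divide \<open>d * d'\<close>, so a congruence modulo this
      product would make them divide each other.\<close>
    have "\<not> dvd_vec (d * d') (act g u a - b)" for u
      using div[of "d * d'" u d] div[of "d * d'" u d'] 3 zdvd_antisym_nonneg[of d d'] by auto
    then show ?thesis using 3 by (intro exI[of _ "d * d'"]) auto
  next
    case 4
    then have "content a = 0" "content b = 0" by (simp_all add: d_def d'_def)
    then have "a = 0" "b = 0" by (simp_all only: content_zero_iff)
    with False ne show ?thesis by force
  next
    case 5
    obtain a' b' where a': "a = smul d a'" and b': "b = smul d b'"
      using dvd_content_iff[of d a] dvd_content_iff[of d b] 5 unfolding d_def[symmetric] d'_def[symmetric] dvd_vec_iff by auto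
    have c: "content a' = 1" "content b' = 1"
      using 5 content_smul[of d a'] content_smul[of d b']
      unfolding a'[symmetric] b'[symmetric] d_def[symmetric] d'_def[symmetric] by simp_all
    \<comment> \<open>The factor 2 guarantees \<open>m \<ge> 2\<close>, also when the index is
      1.\<close>
    define m where "m = 2 * (fact (card (rcosets\<^bsub>F\<^esub> U)) :: int)"
    have m: "m \<ge> 2" by (simp add: m_def)
    \<comment> \<open>All elementary matrices are available in \<open>F\<close>, so
      \<open>b'\<close> can first be moved to the unit vector treated by
      \<open>reach_unit_vec\<close>.\<close>
    have "\<exists>w\<in>carrier F. smul (content b') (unit_vec 0) = act g w b'"
    proof (rule reach_content[of "\<lambda>x y. \<exists>w\<in>carrier F. y = act g w x"])
      fix p q r assume "\<exists>w\<in>carrier F. q = act g w p" "\<exists>w\<in>carrier F. r = act g w q"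
      then obtain v w where "v \<in> carrier F" "w \<in> carrier F" "q = act g w p" "r = act g v q" by blast
      then show "\<exists>w\<in>carrier F. r = act g w p" by (intro bexI[of _ "reduce (v @ w)"] append_carrier) simp_all
    next
      fix i j k a assume ij: "i < (4 :: nat)" "j < (4 :: nat)" "i \<noteq> j"
      have "subgroup (carrier F) F" by (rule F.subgroup_self)
      moreover have "rcosets\<^bsub>F\<^esub> (carrier F) = {carrier F}"
        using F.coset_join2[OF _ F.subgroup_self] by (auto simp: RCOSETS_def)
      ultimately obtain w where "w \<in> carrier F" "act g w = elem i j k"
        using elem_power_in_subgroup[of "carrier F" i j k] ij by auto
      then show "\<exists>w\<in>carrier F. elem i j k a = act g w a" by (intro bexI[of _ w]) simp_all
    qed
    then obtain w where w: "w \<in> carrier F" "act g w b' = unit_vec 0" using c by auto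
    have "\<not> dvd_vec (d * (m * m)) (act g u a - b)" if u: "u \<in> S" for u
    proof
      assume "dvd_vec (d * (m * m)) (act g u a - b)"
      then have "dvd_vec (d * (m * m)) (smul d (act g u a' - b'))" by (simp add: a' b' smul_add act_smul)
      then have "dvd_vec (m * m) (act g u a' - b')" using 5 by (simp only: dvd_vec_smul_smul)
      then have "dvd_vec (m * m) (act g w (act g u a' - b'))" by (simp only: act_dvd_vec)
      then have dvd: "dvd_vec (m * m) (act g w (act g u a') - unit_vec 0)" by (simp add: w)
      have "\<exists>v\<in>U. unit_vec 0 = act g v (act g w (act g u a'))"
      proof (rule reach_unit_vec[of "\<lambda>x y. \<exists>v\<in>U. y = act g v x" m])
        fix p q r assume "\<exists>w\<in>U. q = act g w p" "\<exists>w\<in>U. r = act g w q"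
        then obtain v w where "v \<in> U" "w \<in> U" "q = act g w p" "r = act g v q" by blast
        then show "\<exists>w\<in>U. r = act g w p" using U.m_closed[of v w] by (intro bexI[of _ "reduce (v @ w)"]) (simp_all add: free_group_def)
      next
        fix i j k a assume ij: "i < (4 :: nat)" "j < (4 :: nat)" "i \<noteq> j"
        have "m * k = fact (card (rcosets\<^bsub>F\<^esub> U)) * (2 * k)" by (simp add: m_def)
        then obtain w where "w \<in> U" "act g w = elem i j (m * k)"
          using elem_power_in_subgroup[OF U.subgroup_axioms _ ij, of "2 * k"] assms(1)
          by (auto simp: fin_normal_def)
        then show "\<exists>w\<in>U. elem i j (m * k) a = act g w a" by (intro bexI[of _ w]) simp_all
      qed (use m c dvd in auto)
      then obtain v where v: "v \<in> U" "unit_vec 0 = act g v (act g w (act g u a'))" by blast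
      \<comment> \<open>Normality of \<open>U\<close> allows moving the target back from the unit
        vector to \<open>b'\<close>.\<close>
      let ?v = "reduce (inv_word w @ v @ w)"
      have "?v \<in> U"
        using fin_normal_conj[OF U, of v "inv_word w"] v(1) w(1) U.subset by (auto simp: carrier_words reduce_carrier)
      then have "reduce (?v @ u) \<in> S" using S u by blast
      moreover have "act g (reduce (?v @ u)) a = b"
      proof -
        have "act g (reduce (?v @ u)) a' = act g (inv_word w) (unit_vec 0)" by (simp add: v(2))
        also have "\<dots> = b'" by (simp flip: w(2))
        finally show ?thesis by (simp add: a' b' act_smul)
      qed
      ultimately show False using ne by blast
    qed
    then show ?thesis using 5 m by (intro exI[of _ "d * (m * m)"]) auto
  qed
qed (use zero_less_one in blast)

text \<open>Conjugates of a vector are the vectors in its orbit, because the vector part of the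
  conjugator cancels. For trivial \<open>h\<close> this is separation of orbits, otherwise residual
  finiteness of \<open>F\<close>.\<close>

lemma separate_elliptic:
  assumes H: "subgroup H G" and core: "q0 > 0" "fin_normal F U0" "congr_sub q0 U0 \<subseteq> H"
    and h: "h \<in> carrier F"
    and nc: "\<And>k. k \<in> H \<Longrightarrow> k \<otimes>\<^bsub>G\<^esub> (a, [], False) \<otimes>\<^bsub>G\<^esub> inv\<^bsub>G\<^esub> k \<noteq> (b, h, False)"
  shows "\<exists>W. fin_normal G W \<and> (\<forall>k\<in>H. k \<otimes>\<^bsub>G\<^esub> (a, [], False) \<otimes>\<^bsub>G\<^esub> inv\<^bsub>G\<^esub> k \<otimes>\<^bsub>G\<^esub> inv\<^bsub>G\<^esub> (b, h, False) \<notin> W)"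
proof -
  interpret H: subgroup H G by fact
  have conj: "(c, u, False) \<otimes>\<^bsub>G\<^esub> (a, [], False) \<otimes>\<^bsub>G\<^esub> inv\<^bsub>G\<^esub> (c, u, False) = (act g u a, [], False)"
    if "u \<in> carrier F" for c u using that by simp
  show ?thesis
  proof (cases "h = []")
    case True
    interpret U0: normal U0 F using core by (simp add: fin_normal_def)
    define S where "S = {u. \<exists>c. (c, u, False) \<in> H}"
    have S: "S \<subseteq> carrier F" unfolding S_def using H.subset by fastforce
    have ne: "act g u a \<noteq> b" if "u \<in> S" for u
    proof -
      obtain c where "(c, u, False) \<in> H" using \<open>u \<in> S\<close> by (auto simp: S_def)
      from nc[OF this] show ?thesis using conj[of u c] that S by (auto simp: True)
    qed
    have "reduce (v @ u) \<in> S" if uv: "u \<in> S" "v \<in> U0" for u v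
    proof -
      obtain c where c: "(c, u, False) \<in> H" using uv by (auto simp: S_def)
      have "(0, v, False) \<in> H" using core(3) uv(2) by auto
      from H.m_closed[OF this c] have "(act g v c, reduce (v @ u), False) \<in> H" by simp
      then show ?thesis unfolding S_def by blast
    qed
    then obtain q where q: "q > 0" "\<forall>u\<in>S. \<not> dvd_vec q (act g u a - b)"
      using separate_orbits[OF core(2) ne] S by blast
    have "fin_normal G (congr_sub q (ker_mod q))"
      using q by (intro fin_normal_congr_sub fin_normal_ker_mod) auto
    moreover have "k \<otimes>\<^bsub>G\<^esub> (a, [], False) \<otimes>\<^bsub>G\<^esub> inv\<^bsub>G\<^esub> k \<otimes>\<^bsub>G\<^esub> inv\<^bsub>G\<^esub> (b, h, False) \<notin> congr_sub q (ker_mod q)" if k: "k \<in> H" for k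
    proof -
      obtain c u where cu: "k = (c, u, False)" "u \<in> carrier F" using H.mem_carrier[OF k] by (elim G_cases)
      have "u \<in> S" using k unfolding S_def cu by blast
      then show ?thesis using q(2) cu(2) unfolding cu(1) conj[OF cu(2)] by (simp add: True)
    qed
    ultimately show ?thesis by blast
  next
    case False
    then have h': "reduce h \<noteq> []" using h by (simp add: reduce_carrier)
    \<comment> \<open>Residual finiteness as a special case: no exact conjugator takes
      \<open>h \<noteq> 1\<close> to the empty word, so \<open>E\<close> is empty and some finite
      quotient of \<open>F\<close> admits none either.\<close>
    obtain E where E: "E \<subseteq> words n" "\<And>e. e \<in> E \<Longrightarrow> reduce (e @ h) = reduce ([] @ e)"
      and approx: "\<And>U. fin_normal F U \<Longrightarrow> \<exists>\<Delta>. fin_normal F \<Delta> \<and> \<Delta> \<subseteq> U \<and>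
        (\<forall>d\<in>words n. reduce (d @ h @ inv_word d @ inv_word []) \<in> \<Delta> \<longrightarrow>
          (\<exists>e\<in>E. \<exists>j. reduce (inv_word d @ e @ concat (replicate j h)) \<in> U))"
      using conjugators_approximate[OF carrier_words[OF h] h' carrier_words[OF Nil_carrier]] by metis
    have "e \<notin> E" for e
    proof
      assume "e \<in> E"
      then have "reduce (inv_word e @ e @ h) = reduce (inv_word e @ e)"
        using E(2) reduce_twice(1)[of "inv_word e" "e @ h"] by simp
      moreover have "reduce (inv_word e @ e @ h) = reduce h" using reduce_cancel(1)[of "[]" e h]
        by (simp only: append_Nil)
      ultimately show False using h' by simp
    qed
    \<comment> \<open>\<open>ker_mod 1\<close> is all of \<open>F\<close>: with modulus 1 the
      quotient of \<open>G\<close> sees only the free part.\<close>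
    then obtain D where D: "fin_normal F D" "D \<subseteq> ker_mod 1" "\<And>d. d \<in> words n \<Longrightarrow> reduce (d @ h @ inv_word d @ inv_word []) \<notin> D"
      using approx[OF fin_normal_ker_mod[of 1]] zero_less_one by blast
    interpret D: normal D F using D by (simp add: fin_normal_def)
    have "h \<notin> D" using D(3)[of "[]"] h by (simp add: reduce_carrier carrier_words[OF Nil_carrier])
    then have "inv_word h \<notin> D" using D.m_inv_closed[of "inv_word h"] h by (auto simp: inv_free_group)
    then have "k \<otimes>\<^bsub>G\<^esub> (a, [], False) \<otimes>\<^bsub>G\<^esub> inv\<^bsub>G\<^esub> k \<otimes>\<^bsub>G\<^esub> inv\<^bsub>G\<^esub> (b, h, False) \<notin> congr_sub 1 D" if k: "k \<in> H" for k
    proof -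
      obtain c u where cu: "k = (c, u, False)" "u \<in> carrier F" using H.mem_carrier[OF k] by (elim G_cases)
      then show ?thesis using \<open>inv_word h \<notin> D\<close> h unfolding cu(1) conj[OF cu(2)] by (simp add: reduce_carrier)
    qed
    moreover have "fin_normal G (congr_sub 1 D)" using D by (intro fin_normal_congr_sub) auto
    ultimately show ?thesis by blast
  qed
qed

theorem hereditarily_conjugacy_separable_G: "hereditarily_conjugacy_separable G"
  unfolding hereditarily_conjugacy_separable_def
proof (intro allI impI, elim conjE)
  fix H assume H: "subgroup H G" "finite (rcosets\<^bsub>G\<^esub> H)"
  interpret H: subgroup H G by fact
  interpret GH: group "G\<lparr>carrier := H\<rparr>" by (rule G.subgroup_imp_group[OF H(1)])
  obtain q0 U0 where core: "q0 > 0" "fin_normal F U0" "congr_sub q0 U0 \<subseteq> H" using finite_index_core[OF H] by blast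
  have inv: "inv\<^bsub>G\<lparr>carrier := H\<rparr>\<^esub> x = inv\<^bsub>G\<^esub> x" if "x \<in> H" for x using G.m_inv_consistent[OF H(1) that] .
  show "conjugacy_separable (G\<lparr>carrier := H\<rparr>)"
  proof (rule GH.conjugacy_separable_if)
    fix x y assume "x \<in> carrier (G\<lparr>carrier := H\<rparr>)" "y \<in> carrier (G\<lparr>carrier := H\<rparr>)" and nc: "\<not> conjugate (G\<lparr>carrier := H\<rparr>) x y"
    then have xy: "x \<in> H" "y \<in> H" by simp_all
    obtain a \<gamma> where x: "x = (a, \<gamma>, False)" "\<gamma> \<in> carrier F" using H.mem_carrier[OF xy(1)] by (elim G_cases)
    obtain b h where y: "y = (b, h, False)" "h \<in> carrier F" using H.mem_carrier[OF xy(2)] by (elim G_cases)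
    have nc': "k \<otimes>\<^bsub>G\<^esub> (a, \<gamma>, False) \<otimes>\<^bsub>G\<^esub> inv\<^bsub>G\<^esub> k \<noteq> (b, h, False)" if "k \<in> H" for k
    proof -
      have "y \<noteq> k \<otimes>\<^bsub>G\<^esub> x \<otimes>\<^bsub>G\<^esub> inv\<^bsub>G\<^esub> k" using nc inv[OF that] that by (auto simp: conjugate_def)
      then show ?thesis unfolding x y by metis
    qed
    have "\<exists>W. fin_normal G W \<and> (\<forall>k\<in>H. k \<otimes>\<^bsub>G\<^esub> (a, \<gamma>, False) \<otimes>\<^bsub>G\<^esub> inv\<^bsub>G\<^esub> k \<otimes>\<^bsub>G\<^esub> inv\<^bsub>G\<^esub> (b, h, False) \<notin> W)"
    proof (cases "\<gamma> = []")
      case True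
      show ?thesis using separate_elliptic[OF H(1) core y(2), of a b] nc' unfolding True by blast
    next
      case False
      show ?thesis by (rule separate_hyperbolic[OF H(1) core x(2) False y(2) nc'])
    qed
    then obtain W where W: "fin_normal G W" "\<forall>k\<in>H. k \<otimes>\<^bsub>G\<^esub> x \<otimes>\<^bsub>G\<^esub> inv\<^bsub>G\<^esub> k \<otimes>\<^bsub>G\<^esub> inv\<^bsub>G\<^esub> y \<notin> W"
      unfolding x(1) y(1) by blast
    have "fin_normal (G\<lparr>carrier := H\<rparr>) (W \<inter> H)" by (rule G.fin_normal_restrict[OF W(1) H(1)])
    moreover have "\<forall>k\<in>carrier (G\<lparr>carrier := H\<rparr>). k \<otimes>\<^bsub>G\<lparr>carrier := H\<rparr>\<^esub> x \<otimes>\<^bsub>G\<lparr>carrier := H\<rparr>\<^esub> inv\<^bsub>G\<lparr>carrier := H\<rparr>\<^esub> k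
        \<otimes>\<^bsub>G\<lparr>carrier := H\<rparr>\<^esub> inv\<^bsub>G\<lparr>carrier := H\<rparr>\<^esub> y \<notin> W \<inter> H"
      using W(2) xy(2) by (simp add: inv)
    ultimately show "\<exists>V. fin_normal (G\<lparr>carrier := H\<rparr>) V \<and> (\<forall>k\<in>carrier (G\<lparr>carrier := H\<rparr>).
        k \<otimes>\<^bsub>G\<lparr>carrier := H\<rparr>\<^esub> x \<otimes>\<^bsub>G\<lparr>carrier := H\<rparr>\<^esub> inv\<^bsub>G\<lparr>carrier := H\<rparr>\<^esub> k \<otimes>\<^bsub>G\<lparr>carrier := H\<rparr>\<^esub> inv\<^bsub>G\<lparr>carrier := H\<rparr>\<^esub> y \<notin> V)"
      by blast
  qed
qed

end

section \<open>Finite presentation\<close>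

lemma subspace_eq_UNIV:
  assumes "subspace B" "\<And>i. i < 4 \<Longrightarrow> unit_vec i \<in> B"
  shows "a \<in> B"
  by (subst vec_decomp) (intro subspace_add subspace_smul assms, simp_all)

lemma coord_add: "coord (a + b) i = coord a i + coord b i"
  by (cases a; cases b) auto

context group
begin

lemma normal_normal_closure:
  assumes "R \<subseteq> carrier G"
  shows "normal_closure G R \<lhd> G"
proof -
  have "carrier G \<lhd> G" by (rule normal_self)
  then have ne: "{N. N \<lhd> G \<and> R \<subseteq> N} \<noteq> {}" using assms by blast
  have "subgroup (normal_closure G R) G"
    unfolding normal_closure_def by (rule subgroups_Inter[OF _ ne]) (auto simp: normal_inv_iff)
  then show ?thesis by (auto simp: normal_inv_iff normal_closure_def)
qed

definition additive :: "(mat \<Rightarrow> 'a) \<Rightarrow> bool" where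
  "additive h \<longleftrightarrow> (\<forall>a. h a \<in> carrier G) \<and> (\<forall>a b. h (a + b) = h a \<otimes> h b)"

lemma additive_diff:
  assumes "additive h"
  shows "h 0 = \<one>" "h (a - b) = h a \<otimes> inv (h b)"
proof -
  have c: "h a \<in> carrier G" and add: "h (a + b) = h a \<otimes> h b" for a b
    using assms unfolding additive_def by blast+
  show "h 0 = \<one>" using add[of 0 0] c[of 0] by simp
  show "h (a - b) = h a \<otimes> inv (h b)" using add[of "a - b" b] c by (simp add: m_assoc)
qed

lemma additive_eqI:
  assumes h: "additive h" "additive h'" and unit: "\<And>i. i < 4 \<Longrightarrow> h (unit_vec i) = h' (unit_vec i)"
  shows "h a = h' a"
proof -
  have "subspace {a. h a = h' a}"
    unfolding subspace_def by (auto simp: additive_diff[OF h(1)] additive_diff[OF h(2)])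
  then show ?thesis using subspace_eq_UNIV[of "{a. h a = h' a}" a] unit by blast
qed

lemma int_pow_commute:
  assumes "x \<in> carrier G" "y \<in> carrier G" "x \<otimes> y = y \<otimes> x"
  shows "x [^] (k :: int) \<otimes> y = y \<otimes> x [^] k"
proof (induction k rule: int_induct[where k = 0])
  case (step1 k)
  have "x [^] (k + 1) \<otimes> y = (x [^] k \<otimes> y) \<otimes> x" using assms by (simp add: int_pow_mult m_assoc)
  then show ?case using assms by (simp add: step1 int_pow_mult m_assoc)
next
  case (step2 k)
  have "inv x \<otimes> y = y \<otimes> inv x"
    using assms by (metis inv_closed inv_solve_left' inv_solve_right' m_assoc m_closed)
  moreover have "x [^] (k - 1) = x [^] k \<otimes> inv x" using assms by (simp add: int_pow_diff)
  ultimately have "x [^] (k - 1) \<otimes> y = (x [^] k \<otimes> y) \<otimes> inv x" using assms by (simp add: m_assoc)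
  then show ?case using assms by (simp add: step2(2) \<open>x [^] (k - 1) = x [^] k \<otimes> inv x\<close> m_assoc)
qed (use assms in simp)

lemma m_interchange:
  assumes "p \<in> carrier G" "q \<in> carrier G" "r \<in> carrier G" "s \<in> carrier G" "q \<otimes> r = r \<otimes> q"
  shows "(p \<otimes> q) \<otimes> (r \<otimes> s) = (p \<otimes> r) \<otimes> (q \<otimes> s)"
proof -
  have "(p \<otimes> q) \<otimes> (r \<otimes> s) = p \<otimes> (q \<otimes> r) \<otimes> s" using assms(1-4) by (simp add: m_assoc)
  also have "\<dots> = (p \<otimes> r) \<otimes> (q \<otimes> s)" unfolding assms(5) using assms(1-4) by (simp add: m_assoc)
  finally show ?thesis .
qed

lemma m_commute:
  assumes "x \<in> carrier G" "y \<in> carrier G" "z \<in> carrier G" "x \<otimes> z = z \<otimes> x" "y \<otimes> z = z \<otimes> y"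
  shows "(x \<otimes> y) \<otimes> z = z \<otimes> (x \<otimes> y)"
proof -
  have "(x \<otimes> y) \<otimes> z = x \<otimes> (z \<otimes> y)" using assms(1-3) by (simp add: m_assoc assms(5))
  also have "\<dots> = (z \<otimes> x) \<otimes> y" using assms(1-3) by (simp add: assms(4) flip: m_assoc)
  finally show ?thesis using assms(1-3) by (simp add: m_assoc)
qed

lemma additive_exists:
  assumes E: "\<And>i. i < 4 \<Longrightarrow> E i \<in> carrier G"
    and comm: "\<And>i j. i < 4 \<Longrightarrow> j < 4 \<Longrightarrow> E i \<otimes> E j = E j \<otimes> E i"
  shows "\<exists>h. additive h \<and> (\<forall>i<4. h (unit_vec i) = E i)"
proof -
  define P where "P i a = E i [^] coord a i" for i a
  define h where "h a = (P 0 a \<otimes> P 1 a) \<otimes> (P 2 a \<otimes> P 3 a)" for a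
  have P: "P i a \<in> carrier G" if "i < 4" for i a using E[OF that] by (simp add: P_def)
  have P_comm: "P i a \<otimes> P j b = P j b \<otimes> P i a" if "i < 4" "j < 4" for i j a b
    unfolding P_def using E that comm by (intro int_pow_commute int_pow_commute[symmetric]) auto
  have P_add: "P i (a + b) = P i a \<otimes> P i b" if "i < 4" for i a b
    unfolding P_def using E[OF that] by (simp add: coord_add int_pow_mult)
  have "h (a + b) = h a \<otimes> h b" for a b
  proof -
    have "h (a + b) = ((P 0 a \<otimes> P 0 b) \<otimes> (P 1 a \<otimes> P 1 b)) \<otimes> ((P 2 a \<otimes> P 2 b) \<otimes> (P 3 a \<otimes> P 3 b))"
      by (simp add: h_def P_add)
    also have "\<dots> = ((P 0 a \<otimes> P 1 a) \<otimes> (P 0 b \<otimes> P 1 b)) \<otimes> ((P 2 a \<otimes> P 3 a) \<otimes> (P 2 b \<otimes> P 3 b))"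
      by (simp add: m_interchange[symmetric] P P_comm)
    also have "\<dots> = ((P 0 a \<otimes> P 1 a) \<otimes> (P 2 a \<otimes> P 3 a)) \<otimes> ((P 0 b \<otimes> P 1 b) \<otimes> (P 2 b \<otimes> P 3 b))"
    proof (rule m_interchange)
      have *: "(P 0 b \<otimes> P 1 b) \<otimes> P i a = P i a \<otimes> (P 0 b \<otimes> P 1 b)" if "i < 4" for i
        using that by (intro m_commute) (auto simp: P P_comm)
      show "(P 0 b \<otimes> P 1 b) \<otimes> (P 2 a \<otimes> P 3 a) = (P 2 a \<otimes> P 3 a) \<otimes> (P 0 b \<otimes> P 1 b)"
        by (rule m_commute[symmetric]) (use *[of 2] *[of 3] in \<open>simp_all add: P\<close>)
    qed (simp_all add: P)
    finally show ?thesis by (simp add: h_def)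
  qed
  moreover have "h a \<in> carrier G" for a by (simp add: h_def P)
  moreover have "h (unit_vec i) = E i" if "i < 4" for i
  proof -
    have "i = 0 \<or> i = 1 \<or> i = 2 \<or> i = 3" using that by linarith
    then show ?thesis using E by (auto simp: h_def P_def unit_vec_def)
  qed
  ultimately show ?thesis unfolding additive_def by blast
qed

lemma eval_word_map_hom:
  assumes "group H" "h \<in> hom G H" "set zs \<subseteq> carrier G" "w \<in> words (length zs)"
  shows "eval_word H (map h zs) w = h (eval_word G zs w)"
proof -
  interpret H: group H by fact
  interpret h: group_hom G H h using assms(2) by (simp add: group_hom_def group_hom_axioms_def)
  show ?thesis using assms(4)
  proof (induction w)
    case (Cons a w)
    then show ?case
      using assms(3) nth_mem[of "fst a" zs]
      by (cases a) (auto simp: subset_iff intro: eval_word_closed)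
  qed simp
qed

text \<open>The homomorphism out of \<open>G\<close> is only needed for the group \<open>Q\<close> presented by \<open>R\<close>; it bounds the
  kernel of the evaluation map from above.\<close>

lemma finitely_presentedI:
  assumes zs: "set zs \<subseteq> carrier G" "length zs = k" "\<And>x. x \<in> carrier G \<Longrightarrow> \<exists>w\<in>words k. x = eval_word G zs w"
    and R: "finite R" "R \<subseteq> words k" "\<And>r. r \<in> R \<Longrightarrow> eval_word G zs r = \<one>"
    and pres: "\<And>(Q :: word set monoid) qs. group Q \<Longrightarrow> set qs \<subseteq> carrier Q \<Longrightarrow> length qs = k \<Longrightarrow>
      (\<And>r. r \<in> R \<Longrightarrow> eval_word Q qs r = \<one>\<^bsub>Q\<^esub>) \<Longrightarrow> \<exists>h\<in>hom G Q. map h zs = qs"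
  shows "finitely_presented G"
proof -
  interpret F: group "free_group k" by (rule group_free_group)
  interpret \<theta>: group_hom "free_group k" G "eval_word G zs"
    using eval_word_hom[OF zs(1)] zs(2) by (simp add: group_hom_def group_hom_axioms_def F.is_group)
  let ?NC = "normal_closure (free_group k) (reduce ` R)"
  have R': "reduce ` R \<subseteq> carrier (free_group k)" using R(2) by auto
  have NC: "?NC \<lhd> free_group k" by (rule F.normal_normal_closure[OF R'])
  interpret NC: normal ?NC "free_group k" by (rule NC)
  have RNC: "reduce r \<in> ?NC" if "r \<in> R" for r using that by (auto simp: normal_closure_def)
  have sur: "eval_word G zs ` carrier (free_group k) = carrier G"
  proof
    show "carrier G \<subseteq> eval_word G zs ` carrier (free_group k)"
    proof
      fix x assume "x \<in> carrier G"
      then obtain w where "w \<in> words k" "x = eval_word G zs w" using zs(3) by blast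
      then show "x \<in> eval_word G zs ` carrier (free_group k)"
        using zs(1,2) by (intro image_eqI[of _ _ "reduce w"]) auto
    qed
  qed auto
  have "kernel (free_group k) G (eval_word G zs) = ?NC"
  proof
    have "reduce ` R \<subseteq> kernel (free_group k) G (eval_word G zs)"
      using R zs R' by (auto simp: kernel_def subset_iff)
    then show "?NC \<subseteq> kernel (free_group k) G (eval_word G zs)"
      using \<theta>.normal_kernel by (auto simp: normal_closure_def)
    show "kernel (free_group k) G (eval_word G zs) \<subseteq> ?NC"
    proof
      fix w assume "w \<in> kernel (free_group k) G (eval_word G zs)"
      then have w: "w \<in> carrier (free_group k)" "w \<in> words k" "eval_word G zs w = \<one>"
        by (auto simp: kernel_def carrier_free_group)
      define Q where "Q = free_group k Mod ?NC"
      define qs where "qs = map (\<lambda>i. ?NC #>\<^bsub>free_group k\<^esub> [(i, True)]) [0..<k]"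
      have Q: "group Q" unfolding Q_def by (rule NC.factorgroup_is_group)
      have qs: "set qs \<subseteq> carrier Q" "\<And>w. w \<in> words k \<Longrightarrow> eval_word Q qs w = ?NC #>\<^bsub>free_group k\<^esub> reduce w"
        unfolding Q_def qs_def by (rule eval_word_Mod[OF NC])+
      have one: "\<one>\<^bsub>Q\<^esub> = ?NC" by (simp add: Q_def FactGroup_def)
      have "eval_word Q qs r = \<one>\<^bsub>Q\<^esub>" if r: "r \<in> R" for r
        using F.coset_join2[OF _ NC.subgroup_axioms RNC[OF r]] R' R(2) r by (subst qs(2)) (auto simp: one)
      then obtain h where h: "h \<in> hom G Q" "map h zs = qs"
        using pres[OF Q qs(1)] by (auto simp: qs_def)
      have "eval_word Q qs w = h \<one>"
        using eval_word_map_hom[OF Q h(1) zs(1)] w zs(2) by (simp add: h(2))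
      also have "\<dots> = ?NC" using hom_one[OF h(1) is_group Q] by (simp add: one)
      finally have "?NC #>\<^bsub>free_group k\<^esub> w = ?NC"
        using w by (simp add: qs(2) carrier_free_group reduce_reduced)
      then show "w \<in> ?NC" using w(1) F.coset_join1[OF _ w(1) NC.subgroup_axioms] by blast
    qed
  qed
  then have "free_group k Mod ?NC \<cong> G" using \<theta>.FactGroup_iso[OF sur] by simp
  then have "G \<cong> free_group k Mod ?NC"
    using group.iso_sym[OF NC.factorgroup_is_group] by blast
  then show ?thesis
    unfolding finitely_presented_def using is_group R(1) R' by blast
qed

end

context twisted_action
begin

definition gens :: "(mat \<times> word \<times> bool) list" where
  "gens = map (\<lambda>i. (unit_vec i, [], False)) [0..<4] @ map (\<lambda>i. (0, [(i, True)], False)) [0..<n]"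

definition shift_letters :: "word \<Rightarrow> word" where
  "shift_letters = map (\<lambda>(i, e). (4 + i, e))"

text \<open>The presentation of an extension of \<open>\<int>\<^sup>4\<close> by a free group: the
  basis vectors commute, and conjugation by the \<open>i\<close>-th letter takes the
  \<open>j\<close>-th basis vector to the vector spelled by \<open>u i j\<close>.\<close>

definition gens_rels :: "(nat \<Rightarrow> nat \<Rightarrow> word) \<Rightarrow> word set" where
  "gens_rels u = (\<lambda>(i, j). [(i, True), (j, True)] @ inv_word [(j, True), (i, True)]) ` ({..<4} \<times> {..<4}) \<union>
     (\<lambda>(i, j). [(4 + i, True), (j, True)] @ inv_word (u i j @ [(4 + i, True)])) ` ({..<n} \<times> {..<4})"

lemma gens_simps: "length gens = 4 + n" "i < 4 \<Longrightarrow> gens ! i = (unit_vec i, [], False)"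
    "i < n \<Longrightarrow> gens ! (4 + i) = (0, [(i, True)], False)"
  by (auto simp: gens_def nth_append)

lemma g_0 [simp]: "act_letter g a 0 = 0" "g i 0 = 0"
  using act_0[of "[a]"] add[of i 0 0] by simp_all

lemma letter_carrier: "i < n \<Longrightarrow> [(i, e)] \<in> carrier F"
  by (simp add: carrier_free_group reduced_def)

lemma gens_closed: "set gens \<subseteq> carrier G"
  by (auto simp: gens_def letter_carrier)

lemma words_mono: "w \<in> words k \<Longrightarrow> k \<le> l \<Longrightarrow> w \<in> words l"
  by (induction w) auto

lemma shift_letters_words: "w \<in> words n \<Longrightarrow> shift_letters w \<in> words (4 + n)"
  by (induction w) (auto simp: shift_letters_def)

lemma eval_shift_letters: "w \<in> words n \<Longrightarrow> eval_word G gens (shift_letters w) = (0, reduce w, False)"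
proof (induction w)
  case (Cons a w)
  obtain i e where a: "a = (i, e)" by (cases a)
  have i: "i < n" using Cons.prems by (simp add: a)
  have "reduce [(i, e)] = [(i, e)]" by (simp add: reduce_def)
  then have "(0, [(i, e)], False) \<otimes>\<^bsub>G\<^esub> (0, reduce w, False) = (0, reduce (a # w), False)"
    using reduce_twice(1)[of "[(i, e)]" w] by (simp add: a)
  then show ?case
    using Cons i by (cases e) (simp_all add: shift_letters_def a gens_simps letter_carrier inv_letter_def)
qed (simp add: shift_letters_def G_one)

lemma eval_vec_exists: "\<exists>u\<in>words 4. eval_word G gens u = (a, [], False)"
proof -
  let ?B = "{a. \<exists>u\<in>words 4. eval_word G gens u = (a, [], False)}"
  have w: "u \<in> words (length gens)" if "u \<in> words 4" for u
    using words_mono[OF that, of "4 + n"] by (simp add: gens_simps)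
  have "subspace ?B"
    unfolding subspace_def
  proof (intro conjI ballI)
    have "eval_word G gens [] = (0, [], False)" by (simp add: G_one)
    then show "0 \<in> ?B" using words_Nil by blast
    fix a b assume "a \<in> ?B" "b \<in> ?B"
    then obtain u v where uv: "u \<in> words 4" "v \<in> words 4"
      "eval_word G gens u = (a, [], False)" "eval_word G gens v = (b, [], False)" by blast
    then have "eval_word G gens (u @ inv_word v) = (a - b, [], False)"
      by (simp add: gens_closed w)
    then show "a - b \<in> ?B" using uv(1,2) by (intro CollectI bexI[of _ "u @ inv_word v"]) auto
  qed
  moreover have "unit_vec i \<in> ?B" if "i < 4" for i
  proof -
    have "eval_word G gens [(i, True)] = (unit_vec i, [], False)" using that by (simp add: gens_simps G_one)
    then show ?thesis using that by (intro CollectI bexI[of _ "[(i, True)]"]) auto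
  qed
  ultimately show ?thesis using subspace_eq_UNIV[of ?B a] by blast
qed

lemma eval_gens_surj:
  assumes "x \<in> carrier G"
  shows "\<exists>w\<in>words (4 + n). x = eval_word G gens w"
proof -
  obtain a w where x: "x = (a, w, False)" "w \<in> carrier F" using assms by (rule G_cases)
  obtain u where u: "u \<in> words 4" "eval_word G gens u = (a, [], False)" using eval_vec_exists by blast
  have 1: "u \<in> words (4 + n)" using words_mono[OF u(1)] by simp
  have 2: "shift_letters w \<in> words (4 + n)" using x by (intro shift_letters_words carrier_words)
  have "eval_word G gens (u @ shift_letters w) = x"
    using 1 2 x by (simp add: gens_closed gens_simps(1) u(2) eval_shift_letters carrier_words reduce_carrier)
  then show ?thesis using 1 2 by (intro bexI[of _ "u @ shift_letters w"]) auto
qed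

lemma generating_list_K: "generating_list K (gens @ [(0, [], True)])"
proof -
  have sub: "set (gens @ [(0, [], True)]) \<subseteq> carrier K"
    using gens_closed by (auto simp: split_sub_def split_ext_def)
  have GK: "carrier G \<subseteq> carrier K" using K.subgroupE(1)[OF subgroup_G] .
  have "carrier G \<subseteq> eval_word G gens ` words (4 + n)" using eval_gens_surj by blast
  then have "generate G (set gens) = carrier G"
    using G.generate_incl[OF gens_closed] by (simp add: G.generate_eq_eval_word[OF gens_closed] gens_simps(1))
  moreover have "generate G (set gens) = generate K (set gens)"
    using K.generate_consistent[OF gens_closed subgroup_G] by (simp add: split_sub_def)
  ultimately have G: "carrier G \<subseteq> generate K (set (gens @ [(0, [], True)]))"
    using K.mono_generate[of "set gens" "set (gens @ [(0, [], True)])"] by auto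
  have "carrier K \<subseteq> generate K (set (gens @ [(0, [], True)]))"
  proof
    fix x assume "x \<in> carrier K"
    then obtain a w e where x: "x = (a, w, e)" "w \<in> carrier F" by (cases x) auto
    have 1: "(a, w, False) \<in> generate K (set (gens @ [(0, [], True)]))" using G x by auto
    show "x \<in> generate K (set (gens @ [(0, [], True)]))"
    proof (cases e)
      case True
      have "(0, [], True) \<in> generate K (set (gens @ [(0, [], True)]))" by (rule generate.incl) simp
      from generate.eng[OF 1 this] show ?thesis using x True by (simp add: reduce_carrier)
    qed (use 1 x in simp)
  qed
  then show ?thesis using sub K.generate_incl[OF sub] by (auto simp: generating_list_def)
qed

text \<open>Commuting images of the basis vectors define \<open>A\<close> on
  \<open>\<int>\<^sup>4\<close>. By the relators, conjugation by the image of a letter agrees with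
  \<open>g i\<close> on basis vectors, hence by additivity on all vectors, and then for inverse
  letters and words; so \<open>A\<close> and the evaluation of words fit together.\<close>

lemma hom_from_G:
  assumes Q: "group Q" and qs: "set qs \<subseteq> carrier Q" "length qs = 4 + n"
    and u: "\<And>i j. i < n \<Longrightarrow> j < 4 \<Longrightarrow> u i j \<in> words 4 \<and> eval_word G gens (u i j) = (g i (unit_vec j), [], False)"
    and rels: "\<And>r. r \<in> gens_rels u \<Longrightarrow> eval_word Q qs r = \<one>\<^bsub>Q\<^esub>"
  shows "\<exists>h\<in>hom G Q. map h gens = qs"
proof -
  interpret Q: group Q by fact
  have c: "qs ! i \<in> carrier Q" if "i < 4 + n" for i using that qs nth_mem[of i qs] by auto
  have w4: "v \<in> words (length qs)" if "v \<in> words 4" for v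
    using words_mono[OF that, of "4 + n"] qs by simp
  have comm: "qs ! i \<otimes>\<^bsub>Q\<^esub> qs ! j = qs ! j \<otimes>\<^bsub>Q\<^esub> qs ! i" if ij: "i < 4" "j < 4" for i j
  proof -
    have rel: "[(i, True), (j, True)] @ inv_word [(j, True), (i, True)] \<in> gens_rels u"
      using ij unfolding gens_rels_def by (intro UnI1 image_eqI[of _ _ "(i, j)"]) auto
    have "eval_word Q qs [(i, True), (j, True)] = eval_word Q qs [(j, True), (i, True)]"
      by (rule iffD1[OF Q.eval_word_quotient_iff[OF qs(1)] rels[OF rel]]) (use ij qs(2) in simp_all)
    then show ?thesis using ij c by simp
  qed
  obtain A where A: "Q.additive A" "\<And>i. i < 4 \<Longrightarrow> A (unit_vec i) = qs ! i"
    using Q.additive_exists[of "\<lambda>i. qs ! i"] c comm by auto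
  have A_closed: "A a \<in> carrier Q" and A_add: "A (a + b) = A a \<otimes>\<^bsub>Q\<^esub> A b" for a b
    using A(1) unfolding Q.additive_def by blast+
  have eval_A: "v \<in> words 4 \<Longrightarrow> \<exists>a. eval_word G gens v = (a, [], False) \<and> eval_word Q qs v = A a" for v
  proof (induction v)
    case Nil
    show ?case using Q.additive_diff(1)[OF A(1)] by (simp add: G_one)
  next
    case (Cons l v)
    then obtain b where b: "eval_word G gens v = (b, [], False)" "eval_word Q qs v = A b" by auto
    obtain i e where l: "l = (i, e)" by (cases l)
    have i: "i < 4" using Cons.prems by (simp add: l)
    show ?case
    proof (cases e)
      case True
      then have "eval_word G gens (l # v) = (unit_vec i + b, [], False) \<and> eval_word Q qs (l # v) = A (unit_vec i + b)"
        using i by (simp add: l b gens_simps A A_add)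
      then show ?thesis by blast
    next
      case False
      have "A (- unit_vec i) = inv\<^bsub>Q\<^esub> (qs ! i)"
        using Q.additive_diff(1)[OF A(1)] Q.additive_diff(2)[OF A(1), of 0 "unit_vec i"] i c by (simp add: A)
      then have "A (b - unit_vec i) = inv\<^bsub>Q\<^esub> (qs ! i) \<otimes>\<^bsub>Q\<^esub> A b" using A_add[of "- unit_vec i" b] by simp
      then have "eval_word G gens (l # v) = (b - unit_vec i, [], False) \<and> eval_word Q qs (l # v) = A (b - unit_vec i)"
        using i False by (simp add: l b gens_simps)
      then show ?thesis by blast
    qed
  qed
  define ys where "ys = drop 4 qs"
  have ys: "set ys \<subseteq> carrier Q" "length ys = n" "\<And>i. i < n \<Longrightarrow> ys ! i = qs ! (4 + i)"
    using qs set_drop_subset[of 4 qs] by (auto simp: ys_def)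
  have twist: "ys ! i \<otimes>\<^bsub>Q\<^esub> A b = A (g i b) \<otimes>\<^bsub>Q\<^esub> ys ! i" if i: "i < n" for i b
  proof -
    let ?y = "qs ! (4 + i)"
    have y: "?y \<in> carrier Q" using c i by simp
    have "?y \<otimes>\<^bsub>Q\<^esub> A b \<otimes>\<^bsub>Q\<^esub> inv\<^bsub>Q\<^esub> ?y = A (g i b)"
    proof (rule Q.additive_eqI[where h = "\<lambda>b. ?y \<otimes>\<^bsub>Q\<^esub> A b \<otimes>\<^bsub>Q\<^esub> inv\<^bsub>Q\<^esub> ?y" and h' = "\<lambda>b. A (g i b)"])
      show "Q.additive (\<lambda>b. ?y \<otimes>\<^bsub>Q\<^esub> A b \<otimes>\<^bsub>Q\<^esub> inv\<^bsub>Q\<^esub> ?y)"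
        unfolding Q.additive_def using y by (auto simp: A_closed A_add Q.m_assoc Q.inv_solve_left)
      show "Q.additive (\<lambda>b. A (g i b))" unfolding Q.additive_def by (auto simp: A_closed A_add add)
      fix j assume j: "j < (4 :: nat)"
      have "eval_word Q qs (u i j) = A (g i (unit_vec j))"
        using eval_A[of "u i j"] u[OF i j] by auto
      moreover have rel: "[(4 + i, True), (j, True)] @ inv_word (u i j @ [(4 + i, True)]) \<in> gens_rels u"
        using i j unfolding gens_rels_def by (intro UnI2 image_eqI[of _ _ "(i, j)"]) auto
      have "eval_word Q qs [(4 + i, True), (j, True)] = eval_word Q qs (u i j @ [(4 + i, True)])"
        by (rule iffD1[OF Q.eval_word_quotient_iff[OF qs(1)] rels[OF rel]]) (use i j qs(2) w4 u[OF i j] in simp_all)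
      ultimately have "?y \<otimes>\<^bsub>Q\<^esub> A (unit_vec j) = A (g i (unit_vec j)) \<otimes>\<^bsub>Q\<^esub> ?y"
        using i j y c qs w4 u[OF i j] by (simp add: A)
      then show "?y \<otimes>\<^bsub>Q\<^esub> A (unit_vec j) \<otimes>\<^bsub>Q\<^esub> inv\<^bsub>Q\<^esub> ?y = A (g i (unit_vec j))"
        using y by (simp add: A_closed Q.m_assoc)
    qed
    then have "?y \<otimes>\<^bsub>Q\<^esub> A b = A (g i b) \<otimes>\<^bsub>Q\<^esub> ?y"
      using y Q.inv_solve_right'[of "A (g i b)" "?y \<otimes>\<^bsub>Q\<^esub> A b" ?y] by (simp add: A_closed)
    then show ?thesis using i by (simp add: ys)
  qed
  have letter: "Q.eval_letter ys l \<otimes>\<^bsub>Q\<^esub> A b = A (act_letter g l b) \<otimes>\<^bsub>Q\<^esub> Q.eval_letter ys l" if l: "fst l < n" for l b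
  proof (cases "snd l")
    case True
    then show ?thesis using twist[OF l] by (simp add: Q.eval_letter_def act_letter_def)
  next
    case False
    let ?y = "ys ! fst l" and ?b = "inv_into UNIV (g (fst l)) b"
    have y: "?y \<in> carrier Q" using ys(1,2) l nth_mem[of "fst l" ys] by auto
    have "g (fst l) ?b = b" using bij[of "fst l"] by (simp add: bij_is_surj surj_f_inv_f)
    then have "?y \<otimes>\<^bsub>Q\<^esub> A ?b = A b \<otimes>\<^bsub>Q\<^esub> ?y" using twist[OF l, of ?b] by simp
    then have "A ?b = inv\<^bsub>Q\<^esub> ?y \<otimes>\<^bsub>Q\<^esub> (A b \<otimes>\<^bsub>Q\<^esub> ?y)"
      using y by (simp add: Q.inv_solve_left A_closed)
    then have "inv\<^bsub>Q\<^esub> ?y \<otimes>\<^bsub>Q\<^esub> A b = A ?b \<otimes>\<^bsub>Q\<^esub> inv\<^bsub>Q\<^esub> ?y"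
      using y by (simp add: A_closed Q.m_assoc)
    then show ?thesis using False by (simp add: Q.eval_letter_def act_letter_def)
  qed
  have word: "v \<in> words n \<Longrightarrow> eval_word Q ys v \<otimes>\<^bsub>Q\<^esub> A b = A (act g v b) \<otimes>\<^bsub>Q\<^esub> eval_word Q ys v" for v b
  proof (induction v arbitrary: b)
    case (Cons l v)
    then have l: "Q.eval_letter ys l \<in> carrier Q" and v: "eval_word Q ys v \<in> carrier Q" using ys by auto
    have "eval_word Q ys (l # v) \<otimes>\<^bsub>Q\<^esub> A b = Q.eval_letter ys l \<otimes>\<^bsub>Q\<^esub> (A (act g v b) \<otimes>\<^bsub>Q\<^esub> eval_word Q ys v)"
      using Cons l v by (simp add: Q.eval_word_Cons Q.m_assoc A_closed del: eval_word.simps(2))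
    also have "\<dots> = (A (act_letter g l (act g v b)) \<otimes>\<^bsub>Q\<^esub> Q.eval_letter ys l) \<otimes>\<^bsub>Q\<^esub> eval_word Q ys v"
      using Cons.prems l v by (simp add: A_closed letter flip: Q.m_assoc)
    finally show ?case using l v by (simp add: Q.eval_word_Cons Q.m_assoc A_closed del: eval_word.simps(2))
  qed (simp add: A_closed)
  define h where "h = (\<lambda>(a, v, e :: bool). A a \<otimes>\<^bsub>Q\<^esub> eval_word Q ys v)"
  have "h \<in> hom G Q"
  proof (rule homI)
    fix x assume "x \<in> carrier G"
    then obtain a v where "x = (a, v, False)" "v \<in> words n" by (elim G_cases) (auto simp: carrier_words)
    then show "h x \<in> carrier Q" using ys by (simp add: h_def A_closed)
    fix y assume "x \<in> carrier G" "y \<in> carrier G"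
    then obtain a v b w where x: "x = (a, v, False)" "v \<in> words n" and y: "y = (b, w, False)" "w \<in> words n"
      by (elim G_cases) (auto simp: carrier_words)
    have v: "eval_word Q ys v \<in> carrier Q" "eval_word Q ys w \<in> carrier Q" using x y ys by auto
    have "h (x \<otimes>\<^bsub>G\<^esub> y) = A a \<otimes>\<^bsub>Q\<^esub> ((A (act g v b) \<otimes>\<^bsub>Q\<^esub> eval_word Q ys v) \<otimes>\<^bsub>Q\<^esub> eval_word Q ys w)"
      using x y ys v by (simp add: h_def A_add A_closed Q.m_assoc)
    also have "\<dots> = A a \<otimes>\<^bsub>Q\<^esub> ((eval_word Q ys v \<otimes>\<^bsub>Q\<^esub> A b) \<otimes>\<^bsub>Q\<^esub> eval_word Q ys w)"
      using word[OF x(2), of b] by simp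
    also have "\<dots> = h x \<otimes>\<^bsub>Q\<^esub> h y" using x y v by (simp add: h_def A_closed Q.m_assoc)
    finally show "h (x \<otimes>\<^bsub>G\<^esub> y) = h x \<otimes>\<^bsub>Q\<^esub> h y" .
  qed
  moreover have "map h gens = qs"
  proof (rule nth_equalityI)
    show len: "length (map h gens) = length qs" using qs by (simp add: gens_simps)
    fix i assume "i < length (map h gens)"
    then have i: "i < 4 + n" by (simp add: gens_simps)
    show "map h gens ! i = qs ! i"
    proof (cases "i < 4")
      case True
      then show ?thesis using c[OF i] by (simp add: gens_simps h_def A)
    next
      case False
      then obtain j where j: "i = 4 + j" "j < n" using i by (metis add_less_cancel_left le_Suc_ex not_less)
      then show ?thesis
        using c[OF i] Q.additive_diff(1)[OF A(1)] by (simp add: gens_simps h_def ys)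
    qed
  qed
  ultimately show ?thesis by blast
qed

theorem finitely_presented_G: "finitely_presented G"
proof -
  define u where "u i j = (SOME u. u \<in> words 4 \<and> eval_word G gens u = (g i (unit_vec j), [], False))" for i j
  have u: "u i j \<in> words 4 \<and> eval_word G gens (u i j) = (g i (unit_vec j), [], False)" for i j
    unfolding u_def by (rule someI_ex) (use eval_vec_exists in blast)
  show ?thesis
  proof (rule G.finitely_presentedI[OF gens_closed gens_simps(1) eval_gens_surj])
    have *: "u i j \<in> words (4 + n)" for i j using words_mono[of "u i j" 4] u by simp
    show "finite (gens_rels u)" by (simp add: gens_rels_def)
    show "gens_rels u \<subseteq> words (4 + n)" using * by (auto simp: gens_rels_def)
    fix r assume "r \<in> gens_rels u"
    then consider i j where "i < 4" "j < 4" "r = [(i, True), (j, True)] @ inv_word [(j, True), (i, True)]"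
      | i j where "i < n" "j < 4" "r = [(4 + i, True), (j, True)] @ inv_word (u i j @ [(4 + i, True)])"
      unfolding gens_rels_def by auto
    then show "eval_word G gens r = \<one>\<^bsub>G\<^esub>"
    proof cases
      case (1 i j)
      then have "eval_word G gens [(i, True), (j, True)] = eval_word G gens [(j, True), (i, True)]"
        by (simp add: gens_simps G_one add.commute)
      then show ?thesis unfolding 1(3)
        by (intro iffD2[OF G.eval_word_quotient_iff[OF gens_closed]]) (use 1(1,2) in \<open>simp_all add: gens_simps(1)\<close>)
    next
      case (2 i j)
      then have "eval_word G gens [(4 + i, True), (j, True)] = eval_word G gens (u i j @ [(4 + i, True)])"
        using * u[of i j] by (simp add: gens_simps gens_closed G_one reduce_carrier letter_carrier act_letter_def)
      then show ?thesis unfolding 2(3)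
        by (intro iffD2[OF G.eval_word_quotient_iff[OF gens_closed]]) (use 2(1,2) * in \<open>simp_all add: gens_simps(1)\<close>)
    qed
  next
    fix Q :: "word set monoid" and qs
    assume Q: "group Q" "set qs \<subseteq> carrier Q" "length qs = 4 + n" "\<And>r. r \<in> gens_rels u \<Longrightarrow> eval_word Q qs r = \<one>\<^bsub>Q\<^esub>"
    show "\<exists>h\<in>hom G Q. map h gens = qs" by (rule hom_from_G[OF Q(1-3) _ Q(4)]) (rule u)
  qed
qed

end

section \<open>The overgroup of a Collatz system\<close>

lemma bij_mm: "det P = 1 \<Longrightarrow> bij (mm P)"
  by (rule o_bij[of "mm (adj P)"]) (auto simp: fun_eq_iff mm_cancel)

lemma bij_conj_mm: "det P = 1 \<Longrightarrow> bij (\<lambda>A. mm P (mm A (adj P)))"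
  by (rule o_bij[of "\<lambda>A. mm (adj P) (mm A P)"]) (auto simp: fun_eq_iff mm_cancel mm_assoc mm_adj)

lemma bij_elem: "i < 4 \<Longrightarrow> j < 4 \<Longrightarrow> i \<noteq> j \<Longrightarrow> bij (elem i j k)"
  by (rule o_bij[of "elem i j (- k)"]) (auto simp: fun_eq_iff elem_elem simp del: split_paired_All)

lemma elem_add: "elem i j k (a + b) = elem i j k a + elem i j k b"
  by (simp add: elem_def coord_add distrib_left smul_add)

text \<open>The centralizer of \<open>\<tau>\<close> in the free group is generated by the letters acting as \<open>fixed_maps\<close>, and
  the orbit of \<open>I2\<close> under it is the normal closure of the relators. The two copies of \<open>swapped_maps\<close> give
  all of \<open>G\<close> a big action without enlarging that centralizer.\<close>

definition fixed_maps :: "nat \<Rightarrow> word list \<Rightarrow> (mat \<Rightarrow> mat) list" where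
  "fixed_maps k R = map (\<lambda>i A. mm (rho i) (mm A (adj (rho i)))) [0..<k] @ map (\<lambda>r. mm (mat_word r)) R"

text \<open>The left multiplications by \<open>rho i\<close> serve the reduction of the Collatz
  problem: they let the free group carry \<open>I2\<close> to the matrix of any given word.\<close>

definition swapped_maps :: "nat \<Rightarrow> (mat \<Rightarrow> mat) list" where
  "swapped_maps k = map (\<lambda>(i, j). elem i j 1) [(i, j) \<leftarrow> List.product [0..<4] [0..<4]. i \<noteq> j] @
     map (\<lambda>i. mm (rho i)) [0..<k]"

definition all_maps :: "nat \<Rightarrow> word list \<Rightarrow> (mat \<Rightarrow> mat) list" where
  "all_maps k R = fixed_maps k R @ swapped_maps k @ swapped_maps k"

definition gen_map :: "nat \<Rightarrow> word list \<Rightarrow> nat \<Rightarrow> mat \<Rightarrow> mat" where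
  "gen_map k R i = (if i < length (all_maps k R) then all_maps k R ! i else id)"

definition gen_swap :: "nat \<Rightarrow> word list \<Rightarrow> nat \<Rightarrow> nat" where
  "gen_swap k R i = (let p = length (fixed_maps k R); q = length (swapped_maps k) in
     if p \<le> i \<and> i < p + q then i + q else if p + q \<le> i \<and> i < p + 2 * q then i - q else i)"

lemma all_maps_linear:
  assumes "f \<in> set (all_maps k R)"
  shows "bij f" "f (a + b) = f a + f b"
proof -
  have "det (rho i) = 1" for i using det_mat_letter[of "(i, True)"] by (simp add: mat_letter_def)
  then show "bij f" "f (a + b) = f a + f b"
    using assms
    by (auto simp: all_maps_def fixed_maps_def swapped_maps_def mm_add elem_add intro: bij_mm bij_conj_mm bij_elem)
qed

lemma swapped_maps_gen_map:
  assumes "f \<in> set (swapped_maps k)"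
  shows "\<exists>l<length (all_maps k R). gen_map k R l = f"
proof -
  have "f \<in> set (all_maps k R)" using assms by (simp add: all_maps_def)
  then show ?thesis unfolding gen_map_def in_set_conv_nth by auto
qed

lemma elementary_action_gen:
  "elementary_action (length (all_maps k R)) (gen_swap k R) (gen_map k R)"
proof
  show "bij (gen_map k R i)" for i
    using all_maps_linear(1)[OF nth_mem, of i k R] by (simp add: gen_map_def)
  show "gen_map k R i (a + b) = gen_map k R i a + gen_map k R i b" for i a b
    using all_maps_linear(2)[OF nth_mem, of i k R] by (simp add: gen_map_def)
  show "gen_swap k R i < length (all_maps k R)" if "i < length (all_maps k R)" for i
    using that by (auto simp: gen_swap_def all_maps_def Let_def)
  show "gen_swap k R (gen_swap k R i) = i" for i
    by (auto simp: gen_swap_def Let_def)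
  show "gen_map k R (gen_swap k R i) = gen_map k R i" for i
    by (auto simp: gen_map_def gen_swap_def all_maps_def nth_append Let_def add.commute diff_diff_left)
  show "\<exists>l<length (all_maps k R). gen_map k R l = elem i j 1" if "i < 4" "j < 4" "i \<noteq> j" for i j
    using that by (intro swapped_maps_gen_map) (force simp: swapped_maps_def)
qed

lemma gen_map_rho: "i < k \<Longrightarrow> \<exists>l<length (all_maps k R). gen_map k R l = mm (rho i)"
  by (intro swapped_maps_gen_map) (force simp: swapped_maps_def)

lemma gen_map_fixed:
  "i < k \<Longrightarrow> gen_map k R i = (\<lambda>A. mm (rho i) (mm A (adj (rho i))))"
  "i < length R \<Longrightarrow> gen_map k R (k + i) = mm (mat_word (R ! i))"
  by (auto simp: gen_map_def all_maps_def fixed_maps_def nth_append)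

interpretation gen: elementary_action "length (all_maps k R)" "gen_swap k R" "gen_map k R" for k R
  by (rule elementary_action_gen)

text \<open>The involution permutes letters, so a word is fixed iff each of its letters is; fixed
  letters are exactly those of \<open>fixed_maps\<close>.\<close>

lemma fixed_word_iff:
  "w \<in> words (length (all_maps k R)) \<Longrightarrow> tau_word (gen_swap k R) w = w \<longleftrightarrow> w \<in> words (k + length R)"
proof (induction w)
  case (Cons a w)
  have "gen_swap k R i = i \<longleftrightarrow> i < k + length R" if "i < length (all_maps k R)" for i
    using that by (auto simp: gen_swap_def Let_def all_maps_def fixed_maps_def)
  then show ?case using Cons by (cases a) auto
qed simp

lemma act_letter_eqI:
  assumes "bij (g (fst a))" "if snd a then g (fst a) x = y else g (fst a) y = x"
  shows "act_letter g a x = y"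
  using assms by (auto simp: act_letter_def bij_is_inj intro: inv_f_eq split: if_splits)

lemma act_fixed_letter:
  shows "fst a < k \<Longrightarrow> act_letter (gen_map k R) a P = mm (mat_letter a) (mm P (mat_letter (inv_letter a)))"
    and "i < length R \<Longrightarrow> act_letter (gen_map k R) (k + i, True) P = mm (mat_word (R ! i)) P"
    and "i < length R \<Longrightarrow> act_letter (gen_map k R) (k + i, False) P = mm (adj (mat_word (R ! i))) P"
proof -
  have d: "det (rho i) = 1" for i using det_mat_letter[of "(i, True)"] by (simp add: mat_letter_def)
  show "fst a < k \<Longrightarrow> act_letter (gen_map k R) a P = mm (mat_letter a) (mm P (mat_letter (inv_letter a)))"
    by (rule act_letter_eqI[OF gen.bij]) (auto simp: gen_map_fixed mat_letter_def mm_assoc mm_cancel mm_adj d inv_letter_def)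
  show "i < length R \<Longrightarrow> act_letter (gen_map k R) (k + i, True) P = mm (mat_word (R ! i)) P"
    by (rule act_letter_eqI[OF gen.bij]) (auto simp: gen_map_fixed)
  show "i < length R \<Longrightarrow> act_letter (gen_map k R) (k + i, False) P = mm (adj (mat_word (R ! i))) P"
    by (rule act_letter_eqI[OF gen.bij]) (auto simp: gen_map_fixed mm_cancel)
qed

lemma orb_eq_act: "orb k R = {act (gen_map k R) w I2 | w. w \<in> words (k + length R)}"
proof (intro equalityI subsetI)
  fix P assume "P \<in> orb k R"
  then show "P \<in> {act (gen_map k R) w I2 | w. w \<in> words (k + length R)}"
  proof induction
    case one
    have "I2 = act (gen_map k R) [] I2" by simp
    then show ?case by (blast intro: words_Nil)
  next
    case (conj P a)
    then obtain w where "P = act (gen_map k R) w I2" "w \<in> words (k + length R)" by blast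
    then have "mm (mat_letter a) (mm P (mat_letter (inv_letter a))) = act (gen_map k R) (a # w) I2"
      "a # w \<in> words (k + length R)" using conj by (simp_all add: act_fixed_letter)
    then show ?case by blast
  next
    case (rel P r)
    then obtain w i where "P = act (gen_map k R) w I2" "w \<in> words (k + length R)" "i < length R" "r = R ! i"
      by (auto simp: in_set_conv_nth)
    then have "mm (mat_word r) P = act (gen_map k R) ((k + i, True) # w) I2"
      "(k + i, True) # w \<in> words (k + length R)" by (simp_all add: act_fixed_letter)
    then show ?case by blast
  next
    case (rel_inv P r)
    then obtain w i where "P = act (gen_map k R) w I2" "w \<in> words (k + length R)" "i < length R" "r = R ! i"
      by (auto simp: in_set_conv_nth)
    then have "mm (adj (mat_word r)) P = act (gen_map k R) ((k + i, False) # w) I2"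
      "(k + i, False) # w \<in> words (k + length R)" by (simp_all add: act_fixed_letter)
    then show ?case by blast
  qed
next
  fix P assume "P \<in> {act (gen_map k R) w I2 | w. w \<in> words (k + length R)}"
  then obtain w where "P = act (gen_map k R) w I2" "w \<in> words (k + length R)" by blast
  then show "P \<in> orb k R"
  proof (induction w arbitrary: P)
    case Nil
    then show ?case by (simp add: orb.one)
  next
    case (Cons a w)
    obtain j e where a: "a = (j, e)" by (cases a)
    have Q: "act (gen_map k R) w I2 \<in> orb k R" using Cons by simp
    show ?case
    proof (cases "j < k")
      case True
      then show ?thesis using Cons.prems orb.conj[OF Q, of a] by (simp add: act_fixed_letter a)
    next
      case False
      then obtain i where i: "j = k + i" "i < length R" using Cons.prems a by (metis add_diff_inverse_nat fst_conv nat_add_left_cancel_less words_Cons)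
      then show ?thesis
        using Cons.prems orb.rel[OF Q, of "R ! i"] orb.rel_inv[OF Q, of "R ! i"]
        by (cases e) (simp_all add: act_fixed_letter a)
    qed
  qed
qed

lemma conjugate_gen_iff:
  "conjugate (split_ext (length (all_maps k R)) (gen_swap k R) (gen_map k R)) (I2, [], True) (B, [], True) \<longleftrightarrow> B \<in> orb k R"
proof -
  have le: "words (k + length R) \<subseteq> words (length (all_maps k R))"
    unfolding words_def by (rule lists_mono) (auto simp: all_maps_def fixed_maps_def)
  have "(\<exists>w\<in>carrier (free_group (length (all_maps k R))). tau_word (gen_swap k R) w = w \<and> B = act (gen_map k R) w I2)
      \<longleftrightarrow> (\<exists>w\<in>words (k + length R). B = act (gen_map k R) w I2)"
  proof
    assume "\<exists>w\<in>carrier (free_group (length (all_maps k R))). tau_word (gen_swap k R) w = w \<and> B = act (gen_map k R) w I2"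
    then obtain w where "w \<in> words (length (all_maps k R))" "tau_word (gen_swap k R) w = w" "B = act (gen_map k R) w I2"
      by (auto simp: carrier_free_group)
    then show "\<exists>w\<in>words (k + length R). B = act (gen_map k R) w I2" using fixed_word_iff by blast
  next
    assume "\<exists>w\<in>words (k + length R). B = act (gen_map k R) w I2"
    then obtain w where w: "w \<in> words (k + length R)" "B = act (gen_map k R) w I2" by blast
    then have "reduce w \<in> words (k + length R)" by (intro reduce_in_words)
    then have "reduce w \<in> carrier (free_group (length (all_maps k R)))" "tau_word (gen_swap k R) (reduce w) = reduce w"
      using le fixed_word_iff[of "reduce w" k R] by (auto simp: carrier_free_group reduced_reduce)
    then show "\<exists>w\<in>carrier (free_group (length (all_maps k R))). tau_word (gen_swap k R) w = w \<and> B = act (gen_map k R) w I2"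
      using w(2) by (intro bexI[of _ "reduce w"]) simp_all
  qed
  then show ?thesis unfolding gen.conjugate_tau_iff orb_eq_act by blast
qed

lemma (in twisted_action) hom_kills_multiples:
  assumes M: "group M" "finite (carrier M)" and \<phi>: "\<phi> \<in> hom K M" and a: "dvd_vec (int (order M)) a"
  shows "\<phi> (a, [], False) = \<one>\<^bsub>M\<^esub>"
proof -
  interpret M: group M by fact
  interpret \<phi>: group_hom K M \<phi> using \<phi> by (simp add: group_hom_def group_hom_axioms_def)
  obtain b where b: "a = smul (int (order M)) b" using a unfolding dvd_vec_iff by blast
  have "(b, [], False) [^]\<^bsub>K\<^esub> k = (smul (int k) b, [], False)" for k :: nat
    by (induction k) (simp_all add: K_one smul_add algebra_simps)
  then have "\<phi> (a, [], False) = \<phi> (b, [], False) [^]\<^bsub>M\<^esub> order M"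
    using \<phi>.hom_nat_pow[of "(b, [], False)" "order M"] by (simp add: b)
  also have "\<dots> = \<one>\<^bsub>M\<^esub>" using \<phi>.hom_closed[of "(b, [], False)"] by (intro M.pow_order_eq_1) simp
  finally show ?thesis .
qed

text \<open>The matrix of \<open>bs_word\<close> is outside the orbit, yet modulo the order of a
  finite group it agrees with some \<open>P\<close> in the orbit, and a homomorphism to that group
  cannot distinguish the two.\<close>

lemma not_conjugacy_separable_K:
  assumes sys: "collatz_system m A C z"
  defines "R \<equiv> relators m A C z"
  shows "\<not> conjugacy_separable (split_ext (length (all_maps (4 + m) R)) (gen_swap (4 + m) R) (gen_map (4 + m) R))"
    (is "\<not> conjugacy_separable ?K")
proof
  assume cs: "conjugacy_separable ?K"
  let ?bs = "mat_word bs_word"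
  have "\<not> conjugate ?K (I2, [], True) (?bs, [], True)"
    using orb_kt_word(2)[OF sys] by (simp add: conjugate_gen_iff R_def)
  moreover have "(I2, [], True) \<in> carrier ?K" "(?bs, [], True) \<in> carrier ?K" by simp_all
  ultimately obtain M \<phi> where M: "group (M :: nat monoid)" "finite (carrier M)" and \<phi>: "\<phi> \<in> hom ?K M"
    and nc: "\<not> conjugate M (\<phi> (I2, [], True)) (\<phi> (?bs, [], True))"
    using cs unfolding conjugacy_separable_def by blast
  interpret M: group M by fact
  interpret \<phi>: group_hom ?K M \<phi> using \<phi> by (simp add: group_hom_def group_hom_axioms_def gen.group_K)
  have "order M > 0" using M(2) by (simp add: M.order_gt_0_iff_finite)
  then obtain P where P: "P \<in> orb (4 + m) R" "dvd_vec (int (order M)) (?bs - P)"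
    using orb_kt_word(3)[OF sys, of "int (order M)"] by (auto simp: R_def)
  have "conjugate ?K (I2, [], True) (P, [], True)" using P(1) by (simp add: conjugate_gen_iff)
  then obtain k where "k \<in> carrier ?K" "(P, [], True) = k \<otimes>\<^bsub>?K\<^esub> (I2, [], True) \<otimes>\<^bsub>?K\<^esub> inv\<^bsub>?K\<^esub> k"
    unfolding conjugate_def by blast
  then have k: "\<phi> (P, [], True) = \<phi> k \<otimes>\<^bsub>M\<^esub> \<phi> (I2, [], True) \<otimes>\<^bsub>M\<^esub> inv\<^bsub>M\<^esub> (\<phi> k)" "\<phi> k \<in> carrier M"
    by simp_all
  have "\<phi> (?bs, [], True) = \<phi> ((?bs - P, [], False) \<otimes>\<^bsub>?K\<^esub> (P, [], True))" by simp
  also have "\<dots> = \<phi> (P, [], True)"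
    using gen.hom_kills_multiples[OF M \<phi> P(2)] \<phi>.hom_closed[of "(P, [], True)"]
    by (subst \<phi>.hom_mult) simp_all
  finally show False using nc k unfolding conjugate_def by auto
qed

text \<open>Prepends \<open>w\<close> to a list with code \<open>s\<close>. Lists are coded from the
  right, so prepending a fixed word is computable and powers of words become iterations.\<close>

definition encode_append :: "word \<Rightarrow> nat \<Rightarrow> nat" where
  "encode_append w s = foldr (\<lambda>(i, e) s. Suc (prod_encode (prod_encode (i, of_bool e), s))) w s"

lemma encode_append_append: "encode_append (u @ v) s = encode_append u (encode_append v s)"
  by (simp add: encode_append_def)

lemma encode_word_eq: "encode_word w = encode_append w 0"
  unfolding encode_word_def encode_append_def by (induction w) auto

lemma total_computable_triangle:
  assumes "total_computable k F"
  shows "total_computable k (\<lambda>xs. triangle (F xs))"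
  unfolding triangle_def
  by (intro total_computable_div total_computable_mult total_computable_Suc total_computable_const assms)

lemma total_computable_encode_append:
  assumes "total_computable k S"
  shows "total_computable k (\<lambda>xs. encode_append w (S xs))"
proof (induction w)
  case (Cons a w)
  then show ?case
    unfolding encode_append_def prod_encode_def
    by (cases a) (auto intro!: total_computable_Suc total_computable_add total_computable_triangle total_computable_const)
qed (simp add: encode_append_def assms)

lemma total_computable_encode_append_power:
  assumes N: "total_computable k N" and S: "total_computable k S"
  shows "total_computable k (\<lambda>xs. encode_append (concat (replicate (N xs) w)) (S xs))"
proof -
  have *: "rec_nat s (\<lambda>_ r. encode_append w r) n = encode_append (concat (replicate n w)) s" for s n
    by (induction n) (simp_all add: encode_append_append, simp add: encode_append_def)
  have "total_computable k (\<lambda>xs. rec_nat (S xs) (\<lambda>n r. encode_append w r) (N xs))"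
    by (intro total_computable_rec N S total_computable_encode_append total_computable_proj) simp
  then show ?thesis by (simp add: *)
qed

lemma concat_map_replicate: "concat (map c (replicate n a)) = concat (replicate n (c a))"
  by (induction n) auto

lemma kt_word_eq: "kt_word n = [(2, True)] @ replicate n (0, True) @ [(1, True)] @ replicate n (0, False) @
    [(2, False)] @ replicate n (0, True) @ [(1, False)] @ replicate n (0, False)"
  "inv_word (kt_word n) = replicate n (0, True) @ [(1, True)] @ replicate n (0, False) @ [(2, True)] @
    replicate n (0, True) @ [(1, False)] @ replicate n (0, False) @ [(2, False)]"
  by (simp_all add: kt_word_def tword_def comm_word_def xpow_def inv_word_def inv_letter_def)

text \<open>The word consists of eight blocks, four of them \<open>n\<close>-th powers of a letter,
  and the substitution \<open>c\<close> turns each block into a fixed word or a power of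
  one.\<close>

lemma total_computable_kt_word:
  assumes "total_computable 1 S"
  shows "total_computable 1 (\<lambda>xs. encode_append (concat (map c (kt_word (xs ! 0)))) (S xs))"
    and "total_computable 1 (\<lambda>xs. encode_append (concat (map c (inv_word (kt_word (xs ! 0))))) (S xs))"
  unfolding kt_word_eq(2) unfolding kt_word_eq(1) map_append concat_append concat_map_replicate encode_append_append
  by (intro total_computable_encode_append total_computable_encode_append_power total_computable_proj assms zero_less_one)+

text \<open>Reduces reaching \<open>z\<close> from \<open>n\<close> to conjugacy of
  \<open>(I2, [], True)\<close> and \<open>(mat_word (kt_word n), [], True)\<close>. The work is to
  write the second element, computably in \<open>n\<close>, as a word over an arbitrary generating
  list.\<close>

lemma unsolvable_conjugacy_problem_K:
  assumes sys: "collatz_system m A C z"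
    and undec: "\<not> total_computable 1 (\<lambda>xs. if collatz_reaches m A C z (xs ! 0) then 1 else 0)"
  defines "R \<equiv> relators m A C z"
  shows "unsolvable_conjugacy_problem (split_ext (length (all_maps (4 + m) R)) (gen_swap (4 + m) R) (gen_map (4 + m) R))"
    (is "unsolvable_conjugacy_problem ?K")
  unfolding unsolvable_conjugacy_problem_def
proof (intro conjI allI impI notI)
  show "\<exists>zs. generating_list ?K zs" using gen.generating_list_K by blast
  fix zs assume gl: "generating_list ?K zs" and solv: "solvable_conjugacy_problem ?K zs"
  let ?g = "gen_map (4 + m) R" and ?F = "free_group (length (all_maps (4 + m) R))"
  have zs: "set zs \<subseteq> carrier ?K" using gl by (simp add: generating_list_def)
  have word_exists: "\<exists>w. w \<in> words (length zs) \<and> eval_word ?K zs w = x" if "x \<in> carrier ?K" for x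
  proof -
    have "x \<in> eval_word ?K zs ` words (length zs)"
      using that gl gen.K.generate_eq_eval_word[OF zs] by (simp add: generating_list_def)
    then show ?thesis by blast
  qed
  define word_for where "word_for x = (SOME w. w \<in> words (length zs) \<and> eval_word ?K zs w = x)" for x
  have word_for: "word_for x \<in> words (length zs)" "eval_word ?K zs (word_for x) = x" if "x \<in> carrier ?K" for x
    unfolding word_for_def using someI_ex[OF word_exists[OF that]] by blast+
  \<comment> \<open>Swapped letters acting by left multiplication with \<open>rho i\<close>;
    substituting them for the letters of a word gives a word that moves \<open>I2\<close> to its
    matrix.\<close>
  have "\<exists>l. l < length (all_maps (4 + m) R) \<and> ?g l = mm (rho i)" if "i < 4 + m" for i
    using gen_map_rho[OF that] by blast
  then obtain l where l: "\<And>i. i < 4 + m \<Longrightarrow> l i < length (all_maps (4 + m) R)"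
    "\<And>i. i < 4 + m \<Longrightarrow> ?g (l i) = mm (rho i)" by metis
  define lift where "lift = map (map_prod l id :: nat \<times> bool \<Rightarrow> nat \<times> bool)"
  have letter: "act_letter ?g (map_prod l id a) P = mm (mat_letter a) P" if "fst a < 4 + m" for a P
    using l(2)[OF that] det_mat_letter[of "(fst a, True)"]
    by (intro act_letter_eqI[OF gen.bij]) (auto simp: mat_letter_def mm_cancel)
  have lift: "lift w \<in> words (length (all_maps (4 + m) R)) \<and> act ?g (lift w) P = mm (mat_word w) P"
    if "w \<in> words (4 + m)" for w P
    using that by (induction w) (auto simp: lift_def l(1) letter mm_assoc)
  define c where "c a = word_for (0, [map_prod l id a], False)" for a
  have c: "c a \<in> words (length zs)" "eval_word ?K zs (c a) = (0, [map_prod l id a], False)" if "fst a < 4 + m" for a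
  proof -
    have "(0, [map_prod l id a], False) \<in> carrier ?K"
      using l(1)[OF that] by (cases a) (simp add: gen.letter_carrier)
    then show "c a \<in> words (length zs)" "eval_word ?K zs (c a) = (0, [map_prod l id a], False)"
      unfolding c_def by (rule word_for)+
  qed
  have words_c: "concat (map c w) \<in> words (length zs)" if "w \<in> words (4 + m)" for w
    using that by (induction w) (auto simp: c(1))
  have eval_c: "eval_word ?K zs (concat (map c w)) = (0, reduce (lift w), False)" if "w \<in> words (4 + m)" for w
    using that
  proof (induction w)
    case (Cons a w)
    then show ?case
      using gen.reduce_twice(1)[of "[map_prod l id a]" "lift w"] zs words_c[of w] by (simp add: c lift_def)
  qed (simp add: gen.K_one lift_def)
  \<comment> \<open>The product \<open>w I2 w\<^sup>-\<^sup>1 \<tau>\<close> with \<open>w\<close>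
    the lifted \<open>kt_word n\<close>: the free parts cancel and leave the vector \<open>w\<close>
    applied to \<open>I2\<close>.\<close>
  define v where "v n = concat (map c (kt_word n)) @ word_for (I2, [], False) @ concat (map c (inv_word (kt_word n))) @
    word_for (0, [], True)" for n
  define u where "u = word_for (I2, [], True)"
  have w1: "word_for (a, [], e) \<in> words (length zs)" "eval_word ?K zs (word_for (a, [], e)) = (a, [], e)" for a e
    by (rule word_for, simp)+
  have kt: "kt_word n \<in> words (4 + m)" "inv_word (kt_word n) \<in> words (4 + m)" for n by simp_all
  have v: "v n \<in> words (length zs)" "eval_word ?K zs (v n) = (mat_word (kt_word n), [], True)" for n
  proof -
    show "v n \<in> words (length zs)" using words_c[OF kt(1)] words_c[OF kt(2)] w1(1) by (simp add: v_def)
    have "lift (inv_word w) = inv_word (lift w)" for w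
      by (induction w) (auto simp: lift_def inv_letter_def)
    then have "eval_word ?K zs (v n) = (0, reduce (lift (kt_word n)), False) \<otimes>\<^bsub>?K\<^esub> ((I2, [], False) \<otimes>\<^bsub>?K\<^esub>
        ((0, reduce (inv_word (lift (kt_word n))), False) \<otimes>\<^bsub>?K\<^esub> (0, [], True)))"
      unfolding v_def using words_c[OF kt(1)] words_c[OF kt(2)] w1 zs
      by (simp add: eval_c kt del: gen.K_mult)
    also have "\<dots> = (mat_word (kt_word n), [], True)"
      using lift[OF kt(1)[of n], of I2] by simp
    finally show "eval_word ?K zs (v n) = (mat_word (kt_word n), [], True)" .
  qed
  obtain f where f: "\<And>x y. x \<in> words (length zs) \<Longrightarrow> y \<in> words (length zs) \<Longrightarrow>
      computes f [encode_word x, encode_word y] (if conjugate ?K (eval_word ?K zs x) (eval_word ?K zs y) then 1 else 0)"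
    using solv unfolding solvable_conjugacy_problem_def by blast
  have dec: "computes f [encode_word u, encode_word (v n)] (if collatz_reaches m A C z n then 1 else 0)" for n
    using f[of u "v n"] w1[of I2 True] v[of n] orb_kt_word(1)[OF sys, of n]
    by (simp add: u_def conjugate_gen_iff R_def)
  have "total_computable 1 (\<lambda>xs. encode_word (v (xs ! 0)))"
    unfolding v_def encode_word_eq encode_append_append
    by (intro total_computable_kt_word total_computable_encode_append total_computable_const)
  then obtain fv where fv: "\<And>xs. length xs = 1 \<Longrightarrow> computes fv xs (encode_word (v (xs ! 0)))"
    by (auto simp: total_computable_def)
  obtain fu where fu: "\<And>xs. length xs = 1 \<Longrightarrow> computes fu xs (encode_word u)"
    using total_computable_const[of 1 "encode_word u"] by (auto simp: total_computable_def)
  have "total_computable 1 (\<lambda>xs. if collatz_reaches m A C z (xs ! 0) then 1 else 0)"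
    unfolding total_computable_def
    by (intro exI[of _ "Comp f [fu, fv]"] allI impI computes.Comp[OF _ dec]) (simp add: fu fv)
  with undec show False ..
qed

section \<open>Transport of structure\<close>

lemma group_hom_iso: "f \<in> iso G H \<Longrightarrow> group G \<Longrightarrow> group H \<Longrightarrow> group_hom G H f"
  by (simp add: group_hom_def group_hom_axioms_def iso_def)

lemma rcosets_iso:
  assumes "f \<in> iso G H" "S \<subseteq> carrier G"
  shows "rcosets\<^bsub>H\<^esub> (f ` S) = (`) f ` (rcosets\<^bsub>G\<^esub> S)"
proof -
  have mult: "f (x \<otimes>\<^bsub>G\<^esub> y) = f x \<otimes>\<^bsub>H\<^esub> f y" if "x \<in> carrier G" "y \<in> carrier G" for x y
    using assms(1) that by (auto simp: iso_def hom_def)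
  have "f ` S #>\<^bsub>H\<^esub> f x = f ` (S #>\<^bsub>G\<^esub> x)" if "x \<in> carrier G" for x
    using assms(2) mult that by (auto simp: r_coset_def image_iff subset_iff)
  moreover have "carrier H = f ` carrier G" using assms(1) by (auto simp: iso_def bij_betw_def)
  ultimately show ?thesis by (auto simp: RCOSETS_def image_iff)
qed

lemma card_rcosets_iso:
  assumes f: "f \<in> iso G H" and S: "subgroup S G" and "group G"
  shows "card (rcosets\<^bsub>H\<^esub> (f ` S)) = card (rcosets\<^bsub>G\<^esub> S)"
proof -
  interpret group G by fact
  have "inj_on f (carrier G)" using f by (simp add: iso_def bij_betw_def)
  moreover have "c \<subseteq> carrier G" if "c \<in> rcosets\<^bsub>G\<^esub> S" for c
    using that by (rule subgroup.rcosets_carrier[OF S is_group])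
  ultimately have "inj_on ((`) f) (rcosets\<^bsub>G\<^esub> S)"
    unfolding inj_on_def[of "(`) f"] by (metis inj_on_image_eq_iff)
  then show ?thesis
    unfolding rcosets_iso[OF f subgroup.subset[OF S]] by (rule card_image)
qed

lemma iso_restrict_image:
  assumes f: "f \<in> iso G H" and S: "S \<subseteq> carrier G"
  shows "f \<in> iso (G\<lparr>carrier := S\<rparr>) (H\<lparr>carrier := f ` S\<rparr>)"
  using f S unfolding iso_def bij_betw_def hom_def
  by (auto simp: Pi_iff subset_iff intro: inj_on_subset)

lemma subgroup_image_iso:
  "f \<in> iso G H \<Longrightarrow> group G \<Longrightarrow> group H \<Longrightarrow> subgroup S G \<Longrightarrow> subgroup (f ` S) H"
  by (rule group_hom.subgroup_img_is_subgroup[OF group_hom_iso])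

lemma hereditarily_conjugacy_separable_iso:
  assumes f: "f \<in> iso G H" and "group G" "group H" and hcs: "hereditarily_conjugacy_separable G"
  shows "hereditarily_conjugacy_separable H"
  unfolding hereditarily_conjugacy_separable_def
proof (intro allI impI, elim conjE)
  fix T assume T: "subgroup T H" "finite (rcosets\<^bsub>H\<^esub> T)"
  let ?g = "inv_into (carrier G) f"
  have g: "?g \<in> iso H G" using group.iso_set_sym[OF assms(2) f] .
  have S: "subgroup (?g ` T) G" by (rule subgroup_image_iso[OF g assms(3,2) T(1)])
  have "finite (rcosets\<^bsub>G\<^esub> (?g ` T))"
    using T(2) by (simp add: rcosets_iso[OF g subgroup.subset[OF T(1)]])
  then have cs: "conjugacy_separable (G\<lparr>carrier := ?g ` T\<rparr>)"
    using S hcs by (simp add: hereditarily_conjugacy_separable_def)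
  have "f ` ?g ` T = T"
    using f subgroup.subset[OF T(1)] unfolding iso_def bij_betw_def by (auto simp: image_image f_inv_into_f subset_iff)
  then have "f \<in> iso (G\<lparr>carrier := ?g ` T\<rparr>) (H\<lparr>carrier := T\<rparr>)"
    using iso_restrict_image[OF f subgroup.subset[OF S]] by simp
  then show "conjugacy_separable (H\<lparr>carrier := T\<rparr>)"
    by (rule conjugacy_separable_iso[OF _ group.subgroup_imp_group[OF assms(2) S] group.subgroup_imp_group[OF assms(3) T(1)] cs])
qed

lemma finitely_presented_iso:
  assumes f: "f \<in> iso G H" and "group H" and fp: "finitely_presented G"
  shows "finitely_presented H"
proof -
  have G: "group G" using fp by (simp add: finitely_presented_def)
  have "H \<cong> G" using group.iso_set_sym[OF G f] by (auto simp: is_iso_def)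
  then show ?thesis
    using fp assms(2) unfolding finitely_presented_def by (meson iso_trans)
qed

lemma generating_list_iso:
  assumes f: "f \<in> iso G H" and "group G" "group H" and zs: "generating_list G zs"
  shows "generating_list H (map f zs)"
proof -
  interpret group_hom G H f by (rule group_hom_iso[OF assms(1-3)])
  have "f ` carrier G = carrier H" using f by (simp add: iso_def bij_betw_def)
  then show ?thesis
    using zs generate_img[of "set zs"] by (auto simp: generating_list_def)
qed

lemma solvable_conjugacy_problem_iso:
  assumes f: "f \<in> iso G H" and "group G" "group H" and zs: "set zs \<subseteq> carrier G"
    and solv: "solvable_conjugacy_problem G zs"
  shows "solvable_conjugacy_problem H (map f zs)"
proof -
  interpret G: group G by fact
  have hom: "f \<in> hom G H" using f by (simp add: iso_def)
  have "conjugate H (eval_word H (map f zs) u) (eval_word H (map f zs) v) \<longleftrightarrow> conjugate G (eval_word G zs u) (eval_word G zs v)"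
    if "u \<in> words (length zs)" "v \<in> words (length zs)" for u v
    using that conjugate_iso[OF f assms(2,3)] zs by (simp add: G.eval_word_map_hom[OF assms(3) hom zs])
  then show ?thesis using solv unfolding solvable_conjugacy_problem_def by simp
qed

lemma unsolvable_conjugacy_problem_iso:
  assumes f: "f \<in> iso G H" and "group G" "group H" and unsolv: "unsolvable_conjugacy_problem G"
  shows "unsolvable_conjugacy_problem H"
  unfolding unsolvable_conjugacy_problem_def
proof (intro conjI allI impI notI)
  show "\<exists>zs. generating_list H zs"
    using unsolv generating_list_iso[OF assms(1-3)] unfolding unsolvable_conjugacy_problem_def by blast
  fix zs assume zs: "generating_list H zs" "solvable_conjugacy_problem H zs"
  have g: "inv_into (carrier G) f \<in> iso H G" using group.iso_set_sym[OF assms(2) f] .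
  have "set zs \<subseteq> carrier H" using zs by (simp add: generating_list_def)
  then have "solvable_conjugacy_problem G (map (inv_into (carrier G) f) zs)"
    using solvable_conjugacy_problem_iso[OF g assms(3,2) _ zs(2)] by blast
  then show False
    using unsolv generating_list_iso[OF g assms(3,2) zs(1)] unfolding unsolvable_conjugacy_problem_def by blast
qed

text \<open>The carrier is countable, so \<open>to_nat\<close> moves \<open>K\<close> to natural
  numbers. The subgroup is transported as a restriction of the new \<open>K\<close>, because
  \<open>overgroup\<close> asks for literally the same operations.\<close>

lemma (in elementary_action) exists_over_nat:
  assumes "\<not> conjugacy_separable K" "unsolvable_conjugacy_problem K"
  shows "\<exists>(G :: nat monoid) (K :: nat monoid).
    group G \<and> finitely_presented G \<and> hereditarily_conjugacy_separable G \<and>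
    overgroup K G \<and> card (rcosets\<^bsub>K\<^esub> (carrier G)) = 2 \<and>
    \<not> conjugacy_separable K \<and> unsolvable_conjugacy_problem K"
proof -
  define K' where "K' = transport (to_nat :: mat \<times> word \<times> bool \<Rightarrow> nat) K"
  have K': "group K'" and f: "to_nat \<in> iso K K'"
    unfolding K'_def by (rule transport_iso[OF group_K], rule inj_on_subset[OF inj_to_nat], simp)+
  define G' where "G' = K'\<lparr>carrier := to_nat ` carrier G\<rparr>"
  have sub: "subgroup (carrier G') K'"
    using subgroup_image_iso[OF f group_K K' subgroup_G] by (simp add: G'_def)
  have G': "group G'" using group.subgroup_imp_group[OF K' sub] by (simp add: G'_def)
  have "K\<lparr>carrier := carrier G\<rparr> = G" using overgroup by (simp add: overgroup_def)
  then have fG: "to_nat \<in> iso G G'"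
    using iso_restrict_image[OF f subgroup.subset[OF subgroup_G]] by (simp add: G'_def)
  have "overgroup K' G'" using K' sub by (simp add: overgroup_def G'_def)
  moreover have "card (rcosets\<^bsub>K'\<^esub> (carrier G')) = 2"
    using card_rcosets_iso[OF f subgroup_G group_K] card_rcosets by (simp add: G'_def)
  moreover have "\<not> conjugacy_separable K'"
    using conjugacy_separable_iso[OF group.iso_set_sym[OF group_K f] K' group_K] assms(1) by blast
  ultimately show ?thesis
    using G' finitely_presented_iso[OF fG G' finitely_presented_G]
      hereditarily_conjugacy_separable_iso[OF fG group_G G' hereditarily_conjugacy_separable_G]
      unsolvable_conjugacy_problem_iso[OF f group_K K' assms(2)] by blast
qed

theorem theorem1p3:
  shows "\<exists>(G :: nat monoid) (K :: nat monoid).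
    group G \<and> finitely_presented G \<and> hereditarily_conjugacy_separable G \<and>
    overgroup K G \<and> card (rcosets\<^bsub>K\<^esub> (carrier G)) = 2 \<and>
    \<not> conjugacy_separable K \<and> unsolvable_conjugacy_problem K"
proof -
  obtain m A C z where sys: "collatz_system m A C z"
    and undec: "\<not> total_computable 1 (\<lambda>xs. if collatz_reaches m A C z (xs ! 0) then 1 else 0)"
    using undecidable_collatz by blast
  show ?thesis
    by (rule gen.exists_over_nat[OF not_conjugacy_separable_K[OF sys] unsolvable_conjugacy_problem_K[OF sys undec]])
qed

end
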